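(* Let $K$ be a knot in $S^3$ and $J$ a fibered knot in the complement of $K$ such that $\mathrm{lk}(J,K)=0$. Let $p:\overline{S^3\backslash V(J)}\to S^1$ be a given fibration and $\Sigma=p^{-1}(z_0)$ for some $z_0\in S^1$. If $J$ and $K$ are unlinked in $S^3$, then every virtual cover $\hat{K}$ of $K$ relative to $(J,p,\Sigma)$ is classical.
   Context: Knots are smooth embeddings of $S^1$; $I=[0,1]$; $V(J)$ is a closed regular neighborhood of $J$ with $V(J)\cap\mathrm{im}(K)=\emptyset$. $J$ and $K$ are unlinked if there is a 3-cell $V\subset S^3$ with $\mathrm{im}(K)\subset V$ and $\mathrm{im}(J)\cap V=\emptyset$. Virtual knots. A virtual knot is an equivalence class of virtual knot diagrams under planar isotopy and the extended Reidemeister moves; equivalently, a stable equivalence class of knots in $\Sigma'\times I$ with $\Sigma'$ a compact oriented surface (not necessarily closed), where stable equivalence is generated by ambient isotopy fixing $\partial(\Sigma'\times I)$ pointwise, orientation preserving homeomorphisms of surfaces, and stabilization/destabilization. (Stabilization: cut $\Sigma'\times I$ along $\sigma\times I$ disjoint from the knot, where $\sigma$ is a smooth embedded one-dimensional submanifold of $\Sigma'$; if $\sigma\approx S^1$, cap off each copy of $\sigma\times I$ with a thickened disk $D^2\times I$; discard components not containing the knot. Destabilization is the inverse.) A virtual knot is classical if it has a diagram without virtual crossings (equivalently, its stable class contains a knot in $D^2\times I$). Fibered triple. A knot $J\subset S^3$ is fibered if $\overline{S^3\backslash V(J)}$ fibers locally trivially over $S^1$. A fibered triple $(J,p,\Sigma)$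 consists of a fibered knot $J$, a given fibration $p:\overline{S^3\backslash V(J)}\to S^1$ and a fiber $\Sigma=p^{-1}(z_0)$; $\Sigma$ is considered a Seifert surface of $J$ by identifying $J$ with $V(J)\cap\Sigma$. Virtual cover. Let $K$ be a knot in $\overline{S^3\backslash V(J)}$ with $\mathrm{lk}(J,K)=0$. Let $\pi_J:M_J\to\overline{S^3\backslash V(J)}$ be the infinite cyclic cover; there is an orientation preserving homeomorphism $M_J\approx\Sigma\times(0,1)$. Let $K'$ be a knot in $M_J$ with $\pi_J\circ K'=K$, regarded as a knot in $\Sigma\times I$ via $\Sigma\times(0,1)\hookrightarrow\Sigma\times I$. The virtual knot $\hat K$ representing the stable equivalence class of $K'$ is called a virtual cover of $K$ relative to $(J,p,\Sigma)$. *)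

theory Defs
  imports "HOL-Analysis.Analysis" "HOL-Homology.Homology"
begin

section \<open>Smooth maps between subsets of Euclidean spaces\<close>

primrec Ck_on :: "nat \<Rightarrow> 'a::euclidean_space set \<Rightarrow> ('a \<Rightarrow> 'b::euclidean_space) \<Rightarrow> bool" where
  "Ck_on 0 U f \<longleftrightarrow> continuous_on U f"
| "Ck_on (Suc k) U f \<longleftrightarrow>
     (\<exists>f'. (\<forall>x\<in>U. (f has_derivative f' x) (at x)) \<and> (\<forall>v. Ck_on k U (\<lambda>x. f' x v)))"

text \<open>On an arbitrary subset, smooth means: locally the restriction of a smooth map that is
  defined on an open set of the ambient space.\<close>

definition smooth_on :: "'a::euclidean_space set \<Rightarrow> ('a \<Rightarrow> 'b::euclidean_space) \<Rightarrow> bool" where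
  "smooth_on A f \<longleftrightarrow>
     (\<forall>x\<in>A. \<exists>U g. open U \<and> x \<in> U \<and> (\<forall>k. Ck_on k U g) \<and> (\<forall>y\<in>A \<inter> U. g y = f y))"

definition diffeomorphism ::
  "'a::euclidean_space set \<Rightarrow> 'b::euclidean_space set \<Rightarrow> ('a \<Rightarrow> 'b) \<Rightarrow> ('b \<Rightarrow> 'a) \<Rightarrow> bool" where
  "diffeomorphism A B f g \<longleftrightarrow> homeomorphism A B f g \<and> smooth_on A f \<and> smooth_on B g"

text \<open>Smoothness of the inverse makes the derivative injective, so for a compact manifold this
  is the usual notion (an injective immersion).\<close>

definition smooth_embedding :: "'a::euclidean_space set \<Rightarrow> ('a \<Rightarrow> 'b::euclidean_space) \<Rightarrow> bool" where
  "smooth_embedding A f \<longleftrightarrow> (\<exists>g. diffeomorphism A (f ` A) f g)"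

section \<open>Orientations of topological manifolds\<close>

text \<open>A local homeomorphism of \<open>\<real>\<^sup>n\<close> (for \<open>n \<ge> 2\<close>) preserves the orientation at
  \<open>x\<close> if its local degree at \<open>x\<close> is 1, that is, if on every small sphere around
  \<open>x\<close> the map \<open>v \<mapsto> g (x + v) - g x\<close> is homotopic to the inclusion into
  \<open>\<real>\<^sup>n - {0}\<close>. Only the germ of \<open>g\<close> at \<open>x\<close> matters.\<close>

definition orientation_preserving_at :: "('a::euclidean_space \<Rightarrow> 'a) \<Rightarrow> 'a \<Rightarrow> bool" where
  "orientation_preserving_at g x \<longleftrightarrow>
     (\<forall>\<^sub>F r in at_right 0.
        homotopic_with_canon (\<lambda>_. True) (sphere 0 r) (- {0}) (\<lambda>v. g (x + v) - g x) (\<lambda>v. v))"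

text \<open>Open embeddings of the model space (\<open>\<complex>\<close> for surfaces, \<open>\<complex> \<times> \<real>\<close> for
  3-manifolds). An orientation is given by a set of such charts for the manifold interior, any two
  of which agree where they overlap.\<close>

definition open_chart :: "'m::topological_space set \<Rightarrow> ('a::euclidean_space \<Rightarrow> 'm) \<Rightarrow> bool" where
  "open_chart X e \<longleftrightarrow>
     (\<exists>g. homeomorphism UNIV (range e) e g) \<and> openin (top_of_set X) (range e)"

definition orientation_preserving ::
  "('a::euclidean_space \<Rightarrow> 'm) set \<Rightarrow> ('a \<Rightarrow> 'n) set \<Rightarrow> ('m \<Rightarrow> 'n) \<Rightarrow> bool" where
  "orientation_preserving A B f \<longleftrightarrow>
     (\<forall>a\<in>A. \<forall>b\<in>B. \<forall>x y. f (a x) = b y \<longrightarrow>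
        orientation_preserving_at (\<lambda>u. inv_into UNIV b (f (a u))) x)"

section \<open>Compact oriented surfaces\<close>

text \<open>Surfaces are smooth submanifolds, possibly with boundary, of \<open>\<real>\<^sup>4\<close>; every compact
  surface has such a model.\<close>

definition compact_surface :: "(real^4) set \<Rightarrow> bool" where
  "compact_surface S \<longleftrightarrow> compact S \<and>
     (\<forall>x\<in>S. \<exists>U W f g. x \<in> U \<and> openin (top_of_set S) U \<and>
        openin (top_of_set {z::complex. Im z \<ge> 0}) W \<and> diffeomorphism W U f g)"

definition surface_interior :: "(real^4) set \<Rightarrow> (real^4) set" where
  "surface_interior S = \<Union> {range e | e :: complex \<Rightarrow> real^4. open_chart S e}"

definition surface_boundary :: "(real^4) set \<Rightarrow> (real^4) set" where
  "surface_boundary S = S - surface_interior S"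

definition surface_orientation :: "(real^4) set \<Rightarrow> (complex \<Rightarrow> real^4) set \<Rightarrow> bool" where
  "surface_orientation S ori \<longleftrightarrow>
     (\<forall>e\<in>ori. open_chart S e) \<and> \<Union> (range ` ori) = surface_interior S \<and>
     orientation_preserving ori ori (\<lambda>x. x)"

text \<open>Product orientation of \<open>S \<times> (0,1)\<close>, the surface factor first.\<close>

definition product_charts ::
  "(complex \<Rightarrow> real^4) set \<Rightarrow> (complex \<times> real \<Rightarrow> (real^4) \<times> real) set" where
  "product_charts ori =
     {\<lambda>u. (e (fst u), s (snd u)) | e s.
        e \<in> ori \<and> strict_mono s \<and> continuous_on UNIV s \<and> range s \<subseteq> {0<..<1}}"

section \<open>Knots in thickened surfaces, and virtual knots\<close>

abbreviation circle :: "complex set" where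
  "circle \<equiv> sphere 0 1"

text \<open>A triple \<open>(S, ori, K)\<close> stands for a knot \<open>K\<close> in \<open>S \<times> I\<close>, where
  \<open>ori\<close> orients \<open>S\<close>.\<close>

type_synonym thick_knot =
  "(real^4) set \<times> (complex \<Rightarrow> real^4) set \<times> (complex \<Rightarrow> (real^4) \<times> real)"

fun is_thick_knot :: "thick_knot \<Rightarrow> bool" where
  "is_thick_knot (S, ori, K) \<longleftrightarrow>
     compact_surface S \<and> surface_orientation S ori \<and>
     smooth_embedding circle K \<and> K ` circle \<subseteq> S \<times> {0..1}"

fun ambient_isotopic :: "thick_knot \<Rightarrow> thick_knot \<Rightarrow> bool" where
  "ambient_isotopic (S, ori, K) (S', ori', K') \<longleftrightarrow> S' = S \<and> ori' = ori \<and>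
     (\<exists>H :: real \<times> ((real^4) \<times> real) \<Rightarrow> (real^4) \<times> real.
        continuous_on ({0..1} \<times> (S \<times> {0..1})) H \<and>
        (\<forall>t\<in>{0..1}. \<exists>G. homeomorphism (S \<times> {0..1}) (S \<times> {0..1}) (\<lambda>x. H (t, x)) G) \<and>
        (\<forall>t\<in>{0..1}. \<forall>x \<in> surface_boundary S \<times> {0..1} \<union> S \<times> {0, 1}. H (t, x) = x) \<and>
        (\<forall>x \<in> S \<times> {0..1}. H (0, x) = x) \<and>
        (\<forall>z\<in>circle. H (1, K z) = K' z))"

fun surface_homeomorphic :: "thick_knot \<Rightarrow> thick_knot \<Rightarrow> bool" where
  "surface_homeomorphic (S, ori, K) (S', ori', K') \<longleftrightarrow>
     (\<exists>h k. homeomorphism S S' h k \<and> orientation_preserving ori ori' h \<and>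
        (\<forall>z\<in>circle. K' z = (h (fst (K z)), snd (K z))))"

text \<open>\<open>(C, oriC, KC)\<close> arises from \<open>(S, ori, K)\<close> by cutting along
  \<open>\<sigma> \<times> I\<close>: the regluing map \<open>q\<close> is injective except that it identifies the two
  disjoint copies \<open>\<sigma>1\<close>, \<open>\<sigma>2\<close> of \<open>\<sigma>\<close> in the boundary of \<open>C\<close>.
  It is only required to be continuous, because cutting along an arc creates corners, which are
  rounded in \<open>C\<close>.\<close>

fun cut_along ::
  "thick_knot \<Rightarrow> (real^4) set \<Rightarrow> thick_knot \<Rightarrow> (real^4) set \<Rightarrow> (real^4) set \<Rightarrow> bool" where
  "cut_along (S, ori, K) \<sigma> (C, oriC, KC) \<sigma>1 \<sigma>2 \<longleftrightarrow>
     K ` circle \<inter> \<sigma> \<times> {0..1} = {} \<and>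
     (\<exists>q. continuous_on C q \<and> q ` C = S \<and>
        \<sigma>1 \<union> \<sigma>2 = C \<inter> q -` \<sigma> \<and> \<sigma>1 \<inter> \<sigma>2 = {} \<and>
        \<sigma>1 \<union> \<sigma>2 \<subseteq> surface_boundary C \<and>
        (\<exists>r. homeomorphism \<sigma>1 \<sigma> q r) \<and>
        (\<exists>r. homeomorphism \<sigma>2 \<sigma> q r) \<and>
        (\<exists>r. homeomorphism (C - (\<sigma>1 \<union> \<sigma>2)) (S - \<sigma>) q r) \<and>
        orientation_preserving oriC ori q \<and>
        (\<forall>z\<in>circle. K z = (q (fst (KC z)), snd (KC z))))"

text \<open>Capping off: \<open>C'\<close> is \<open>C\<close> (embedded by \<open>j\<close>) with disks glued to the
  circles \<open>c1\<close> and \<open>c2\<close>.\<close>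

fun cap_off ::
  "thick_knot \<Rightarrow> (real^4) set \<Rightarrow> (real^4) set \<Rightarrow> thick_knot \<Rightarrow> bool" where
  "cap_off (C, oriC, KC) c1 c2 (C', ori', K') \<longleftrightarrow>
     (\<exists>j k d1 d2 k1 k2. \<exists>D1 D2.
        homeomorphism C (j ` C) j k \<and> orientation_preserving oriC ori' j \<and>
        homeomorphism (cball (0::complex) 1) D1 d1 k1 \<and>
        homeomorphism (cball (0::complex) 1) D2 d2 k2 \<and>
        C' = j ` C \<union> D1 \<union> D2 \<and> D1 \<inter> D2 = {} \<and>
        j ` C \<inter> D1 = j ` c1 \<and> d1 ` circle = j ` c1 \<and>
        j ` C \<inter> D2 = j ` c2 \<and> d2 ` circle = j ` c2 \<and>
        (\<forall>z\<in>circle. K' z = (j (fst (KC z)), snd (KC z))))"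

fun discard_components :: "thick_knot \<Rightarrow> thick_knot \<Rightarrow> bool" where
  "discard_components (S, ori, K) (S', ori', K') \<longleftrightarrow>
     S' \<in> components S \<and> ori' = {e \<in> ori. range e \<subseteq> S'} \<and>
     K ` circle \<subseteq> S' \<times> {0..1} \<and> (\<forall>z\<in>circle. K' z = K z)"

definition interior_circle :: "(real^4) set \<Rightarrow> (real^4) set \<Rightarrow> bool" where
  "interior_circle S \<sigma> \<longleftrightarrow> \<sigma> \<subseteq> surface_interior S \<and>
     (\<exists>\<gamma>. smooth_embedding circle \<gamma> \<and> \<sigma> = \<gamma> ` circle)"

definition proper_arc :: "(real^4) set \<Rightarrow> (real^4) set \<Rightarrow> bool" where
  "proper_arc S \<sigma> \<longleftrightarrow> \<sigma> \<subseteq> S \<and>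
     (\<exists>\<gamma>::real \<Rightarrow> real^4. smooth_embedding {0..1} \<gamma> \<and> \<sigma> = \<gamma> ` {0..1} \<and>
        \<sigma> \<inter> surface_boundary S = {\<gamma> 0, \<gamma> 1})"

definition stabilization :: "thick_knot \<Rightarrow> thick_knot \<Rightarrow> bool" where
  "stabilization T T' \<longleftrightarrow>
     (\<exists>\<sigma> \<sigma>1 \<sigma>2 T1. is_thick_knot T1 \<and> cut_along T \<sigma> T1 \<sigma>1 \<sigma>2 \<and>
        (proper_arc (fst T) \<sigma> \<and> discard_components T1 T' \<or>
         interior_circle (fst T) \<sigma> \<and>
           (\<exists>T2. is_thick_knot T2 \<and> cap_off T1 \<sigma>1 \<sigma>2 T2 \<and> discard_components T2 T')))"

definition stable_move :: "thick_knot \<Rightarrow> thick_knot \<Rightarrow> bool" where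
  "stable_move T T' \<longleftrightarrow> is_thick_knot T \<and> is_thick_knot T' \<and>
     (ambient_isotopic T T' \<or> surface_homeomorphic T T' \<or> stabilization T T')"

text \<open>\<^const>\<open>equivclp\<close> also closes under the inverse moves, in particular destabilization.\<close>

definition virtual_knot_of :: "thick_knot \<Rightarrow> thick_knot set" where
  "virtual_knot_of T = {T'. equivclp stable_move T T'}"

definition classical :: "thick_knot set \<Rightarrow> bool" where
  "classical vk \<longleftrightarrow>
     (\<exists>D ori K. (D, ori, K) \<in> vk \<and> is_thick_knot (D, ori, K) \<and> D homeomorphic cball (0::complex) 1)"

section \<open>Knots in the 3-sphere\<close>

abbreviation S3 :: "(real^4) set" where
  "S3 \<equiv> sphere 0 1"

definition knot_in_S3 :: "(complex \<Rightarrow> real^4) \<Rightarrow> bool" where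
  "knot_in_S3 K \<longleftrightarrow> smooth_embedding circle K \<and> K ` circle \<subseteq> S3"

text \<open>The sphere is oriented as the boundary of the ball, outward normal first.\<close>

definition positive_at :: "(complex \<times> real \<Rightarrow> real^4) \<Rightarrow> complex \<times> real \<Rightarrow> bool" where
  "positive_at e u \<longleftrightarrow>
     (let D = frechet_derivative e (at u)
      in det (vector [e u, D (1, 0), D (\<i>, 0), D (0, 1)] :: real^4^4) > 0)"

definition S3_charts :: "(complex \<times> real \<Rightarrow> real^4) set" where
  "S3_charts = {e. open_chart S3 e \<and> smooth_on UNIV e \<and> (\<forall>u. positive_at e u)}"

text \<open>\<open>\<tau>\<close> parametrises a closed tubular neighbourhood of \<open>J\<close> by the solid torus
  \<open>S\<^sup>1 \<times> D\<^sup>2\<close>.\<close>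

definition tube :: "(complex \<Rightarrow> real^4) \<Rightarrow> (complex \<times> complex \<Rightarrow> real^4) \<Rightarrow> bool" where
  "tube J \<tau> \<longleftrightarrow> smooth_embedding (circle \<times> cball 0 1) \<tau> \<and>
     \<tau> ` (circle \<times> cball 0 1) \<subseteq> S3 \<and> (\<forall>z\<in>circle. \<tau> (z, 0) = J z)"

definition positive_tube :: "(complex \<Rightarrow> real^4) \<Rightarrow> (complex \<times> complex \<Rightarrow> real^4) \<Rightarrow> bool" where
  "positive_tube J \<tau> \<longleftrightarrow>
     tube J \<tau> \<and> (\<forall>s. positive_at (\<lambda>(w, t). \<tau> (cis t, w)) (0, s))"

definition regular_nbhd :: "(complex \<Rightarrow> real^4) \<Rightarrow> (real^4) set \<Rightarrow> bool" where
  "regular_nbhd J V \<longleftrightarrow> (\<exists>\<tau>. tube J \<tau> \<and> V = \<tau> ` (circle \<times> cball 0 1))"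

text \<open>The linking number is the class of \<open>K\<close> in \<open>H\<^sub>1(S\<^sup>3 - J)\<close>, which is infinite
  cyclic, generated by the positively oriented meridian \<open>z \<mapsto> \<tau> (1, z)\<close> of \<open>J\<close>. It
  is meaningful for disjoint knots \<open>J\<close> and \<open>K\<close>.\<close>

definition linking_number :: "(complex \<Rightarrow> real^4) \<Rightarrow> (complex \<Rightarrow> real^4) \<Rightarrow> int" where
  "linking_number J K =
     (let X = top_of_set (S3 - J ` circle);
          push = (\<lambda>\<gamma>. hom_induced 1 (top_of_set circle) {} X {} \<gamma>)
      in THE n. \<forall>\<tau>. positive_tube J \<tau> \<longrightarrow>
           (\<forall>a \<in> carrier (homology_group 1 (top_of_set circle)).
              push K a = push (\<lambda>z. \<tau> (1, z)) a [^]\<^bsub>homology_group 1 X\<^esub> n))"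

text \<open>3-cells are tame: the parametrisation extends to an embedding of a larger open ball.\<close>

definition three_cell :: "(real^4) set \<Rightarrow> bool" where
  "three_cell B \<longleftrightarrow>
     (\<exists>f g. homeomorphism (ball (0::complex \<times> real) 2) (f ` ball 0 2) f g \<and>
        f ` ball 0 2 \<subseteq> S3 \<and> B = f ` cball 0 1)"

definition unlinked :: "(complex \<Rightarrow> real^4) \<Rightarrow> (complex \<Rightarrow> real^4) \<Rightarrow> bool" where
  "unlinked J K \<longleftrightarrow> (\<exists>B. three_cell B \<and> K ` circle \<subseteq> B \<and> J ` circle \<inter> B = {})"

section \<open>Fibered triples and virtual covers\<close>

definition exterior_of :: "(real^4) set \<Rightarrow> (real^4) set" where
  "exterior_of V = closure (S3 - V)"

definition circle_fibration :: "(real^4) set \<Rightarrow> (real^4 \<Rightarrow> complex) \<Rightarrow> bool" where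
  "circle_fibration X p \<longleftrightarrow> continuous_on X p \<and> p ` X = circle \<and>
     (\<forall>z\<in>circle. \<exists>U h k. z \<in> U \<and> openin (top_of_set circle) U \<and>
        homeomorphism (X \<inter> p -` U) (U \<times> (X \<inter> p -` {z})) h k \<and>
        (\<forall>x \<in> X \<inter> p -` U. fst (h x) = p x))"

text \<open>That the fiber is a smooth surface is automatic for a smooth fibration.\<close>

definition fibered_triple ::
  "(complex \<Rightarrow> real^4) \<Rightarrow> (real^4) set \<Rightarrow> (real^4 \<Rightarrow> complex) \<Rightarrow> (real^4) set \<Rightarrow> bool" where
  "fibered_triple J V p F \<longleftrightarrow>
     knot_in_S3 J \<and> regular_nbhd J V \<and> circle_fibration (exterior_of V) p \<and>
     (\<exists>z0\<in>circle. F = exterior_of V \<inter> p -` {z0}) \<and> compact_surface F"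

text \<open>A connected covering with a group \<open>\<int>\<close> of deck transformations (the action
  \<open>d\<close>) that is simply transitive on the fibers. For a knot exterior this is the covering
  belonging to the commutator subgroup, since \<open>H\<^sub>1\<close> is infinite cyclic.\<close>

definition infinite_cyclic_cover ::
  "'m::topological_space set \<Rightarrow> ('m \<Rightarrow> real^4) \<Rightarrow> (real^4) set \<Rightarrow> bool" where
  "infinite_cyclic_cover M \<pi> X \<longleftrightarrow> covering_space M \<pi> X \<and> connected M \<and>
     (\<exists>d :: int \<Rightarrow> 'm \<Rightarrow> 'm.
        (\<forall>n. continuous_on M (d n) \<and> d n ` M \<subseteq> M \<and> (\<forall>m\<in>M. \<pi> (d n m) = \<pi> m)) \<and>
        (\<forall>m\<in>M. d 0 m = m) \<and> (\<forall>i j. \<forall>m\<in>M. d (i + j) m = d i (d j m)) \<and>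
        (\<forall>m\<in>M. \<forall>m'\<in>M. \<pi> m = \<pi> m' \<longrightarrow> (\<exists>!n. d n m = m')))"

text \<open>\<open>M\<close> carries the orientation lifted from \<open>S\<^sup>3\<close>, so \<open>\<phi>\<close> preserves
  orientations iff \<open>\<pi> \<circ> \<phi>\<^sup>-\<^sup>1\<close> does.\<close>

definition virtual_cover ::
  "(complex \<Rightarrow> real^4) \<Rightarrow> (real^4) set \<Rightarrow> (real^4) set \<Rightarrow> (complex \<Rightarrow> real^4) set \<Rightarrow>
   'm::topological_space set \<Rightarrow> ('m \<Rightarrow> real^4) \<Rightarrow> thick_knot set \<Rightarrow> bool" where
  "virtual_cover K V F ori M \<pi> vk \<longleftrightarrow>
     infinite_cyclic_cover M \<pi> (exterior_of V) \<and>
     (\<exists>\<phi> \<psi> K'. homeomorphism M (F \<times> {0<..<1}) \<phi> \<psi> \<and>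
        orientation_preserving (product_charts ori) S3_charts (\<pi> \<circ> \<psi>) \<and>
        continuous_on circle K' \<and> K' ` circle \<subseteq> M \<and> (\<forall>z\<in>circle. \<pi> (K' z) = K z) \<and>
        is_thick_knot (F, ori, \<phi> \<circ> K') \<and>
        vk = virtual_knot_of (F, ori, \<phi> \<circ> K'))"

end

theory Submission
  imports Defs
begin

text \<open>An unlinking ball for \<open>K\<close> can be pushed off the tube \<open>V\<close> by a map that fixes \<open>K\<close>; being
  simply connected it lifts to the cyclic cover, so the lifted knot lies in a ball inside
  \<open>\<Sigma> \<times> (0,1)\<close>. Such a knot is isotopic to one inside \<open>L \<times> I\<close>, where \<open>L\<close> is a half-disc at a
  boundary point of \<open>\<Sigma>\<close>: the ball is only topologically embedded, but a smooth map
  \<open>\<iota> : \<Sigma> \<times> \<real> \<rightarrow> \<real>\<^sup>3\<close> that is bi-Lipschitz on the ball (a thickening along a normal field, as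
  \<open>\<Sigma> \<subseteq> S\<^sup>3\<close>) makes the knot smooth in the chart of \<open>L\<close>, and the isotopy shrinks the ball to a
  point, moves that point into the chart, corrects the map there by a small perturbation and
  expands again. Cutting along the arc that bounds \<open>L\<close> in \<open>\<Sigma>\<close> and discarding the other piece is a
  stabilization after which the surface is a disc.\<close>

section \<open>Smooth maps\<close>

text \<open>The obstacle is a clash of categories: every knot in a \<open>stable_move\<close> must
  be a smooth embedding, while the unlinking cell, its lift and the identification of the cover with
  the thickened surface are merely continuous. The isotopy may be nonsmooth, but the knot it ends at
  may not. So the end position is an affine image of \<open>\<iota>\<close> applied to the knot, a
  formula from which the parametrisation of the ball has disappeared: it is smooth because
  \<open>\<iota>\<close> and the knot are, and an embedding because of lower Lipschitz bounds.

  Nontrivial isotopies all come from one device: in a chart, a perturbation of the identity with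
  Lipschitz constant at most 1/2, cut off by a Lipschitz function. Their ends are controlled to
  first order only near a given point, so derivatives are carried along at single points. Strict
  differentiability is the notion that composes and also turns tangency to the identity into a small
  Lipschitz perturbation.

  The arc that bounds \<open>L\<close> meets the boundary of \<Sigma> to infinite order. Hence the
  remaining surface is smooth with no corner to round, and both cusps lie on the piece that is
  replaced by a round disc.\<close>

lemma Ck_on_subset: "Ck_on k U f \<Longrightarrow> V \<subseteq> U \<Longrightarrow> Ck_on k V f"
proof (induction k arbitrary: f)
  case 0 then show ?case by (auto intro: continuous_on_subset)
next
  case (Suc k) then show ?case unfolding Ck_on.simps by blast
qed

lemma Ck_on_cong:
  assumes "open U" "\<And>x. x \<in> U \<Longrightarrow> f x = g x" "Ck_on k U f"
  shows "Ck_on k U g"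
proof (cases k)
  case 0 then show ?thesis using assms by (simp cong: continuous_on_cong)
next
  case (Suc n)
  then obtain f' where "\<forall>x\<in>U. (f has_derivative f' x) (at x)" "\<forall>v. Ck_on n U (\<lambda>x. f' x v)"
    using assms(3) by auto
  then show ?thesis
    unfolding Suc Ck_on.simps using has_derivative_transform_within_open[OF _ assms(1)] assms(2) by metis
qed

lemma Ck_on_lower: "Ck_on (Suc k) U f \<Longrightarrow> Ck_on k U f"
proof (induction k arbitrary: f)
  case 0
  then show ?case
    by (auto intro!: continuous_at_imp_continuous_on intro: has_derivative_continuous)
next
  case (Suc k)
  obtain f' where "\<forall>x\<in>U. (f has_derivative f' x) (at x)" "\<forall>v. Ck_on (Suc k) U (\<lambda>x. f' x v)"
    using Suc.prems by auto
  then show ?case using Suc.IH by auto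
qed

lemma Ck_on_const: "Ck_on k U (\<lambda>x. c)"
proof (induction k arbitrary: c)
  case (Suc k)
  then show ?case by (auto intro!: exI[of _ "\<lambda>x v. 0"])
qed simp

lemma Ck_on_bounded_linear:
  assumes "bounded_linear f" shows "Ck_on k U f"
proof (cases k)
  case 0 then show ?thesis using assms by (simp add: linear_continuous_on)
next
  case (Suc n)
  then show ?thesis using assms
    by (auto intro!: exI[of _ "\<lambda>x. f"] Ck_on_const bounded_linear_imp_has_derivative)
qed

lemma Ck_on_add:
  "Ck_on k U f \<Longrightarrow> Ck_on k U g \<Longrightarrow> Ck_on k U (\<lambda>x. f x + g x)"
proof (induction k arbitrary: f g)
  case 0 then show ?case by (auto intro: continuous_on_add)
next
  case (Suc k)
  obtain f' g' where "\<forall>x\<in>U. (f has_derivative f' x) (at x)" "\<forall>v. Ck_on k U (\<lambda>x. f' x v)"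
    "\<forall>x\<in>U. (g has_derivative g' x) (at x)" "\<forall>v. Ck_on k U (\<lambda>x. g' x v)"
    using Suc.prems by auto
  then show ?case unfolding Ck_on.simps
    by (intro exI[of _ "\<lambda>x v. f' x v + g' x v"]) (auto intro!: Suc.IH has_derivative_add)
qed

lemma Ck_on_sum:
  "(\<And>i. i \<in> I \<Longrightarrow> Ck_on k U (f i)) \<Longrightarrow> Ck_on k U (\<lambda>x. \<Sum>i\<in>I. f i x)"
  by (induction I rule: infinite_finite_induct) (auto intro: Ck_on_add Ck_on_const)

lemma Ck_on_bilinear:
  assumes bl: "bounded_bilinear bop"
  shows "Ck_on k U f \<Longrightarrow> Ck_on k U g \<Longrightarrow> Ck_on k U (\<lambda>x. bop (f x) (g x))"
proof (induction k arbitrary: f g)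
  case 0 then show ?case by (auto intro: bounded_bilinear.continuous_on[OF bl])
next
  case (Suc k)
  obtain f' g' where *: "\<forall>x\<in>U. (f has_derivative f' x) (at x)" "\<forall>v. Ck_on k U (\<lambda>x. f' x v)"
    "\<forall>x\<in>U. (g has_derivative g' x) (at x)" "\<forall>v. Ck_on k U (\<lambda>x. g' x v)"
    using Suc.prems by auto
  have "Ck_on k U f" "Ck_on k U g" using Suc.prems Ck_on_lower by blast+
  then show ?case unfolding Ck_on.simps using *
    by (intro exI[of _ "\<lambda>x v. bop (f x) (g' x v) + bop (f' x v) (g x)"])
       (auto intro!: Ck_on_add Suc.IH bounded_bilinear.FDERIV[OF bl])
qed

lemma Ck_on_linear_compose:
  assumes bl: "bounded_linear L"
  shows "Ck_on k U f \<Longrightarrow> Ck_on k U (\<lambda>x. L (f x))"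
proof (induction k arbitrary: f)
  case 0 then show ?case by (auto intro: bounded_linear.continuous_on[OF bl])
next
  case (Suc k)
  obtain f' where *: "\<forall>x\<in>U. (f has_derivative f' x) (at x)" "\<forall>v. Ck_on k U (\<lambda>x. f' x v)"
    using Suc.prems by auto
  then show ?case unfolding Ck_on.simps
    by (intro exI[of _ "\<lambda>x v. L (f' x v)"])
       (auto intro!: Suc.IH bounded_linear.has_derivative[OF bl])
qed

text \<open>The outer derivative is applied to a vector that varies with the point, while
  \<open>Ck_on\<close> controls derivatives only in fixed directions. Expanding
  \<open>f' x v\<close> in the basis turns the chain rule into a finite sum of products covered by
  the induction hypothesis.\<close>

lemma Ck_on_compose:
  assumes "Ck_on k V g" "Ck_on k U f" "f ` U \<subseteq> V"
  shows "Ck_on k U (\<lambda>x. g (f x))"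
  using assms
proof (induction k arbitrary: g)
  case 0 then show ?case by (auto intro: continuous_on_compose2)
next
  case (Suc k)
  obtain f' g' where *: "\<forall>x\<in>U. (f has_derivative f' x) (at x)" "\<forall>v. Ck_on k U (\<lambda>x. f' x v)"
    "\<forall>x\<in>V. (g has_derivative g' x) (at x)" "\<forall>v. Ck_on k V (\<lambda>x. g' x v)"
    using Suc.prems by auto
  have fk: "Ck_on k U f" using Suc.prems Ck_on_lower by blast
  let ?D = "\<lambda>x v. \<Sum>i\<in>Basis. (f' x v \<bullet> i) *\<^sub>R g' (f x) i"
  have der: "((\<lambda>x. g (f x)) has_derivative ?D x) (at x)" if x: "x \<in> U" for x
  proof -
    have g: "(g has_derivative g' (f x)) (at (f x))" using * x Suc.prems(3) by auto
    then have bl: "bounded_linear (g' (f x))" by (rule has_derivative_bounded_linear)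
    have eq: "?D x = (\<lambda>v. g' (f x) (f' x v))"
    proof
      fix v
      have "g' (f x) (f' x v) = g' (f x) (\<Sum>i\<in>Basis. (f' x v \<bullet> i) *\<^sub>R i)"
        by (simp add: euclidean_representation)
      also have "\<dots> = ?D x v"
        using bl by (simp add: bounded_linear.linear linear_sum linear_cmul)
      finally show "?D x v = g' (f x) (f' x v)" by simp
    qed
    show ?thesis unfolding eq using has_derivative_compose[of f "f' x" x UNIV g] g * x by auto
  qed
  have "Ck_on k U (\<lambda>x. ?D x v)" for v
  proof (intro Ck_on_sum Ck_on_bilinear[OF bounded_bilinear_scaleR])
    fix i
    show "Ck_on k U (\<lambda>x. f' x v \<bullet> i)"
      using Ck_on_linear_compose[OF bounded_linear_inner_left] *(2) by blast
    show "Ck_on k U (\<lambda>x. g' (f x) i)"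
      using Suc.IH[of "\<lambda>y. g' y i"] *(4) fk Suc.prems(3) by blast
  qed
  then show ?case unfolding Ck_on.simps by (intro exI[of _ ?D]) (use der in blast)
qed

definition Cinf :: "'a::euclidean_space set \<Rightarrow> ('a \<Rightarrow> 'b::euclidean_space) \<Rightarrow> bool" where
  "Cinf U f \<longleftrightarrow> (\<forall>k. Ck_on k U f)"

lemma Cinf_subset: "Cinf U f \<Longrightarrow> V \<subseteq> U \<Longrightarrow> Cinf V f"
  unfolding Cinf_def using Ck_on_subset by blast

lemma Cinf_imp_continuous_on: "Cinf U f \<Longrightarrow> continuous_on U f"
  unfolding Cinf_def using Ck_on.simps(1) by blast

lemma Cinf_const: "Cinf U (\<lambda>x. c)"
  unfolding Cinf_def using Ck_on_const by blast

lemma Cinf_bounded_linear: "bounded_linear f \<Longrightarrow> Cinf U f"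
  unfolding Cinf_def using Ck_on_bounded_linear by blast

lemma Cinf_ident: "Cinf U (\<lambda>x. x)"
  by (rule Cinf_bounded_linear) (rule bounded_linear_ident)

lemma Cinf_compose: "Cinf V g \<Longrightarrow> Cinf U f \<Longrightarrow> f ` U \<subseteq> V \<Longrightarrow> Cinf U (\<lambda>x. g (f x))"
  unfolding Cinf_def using Ck_on_compose by blast

lemma Cinf_linear_compose: "bounded_linear L \<Longrightarrow> Cinf U f \<Longrightarrow> Cinf U (\<lambda>x. L (f x))"
  unfolding Cinf_def using Ck_on_linear_compose by blast

lemma Cinf_add: "Cinf U f \<Longrightarrow> Cinf U g \<Longrightarrow> Cinf U (\<lambda>x. f x + g x)"
  unfolding Cinf_def using Ck_on_add by blast

lemma Cinf_sum: "(\<And>i. i \<in> I \<Longrightarrow> Cinf U (f i)) \<Longrightarrow> Cinf U (\<lambda>x. \<Sum>i\<in>I. f i x)"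
  by (simp add: Cinf_def Ck_on_sum)

lemma Cinf_bilinear:
  "bounded_bilinear bop \<Longrightarrow> Cinf U f \<Longrightarrow> Cinf U g \<Longrightarrow> Cinf U (\<lambda>x. bop (f x) (g x))"
  unfolding Cinf_def using Ck_on_bilinear by blast

lemmas Cinf_scaleR = Cinf_bilinear[OF bounded_bilinear_scaleR]
lemmas Cinf_inner = Cinf_bilinear[OF bounded_bilinear_inner]

lemma Cinf_mult:
  fixes f g :: "'a::euclidean_space \<Rightarrow> 'b::{real_normed_algebra,euclidean_space}"
  shows "Cinf U f \<Longrightarrow> Cinf U g \<Longrightarrow> Cinf U (\<lambda>x. f x * g x)"
  by (rule Cinf_bilinear[OF bounded_bilinear_mult])

lemma Cinf_minus: "Cinf U f \<Longrightarrow> Cinf U (\<lambda>x. - f x)"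
  by (rule Cinf_linear_compose[OF bounded_linear_minus[OF bounded_linear_ident]])

lemma Cinf_diff: "Cinf U f \<Longrightarrow> Cinf U g \<Longrightarrow> Cinf U (\<lambda>x. f x - g x)"
  using Cinf_add[OF _ Cinf_minus] by simp

section \<open>Smoothness of elementary functions\<close>

lemma Cinf_inverse_id:
  "Cinf {x::'b::{real_normed_field,euclidean_space}. x \<noteq> 0} inverse"
proof -
  have "Ck_on k {x::'b. x \<noteq> 0} inverse" for k
  proof (induction k)
    case 0 then show ?case by (auto intro!: continuous_intros)
  next
    case (Suc k)
    \<comment> \<open>The derivative is a product of copies of \<open>inverse\<close> itself, so the
      induction feeds on its own hypothesis.\<close>
    have "Ck_on k {x::'b. x \<noteq> 0} (\<lambda>x. - (inverse x * v * inverse x))" for v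
      by (intro Ck_on_linear_compose[OF bounded_linear_minus[OF bounded_linear_ident]]
            Ck_on_bilinear[OF bounded_bilinear_mult] Ck_on_const Suc)
    then show ?case unfolding Ck_on.simps
      by (intro exI[of _ "\<lambda>x v. - (inverse x * v * inverse x)"])
         (auto intro!: has_derivative_inverse')
  qed
  then show ?thesis by (simp add: Cinf_def)
qed

lemma Cinf_inverse:
  fixes f :: "'a::euclidean_space \<Rightarrow> 'b::{real_normed_field,euclidean_space}"
  shows "Cinf U f \<Longrightarrow> (\<And>x. x \<in> U \<Longrightarrow> f x \<noteq> 0) \<Longrightarrow> Cinf U (\<lambda>x. inverse (f x))"
  by (rule Cinf_compose[OF Cinf_inverse_id]) auto

lemma Cinf_divide:
  fixes f g :: "'a::euclidean_space \<Rightarrow> 'b::{real_normed_field,euclidean_space}"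
  shows "Cinf U f \<Longrightarrow> Cinf U g \<Longrightarrow> (\<And>x. x \<in> U \<Longrightarrow> g x \<noteq> 0) \<Longrightarrow> Cinf U (\<lambda>x. f x / g x)"
  unfolding divide_inverse by (intro Cinf_mult Cinf_inverse)

lemma Cinf_sqrt_id: "Cinf {0<..} sqrt"
proof -
  have "Ck_on k {0<..} sqrt" for k
  proof (induction k)
    case 0 then show ?case by (auto intro!: continuous_intros)
  next
    case (Suc k)
    have "Ck_on k {0<..} (\<lambda>x. inverse (sqrt x))"
      by (rule Ck_on_compose[OF Cinf_inverse_id[unfolded Cinf_def, rule_format] Suc]) auto
    then have "Ck_on k {0<..} (\<lambda>x. v * (inverse (sqrt x) / 2))" for v
      by (intro Ck_on_bilinear[OF bounded_bilinear_mult] Ck_on_const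
            Ck_on_linear_compose[OF bounded_linear_divide])
    then show ?case unfolding Ck_on.simps
      by (intro exI[of _ "\<lambda>x v. v * (inverse (sqrt x) / 2)"])
         (auto intro!: derivative_eq_intros simp: field_simps)
  qed
  then show ?thesis by (simp add: Cinf_def)
qed

lemma Cinf_sqrt: "Cinf U f \<Longrightarrow> (\<And>x. x \<in> U \<Longrightarrow> f x > 0) \<Longrightarrow> Cinf U (\<lambda>x. sqrt (f x))"
  by (rule Cinf_compose[OF Cinf_sqrt_id]) auto

lemma Cinf_exp_id: "Cinf U (exp :: real \<Rightarrow> real)"
proof -
  have "Ck_on k U (\<lambda>x. exp x :: real)" for k
  proof (induction k)
    case 0 then show ?case by (auto intro!: continuous_intros)
  next
    case (Suc k)
    have "Ck_on k U (\<lambda>x. v * exp x)" for v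
      by (intro Ck_on_bilinear[OF bounded_bilinear_mult] Ck_on_const Suc)
    then show ?case unfolding Ck_on.simps
      by (intro exI[of _ "\<lambda>x v. v * exp x"])
         (auto intro!: derivative_eq_intros)
  qed
  then show ?thesis by (simp add: Cinf_def)
qed

lemma Cinf_cis_id: "Cinf U cis"
proof -
  \<comment> \<open>The constant factor is generalised because the derivative of \<open>cis\<close>
    is again \<open>cis\<close> up to such a factor.\<close>
  have "Ck_on k U (\<lambda>x. c * cis x)" for k c
  proof (induction k arbitrary: c)
    case 0 then show ?case by (auto intro!: continuous_intros)
  next
    case (Suc k)
    have "((\<lambda>x. c * cis x) has_derivative (\<lambda>v. (c * of_real v * \<i>) * cis x)) (at x)" for x
      by (auto intro!: derivative_eq_intros simp: scaleR_conv_of_real)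
    then show ?case unfolding Ck_on.simps
      by (intro exI[of _ "\<lambda>x v. (c * of_real v * \<i>) * cis x"]) (use Suc in auto)
  qed
  from this[of _ 1] show ?thesis by (simp add: Cinf_def)
qed

text \<open>Dividing the flat function exp (-1/x) by powers of x gives a family whose derivatives
  are linear combinations of its members, so that one induction over all \<open>m\<close> proves
  smoothness. The member with m = 0 becomes \<open>bump\<close>, and the one with m = 1 enters
  \<open>lens_map\<close>.\<close>

definition flat_exp :: "nat \<Rightarrow> real \<Rightarrow> real" where
  "flat_exp m x = (if x > 0 then exp (- 1 / x) / x ^ m else 0)"

lemma flat_exp_has_derivative:
  "(flat_exp m has_real_derivative flat_exp (m + 2) x - real m * flat_exp (m + 1) x) (at x)"
proof -
  consider "x > 0" | "x < 0" | "x = 0" by linarith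
  then show ?thesis
  proof cases
    case 1
    have "((\<lambda>x. exp (- 1 / x) / x ^ m) has_real_derivative
        (exp (- 1 / x) / x ^ (m + 2) - real m * (exp (- 1 / x) / x ^ (m + 1)))) (at x)"
    proof (cases m)
      case 0
      then show ?thesis using 1
        by (auto intro!: derivative_eq_intros simp: field_simps power2_eq_square)
    next
      case (Suc n)
      then show ?thesis using 1
        by (auto intro!: derivative_eq_intros simp: field_simps power2_eq_square power_add)
           (metis One_nat_def power_eq_if)
    qed
    then have "(flat_exp m has_real_derivative
        (exp (- 1 / x) / x ^ (m + 2) - real m * (exp (- 1 / x) / x ^ (m + 1)))) (at x)"
      by (rule has_field_derivative_transform_within_open[of _ _ _ "{0<..}"])
         (use 1 in \<open>auto simp: flat_exp_def\<close>)
    then show ?thesis using 1 by (simp add: flat_exp_def)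
  next
    case 2
    have "((\<lambda>x. 0) has_real_derivative 0) (at x)" by simp
    then have "(flat_exp m has_real_derivative 0) (at x)"
      by (rule has_field_derivative_transform_within_open[of _ _ _ "{..<0}"])
         (use 2 in \<open>auto simp: flat_exp_def\<close>)
    then show ?thesis using 2 by (simp add: flat_exp_def)
  next
    case 3
    \<comment> \<open>In terms of the reciprocal of h this is a power divided by an exponential at
      infinity.\<close>
    have r: "((\<lambda>h::real. exp (- 1 / h) / h ^ n) \<longlongrightarrow> 0) (at_right 0)" for n :: nat
    proof -
      have "((\<lambda>h. inverse h ^ n / exp (inverse h)) \<longlongrightarrow> (0::real)) (at_right 0)"
        by (rule filterlim_compose[OF tendsto_power_div_exp_0 filterlim_inverse_at_top_right])
      moreover have "inverse h ^ n / exp (inverse h) = exp (- 1 / h) / h ^ n" for h :: real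
        by (simp add: divide_inverse exp_minus power_inverse mult.commute)
      ultimately show ?thesis by (simp only:)
    qed
    have "((\<lambda>h. flat_exp m h / h) \<longlongrightarrow> 0) (at_right 0)"
      using r[of "Suc m"]
      by (rule Lim_transform_eventually)
         (auto simp: flat_exp_def eventually_at_filter mult.commute)
    moreover have "((\<lambda>h. flat_exp m h / h) \<longlongrightarrow> 0) (at_left 0)"
      by (rule tendsto_eventually) (auto simp: flat_exp_def eventually_at_filter)
    ultimately have "((\<lambda>h. flat_exp m h / h) \<longlongrightarrow> 0) (at 0)"
      by (simp add: filterlim_at_split)
    then show ?thesis using 3 by (simp add: has_field_derivative_iff flat_exp_def)
  qed
qed

lemma Cinf_flat_exp: "Cinf U (flat_exp m)"
proof -
  have "Ck_on k U (flat_exp m)" for k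
  proof (induction k arbitrary: m)
    case 0
    then show ?case
      using DERIV_isCont[OF flat_exp_has_derivative] by (simp add: continuous_at_imp_continuous_on)
  next
    case (Suc k)
    let ?d = "\<lambda>x v. v * (flat_exp (m + 2) x + (- real m) * flat_exp (m + 1) x)"
    have "Ck_on k U (\<lambda>x. ?d x v)" for v
      by (intro Ck_on_bilinear[OF bounded_bilinear_mult] Ck_on_add Ck_on_const Suc)
    moreover have "(flat_exp m has_derivative ?d x) (at x)" for x
      using flat_exp_has_derivative[of m x, unfolded has_field_derivative_def]
      by (rule has_derivative_eq_rhs) (auto simp: algebra_simps)
    ultimately show ?case unfolding Ck_on.simps by (intro exI[of _ ?d]) blast
  qed
  then show ?thesis by (simp add: Cinf_def)
qed

lemma Cinf_euclidean:
  assumes "\<And>i. i \<in> Basis \<Longrightarrow> Cinf U (\<lambda>x. f x \<bullet> i)"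
  shows "Cinf U f"
proof -
  have "Cinf U (\<lambda>x. \<Sum>i\<in>Basis. (f x \<bullet> i) *\<^sub>R i)"
    by (intro Cinf_sum Cinf_scaleR Cinf_const assms)
  then show ?thesis by (simp add: euclidean_representation)
qed

lemma Cinf_Pair:
  assumes "Cinf U f" "Cinf U g" shows "Cinf U (\<lambda>x. (f x, g x))"
proof -
  have "Cinf U (\<lambda>x. (f x, 0) + (0, g x))"
    by (intro Cinf_add Cinf_linear_compose[OF _ assms(1)] Cinf_linear_compose[OF _ assms(2)]
          bounded_linear_Pair bounded_linear_ident bounded_linear_zero)
  then show ?thesis by simp
qed

lemma Cinf_polynomial:
  fixes p :: "'a::euclidean_space \<Rightarrow> 'b::euclidean_space"
  assumes "polynomial_function p" shows "Cinf U p"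
proof (rule Cinf_euclidean)
  fix i :: 'b
  have r: "real_polynomial_function (\<lambda>x. p x \<bullet> i)"
    using assms unfolding polynomial_function_def o_def
    using bounded_linear_inner_left by blast
  have "Cinf U q" if "real_polynomial_function q" for q :: "'a \<Rightarrow> real"
    using that by induction (auto intro: Cinf_bounded_linear Cinf_const Cinf_add Cinf_mult)
  then show "Cinf U (\<lambda>x. p x \<bullet> i)" using r by blast
qed

section \<open>Smooth maps on arbitrary subsets\<close>

lemma Cinf_imp_smooth_on: "open U \<Longrightarrow> Cinf U f \<Longrightarrow> A \<subseteq> U \<Longrightarrow> smooth_on A f"
  unfolding smooth_on_def Cinf_def by (intro ballI exI[of _ U] exI[of _ f]) auto

lemma smooth_on_localI:
  assumes "\<And>x. x \<in> A \<Longrightarrow> \<exists>U g. open U \<and> x \<in> U \<and> Cinf U g \<and> (\<forall>y\<in>A \<inter> U. g y = f y)"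
  shows "smooth_on A f"
  unfolding smooth_on_def using assms[unfolded Cinf_def] by (rule ballI)

lemma smooth_onE:
  assumes "smooth_on A f" "x \<in> A"
  obtains U g where "open U" "x \<in> U" "Cinf U g" "\<And>y. y \<in> A \<Longrightarrow> y \<in> U \<Longrightarrow> g y = f y"
proof -
  obtain U g where "open U \<and> x \<in> U \<and> (\<forall>k. Ck_on k U g) \<and> (\<forall>y\<in>A \<inter> U. g y = f y)"
    using assms unfolding smooth_on_def by (elim ballE exE) auto
  then show ?thesis using that[of U g] by (simp add: Cinf_def)
qed

lemma smooth_on_cong_subset:
  assumes "smooth_on A f" "B \<subseteq> A" "\<And>x. x \<in> B \<Longrightarrow> f x = g x"
  shows "smooth_on B g"
proof (rule smooth_on_localI)
  fix x assume "x \<in> B"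
  then obtain U h where "open U" "x \<in> U" "Cinf U h" "\<And>y. y \<in> A \<Longrightarrow> y \<in> U \<Longrightarrow> h y = f y"
    using smooth_onE[OF assms(1), of x] assms(2) by blast
  then show "\<exists>U h. open U \<and> x \<in> U \<and> Cinf U h \<and> (\<forall>y\<in>B \<inter> U. h y = g y)"
    using assms(2,3) by (intro exI[of _ U] exI[of _ h]) auto
qed

lemma smooth_on_subset: "smooth_on A f \<Longrightarrow> B \<subseteq> A \<Longrightarrow> smooth_on B f"
  using smooth_on_cong_subset[of A f B f] by simp

lemma smooth_on_compose:
  assumes f: "smooth_on A f" and g: "smooth_on B g" and AB: "f ` A \<subseteq> B"
  shows "smooth_on A (\<lambda>x. g (f x))"
proof (rule smooth_on_localI)
  fix x assume x: "x \<in> A"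
  obtain U f1 where U: "open U" "x \<in> U" "Cinf U f1" "\<And>y. y \<in> A \<Longrightarrow> y \<in> U \<Longrightarrow> f1 y = f y"
    using smooth_onE[OF f x] by metis
  obtain V g1 where V: "open V" "f x \<in> V" "Cinf V g1" "\<And>y. y \<in> B \<Longrightarrow> y \<in> V \<Longrightarrow> g1 y = g y"
    using smooth_onE[OF g, of "f x"] AB x by blast
  let ?W = "U \<inter> f1 -` V"
  have "open ?W" using continuous_open_preimage[OF Cinf_imp_continuous_on[OF U(3)] U(1) V(1)] .
  moreover have "Cinf ?W (\<lambda>x. g1 (f1 x))"
    by (rule Cinf_compose[OF V(3)]) (use Cinf_subset[OF U(3)] in auto)
  moreover have "x \<in> ?W" using U V x by auto
  moreover have "g1 (f1 y) = g (f y)" if "y \<in> A \<inter> ?W" for y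
    using that U V AB by auto
  ultimately show "\<exists>U h. open U \<and> x \<in> U \<and> Cinf U h \<and> (\<forall>y\<in>A \<inter> U. h y = g (f y))" by blast
qed

lemma smooth_on_Pair:
  assumes f: "smooth_on A f" and g: "smooth_on A g"
  shows "smooth_on A (\<lambda>x. (f x, g x))"
proof (rule smooth_on_localI)
  fix x assume x: "x \<in> A"
  obtain U f1 where U: "open U" "x \<in> U" "Cinf U f1" "\<And>y. y \<in> A \<Longrightarrow> y \<in> U \<Longrightarrow> f1 y = f y"
    using smooth_onE[OF f x] by metis
  obtain V g1 where V: "open V" "x \<in> V" "Cinf V g1" "\<And>y. y \<in> A \<Longrightarrow> y \<in> V \<Longrightarrow> g1 y = g y"
    using smooth_onE[OF g x] by metis
  have "Cinf (U \<inter> V) (\<lambda>x. (f1 x, g1 x))"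
    by (intro Cinf_Pair Cinf_subset[OF U(3)] Cinf_subset[OF V(3)]) auto
  then show "\<exists>U h. open U \<and> x \<in> U \<and> Cinf U h \<and> (\<forall>y\<in>A \<inter> U. h y = (f y, g y))"
    using U V by (intro exI[of _ "U \<inter> V"] exI[of _ "\<lambda>x. (f1 x, g1 x)"]) auto
qed

lemma smooth_on_imp_continuous_on:
  assumes "smooth_on A f" shows "continuous_on A f"
proof -
  have "continuous (at x within A) f" if x: "x \<in> A" for x
  proof -
    obtain U f1 where U: "open U" "x \<in> U" "Cinf U f1" "\<And>y. y \<in> A \<Longrightarrow> y \<in> U \<Longrightarrow> f1 y = f y"
      using smooth_onE[OF assms x] by metis
    have "continuous (at x) f1"
      using U Cinf_imp_continuous_on continuous_on_eq_continuous_at by blast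
    then have "continuous (at x within A) f1" by (rule continuous_at_imp_continuous_at_within)
    moreover obtain d where "d > 0" "ball x d \<subseteq> U" using U openE by blast
    ultimately show ?thesis
      by (intro continuous_transform_within[of x A f1 d f]) (use U x in \<open>auto simp: dist_commute subset_iff\<close>)
  qed
  then show ?thesis by (simp add: continuous_on_eq_continuous_within)
qed

section \<open>Strict differentiability\<close>

text \<open>Two moving points are compared, rather than one moving point with \<open>x\<close>. This
  yields a local Lipschitz bound and makes the notion composable, yet it asks for regularity at
  \<open>x\<close> only, which is what isotopies built from Lipschitz cutoffs can offer. On a set
  without interior the map \<open>L\<close> need not be unique.\<close>

definition strict_derivative ::
  "'a::euclidean_space set \<Rightarrow> ('a \<Rightarrow> 'b::euclidean_space) \<Rightarrow> 'a \<Rightarrow> ('a \<Rightarrow> 'b) \<Rightarrow> bool" where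
  "strict_derivative A f x L \<longleftrightarrow> bounded_linear L \<and>
     (\<forall>e>0. \<exists>d>0. \<forall>u\<in>A \<inter> ball x d. \<forall>v\<in>A \<inter> ball x d.
        norm (f u - f v - L (u - v)) \<le> e * norm (u - v))"

lemma strict_derivativeD:
  assumes "strict_derivative A f x L" "e > 0"
  obtains d where "d > 0"
    "\<And>u v. u \<in> A \<Longrightarrow> v \<in> A \<Longrightarrow> dist x u < d \<Longrightarrow> dist x v < d \<Longrightarrow>
       norm (f u - f v - L (u - v)) \<le> e * norm (u - v)"
  using assms unfolding strict_derivative_def by (auto simp: Ball_def)

lemma Cinf_imp_has_derivative:
  assumes "Cinf U f"
  obtains f' where "\<And>x. x \<in> U \<Longrightarrow> (f has_derivative f' x) (at x)" "\<And>v. continuous_on U (\<lambda>x. f' x v)"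
proof -
  have "Ck_on (Suc 0) U f" using assms Cinf_def by blast
  then show ?thesis using that by auto
qed

text \<open>Continuity of the partial derivatives gives continuity in operator norm, hence strictness
  by the mean value inequality.\<close>

lemma Cinf_uniform_strict:
  fixes f :: "'a::euclidean_space \<Rightarrow> 'b::euclidean_space"
  assumes U: "open U" "x \<in> U"
    and f': "\<And>x. x \<in> U \<Longrightarrow> (f has_derivative f' x) (at x)" "\<And>v. continuous_on U (\<lambda>x. f' x v)"
    and e: "e > 0"
  obtains d where "d > 0" "ball x d \<subseteq> U"
    "\<And>w u v. w \<in> ball x d \<Longrightarrow> u \<in> ball x d \<Longrightarrow> v \<in> ball x d \<Longrightarrow>
       norm (f u - f v - f' w (u - v)) \<le> e * norm (u - v)"
proof -
  \<comment> \<open>At most \<open>DIM('a)\<close> coordinate errors below \<open>c\<close> add up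
    to e/2, and the estimate is used at two base points.\<close>
  define c where "c = e / (2 * (real DIM('a) + 1))"
  have c: "c > 0" using e by (simp add: c_def)
  have "\<exists>d>0. \<forall>y. dist y x < d \<longrightarrow> y \<in> U \<and> norm (f' y i - f' x i) < c" for i
  proof -
    have "isCont (\<lambda>y. f' y i) x"
      using f'(2) U continuous_on_eq_continuous_at by blast
    then obtain d1 where "d1 > 0" "\<forall>y. dist y x < d1 \<longrightarrow> dist (f' y i) (f' x i) < c"
      unfolding continuous_at_eps_delta using c by blast
    moreover obtain d2 where "d2 > 0" "ball x d2 \<subseteq> U" using U openE by blast
    ultimately show ?thesis
      by (intro exI[of _ "min d1 d2"]) (auto simp: dist_norm norm_minus_commute subset_iff)
  qed
  then obtain dd where dd: "\<And>i. dd i > 0"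
    "\<And>i y. dist y x < dd i \<Longrightarrow> y \<in> U \<and> norm (f' y i - f' x i) < c" by metis
  define d where "d = Min (dd ` Basis)"
  have d: "d > 0" "\<And>i. i \<in> Basis \<Longrightarrow> d \<le> dd i" by (auto simp: d_def dd)
  have dU: "ball x d \<subseteq> U"
  proof
    fix y assume "y \<in> ball x d"
    moreover obtain i :: 'a where "i \<in> Basis" using nonempty_Basis by blast
    ultimately show "y \<in> U" using d(2)[of i] dd(2)[of y i] by (simp add: dist_commute)
  qed
  have bl: "bounded_linear (f' y)" if "y \<in> U" for y using f'(1) that has_derivative_bounded_linear by blast
  have on: "norm (f' y h - f' x h) \<le> e / 2 * norm h" if y: "y \<in> ball x d" for y h
  proof -
    have yU: "y \<in> U" "x \<in> U" using y dU U by auto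
    have "f' y h - f' x h = (\<Sum>i\<in>Basis. (h \<bullet> i) *\<^sub>R (f' y i - f' x i))"
    proof -
      have "f' z h = (\<Sum>i\<in>Basis. (h \<bullet> i) *\<^sub>R f' z i)" if "z \<in> U" for z
      proof -
        have "f' z h = f' z (\<Sum>i\<in>Basis. (h \<bullet> i) *\<^sub>R i)" by (simp add: euclidean_representation)
        then show ?thesis
          using bl[OF that] by (simp add: bounded_linear.linear linear_sum linear_cmul)
      qed
      then show ?thesis using yU by (simp add: sum_subtractf scaleR_diff_right)
    qed
    also have "norm \<dots> \<le> (\<Sum>i\<in>(Basis::'a set). norm h * c)"
    proof (rule sum_norm_le)
      fix i :: 'a assume i: "i \<in> Basis"
      have "norm (f' y i - f' x i) \<le> c" using dd(2)[of y i] d(2)[OF i] y by (auto simp: dist_commute)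
      then show "norm ((h \<bullet> i) *\<^sub>R (f' y i - f' x i)) \<le> norm h * c"
        using Basis_le_norm[OF i, of h] c by (simp add: mult_mono)
    qed
    also have "\<dots> = real DIM('a) * c * norm h" by simp
    also have "\<dots> \<le> e / 2 * norm h"
      by (intro mult_right_mono) (use e in \<open>auto simp: c_def field_simps\<close>)
    finally show ?thesis .
  qed
  have "norm (f u - f v - f' w (u - v)) \<le> e * norm (u - v)"
    if w: "w \<in> ball x d" and u: "u \<in> ball x d" and v: "v \<in> ball x d" for w u v
  proof -
    have wU: "w \<in> U" using w dU by auto
    have lin: "f' w (u - v) = f' w u - f' w v" using bl[OF wU] by (simp add: bounded_linear.linear linear_diff)
    have "norm ((\<lambda>y. f y - f' w y) u - (\<lambda>y. f y - f' w y) v) \<le> e * norm (u - v)"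
    proof (rule differentiable_bound[OF convex_ball[of x d], where f' = "\<lambda>y h. f' y h - f' w h"])
      fix y assume y: "y \<in> ball x d"
      have yU: "y \<in> U" using y dU by auto
      show "((\<lambda>y. f y - f' w y) has_derivative (\<lambda>h. f' y h - f' w h)) (at y within ball x d)"
        by (intro has_derivative_diff has_derivative_at_withinI[OF f'(1)[OF yU]]
              has_derivative_at_withinI[OF bounded_linear_imp_has_derivative] bl wU)
      show "onorm (\<lambda>h. f' y h - f' w h) \<le> e"
      proof (rule onorm_le)
        fix h
        have "norm (f' y h - f' w h) \<le> norm (f' y h - f' x h) + norm (f' w h - f' x h)"
          using norm_triangle_ineq4[of "f' y h - f' x h" "f' w h - f' x h"] by simp
        also have "\<dots> \<le> e * norm h" using on[OF y, of h] on[OF w, of h] by simp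
        finally show "norm (f' y h - f' w h) \<le> e * norm h" .
      qed
    qed (use u v in auto)
    then show ?thesis by (simp add: lin algebra_simps)
  qed
  then show ?thesis using that[OF d(1) dU] by blast
qed

lemma smooth_on_strict_derivative:
  assumes "smooth_on A f" "x \<in> A"
  obtains L where "strict_derivative A f x L"
proof -
  obtain U g where U: "open U" "x \<in> U" "Cinf U g" "\<And>y. y \<in> A \<Longrightarrow> y \<in> U \<Longrightarrow> g y = f y"
    using smooth_onE[OF assms] by metis
  obtain g' where g': "\<And>x. x \<in> U \<Longrightarrow> (g has_derivative g' x) (at x)" "\<And>v. continuous_on U (\<lambda>x. g' x v)"
    using Cinf_imp_has_derivative[OF U(3)] by metis
  have "\<exists>d>0. \<forall>u\<in>A \<inter> ball x d. \<forall>v\<in>A \<inter> ball x d. norm (f u - f v - g' x (u - v)) \<le> e * norm (u - v)"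
    if e: "e > 0" for e
  proof -
    obtain d where "d > 0" "ball x d \<subseteq> U" "\<And>w u v. w \<in> ball x d \<Longrightarrow> u \<in> ball x d \<Longrightarrow> v \<in> ball x d \<Longrightarrow>
       norm (g u - g v - g' w (u - v)) \<le> e * norm (u - v)"
      using Cinf_uniform_strict[OF U(1,2) g' e] by blast
    moreover from this have "g u = f u" if "u \<in> A \<inter> ball x d" for u using U(4) that by auto
    ultimately show ?thesis by (metis IntD2 centre_in_ball)
  qed
  moreover have "bounded_linear (g' x)" using g'(1) U(2) has_derivative_bounded_linear by blast
  ultimately show ?thesis using that unfolding strict_derivative_def by blast
qed

lemma strict_derivative_lipschitz:
  assumes "strict_derivative A f x L"
  obtains d K where "d > 0" "K > 0"
    "\<And>u v. u \<in> A \<Longrightarrow> v \<in> A \<Longrightarrow> dist x u < d \<Longrightarrow> dist x v < d \<Longrightarrow> norm (f u - f v) \<le> K * norm (u - v)"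
proof -
  obtain d where d: "d > 0"
    "\<And>u v. u \<in> A \<Longrightarrow> v \<in> A \<Longrightarrow> dist x u < d \<Longrightarrow> dist x v < d \<Longrightarrow> norm (f u - f v - L (u - v)) \<le> 1 * norm (u - v)"
    using strict_derivativeD[OF assms zero_less_one] by blast
  have "bounded_linear L" using assms strict_derivative_def by blast
  then obtain K where K: "K > 0" "\<And>h. norm (L h) \<le> norm h * K"
    using bounded_linear.pos_bounded by blast
  have "norm (f u - f v) \<le> (K + 1) * norm (u - v)"
    if "u \<in> A" "v \<in> A" "dist x u < d" "dist x v < d" for u v
  proof -
    have "norm (f u - f v) \<le> norm (f u - f v - L (u - v)) + norm (L (u - v))"
      by (metis diff_add_cancel norm_triangle_ineq)
    then show ?thesis using d(2)[OF that] K(2)[of "u - v"] by (simp add: algebra_simps)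
  qed
  then show ?thesis using that[of d "K + 1"] d K by auto
qed

lemma smooth_on_local_lipschitz:
  assumes "smooth_on A f" "x \<in> A"
  obtains d K where "d > 0" "K > 0"
    "\<And>u v. u \<in> A \<Longrightarrow> v \<in> A \<Longrightarrow> dist x u < d \<Longrightarrow> dist x v < d \<Longrightarrow> norm (f u - f v) \<le> K * norm (u - v)"
  using smooth_on_strict_derivative[OF assms] strict_derivative_lipschitz by metis

lemma strict_derivative_subset:
  "strict_derivative A f x L \<Longrightarrow> B \<subseteq> A \<Longrightarrow> strict_derivative B f x L"
  unfolding strict_derivative_def by (meson IntD1 IntD2 IntI subsetD)

text \<open>The error splits into the error of \<open>g\<close> on an increment of \<open>f\<close>
  and the image under \<open>M\<close> of the error of \<open>f\<close>. A local Lipschitz constant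
  \<open>K\<close> of \<open>f\<close> and a bound \<open>KM\<close> for \<open>M\<close> allot half
  of \<open>e\<close> to each.\<close>

lemma strict_derivative_compose:
  assumes f: "strict_derivative A f x L" and g: "strict_derivative B g (f x) M"
    and xA: "x \<in> A" and AB: "f ` A \<subseteq> B"
  shows "strict_derivative A (\<lambda>y. g (f y)) x (\<lambda>h. M (L h))"
proof -
  have bl: "bounded_linear L" "bounded_linear M" using f g strict_derivative_def by blast+
  obtain KM where KM: "KM > 0" "\<And>h. norm (M h) \<le> norm h * KM"
    using bounded_linear.pos_bounded[OF bl(2)] by blast
  obtain d0 K where K: "d0 > 0" "K > 0"
    "\<And>u v. u \<in> A \<Longrightarrow> v \<in> A \<Longrightarrow> dist x u < d0 \<Longrightarrow> dist x v < d0 \<Longrightarrow> norm (f u - f v) \<le> K * norm (u - v)"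
    using strict_derivative_lipschitz[OF f] by blast
  have "\<exists>d>0. \<forall>u\<in>A \<inter> ball x d. \<forall>v\<in>A \<inter> ball x d.
        norm (g (f u) - g (f v) - M (L (u - v))) \<le> e * norm (u - v)" if e: "e > 0" for e
  proof -
    obtain d1 where d1: "d1 > 0" "\<And>u v. u \<in> B \<Longrightarrow> v \<in> B \<Longrightarrow> dist (f x) u < d1 \<Longrightarrow> dist (f x) v < d1 \<Longrightarrow>
       norm (g u - g v - M (u - v)) \<le> (e / (2 * K)) * norm (u - v)"
      using strict_derivativeD[OF g, of "e / (2 * K)"] e K by auto
    obtain d2 where d2: "d2 > 0" "\<And>u v. u \<in> A \<Longrightarrow> v \<in> A \<Longrightarrow> dist x u < d2 \<Longrightarrow> dist x v < d2 \<Longrightarrow>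
       norm (f u - f v - L (u - v)) \<le> (e / (2 * KM)) * norm (u - v)"
      using strict_derivativeD[OF f, of "e / (2 * KM)"] e KM by auto
    define d where "d = min (min d0 d2) (d1 / K)"
    have d: "d > 0" using d1 d2 K by (simp add: d_def)
    have "norm (g (f u) - g (f v) - M (L (u - v))) \<le> e * norm (u - v)"
      if u: "u \<in> A \<inter> ball x d" and v: "v \<in> A \<inter> ball x d" for u v
    proof -
      have near: "dist (f x) (f w) < d1" if w: "w \<in> A \<inter> ball x d" for w
      proof -
        have "norm (f x - f w) \<le> K * norm (x - w)" using K(3)[OF xA, of w] w K(1) by (simp add: d_def)
        also have "\<dots> < K * (d1 / K)"
          using w K by (intro mult_strict_left_mono) (auto simp: d_def dist_norm)
        finally show ?thesis using K by (simp add: dist_norm)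
      qed
      have 1: "norm (g (f u) - g (f v) - M (f u - f v)) \<le> (e / (2 * K)) * norm (f u - f v)"
        using d1(2)[of "f u" "f v"] near u v AB by auto
      have 2: "norm (f u - f v) \<le> K * norm (u - v)" using K(3)[of u v] u v by (simp add: d_def)
      have "(e / (2 * K)) * norm (f u - f v) \<le> (e / (2 * K)) * (K * norm (u - v))"
        using 2 e K by (intro mult_left_mono) auto
      then have 3: "(e / (2 * K)) * norm (f u - f v) \<le> e / 2 * norm (u - v)" using K by simp
      have 4: "norm (M (f u - f v - L (u - v))) \<le> e / 2 * norm (u - v)"
      proof -
        have "norm (M (f u - f v - L (u - v))) \<le> norm (f u - f v - L (u - v)) * KM" by (rule KM)
        also have "\<dots> \<le> (e / (2 * KM)) * norm (u - v) * KM"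
          using d2(2)[of u v] u v KM by (intro mult_right_mono) (auto simp: d_def)
        finally show ?thesis using KM by simp
      qed
      have "M (f u - f v - L (u - v)) = M (f u - f v) - M (L (u - v))"
        using bl(2) by (simp add: bounded_linear.linear linear_diff)
      then have "g (f u) - g (f v) - M (L (u - v)) =
          (g (f u) - g (f v) - M (f u - f v)) + M (f u - f v - L (u - v))" by simp
      then have "norm (g (f u) - g (f v) - M (L (u - v))) \<le>
          norm (g (f u) - g (f v) - M (f u - f v)) + norm (M (f u - f v - L (u - v)))"
        by (simp only: norm_triangle_ineq)
      also have "\<dots> \<le> e / 2 * norm (u - v) + e / 2 * norm (u - v)"
        using 1 3 4 by linarith
      finally show ?thesis by simp
    qed
    then show ?thesis using d by blast
  qed
  moreover have "bounded_linear (\<lambda>h. M (L h))" using bl bounded_linear_compose by blast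
  ultimately show ?thesis unfolding strict_derivative_def by blast
qed

text \<open>\<open>Cinf\<close> supplies a possibly different derivative for every order
  \<open>k\<close>. Uniqueness of the Frechet derivative on an open set makes them one function,
  which is then smooth of all orders.\<close>

lemma Cinf_derivative:
  assumes "open U" "Cinf U f"
  obtains f' where "\<And>x. x \<in> U \<Longrightarrow> (f has_derivative f' x) (at x)" "\<And>v. Cinf U (\<lambda>x. f' x v)"
proof (rule that)
  have *: "\<exists>f'. (\<forall>x\<in>U. (f has_derivative f' x) (at x)) \<and> (\<forall>v. Ck_on k U (\<lambda>x. f' x v))" for k
    using assms(2)[unfolded Cinf_def, rule_format, of "Suc k"] by simp
  show "(f has_derivative frechet_derivative f (at x)) (at x)" if "x \<in> U" for x
    using *[of 0] that frechet_derivative_works differentiable_def by blast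
  show "Cinf U (\<lambda>x. frechet_derivative f (at x) v)" for v
    unfolding Cinf_def
  proof
    fix k
    obtain f' where f': "\<forall>x\<in>U. (f has_derivative f' x) (at x)" "\<forall>v. Ck_on k U (\<lambda>x. f' x v)"
      using *[of k] by blast
    have "f' x = frechet_derivative f (at x)" if "x \<in> U" for x
      using f'(1) that frechet_derivative_at by blast
    then show "Ck_on k U (\<lambda>x. frechet_derivative f (at x) v)"
      using Ck_on_cong[OF assms(1) _ f'(2)[rule_format, of v]] by simp
  qed
qed

section \<open>Stereographic projection\<close>

text \<open>Only the properties used later are recorded: smooth, mutually inverse maps between
  \<open>real^3\<close> and the sphere without the pole \<open>q\<close>. The set
  \<open>x \<bullet> q \<noteq> 1\<close> is open in the ambient space, so \<open>st\<close> is
  smooth in the sense that \<open>smooth_on\<close> asks for.\<close>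

definition stereo :: "real^4 \<Rightarrow> (real^4 \<Rightarrow> real^3) \<Rightarrow> (real^3 \<Rightarrow> real^4) \<Rightarrow> bool" where
  "stereo q st sti \<longleftrightarrow> Cinf {x. x \<bullet> q \<noteq> 1} st \<and> Cinf UNIV sti \<and> (\<forall>v. sti v \<in> S3 - {q}) \<and>
     (\<forall>v. st (sti v) = v) \<and> (\<forall>x\<in>S3 - {q}. sti (st x) = x) \<and> (\<forall>x\<in>S3 - {q}. x \<bullet> q \<noteq> 1)"

lemma stereo_exists:
  assumes q: "q \<in> S3"
  obtains st sti where "stereo q st sti"
proof -
  have qq: "q \<bullet> q = 1" "q \<noteq> 0" using q by (auto simp: dot_square_norm)
  have dm: "dim {x::real^4. q \<bullet> x = 0} = dim (UNIV :: (real^3) set)"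
    using dim_hyperplane[OF qq(2)] by simp
  \<comment> \<open>The projection takes place in the hyperplane orthogonal to the pole, which an
    isometry identifies with \<open>real^3\<close>.\<close>
  obtain lf :: "real^4 \<Rightarrow> real^3" and lg where l: "linear lf" "linear lg"
    "lf ` {x. q \<bullet> x = 0} = UNIV" "lg ` UNIV = {x. q \<bullet> x = 0}"
    "\<And>x. x \<in> {x. q \<bullet> x = 0} \<Longrightarrow> norm (lf x) = norm x" "\<And>x. x \<in> UNIV \<Longrightarrow> norm (lg x) = norm x"
    "\<And>x. x \<in> {x. q \<bullet> x = 0} \<Longrightarrow> lg (lf x) = x" "\<And>x. x \<in> UNIV \<Longrightarrow> lf (lg x) = x"
    by (rule isometries_subspaces[OF subspace_hyperplane subspace_UNIV dm]) (rule that; simp)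
  have lgq: "q \<bullet> lg v = 0" "lg v \<bullet> q = 0" for v using l(4) by (auto simp: inner_commute)
  have lgn: "lg v \<bullet> lg v = v \<bullet> v" for v using l(6)[of v] by (simp add: dot_square_norm)
  define st where "st x = inverse (1 - x \<bullet> q) *\<^sub>R lf (x - (x \<bullet> q) *\<^sub>R q)" for x
  define sti where "sti v = inverse (v \<bullet> v + 1) *\<^sub>R (2 *\<^sub>R lg v + (v \<bullet> v - 1) *\<^sub>R q)" for v
  have pos: "v \<bullet> v + 1 > 0" for v :: "real^3"
    by (simp add: add_nonneg_pos)
  have lin: "bounded_linear lf" "bounded_linear lg" using l by (simp_all add: linear_linear)
  have "Cinf {x. x \<bullet> q \<noteq> 1} st" unfolding st_def
    by (intro Cinf_scaleR Cinf_inverse Cinf_linear_compose[OF lin(1)] Cinf_diff Cinf_inner Cinf_const Cinf_ident) auto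
  moreover have "Cinf UNIV sti" unfolding sti_def using pos
    by (intro Cinf_scaleR Cinf_inverse Cinf_linear_compose[OF lin(2)] Cinf_add Cinf_diff Cinf_inner Cinf_const Cinf_ident)
       (auto simp: less_imp_neq[symmetric])
  moreover have stiq: "sti v \<bullet> q = (v \<bullet> v - 1) / (v \<bullet> v + 1)" for v
    by (simp add: sti_def inner_add_left lgq qq divide_inverse)
  have "sti v \<in> S3 - {q}" for v
  proof -
    have "(2 *\<^sub>R lg v + c *\<^sub>R q) \<bullet> (2 *\<^sub>R lg v + c *\<^sub>R q) = 4 * (v \<bullet> v) + c\<^sup>2" for c
      by (simp add: inner_add_left inner_add_right lgq lgn qq power2_eq_square)
    then have "sti v \<bullet> sti v = inverse (v \<bullet> v + 1) * (inverse (v \<bullet> v + 1) * (4 * (v \<bullet> v) + (v \<bullet> v - 1)\<^sup>2))"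
      by (simp add: sti_def)
    also have "4 * (v \<bullet> v) + (v \<bullet> v - 1)\<^sup>2 = (v \<bullet> v + 1) * (v \<bullet> v + 1)" by (simp add: power2_eq_square algebra_simps)
    also have "inverse (v \<bullet> v + 1) * (inverse (v \<bullet> v + 1) * ((v \<bullet> v + 1) * (v \<bullet> v + 1))) = 1"
      using pos[of v] by (simp add: mult.assoc[symmetric])
    finally have "sti v \<bullet> sti v = 1" .
    moreover have "sti v \<bullet> q \<noteq> 1" unfolding stiq using pos[of v] by (simp add: divide_eq_1_iff)
    ultimately show ?thesis using qq by (auto simp: norm_eq_1)
  qed
  moreover have "st (sti v) = v" for v
  proof -
    have 1: "1 - sti v \<bullet> q = 2 / (v \<bullet> v + 1)" using pos[of v] by (simp add: stiq field_simps)
    have 2: "sti v - (sti v \<bullet> q) *\<^sub>R q = (2 / (v \<bullet> v + 1)) *\<^sub>R lg v"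
      unfolding stiq by (simp add: sti_def algebra_simps divide_inverse)
    have ne: "2 / (v \<bullet> v + 1) \<noteq> 0" using pos[of v] by simp
    show ?thesis unfolding st_def 1 2 using l(8)
      by (simp only: linear_cmul[OF l(1)] scaleR_scaleR left_inverse[OF ne] scaleR_one UNIV_I)
  qed
  moreover have ne1: "x \<bullet> q \<noteq> 1" if "x \<in> S3 - {q}" for x
  proof
    assume "x \<bullet> q = 1"
    then have "(x - q) \<bullet> (x - q) = 0" using that qq
      by (simp add: inner_diff_left inner_diff_right norm_eq_1 inner_commute)
    then show False using that by simp
  qed
  moreover have "sti (st x) = x" if x: "x \<in> S3 - {q}" for x
  proof -
    define c where "c = x \<bullet> q"
    define h where "h = x - c *\<^sub>R q"
    have xx: "x \<bullet> x = 1" using x by (simp add: norm_eq_1)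
    have c1: "c \<noteq> 1" using ne1[OF x] by (simp add: c_def)
    have h: "q \<bullet> h = 0" by (simp add: h_def c_def inner_diff_right qq inner_commute)
    have hh: "h \<bullet> h = 1 - c\<^sup>2"
      by (simp add: h_def inner_diff_left inner_diff_right xx qq c_def[symmetric] power2_eq_square inner_commute algebra_simps)
         (simp add: c_def inner_commute)
    have lfh: "lf h \<bullet> lf h = 1 - c\<^sup>2" using l(5)[of h] h hh by (simp add: dot_square_norm)
    have st: "st x = inverse (1 - c) *\<^sub>R lf h" by (simp add: st_def c_def h_def)
    have lgst: "lg (st x) = inverse (1 - c) *\<^sub>R h" using l(7)[of h] h by (simp add: st linear_cmul[OF l(2)])
    have ss: "st x \<bullet> st x = (1 + c) / (1 - c)"
    proof -
      have "1 - c\<^sup>2 = (1 - c) * (1 + c)" by (simp add: power2_eq_square algebra_simps)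
      then have "st x \<bullet> st x = inverse (1 - c) * (inverse (1 - c) * ((1 - c) * (1 + c)))"
        by (simp add: st lfh)
      then show ?thesis using c1 by (simp add: divide_inverse mult.assoc[symmetric] mult.commute)
    qed
    have 1: "st x \<bullet> st x + 1 = 2 / (1 - c)" "st x \<bullet> st x - 1 = 2 * c / (1 - c)"
      using c1 by (auto simp: ss field_simps)
    have 2: "inverse (2 / (1 - c)) * (2 * inverse (1 - c)) = 1" "inverse (2 / (1 - c)) * (2 * c / (1 - c)) = c"
      using c1 by (auto simp: field_simps)
    have "sti (st x) = h + c *\<^sub>R q"
      unfolding sti_def 1 lgst using 2 by (simp only: scaleR_add_right scaleR_scaleR) simp
    then show ?thesis by (simp add: h_def)
  qed
  ultimately show ?thesis using that[of st sti] unfolding stereo_def by blast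
qed

lemma stereoD:
  assumes "stereo q st sti"
  shows "Cinf {x. x \<bullet> q \<noteq> 1} st" "Cinf UNIV sti" "\<And>v. sti v \<in> S3 - {q}" "\<And>v. st (sti v) = v"
    "\<And>x. x \<in> S3 - {q} \<Longrightarrow> sti (st x) = x" "\<And>x. x \<in> S3 - {q} \<Longrightarrow> x \<bullet> q \<noteq> 1"
  using assms unfolding stereo_def by auto

lemma stereo_smooth: "stereo q st sti \<Longrightarrow> A \<subseteq> S3 - {q} \<Longrightarrow> smooth_on A st"
  by (rule Cinf_imp_smooth_on[where U = "{x. x \<bullet> q \<noteq> 1}"])
     (auto simp: stereo_def intro!: open_Collect_neq continuous_intros)

lemma stereo_inverse_smooth: "stereo q st sti \<Longrightarrow> smooth_on A sti"
  by (rule Cinf_imp_smooth_on[where U = UNIV]) (auto simp: stereo_def)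

section \<open>Smooth embeddings of the circle\<close>

text \<open>By continuity the derivative stays positive on a ball, so \<open>u\<close> is strictly
  increasing there. The inverse \<open>b\<close> satisfies the equation b' = 1 / u'(b), and
  induction on the order along this equation makes it smooth.\<close>

lemma Cinf_real_inverse:
  fixes u :: "real \<Rightarrow> real"
  assumes U: "open U" "s0 \<in> U" "Cinf U u" and D: "(u has_real_derivative D) (at s0)" "D > 0"
  obtains r J b where "r > 0" "ball s0 r \<subseteq> U" "open J" "J = u ` ball s0 r" "Cinf J b"
    "\<And>s. s \<in> ball s0 r \<Longrightarrow> b (u s) = s"
proof -
  obtain u' where u': "\<And>x. x \<in> U \<Longrightarrow> (u has_derivative u' x) (at x)" "\<And>v. Cinf U (\<lambda>x. u' x v)"
    using Cinf_derivative[OF U(1,3)] by metis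
  define w where "w x = u' x 1" for x
  have w: "(u has_real_derivative w x) (at x)" if "x \<in> U" for x
  proof -
    have "u' x v = w x * v" for v
      using has_derivative_bounded_linear[OF u'(1)[OF that]]
      by (metis w_def bounded_linear.linear linear_cmul mult.commute mult.right_neutral real_scaleR_def)
    then have "u' x = (*) (w x)" by auto
    then show ?thesis using u'(1)[OF that] by (simp add: has_field_derivative_def)
  qed
  have wC: "Cinf U w" using u'(2)[of 1] unfolding w_def[abs_def] .
  have "w s0 = D" using w[OF U(2)] D(1) DERIV_unique by blast
  then have "open (U \<inter> w -` {0<..})" "s0 \<in> U \<inter> w -` {0<..}"
    using D(2) U continuous_open_preimage[OF Cinf_imp_continuous_on[OF wC] U(1) open_greaterThan] by auto
  then obtain r where r: "r > 0" "ball s0 r \<subseteq> U \<inter> w -` {0<..}" using openE by blast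
  have mono: "u x < u y" if "x \<in> ball s0 r" "y \<in> ball s0 r" "x < y" for x y
  proof (rule DERIV_pos_imp_increasing[OF that(3)])
    fix z assume "x \<le> z" "z \<le> y"
    then have "z \<in> ball s0 r" using that by (auto simp: dist_real_def)
    then show "\<exists>d. (u has_real_derivative d) (at z) \<and> d > 0" using w r(2) by (intro exI[of _ "w z"]) auto
  qed
  have inj: "inj_on u (ball s0 r)"
    by (rule inj_onI) (metis mono less_irrefl linorder_neqE_linordered_idom)
  define J where "J = u ` ball s0 r"
  have cont: "continuous_on (ball s0 r) u"
    using Cinf_imp_continuous_on[OF U(3)] continuous_on_subset r(2) by blast
  obtain b where b: "homeomorphism (ball s0 r) J u b"
    using invariance_of_domain_homeomorphism[OF open_ball cont _ inj] J_def by auto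
  have J: "open J" unfolding J_def by (rule invariance_of_domain[OF cont open_ball inj])
  have bb: "b y \<in> ball s0 r" "u (b y) = y" if "y \<in> J" for y
    using b that unfolding homeomorphism_def by auto
  have der: "(b has_derivative (\<lambda>v. v * inverse (w (b y)))) (at y)" if y: "y \<in> J" for y
  proof -
    obtain e where e: "e > 0" "ball y e \<subseteq> J" using J y openE by blast
    have "(b has_real_derivative inverse (w (b y))) (at y)"
    proof (rule DERIV_inverse_function[where f = u and a = "y - e" and b = "y + e"])
      show "(u has_real_derivative w (b y)) (at (b y))" using w bb y r(2) by blast
      show "w (b y) \<noteq> 0" using bb(1)[OF y] r(2) by auto
      show "u (b z) = z" if "y - e < z" "z < y + e" for z
        using that e(2) bb(2)[of z] by (auto simp: subset_iff dist_real_def)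
      show "isCont b y" using b J y unfolding homeomorphism_def
        by (simp add: continuous_on_eq_continuous_at)
    qed (use e in auto)
    then show ?thesis unfolding has_field_derivative_def
      by (rule has_derivative_eq_rhs) (auto simp: mult.commute)
  qed
  have "Ck_on k J b" for k
  proof (induction k)
    case 0 then show ?case using b unfolding homeomorphism_def by simp
  next
    case (Suc k)
    have "Ck_on k J (\<lambda>y. inverse (w (b y)))"
    proof (rule Ck_on_compose[OF _ Suc])
      show "Ck_on k (ball s0 r) (\<lambda>x. inverse (w x))"
      proof -
        have "w x \<noteq> 0" if "x \<in> ball s0 r" for x using that r(2) by auto
        moreover have "Cinf (ball s0 r) w" by (rule Cinf_subset[OF wC]) (use r(2) in auto)
        ultimately show ?thesis using Cinf_inverse[of "ball s0 r" w] unfolding Cinf_def by blast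
      qed
    qed (use bb in auto)
    then have "Ck_on k J (\<lambda>y. v * inverse (w (b y)))" for v
      by (intro Ck_on_bilinear[OF bounded_bilinear_mult] Ck_on_const)
    then show ?case unfolding Ck_on.simps
      by (intro exI[of _ "\<lambda>y v. v * inverse (w (b y))"]) (use der in auto)
  qed
  then have "Cinf J b" by (simp add: Cinf_def)
  moreover have "b (u s) = s" if "s \<in> ball s0 r" for s using b that unfolding homeomorphism_def by auto
  ultimately show ?thesis using that[OF r(1) _ J J_def] r(2) by blast
qed

text \<open>Rotation by \<open>- a\<close> moves the question to the point 1, where
  \<open>Arg\<close> is continuous.\<close>

lemma cis_locally_onto:
  assumes "r > 0"
  obtains e where "e > 0" "\<And>z. z \<in> circle \<Longrightarrow> dist (cis a) z < e \<Longrightarrow> \<exists>s\<in>ball a r. z = cis s"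
proof -
  have "isCont Arg 1" by (rule continuous_at_Arg) simp
  then obtain e where e: "e > 0" "\<And>w. dist w 1 < e \<Longrightarrow> dist (Arg w) (Arg 1) < r"
    unfolding continuous_at_eps_delta using assms by blast
  have "\<exists>s\<in>ball a r. z = cis s" if z: "z \<in> circle" "dist (cis a) z < e" for z
  proof -
    define w where "w = z * cis (- a)"
    have "w - 1 = (z - cis a) * cis (- a)" by (simp add: w_def algebra_simps cis_mult)
    then have "dist w 1 = dist (cis a) z" by (simp add: dist_norm norm_mult norm_minus_commute)
    then have "\<bar>Arg w\<bar> < r" using e(2)[of w] z(2) by simp
    moreover have "w = cis (Arg w)"
    proof -
      have "norm w = 1" using z(1) by (simp add: w_def norm_mult)
      then show ?thesis using rcis_cmod_Arg[of w] by (simp add: rcis_def)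
    qed
    moreover have "z = cis a * w" by (simp add: w_def mult.left_commute cis_mult)
    ultimately have "z = cis (a + Arg w)" "a + Arg w \<in> ball a r" by (metis cis_mult, simp add: dist_real_def)
    then show ?thesis by blast
  qed
  then show ?thesis using that e(1) by blast
qed

text \<open>The lower Lipschitz bound keeps the velocity of the curve from vanishing. Projection to
  the line spanned by the velocity \<open>a\<close> is then a locally invertible function of the
  angle, and its smooth inverse, evaluated at \<open>y \<bullet> a\<close>, extends the inverse of
  \<open>k\<close> to an open set of the ambient space.\<close>

lemma smooth_embedding_circleI:
  fixes k :: "complex \<Rightarrow> 'b::euclidean_space"
  assumes sm: "smooth_on circle k" and inj: "inj_on k circle"
    and low: "\<And>z0. z0 \<in> circle \<Longrightarrow> \<exists>c>0. \<exists>d>0. \<forall>z\<in>circle. \<forall>z'\<in>circle.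
        dist z0 z < d \<longrightarrow> dist z0 z' < d \<longrightarrow> c * norm (z - z') \<le> norm (k z - k z')"
  shows "smooth_embedding circle k"
proof -
  obtain g where g: "homeomorphism circle (k ` circle) k g"
    using homeomorphism_compact[OF compact_sphere smooth_on_imp_continuous_on[OF sm] refl inj] by blast
  have gk: "g (k z) = z" if "z \<in> circle" for z using g that unfolding homeomorphism_def by auto
  have "smooth_on (k ` circle) g"
  proof (rule smooth_on_localI)
    fix y assume "y \<in> k ` circle"
    then obtain z0 where z0: "z0 \<in> circle" "y = k z0" by blast
    obtain a0 where a0: "z0 = cis a0"
      using z0(1) complex_norm_eq_1_exp cis_conv_exp by (metis mem_sphere_0)
    obtain U k1 where U: "open U" "z0 \<in> U" "Cinf U k1" "\<And>y. y \<in> circle \<Longrightarrow> y \<in> U \<Longrightarrow> k1 y = k y"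
      using smooth_onE[OF sm z0(1)] by metis
    define Q where "Q = cis -` U"
    have Q: "open Q" "a0 \<in> Q" using U a0 unfolding Q_def
      by (auto intro!: open_vimage continuous_intros)
    define al where "al s = k1 (cis s)" for s
    have alC: "Cinf Q al" unfolding al_def
      by (rule Cinf_compose[OF U(3) Cinf_cis_id]) (auto simp: Q_def)
    have alk: "al s = k (cis s)" if "s \<in> Q" for s using U(4)[of "cis s"] that by (simp add: al_def Q_def)
    obtain al' where al': "\<And>x. x \<in> Q \<Longrightarrow> (al has_derivative al' x) (at x)"
      using Cinf_derivative[OF Q(1) alC] by metis
    define a where "a = al' a0 1"
    have al'v: "al' a0 v = v *\<^sub>R a" for v
      using has_derivative_bounded_linear[OF al'[OF Q(2)]]
      by (metis a_def bounded_linear.linear linear_cmul mult.right_neutral real_scaleR_def)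
    \<comment> \<open>With zero velocity the curve would move by o(s) while \<open>cis\<close> moves
      with unit speed, against the lower bound.\<close>
    have "a \<noteq> 0"
    proof
      assume a: "a = 0"
      obtain c d where cd: "c > 0" "d > 0" "\<And>z z'. z \<in> circle \<Longrightarrow> z' \<in> circle \<Longrightarrow>
        dist z0 z < d \<Longrightarrow> dist z0 z' < d \<Longrightarrow> c * norm (z - z') \<le> norm (k z - k z')"
        using low[OF z0(1)] by blast
      have "al' a0 = (\<lambda>v. 0)" by (auto simp: al'v a)
      then have "(al has_derivative (\<lambda>v. 0)) (at a0)" using al'[OF Q(2)] by simp
      then obtain d1 where d1: "d1 > 0" "\<And>s. norm (s - a0) < d1 \<Longrightarrow> norm (al s - al a0 - 0) \<le> (c / 4) * norm (s - a0)"
        unfolding has_derivative_at_alt using cd(1) by (metis zero_less_divide_iff zero_less_numeral)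
      have cisd: "(cis has_derivative (\<lambda>v. v *\<^sub>R (\<i> * cis a0))) (at a0)"
        by (auto intro!: derivative_eq_intros simp: mult.commute)
      then obtain d2 where d2: "d2 > 0" "\<And>s. norm (s - a0) < d2 \<Longrightarrow>
          norm (cis s - cis a0 - (s - a0) *\<^sub>R (\<i> * cis a0)) \<le> (1 / 2) * norm (s - a0)"
        unfolding has_derivative_at_alt by (metis half_gt_zero_iff zero_less_one)
      have "isCont cis a0" using cisd by (rule has_derivative_continuous)
      then obtain d3 where d3: "d3 > 0" "\<And>s. dist s a0 < d3 \<Longrightarrow> dist (cis s) (cis a0) < d"
        unfolding continuous_at_eps_delta using cd(2) by blast
      obtain d4 where d4: "d4 > 0" "ball a0 d4 \<subseteq> Q" using Q openE by blast
      define s where "s = a0 + (min (min d1 d2) (min d3 d4)) / 2"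
      have s: "s - a0 > 0" "s - a0 < d1" "s - a0 < d2" "s - a0 < d3" "s - a0 < d4"
        using d1(1) d2(1) d3(1) d4(1) by (auto simp: s_def min_def)
      have sQ: "s \<in> Q" using s d4 by (auto simp: subset_iff dist_real_def)
      have "dist (cis s) (cis a0) < d" using d3(2)[of s] s by (simp add: dist_real_def)
      then have 1: "c * norm (cis s - cis a0) \<le> norm (al s - al a0)"
        using cd(3)[of "cis s" "cis a0"] cd(2) alk[OF sQ] alk[OF Q(2)] by (simp add: a0 dist_commute)
      have 2: "norm (al s - al a0) \<le> (c / 4) * (s - a0)" using d1(2)[of s] s by simp
      have "norm ((s - a0) *\<^sub>R (\<i> * cis a0)) = s - a0" using s by (simp add: norm_mult)
      then have 3: "(s - a0) / 2 \<le> norm (cis s - cis a0)"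
        using d2(2)[of s] s norm_triangle_sub[of "(s - a0) *\<^sub>R (\<i> * cis a0)" "cis s - cis a0"]
        by (simp add: norm_minus_commute)
      have "c * ((s - a0) / 2) \<le> c * norm (cis s - cis a0)" using 3 cd(1) by (intro mult_left_mono) auto
      then have "c * (s - a0) \<le> 0" using 1 2 by (simp add: field_simps)
      moreover have "c * (s - a0) > 0" using cd(1) s(1) by simp
      ultimately show False by simp
    qed
    define u where "u s = al s \<bullet> a" for s
    have uC: "Cinf Q u" unfolding u_def by (intro Cinf_inner alC Cinf_const)
    have ud: "(u has_real_derivative (a \<bullet> a)) (at a0)"
    proof -
      have "(u has_derivative (\<lambda>v. al' a0 v \<bullet> a)) (at a0)" unfolding u_def
        by (intro bounded_linear.has_derivative[OF bounded_linear_inner_left] al' Q)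
      then show ?thesis unfolding has_field_derivative_def
        by (rule has_derivative_eq_rhs) (auto simp: al'v mult.commute)
    qed
    obtain r J b where rJ: "r > 0" "ball a0 r \<subseteq> Q" "open J" "J = u ` ball a0 r" "Cinf J b"
      "\<And>s. s \<in> ball a0 r \<Longrightarrow> b (u s) = s"
      using Cinf_real_inverse[OF Q uC ud] \<open>a \<noteq> 0\<close> by (metis inner_gt_zero_iff)
    obtain e where e: "e > 0" "\<And>z. z \<in> circle \<Longrightarrow> dist z0 z < e \<Longrightarrow> \<exists>s\<in>ball a0 r. z = cis s"
      using cis_locally_onto[OF rJ(1)] a0 by metis
    \<comment> \<open>The formula in terms of \<open>y \<bullet> a\<close> is correct only for
      points whose parameter is near \<open>z0\<close>. Continuity of \<open>g\<close> gives an open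
      set \<open>V\<close> that singles these points out.\<close>
    have "openin (top_of_set (k ` circle)) (k ` circle \<inter> g -` ball z0 e)"
      using g unfolding homeomorphism_def by (intro continuous_openin_preimage_gen) auto
    then obtain V where V: "open V" "k ` circle \<inter> g -` ball z0 e = k ` circle \<inter> V"
      by (auto simp: openin_open)
    define W where "W = V \<inter> (\<lambda>y. y \<bullet> a) -` J"
    have Jv: "open ((\<lambda>y. y \<bullet> a) -` J)" by (intro open_vimage rJ continuous_intros)
    have "open W" unfolding W_def using V(1) Jv by blast
    moreover have "y \<in> W"
    proof -
      have "y \<in> k ` circle \<inter> g -` ball z0 e" using z0 e(1) gk by simp
      moreover have "y \<bullet> a = u a0" using alk[OF Q(2)] z0(2) a0 by (simp add: u_def)
      ultimately show ?thesis using V(2) rJ(1,4) by (auto simp: W_def)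
    qed
    moreover have "Cinf W (\<lambda>y. cis (b (y \<bullet> a)))"
    proof (rule Cinf_compose[OF Cinf_cis_id[of UNIV]])
      show "Cinf W (\<lambda>y. b (y \<bullet> a))"
        by (rule Cinf_compose[OF rJ(5)]) (auto simp: W_def intro!: Cinf_inner Cinf_ident Cinf_const)
    qed simp
    moreover have "cis (b (y' \<bullet> a)) = g y'" if y': "y' \<in> k ` circle \<inter> W" for y'
    proof -
      obtain z where z: "z \<in> circle" "y' = k z" using y' by blast
      have "y' \<in> k ` circle \<inter> g -` ball z0 e" using y' V(2) by (auto simp: W_def)
      then have "dist z0 z < e" using gk z by auto
      then obtain s where s: "s \<in> ball a0 r" "z = cis s" using e(2)[OF z(1)] by blast
      have "y' = al s" using alk[of s] s rJ(2) z by auto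
      then have "b (y' \<bullet> a) = s" using rJ(6)[OF s(1)] by (simp add: u_def)
      then show ?thesis using gk[OF z(1)] z(2) s(2) by simp
    qed
    ultimately show "\<exists>U h. open U \<and> y \<in> U \<and> Cinf U h \<and> (\<forall>y'\<in>k ` circle \<inter> U. h y' = g y')"
      by blast
  qed
  then show ?thesis unfolding smooth_embedding_def diffeomorphism_def using g sm by blast
qed

lemma smooth_inverse_lower_lipschitz:
  assumes h: "homeomorphism A B f g" and g: "smooth_on B g" and x: "x \<in> A"
  obtains c d where "c > 0" "d > 0" "\<And>u v. u \<in> A \<Longrightarrow> v \<in> A \<Longrightarrow> dist x u < d \<Longrightarrow> dist x v < d \<Longrightarrow>
    c * norm (u - v) \<le> norm (f u - f v)"
proof -
  have fA: "f ` A = B" "\<And>u. u \<in> A \<Longrightarrow> g (f u) = u" "continuous_on A f"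
    using h unfolding homeomorphism_def by auto
  obtain e K where eK: "e > 0" "K > 0"
    "\<And>u v. u \<in> B \<Longrightarrow> v \<in> B \<Longrightarrow> dist (f x) u < e \<Longrightarrow> dist (f x) v < e \<Longrightarrow> norm (g u - g v) \<le> K * norm (u - v)"
    using smooth_on_local_lipschitz[OF g, of "f x"] x fA(1) by blast
  obtain d where d: "d > 0" "\<And>u. u \<in> A \<Longrightarrow> dist u x < d \<Longrightarrow> dist (f u) (f x) < e"
    using fA(3) x eK(1) unfolding continuous_on_iff by blast
  have "inverse K * norm (u - v) \<le> norm (f u - f v)"
    if "u \<in> A" "v \<in> A" "dist x u < d" "dist x v < d" for u v
    using eK(3)[of "f u" "f v"] d(2)[of u] d(2)[of v] that fA eK(2) by (auto simp: dist_commute field_simps)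
  then show ?thesis using that[of "inverse K" d] eK d by auto
qed

section \<open>Interiors of surfaces\<close>

definition surface_chart ::
  "(real^4) set \<Rightarrow> complex set \<Rightarrow> (real^4) set \<Rightarrow> (complex \<Rightarrow> real^4) \<Rightarrow> (real^4 \<Rightarrow> complex) \<Rightarrow> bool" where
  "surface_chart F W U f g \<longleftrightarrow> openin (top_of_set F) U \<and>
     openin (top_of_set {z. Im z \<ge> 0}) W \<and> diffeomorphism W U f g"

lemma surface_chartD:
  assumes "surface_chart F W U f g"
  shows "openin (top_of_set F) U" "openin (top_of_set {z. Im z \<ge> 0}) W" "homeomorphism W U f g"
    "smooth_on W f" "smooth_on U g" "\<And>w. w \<in> W \<Longrightarrow> f w \<in> U \<and> g (f w) = w \<and> Im w \<ge> 0"
    "\<And>x. x \<in> U \<Longrightarrow> g x \<in> W \<and> f (g x) = x \<and> x \<in> F"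
proof -
  show *: "openin (top_of_set F) U" "openin (top_of_set {z. Im z \<ge> 0}) W" "homeomorphism W U f g"
    "smooth_on W f" "smooth_on U g"
    using assms unfolding surface_chart_def diffeomorphism_def by auto
  show "f w \<in> U \<and> g (f w) = w \<and> Im w \<ge> 0" if "w \<in> W" for w
    using that * openin_imp_subset[OF *(2)] unfolding homeomorphism_def by auto
  show "g x \<in> W \<and> f (g x) = x \<and> x \<in> F" if "x \<in> U" for x
    using that * openin_imp_subset[OF *(1)] unfolding homeomorphism_def by auto
qed

lemma compact_surface_chart:
  assumes "compact_surface F" "x \<in> F"
  obtains W U f g where "surface_chart F W U f g" "x \<in> U"
  using assms unfolding compact_surface_def surface_chart_def by blast

text \<open>A boundary point of the half-plane is not an interior point of any open set inside the
  half-space, so invariance of domain keeps open 3-cells off the boundary.\<close>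

lemma thickened_chart_image_open:
  fixes h :: "complex \<times> real \<Rightarrow> (real^4) \<times> real"
  assumes O: "open O'" "continuous_on O' h" "inj_on h O'" "h ` O' \<subseteq> F \<times> UNIV"
    and ch: "surface_chart F W U f g" and u0: "u0 \<in> O'" "fst (h u0) \<in> U"
  shows "Im (g (fst (h u0))) > 0"
    and "\<exists>T. openin (top_of_set (F \<times> UNIV)) T \<and> h u0 \<in> T \<and> T \<subseteq> h ` O'"
proof -
  note c = surface_chartD[OF ch]
  have gc: "continuous_on U g" using c(3) unfolding homeomorphism_def by blast
  obtain UT where UT: "open UT" "U = F \<inter> UT" using c(1) by (auto simp: openin_open)
  define O2 where "O2 = O' \<inter> (\<lambda>u. fst (h u)) -` UT"
  have "continuous_on O' (\<lambda>u. fst (h u))" by (intro continuous_intros O)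
  then have O2: "open O2" "O2 \<subseteq> O'" "u0 \<in> O2" unfolding O2_def
    using continuous_open_preimage[OF _ O(1) UT(1)] UT(2) u0 by auto
  have hU: "fst (h u) \<in> U" if "u \<in> O2" for u using that O(4) UT(2) by (fastforce simp: O2_def)
  define m where "m u = (g (fst (h u)), snd (h u))" for u
  have mc: "continuous_on O2 m" unfolding m_def
    by (intro continuous_intros continuous_on_compose2[OF gc] continuous_on_subset[OF O(2) O2(2)]) (use hU in auto)
  have mi: "inj_on m O2"
  proof (rule inj_onI)
    fix u v assume uv: "u \<in> O2" "v \<in> O2" "m u = m v"
    have "g (fst (h u)) = g (fst (h v))" using uv(3) by (simp add: m_def)
    then have "fst (h u) = fst (h v)" using c(7)[OF hU[OF uv(1)]] c(7)[OF hU[OF uv(2)]] by metis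
    then have "h u = h v" using uv(3) by (simp add: m_def prod_eq_iff)
    then show "u = v" using O(3) uv O2(2) by (meson inj_onD subsetD)
  qed
  have Mo: "open (m ` O2)" by (rule invariance_of_domain[OF mc O2(1) mi])
  have M: "m u0 \<in> m ` O2" using O2 by auto
  obtain e where e: "e > 0" "ball (m u0) e \<subseteq> m ` O2" using Mo M openE by blast
  \<comment> \<open>The open image also contains a point slightly below \<open>m u0\<close>. Since
    that point still has nonnegative height, the height of \<open>m u0\<close> is positive.\<close>
  have "(fst (m u0) - \<i> * of_real (e / 2), snd (m u0)) \<in> ball (m u0) e"
    using e(1) by (simp add: dist_norm norm_prod_def norm_mult)
  then obtain u where u: "u \<in> O2" "fst (m u) = fst (m u0) - \<i> * of_real (e / 2)"
    using e(2) by (metis (no_types, lifting) fst_conv imageE subsetD)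
  have "Im (fst (m u)) \<ge> 0" using c(7)[OF hU[OF u(1)]] c(6) by (auto simp: m_def)
  then show "Im (g (fst (h u0))) > 0" using u(2) e(1) by (simp add: m_def)
  define T where "T = (U \<times> UNIV) \<inter> (\<lambda>y. (g (fst y), snd y)) -` (m ` O2)"
  have "openin (top_of_set (U \<times> UNIV)) T" unfolding T_def
    by (rule continuous_openin_preimage_gen[OF _ Mo])
       (auto intro!: continuous_on_Pair continuous_on_compose2[OF gc] continuous_on_fst continuous_on_snd continuous_on_id)
  moreover have "openin (top_of_set (F \<times> (UNIV::real set))) (U \<times> UNIV)"
    using c(1) by (intro openin_Times) auto
  ultimately have "openin (top_of_set (F \<times> UNIV)) T" using openin_trans by blast
  moreover have "h u0 \<in> T" using M u0(2) by (auto simp: T_def m_def mem_Times_iff)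
  moreover have "T \<subseteq> h ` O'"
  proof
    fix y assume "y \<in> T"
    then obtain u where u: "u \<in> O2" "g (fst y) = g (fst (h u))" "snd y = snd (h u)" "fst y \<in> U"
      by (auto simp: T_def m_def mem_Times_iff)
    then have "fst y = fst (h u)" using c(7)[OF u(4)] c(7)[OF hU[OF u(1)]] by metis
    then have "y = h u" using u(3) by (simp add: prod_eq_iff)
    then show "y \<in> h ` O'" using u(1) O2(2) by auto
  qed
  ultimately show "\<exists>T. openin (top_of_set (F \<times> UNIV)) T \<and> h u0 \<in> T \<and> T \<subseteq> h ` O'" by blast
qed

lemma thickened_image_openin:
  fixes h :: "complex \<times> real \<Rightarrow> (real^4) \<times> real"
  assumes F: "compact_surface F"
    and O: "open O'" "continuous_on O' h" "inj_on h O'" "h ` O' \<subseteq> F \<times> UNIV"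
  shows "openin (top_of_set (F \<times> UNIV)) (h ` O')"
proof (subst openin_subopen, rule ballI)
  fix y assume "y \<in> h ` O'"
  then obtain u0 where u0: "u0 \<in> O'" "y = h u0" by blast
  then have "fst (h u0) \<in> F" using O(4) by (auto simp: mem_Times_iff)
  then obtain W U f g where ch: "surface_chart F W U f g" "fst (h u0) \<in> U"
    using compact_surface_chart[OF F] by metis
  show "\<exists>T. openin (top_of_set (F \<times> UNIV)) T \<and> y \<in> T \<and> T \<subseteq> h ` O'"
    unfolding u0(2) by (rule thickened_chart_image_open(2)[OF O ch(1) u0(1) ch(2)])
qed

text \<open>Multiplication with the identity of the real line reduces the planar case to the
  thickened one.\<close>

lemma surface_chart_image_open:
  fixes e :: "complex \<Rightarrow> real^4"
  assumes O: "open O'" "continuous_on O' e" "inj_on e O'" "e ` O' \<subseteq> F"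
    and ch: "surface_chart F W U f g" and u0: "u0 \<in> O'" "e u0 \<in> U"
  shows "Im (g (e u0)) > 0"
proof -
  let ?h = "\<lambda>u::complex \<times> real. (e (fst u), snd u)"
  have "continuous_on (O' \<times> UNIV) ?h"
    by (auto intro!: continuous_on_Pair continuous_on_compose2[OF O(2)] continuous_on_fst continuous_on_snd continuous_on_id)
  moreover have "inj_on ?h (O' \<times> UNIV)" using O(3) by (auto simp: inj_on_def)
  moreover have "?h ` (O' \<times> UNIV) \<subseteq> F \<times> UNIV" using O(4) by auto
  ultimately show ?thesis
    using thickened_chart_image_open(1)[of "O' \<times> UNIV" ?h F W U f g "(u0, 0)"] O(1) ch u0
    by (simp add: open_Times)
qed

lemma surface_image_openin:
  fixes e :: "complex \<Rightarrow> real^4"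
  assumes F: "compact_surface F"
    and O: "open O'" "continuous_on O' e" "inj_on e O'" "e ` O' \<subseteq> F"
  shows "openin (top_of_set F) (e ` O')"
proof -
  have "openin (top_of_set (F \<times> UNIV)) ((\<lambda>u. (e (fst u), snd u)) ` (O' \<times> (UNIV :: real set)))"
    by (rule thickened_image_openin[OF F])
       (use O in \<open>auto simp: open_Times inj_on_def intro!: continuous_on_Pair continuous_on_compose2[OF O(2)]
          continuous_on_fst continuous_on_snd continuous_on_id\<close>)
  then obtain T where T: "open T" "(\<lambda>u. (e (fst u), snd u)) ` (O' \<times> (UNIV :: real set)) = (F \<times> UNIV) \<inter> T"
    by (auto simp: openin_open)
  have "e ` O' = F \<inter> (\<lambda>x. (x, 0)) -` T"
  proof
    show "e ` O' \<subseteq> F \<inter> (\<lambda>x. (x, 0)) -` T"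
    proof
      fix x assume "x \<in> e ` O'"
      then have "(x, 0) \<in> (\<lambda>u. (e (fst u), snd u)) ` (O' \<times> (UNIV :: real set))" by force
      then show "x \<in> F \<inter> (\<lambda>x. (x, 0)) -` T" using T(2) by auto
    qed
    show "F \<inter> (\<lambda>x. (x, 0)) -` T \<subseteq> e ` O'"
    proof
      fix x assume "x \<in> F \<inter> (\<lambda>x. (x, 0)) -` T"
      then have "(x, 0) \<in> (\<lambda>u. (e (fst u), snd u)) ` (O' \<times> (UNIV :: real set))" using T(2) by auto
      then show "x \<in> e ` O'" by auto
    qed
  qed
  moreover have "open ((\<lambda>x. (x, 0::real)) -` T)" using T(1) by (intro open_vimage continuous_intros)
  ultimately show ?thesis by (auto simp: openin_open)
qed

text \<open>Invariance of domain makes both the openness of the range and the continuity of the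
  inverse automatic.\<close>

lemma open_chartI:
  fixes e :: "complex \<Rightarrow> real^4"
  assumes F: "compact_surface F" and e: "continuous_on UNIV e" "inj e" "range e \<subseteq> F"
  shows "open_chart F e"
proof -
  have op: "openin (top_of_set F) (e ` A)" if "open A" for A
    by (rule surface_image_openin[OF F that continuous_on_subset[OF e(1)] inj_on_subset[OF e(2)]]) (use e(3) in auto)
  have "openin (top_of_set (range e)) (e ` A)" if "openin (top_of_set UNIV) A" for A
    using op[of A] that openin_subset_trans[of F "e ` A" "range e"] e(3) by auto
  then obtain g where "homeomorphism UNIV (range e) e g"
    using homeomorphism_injective_open_map[OF e(1) refl e(2)] by metis
  then show ?thesis unfolding open_chart_def using op[of UNIV] by auto
qed

lemma open_chartD:
  assumes "open_chart F e"
  shows "continuous_on UNIV e" "inj e" "range e \<subseteq> F" "openin (top_of_set F) (range e)"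
    "continuous_on (range e) (inv_into UNIV e)"
proof -
  obtain g where g: "homeomorphism UNIV (range e) e g" and op: "openin (top_of_set F) (range e)"
    using assms unfolding open_chart_def by blast
  have gl: "g (e u) = u" for u using g unfolding homeomorphism_def by auto
  show "continuous_on UNIV e" using g unfolding homeomorphism_def by auto
  show i: "inj e" using gl by (metis injI)
  show "range e \<subseteq> F" using openin_imp_subset[OF op] .
  show "openin (top_of_set F) (range e)" by (rule op)
  have "inv_into UNIV e y = g y" if "y \<in> range e" for y
    using that i gl by auto
  moreover have "continuous_on (range e) g" using g unfolding homeomorphism_def by blast
  ultimately show "continuous_on (range e) (inv_into UNIV e)" by (simp cong: continuous_on_cong)
qed

text \<open>A radial homeomorphism of the plane onto \<open>ball c r\<close>. It restricts charts to
  small discs although \<open>open_chart\<close> wants the whole plane as the domain.\<close>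

definition squash :: "complex \<Rightarrow> real \<Rightarrow> complex \<Rightarrow> complex" where
  "squash c r z = c + (r / (1 + norm z)) *\<^sub>R z"

text \<open>This form of monotonicity yields injectivity and, through a straight-line homotopy,
  preservation of orientation, with no differentiation at the origin. If the norms differ,
  Cauchy-Schwarz reduces it to the monotonicity of the radial profile r x / (1 + x).\<close>

lemma squash_monotone:
  assumes "r > 0" "a \<noteq> b"
  shows "(squash c r a - squash c r b) \<bullet> (a - b) > 0"
proof -
  define A where "A = r / (1 + norm a)"
  define B where "B = r / (1 + norm b)"
  have AB: "A > 0" "B > 0" using assms by (auto simp: A_def B_def add_pos_nonneg)
  have eq: "squash c r a - squash c r b = A *\<^sub>R a - B *\<^sub>R b" by (simp add: squash_def A_def B_def)
  show ?thesis
  proof (cases "norm a = norm b")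
    case True
    then have "A = B" by (simp add: A_def B_def)
    then have "(squash c r a - squash c r b) \<bullet> (a - b) = A * ((a - b) \<bullet> (a - b))"
      by (simp add: eq scaleR_diff_right[symmetric])
    then show ?thesis using AB assms(2) by simp
  next
    case False
    have *: "(A * x - B * y) * (x - y) > 0" if "x \<noteq> y" "x \<ge> 0" "y \<ge> 0" "A = r / (1 + x)" "B = r / (1 + y)" for x y
    proof -
      have "A * x - B * y = r * (x - y) / ((1 + x) * (1 + y))"
      proof -
        have "A * x - B * y = (r * x * (1 + y) - r * y * (1 + x)) / ((1 + x) * (1 + y))"
          using that by (simp add: diff_frac_eq)
        then show ?thesis by (simp add: algebra_simps)
      qed
      then have "(A * x - B * y) * (x - y) = r * (x - y)\<^sup>2 / ((1 + x) * (1 + y))"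
        by (simp add: power2_eq_square)
      then show ?thesis using that assms(1) by (simp add: add_pos_nonneg)
    qed
    have "(A *\<^sub>R a - B *\<^sub>R b) \<bullet> (a - b) = A * (norm a)\<^sup>2 + B * (norm b)\<^sup>2 - (A + B) * (a \<bullet> b)"
      by (simp add: inner_diff_left inner_diff_right power2_norm_eq_inner inner_commute algebra_simps)
    also have "\<dots> \<ge> A * (norm a)\<^sup>2 + B * (norm b)\<^sup>2 - (A + B) * (norm a * norm b)"
      using norm_cauchy_schwarz[of a b] AB by (simp add: mult_left_mono)
    also have "A * (norm a)\<^sup>2 + B * (norm b)\<^sup>2 - (A + B) * (norm a * norm b)
        = (A * norm a - B * norm b) * (norm a - norm b)" by (simp add: power2_eq_square algebra_simps)
    finally show ?thesis using *[OF False] A_def B_def eq by simp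
  qed
qed

lemma squash_continuous: "continuous_on A (squash c r)"
  unfolding squash_def by (intro continuous_intros) (simp add: add_nonneg_eq_0_iff)

lemma squash_inj: "r > 0 \<Longrightarrow> inj (squash c r)"
  by (rule injI) (metis squash_monotone less_irrefl diff_self inner_zero_left)

lemma squash_range:
  assumes "r > 0" shows "range (squash c r) = ball c r"
proof
  show "range (squash c r) \<subseteq> ball c r"
  proof clarify
    fix z :: complex
    have "dist c (squash c r z) = r * (norm z / (1 + norm z))"
      using assms by (simp add: squash_def dist_norm add_nonneg_nonneg)
    also have "\<dots> < r" using assms by (simp add: field_simps add_pos_nonneg)
    finally show "squash c r z \<in> ball c r" by simp
  qed
  show "ball c r \<subseteq> range (squash c r)"
  proof
    fix y assume y: "y \<in> ball c r"
    define d where "d = norm (y - c)"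
    have d: "d < r" "d \<ge> 0" using y by (auto simp: d_def dist_norm norm_minus_commute)
    define z where "z = (1 / (r - d)) *\<^sub>R (y - c)"
    have "norm z = d / (r - d)" using d by (simp add: z_def d_def[symmetric])
    then have "1 + norm z = r / (r - d)" using d by (simp add: field_simps)
    then have "squash c r z = y" using d assms by (simp add: squash_def z_def)
    then show "y \<in> range (squash c r)" by (metis rangeI)
  qed
qed

text \<open>A chart at an interior point. Here \<open>f\<close> is smooth on an open ball and may be
  differentiated, whereas the map of a \<open>surface_chart\<close> is only known to have local
  smooth extensions.\<close>

definition disc_chart ::
  "(real^4) set \<Rightarrow> complex \<Rightarrow> real \<Rightarrow> (complex \<Rightarrow> real^4) \<Rightarrow> (real^4 \<Rightarrow> complex) \<Rightarrow> bool" where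
  "disc_chart F c r f g \<longleftrightarrow> r > 0 \<and> Cinf (ball c r) f \<and> homeomorphism (ball c r) (f ` ball c r) f g \<and>
     openin (top_of_set F) (f ` ball c r) \<and> smooth_on (f ` ball c r) g"

lemma disc_chart_in_surface_chart:
  assumes ch: "surface_chart F W U f g" and w: "w \<in> W" "Im w > 0"
  obtains r f' where "disc_chart F w r f' g" "ball w r \<subseteq> W" "\<And>z. z \<in> ball w r \<Longrightarrow> f' z = f z"
    "ball w r \<subseteq> {z. Im z > 0}"
proof -
  note c = surface_chartD[OF ch]
  obtain N f1 where N: "open N" "w \<in> N" "Cinf N f1" "\<And>y. y \<in> W \<Longrightarrow> y \<in> N \<Longrightarrow> f1 y = f y"
    using smooth_onE[OF c(4) w(1)] by metis
  obtain T where T: "open T" "W = {z. Im z \<ge> 0} \<inter> T" using c(2) by (auto simp: openin_open)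
  have "open (T \<inter> {z. Im z > 0} \<inter> N)"
    using T N by (intro open_Int open_halfspace_Im_gt)
  moreover have "w \<in> T \<inter> {z. Im z > 0} \<inter> N" using T w N by auto
  ultimately obtain r where r: "r > 0" "ball w r \<subseteq> T \<inter> {z. Im z > 0} \<inter> N" using openE by blast
  have bW: "ball w r \<subseteq> W"
  proof
    fix z assume "z \<in> ball w r"
    then have "z \<in> T" "Im z > 0" using r(2) by blast+
    then show "z \<in> W" using T(2) by simp
  qed
  have ff: "f1 z = f z" if "z \<in> ball w r" for z
    by (rule N(4)) (use that bW r(2) in blast)+
  have im: "f1 ` ball w r = f ` ball w r" using ff by force
  have "homeomorphism (ball w r) (f ` ball w r) f g"
    by (rule homeomorphism_of_subsets[OF c(3) bW]) (use c(6) bW in auto)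
  then have hom: "homeomorphism (ball w r) (f1 ` ball w r) f1 g"
    unfolding im by (rule homeomorphism_cong[OF _ refl refl]) (use ff in auto)
  have "openin (top_of_set {z. Im z \<ge> 0}) (ball w r)"
    using bW openin_imp_subset[OF c(2)] by (auto simp: openin_open intro!: exI[of _ "ball w r"])
  then have "openin (top_of_set W) (ball w r)"
    by (rule openin_subset_trans[OF _ bW openin_imp_subset[OF c(2)]])
  then have "openin (top_of_set U) (f ` ball w r)"
    using homeomorphism_imp_open_map[OF c(3)] by blast
  then have "openin (top_of_set F) (f1 ` ball w r)" unfolding im using c(1) openin_trans by blast
  moreover have "smooth_on (f1 ` ball w r) g"
    by (rule smooth_on_subset[OF c(5)]) (use im bW c(6) in auto)
  moreover have "Cinf (ball w r) f1" using Cinf_subset[OF N(3)] r(2) by blast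
  ultimately have "disc_chart F w r f1 g" unfolding disc_chart_def using r(1) hom by blast
  then show ?thesis using that[of r f1] bW ff r(2) by blast
qed

lemma disc_chart_interior:
  assumes F: "compact_surface F" and d: "disc_chart F c r f g"
  shows "f ` ball c r \<subseteq> surface_interior F"
proof -
  have r: "r > 0" "continuous_on (ball c r) f"
    using d unfolding disc_chart_def homeomorphism_def by blast+
  have rF: "f ` ball c r \<subseteq> F" using d openin_imp_subset unfolding disc_chart_def by blast
  have ri: "inj_on f (ball c r)"
    using d unfolding disc_chart_def homeomorphism_def by (intro inj_on_inverseI[of _ g]) auto
  let ?e = "f \<circ> squash c r"
  have "open_chart F ?e"
  proof (rule open_chartI[OF F])
    show "continuous_on UNIV ?e"
      by (rule continuous_on_compose[OF squash_continuous]) (use r squash_range in auto)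
    show "inj ?e" by (rule comp_inj_on[OF squash_inj]) (use r ri squash_range in auto)
    show "range ?e \<subseteq> F" using rF squash_range[OF r(1), of c] by (metis image_comp)
  qed
  moreover have "range ?e = f ` ball c r" using squash_range[OF r(1)] by (metis image_comp)
  ultimately show ?thesis unfolding surface_interior_def by blast
qed

text \<open>Interior points are defined by arbitrary topological charts. Invariance of domain is
  what turns this into positive height in any given smooth chart.\<close>

lemma interior_point_chart:
  assumes F: "compact_surface F" and x: "x \<in> surface_interior F"
    and ch: "surface_chart F W U f g" "x \<in> U"
  shows "Im (g x) > 0"
proof -
  obtain e :: "complex \<Rightarrow> real^4" where e: "open_chart F e" "x \<in> range e"
    using x unfolding surface_interior_def by blast
  then obtain u where "x = e u" by blast
  then show ?thesis
    using surface_chart_image_open[OF open_UNIV open_chartD(1,2,3)[OF e(1)] ch(1), of u] ch(2) by simp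
qed

lemma surface_interior_disc_chart:
  assumes F: "compact_surface F" and x: "x \<in> surface_interior F"
  obtains c r f g where "disc_chart F c r f g" "f c = x"
proof -
  have "x \<in> F" using x open_chartD(3) unfolding surface_interior_def by fastforce
  then obtain W U f g where ch: "surface_chart F W U f g" "x \<in> U" using compact_surface_chart[OF F] by metis
  note c = surface_chartD[OF ch(1)]
  have "Im (g x) > 0" by (rule interior_point_chart[OF F x ch])
  moreover have "g x \<in> W" "f (g x) = x" using c(7)[OF ch(2)] by auto
  ultimately obtain r f' where "disc_chart F (g x) r f' g" "\<And>z. z \<in> ball (g x) r \<Longrightarrow> f' z = f z"
    using disc_chart_in_surface_chart[OF ch(1)] by metis
  then show ?thesis using that \<open>f (g x) = x\<close> by (metis centre_in_ball disc_chart_def)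
qed

text \<open>This keeps the lifted ball off the boundary of the surface, where ambient isotopies have
  to be constant.\<close>

lemma thickened_image_interior:
  fixes h :: "complex \<times> real \<Rightarrow> (real^4) \<times> real"
  assumes F: "compact_surface F"
    and O: "open O'" "continuous_on O' h" "inj_on h O'" "h ` O' \<subseteq> F \<times> UNIV"
  shows "h ` O' \<subseteq> surface_interior F \<times> UNIV"
proof
  fix y assume "y \<in> h ` O'"
  then obtain u0 x where u0: "u0 \<in> O'" "y = h u0" "x = fst y" by blast
  then have "x \<in> F" using O(4) by (auto simp: mem_Times_iff)
  then obtain W U f g where ch: "surface_chart F W U f g" "x \<in> U"
    using compact_surface_chart[OF F] by metis
  note c = surface_chartD[OF ch(1)]
  have "Im (g x) > 0" using thickened_chart_image_open(1)[OF O ch(1) u0(1)] u0 ch(2) by metis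
  moreover have "g x \<in> W" "f (g x) = x" using c(7)[OF ch(2)] by auto
  ultimately obtain r f' where d: "disc_chart F (g x) r f' g" "\<And>z. z \<in> ball (g x) r \<Longrightarrow> f' z = f z"
    using disc_chart_in_surface_chart[OF ch(1)] by metis
  then have "x \<in> f' ` ball (g x) r" using \<open>f (g x) = x\<close> unfolding disc_chart_def
    by (metis centre_in_ball image_eqI)
  then show "y \<in> surface_interior F \<times> UNIV"
    using disc_chart_interior[OF F d(1)] u0(3) by (auto simp: mem_Times_iff)
qed

section \<open>Ambient isotopies\<close>

text \<open>Of an ambient isotopy only the final map is kept. These maps are closed under
  composition and inversion, so an isotopy can be assembled by calculating with maps.\<close>

definition iso_end ::
  "(real^4) set \<Rightarrow> ((real^4) \<times> real \<Rightarrow> (real^4) \<times> real) \<Rightarrow> bool" where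
  "iso_end F \<theta> \<longleftrightarrow> (\<exists>H :: real \<times> ((real^4) \<times> real) \<Rightarrow> (real^4) \<times> real.
     continuous_on ({0..1} \<times> (F \<times> {0..1})) H \<and>
     (\<forall>t\<in>{0..1}. \<exists>G. homeomorphism (F \<times> {0..1}) (F \<times> {0..1}) (\<lambda>x. H (t, x)) G) \<and>
     (\<forall>t\<in>{0..1}. \<forall>x \<in> surface_boundary F \<times> {0..1} \<union> F \<times> {0, 1}. H (t, x) = x) \<and>
     (\<forall>x \<in> F \<times> {0..1}. H (0, x) = x) \<and>
     (\<forall>x \<in> F \<times> {0..1}. H (1, x) = \<theta> x))"

lemma iso_end_id: "iso_end F (\<lambda>x. x)"
  unfolding iso_end_def
  by (rule exI[of _ snd]) (auto intro!: continuous_on_snd continuous_on_id exI[of _ "\<lambda>x. x"] homeomorphismI)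

lemma iso_end_maps:
  assumes "iso_end F \<theta>"
  shows "\<theta> ` (F \<times> {0..1}) = F \<times> {0..1}" "inj_on \<theta> (F \<times> {0..1})" "continuous_on (F \<times> {0..1}) \<theta>"
proof -
  obtain H where H: "\<forall>t\<in>{0..1}. \<exists>G. homeomorphism (F \<times> {0..1}) (F \<times> {0..1}) (\<lambda>x. H (t, x)) G"
     "\<forall>x \<in> F \<times> {0..1}. H (1::real, x) = \<theta> x" using assms unfolding iso_end_def by blast
  then obtain G where "homeomorphism (F \<times> {0..1}) (F \<times> {0..1}) (\<lambda>x. H (1, x)) G" by force
  then have G: "homeomorphism (F \<times> {0..1}) (F \<times> {0..1}) \<theta> G"
    by (rule homeomorphism_cong[OF _ refl refl]) (use H(2) in auto)
  show "\<theta> ` (F \<times> {0..1}) = F \<times> {0..1}" "continuous_on (F \<times> {0..1}) \<theta>"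
    using G unfolding homeomorphism_def by blast+
  show "inj_on \<theta> (F \<times> {0..1})"
    using G unfolding homeomorphism_def by (intro inj_on_inverseI[of _ G]) blast
qed

lemma iso_end_comp:
  assumes "iso_end F a" "iso_end F b" shows "iso_end F (\<lambda>x. b (a x))"
proof -
  let ?I = "{0..1::real}" let ?X = "F \<times> ?I"
  obtain A where A: "continuous_on (?I \<times> ?X) A"
    "\<And>t. t \<in> ?I \<Longrightarrow> \<exists>G. homeomorphism ?X ?X (\<lambda>x. A (t, x)) G"
    "\<forall>t\<in>?I. \<forall>x \<in> surface_boundary F \<times> ?I \<union> F \<times> {0, 1}. A (t, x) = x"
    "\<forall>x \<in> ?X. A (0, x) = x" "\<forall>x \<in> ?X. A (1, x) = a x"
    using assms(1) unfolding iso_end_def by blast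
  obtain B where B: "continuous_on (?I \<times> ?X) B"
    "\<And>t. t \<in> ?I \<Longrightarrow> \<exists>G. homeomorphism ?X ?X (\<lambda>x. B (t, x)) G"
    "\<forall>t\<in>?I. \<forall>x \<in> surface_boundary F \<times> ?I \<union> F \<times> {0, 1}. B (t, x) = x"
    "\<forall>x \<in> ?X. B (0, x) = x" "\<forall>x \<in> ?X. B (1, x) = b x"
    using assms(2) unfolding iso_end_def by blast
  have AX: "A (t, x) \<in> ?X" if "t \<in> ?I" "x \<in> ?X" for t x
    using A(2)[OF that(1)] that(2) unfolding homeomorphism_def by blast
  define C where "C p = B (fst p, A p)" for p
  have "continuous_on (?I \<times> ?X) C" unfolding C_def
    by (rule continuous_on_compose2[OF B(1) continuous_on_Pair[OF continuous_on_fst[OF continuous_on_id] A(1)]])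
       (use AX in force)
  moreover have "\<exists>G. homeomorphism ?X ?X (\<lambda>x. C (t, x)) G" if t: "t \<in> ?I" for t
  proof -
    obtain G1 G2 where "homeomorphism ?X ?X (\<lambda>x. A (t, x)) G1" "homeomorphism ?X ?X (\<lambda>x. B (t, x)) G2"
      using A(2)[OF t] B(2)[OF t] by blast
    then have "homeomorphism ?X ?X ((\<lambda>x. B (t, x)) \<circ> (\<lambda>x. A (t, x))) (G1 \<circ> G2)"
      by (rule homeomorphism_compose)
    then show ?thesis by (auto simp: C_def o_def)
  qed
  moreover have "C (t, x) = x" if "t \<in> ?I" "x \<in> surface_boundary F \<times> ?I \<union> F \<times> {0, 1}" for t x
    using A(3) B(3) that by (auto simp: C_def)
  moreover have "C (0, x) = x" if "x \<in> ?X" for x using A(4) B(4) that by (auto simp: C_def)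
  moreover have "C (1, x) = b (a x)" if "x \<in> ?X" for x
    using A(5) B(5) AX[of 1 x] that by (auto simp: C_def)
  ultimately show ?thesis unfolding iso_end_def by (intro exI[of _ C]) blast
qed

text \<open>The inverses at the single times must be jointly continuous. The isotopy is therefore
  read as a level-preserving bijection \<open>P\<close> of the compact space of pairs of a time and
  a point, where a continuous bijection is a homeomorphism.\<close>

lemma iso_end_inverse:
  assumes F: "compact F" and a: "iso_end F a"
  obtains b where "iso_end F b" "\<And>x. x \<in> F \<times> {0..1} \<Longrightarrow> b (a x) = x" "\<And>x. x \<in> F \<times> {0..1} \<Longrightarrow> a (b x) = x"
proof -
  let ?I = "{0..1::real}" let ?X = "F \<times> ?I"
  obtain A where A: "continuous_on (?I \<times> ?X) A"
    "\<And>t. t \<in> ?I \<Longrightarrow> \<exists>G. homeomorphism ?X ?X (\<lambda>x. A (t, x)) G"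
    "\<forall>t\<in>?I. \<forall>x \<in> surface_boundary F \<times> ?I \<union> F \<times> {0, 1}. A (t, x) = x"
    "\<forall>x \<in> ?X. A (0, x) = x" "\<forall>x \<in> ?X. A (1, x) = a x"
    using a unfolding iso_end_def by blast
  define P where "P p = (fst p, A p)" for p
  have Pc: "continuous_on (?I \<times> ?X) P" unfolding P_def
    by (rule continuous_on_Pair[OF continuous_on_fst[OF continuous_on_id] A(1)])
  have Pi: "inj_on P (?I \<times> ?X)"
  proof (rule inj_onI)
    fix p q assume pq: "p \<in> ?I \<times> ?X" "q \<in> ?I \<times> ?X" "P p = P q"
    have e: "fst p = fst q" "A (fst p, snd p) = A (fst p, snd q)"
      using pq(3) by (simp_all add: P_def) (metis prod.collapse)
    have m: "fst p \<in> ?I" "snd p \<in> ?X" "snd q \<in> ?X" using pq(1,2) by (metis mem_Times_iff)+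
    obtain G where "homeomorphism ?X ?X (\<lambda>x. A (fst p, x)) G" using A(2)[OF m(1)] by blast
    from homeomorphism_apply1[OF this m(2)] homeomorphism_apply1[OF this m(3)]
    have "snd p = snd q" using e(2) by metis
    with e(1) show "p = q" by (rule prod_eqI)
  qed
  have Ps: "P ` (?I \<times> ?X) = ?I \<times> ?X"
  proof -
    have 1: "P p \<in> ?I \<times> ?X" if p: "p \<in> ?I \<times> ?X" for p
    proof -
      have m: "fst p \<in> ?I" "snd p \<in> ?X" using p by (metis mem_Times_iff)+
      obtain G where "homeomorphism ?X ?X (\<lambda>x. A (fst p, x)) G" using A(2)[OF m(1)] by blast
      from homeomorphism_image1[OF this] imageI[OF m(2), of "\<lambda>x. A (fst p, x)"]
      have "A (fst p, snd p) \<in> ?X" by (simp only:)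
      then show ?thesis using m(1) by (simp only: P_def prod.collapse mem_Sigma_iff)
    qed
    have 2: "p \<in> P ` (?I \<times> ?X)" if p: "p \<in> ?I \<times> ?X" for p
    proof -
      have m: "fst p \<in> ?I" "snd p \<in> ?X" using p by (metis mem_Times_iff)+
      obtain G where "homeomorphism ?X ?X (\<lambda>x. A (fst p, x)) G" using A(2)[OF m(1)] by blast
      from homeomorphism_image1[OF this]
      have "snd p \<in> (\<lambda>x. A (fst p, x)) ` ?X" using m(2) by simp
      then obtain x where x: "snd p = A (fst p, x)" "x \<in> ?X" by (rule imageE)
      have "P (fst p, x) = (fst p, snd p)" unfolding P_def x(1) by (simp only: fst_conv)
      then have "p = P (fst p, x)" by (simp only: prod.collapse)
      moreover have "(fst p, x) \<in> ?I \<times> ?X" using m(1) x(2) by (rule SigmaI)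
      ultimately show ?thesis by (rule image_eqI)
    qed
    show ?thesis by (intro subset_antisym image_subsetI subsetI) (fact 1, fact 2)
  qed
  have "compact (?I \<times> ?X)" using F by (intro compact_Times) auto
  then obtain Q where Q: "homeomorphism (?I \<times> ?X) (?I \<times> ?X) P Q"
    using homeomorphism_compact[OF _ Pc Ps Pi] by blast
  define B where "B p = snd (Q p)" for p
  have QX: "Q p \<in> ?I \<times> ?X" "P (Q p) = p" if "p \<in> ?I \<times> ?X" for p
    using Q that unfolding homeomorphism_def by blast+
  have Qt: "Q (t, x) = (t, B (t, x))" "A (t, B (t, x)) = x" "B (t, x) \<in> ?X" if "t \<in> ?I" "x \<in> ?X" for t x
  proof -
    have p: "(t, x) \<in> ?I \<times> ?X" using that by blast
    from QX(2)[OF p] have 1: "fst (Q (t, x)) = t" "A (Q (t, x)) = x" by (auto simp: P_def)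
    then show 2: "Q (t, x) = (t, B (t, x))" by (simp add: B_def prod_eq_iff)
    show "A (t, B (t, x)) = x" using 1(2) 2 by simp
    show "B (t, x) \<in> ?X" using QX(1)[OF p] 2 by auto
  qed
  have BA: "B (t, A (t, x)) = x" if "t \<in> ?I" "x \<in> ?X" for t x
    using Q that unfolding homeomorphism_def B_def P_def by force
  have Bc: "continuous_on (?I \<times> ?X) B" using Q unfolding homeomorphism_def B_def
    by (intro continuous_on_snd) blast
  have AX: "A (t, x) \<in> ?X" if "t \<in> ?I" "x \<in> ?X" for t x
    using A(2)[OF that(1)] that(2) unfolding homeomorphism_def by blast
  have "\<exists>G. homeomorphism ?X ?X (\<lambda>x. B (t, x)) G" if t: "t \<in> ?I" for t
  proof (rule exI[of _ "\<lambda>x. A (t, x)"], rule homeomorphismI)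
    show "continuous_on ?X (\<lambda>x. B (t, x))" "continuous_on ?X (\<lambda>x. A (t, x))"
      using t by (auto intro!: continuous_on_compose2[OF Bc] continuous_on_compose2[OF A(1)] continuous_on_Pair continuous_on_const continuous_on_id)
    show "(\<lambda>x. B (t, x)) ` ?X \<subseteq> ?X" using Qt(3)[OF t] by blast
    show "(\<lambda>x. A (t, x)) ` ?X \<subseteq> ?X" using AX[OF t] by blast
  qed (use Qt(2)[OF t] BA[OF t] in blast)+
  moreover have "B (t, x) = x" if "t \<in> ?I" "x \<in> surface_boundary F \<times> ?I \<union> F \<times> {0, 1}" for t x
  proof -
    have "x \<in> ?X" using that(2) by (auto simp: surface_boundary_def)
    then show ?thesis using BA[OF that(1), of x] A(3) that by simp
  qed
  moreover have "B (0, x) = x" if "x \<in> ?X" for x using BA[of 0 x] A(4) that by simp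
  ultimately have "iso_end F (\<lambda>x. B (1, x))" unfolding iso_end_def
    by (intro exI[of _ B]) (use Bc in blast)
  moreover have "B (1, a x) = x" "a (B (1, x)) = x" if "x \<in> ?X" for x
    using BA[of 1 x] A(5) Qt[of 1 x] that by auto
  ultimately show ?thesis using that by blast
qed

lemma iso_end_ambient_isotopic:
  assumes "iso_end F \<theta>" "K ` circle \<subseteq> F \<times> {0..1}" "\<And>z. z \<in> circle \<Longrightarrow> \<theta> (K z) = K' z"
  shows "ambient_isotopic (F, ori, K) (F, ori, K')"
proof -
  obtain H where H: "continuous_on ({0..1} \<times> (F \<times> {0..1})) H"
     "\<forall>t\<in>{0..1}. \<exists>G. homeomorphism (F \<times> {0..1}) (F \<times> {0..1}) (\<lambda>x. H (t, x)) G"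
     "\<forall>t\<in>{0..1}. \<forall>x \<in> surface_boundary F \<times> {0..1} \<union> F \<times> {0, 1}. H (t, x) = x"
     "\<forall>x \<in> F \<times> {0..1}. H (0::real, x) = x" "\<forall>x \<in> F \<times> {0..1}. H (1, x) = \<theta> x"
    using assms(1) unfolding iso_end_def by blast
  have "H (1, K z) = K' z" if "z \<in> circle" for z using H(5) assms(2,3) that by (metis image_subset_iff)
  then show ?thesis unfolding ambient_isotopic.simps using H(1-4) by blast
qed

section \<open>Isotopies supported in a chart\<close>

definition thick_chart ::
  "(real^4) set \<Rightarrow> (complex \<times> real) set \<Rightarrow> (complex \<times> real \<Rightarrow> (real^4) \<times> real) \<Rightarrow>
   ((real^4) \<times> real \<Rightarrow> complex \<times> real) \<Rightarrow> bool" where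
  "thick_chart F P \<kappa> \<kappa>i \<longleftrightarrow> open P \<and> homeomorphism P (\<kappa> ` P) \<kappa> \<kappa>i \<and>
     \<kappa> ` P \<subseteq> surface_interior F \<times> {0<..<1} \<and> openin (top_of_set (F \<times> {0..1})) (\<kappa> ` P)"

text \<open>By invariance of domain a continuous injection is enough. Openness of the image in the
  thickened surface is what allows a map supported in the chart to be extended by the
  identity.\<close>

lemma thick_chartI:
  assumes F: "compact_surface F"
    and P: "open P" "continuous_on P \<kappa>" "inj_on \<kappa> P" "\<kappa> ` P \<subseteq> F \<times> {0<..<1}"
  obtains \<kappa>i where "thick_chart F P \<kappa> \<kappa>i"
proof -
  have PU: "\<kappa> ` P \<subseteq> F \<times> UNIV" by (rule subset_trans[OF P(4)]) (rule Sigma_mono; simp)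
  have P01: "\<kappa> ` P \<subseteq> F \<times> {0..1}" by (rule subset_trans[OF P(4)]) (rule Sigma_mono; auto)
  have op: "openin (top_of_set (F \<times> UNIV)) (\<kappa> ` A)" if "open A" "A \<subseteq> P" for A
    by (rule thickened_image_openin[OF F that(1) continuous_on_subset[OF P(2) that(2)] inj_on_subset[OF P(3) that(2)]])
       (use PU that(2) in blast)
  have op2: "openin (top_of_set T) (\<kappa> ` A)" if "open A" "A \<subseteq> P" "\<kappa> ` A \<subseteq> T" "T \<subseteq> F \<times> UNIV" for A T
    by (rule openin_subset_trans[OF op that(3,4)]) (use that in auto)
  have "openin (top_of_set (\<kappa> ` P)) (\<kappa> ` A)" if "openin (top_of_set P) A" for A
  proof (rule op2)
    show "open A" using that P(1) openin_open_eq by blast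
    show "A \<subseteq> P" using that openin_imp_subset by blast
    then show "\<kappa> ` A \<subseteq> \<kappa> ` P" by blast
    show "\<kappa> ` P \<subseteq> F \<times> UNIV" by (rule PU)
  qed
  then obtain \<kappa>i where hom: "homeomorphism P (\<kappa> ` P) \<kappa> \<kappa>i"
    using homeomorphism_injective_open_map[OF P(2) refl P(3)] by blast
  have "openin (top_of_set (F \<times> {0..1})) (\<kappa> ` P)"
    by (rule op2[OF P(1) subset_refl P01]) (rule Sigma_mono; simp)
  moreover have "\<kappa> ` P \<subseteq> surface_interior F \<times> UNIV"
    by (rule thickened_image_interior[OF F P(1-3)]) (rule PU)
  have "\<kappa> ` P \<subseteq> surface_interior F \<times> {0<..<1}"
  proof
    fix y assume "y \<in> \<kappa> ` P"
    then have "y \<in> surface_interior F \<times> UNIV" "y \<in> F \<times> {0<..<1}"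
      using P(4) \<open>\<kappa> ` P \<subseteq> surface_interior F \<times> UNIV\<close> by blast+
    then show "y \<in> surface_interior F \<times> {0<..<1}" by (simp add: mem_Times_iff)
  qed
  ultimately show ?thesis using that hom P(1) unfolding thick_chart_def by blast
qed

text \<open>To solve x + t u(x) = z is to find a fixed point of x \<mapsto> z - t u(x), which is a
  contraction.\<close>

lemma contraction_perturbation_bij:
  fixes u :: "'a::euclidean_space \<Rightarrow> 'a"
  assumes "\<And>x y. norm (u x - u y) \<le> 1 / 2 * norm (x - y)" "t \<in> {0..1}"
  shows "bij (\<lambda>x. x + t *\<^sub>R u x)"
proof (rule bijI)
  have tu: "norm (t *\<^sub>R u x - t *\<^sub>R u y) \<le> 1 / 2 * norm (x - y)" for x y
  proof -
    have "norm (t *\<^sub>R u x - t *\<^sub>R u y) = t * norm (u x - u y)"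
      using assms(2) by (simp add: scaleR_diff_right[symmetric])
    also have "\<dots> \<le> 1 * norm (u x - u y)" using assms(2) by (intro mult_right_mono) auto
    finally show ?thesis using assms(1)[of x y] by simp
  qed
  show "inj (\<lambda>x. x + t *\<^sub>R u x)"
  proof (rule injI)
    fix x y assume eq: "x + t *\<^sub>R u x = y + t *\<^sub>R u y"
    then have "x - y = - (t *\<^sub>R u x - t *\<^sub>R u y)" by (simp add: algebra_simps)
    then have "norm (x - y) \<le> 1 / 2 * norm (x - y)" using tu[of x y] by (metis norm_minus_cancel)
    then show "x = y" by simp
  qed
  show "surj (\<lambda>x. x + t *\<^sub>R u x)"
    unfolding surj_def
  proof
    fix z
    have "dist (z - t *\<^sub>R u x) (z - t *\<^sub>R u y) \<le> 1 / 2 * dist x y" for x y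
      using tu[of x y] by (simp add: dist_norm norm_minus_commute)
    then have "\<exists>!x. z - t *\<^sub>R u x = x"
      by (intro banach_fix_type[where c = "1 / 2"]) auto
    then show "\<exists>x. z = x + t *\<^sub>R u x" by (metis add_diff_cancel_right' diff_add_cancel)
  qed
qed

text \<open>The isotopy runs along the straight lines y + t u(y) inside the chart and is the
  identity elsewhere. The Lipschitz constant 1/2 makes every stage bijective.\<close>

lemma iso_end_perturbation:
  assumes F: "compact F" and ch: "thick_chart F P \<kappa> \<kappa>i"
    and u: "\<And>x y. norm (u x - u y) \<le> 1 / 2 * norm (x - y)"
    and C: "compact C" "C \<subseteq> P" "\<And>x. x \<notin> C \<Longrightarrow> u x = 0"
  obtains \<theta> where "iso_end F \<theta>" "\<And>y. y \<in> P \<Longrightarrow> \<theta> (\<kappa> y) = \<kappa> (y + u y)"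
proof -
  let ?I = "{0..1::real}" let ?X = "F \<times> ?I"
  have P: "open P" "homeomorphism P (\<kappa> ` P) \<kappa> \<kappa>i" "\<kappa> ` P \<subseteq> surface_interior F \<times> {0<..<1}"
    "openin (top_of_set ?X) (\<kappa> ` P)" using ch unfolding thick_chart_def by auto
  have k: "continuous_on P \<kappa>" "continuous_on (\<kappa> ` P) \<kappa>i" "\<And>y. y \<in> P \<Longrightarrow> \<kappa>i (\<kappa> y) = y"
    using P(2) unfolding homeomorphism_def by auto
  have PX: "\<kappa> ` P \<subseteq> ?X" using openin_imp_subset[OF P(4)] .
  have uc: "continuous_on UNIV u"
    by (rule lipschitz_on_continuous_on[of "1 / 2"]) (rule lipschitz_onI, use u in \<open>auto simp: dist_norm\<close>)
  define h where "h t y = y + t *\<^sub>R u y" for t :: real and y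
  have bij: "bij (h t)" if "t \<in> ?I" for t
    unfolding h_def using contraction_perturbation_bij[OF u that] .
  \<comment> \<open>Points outside \<open>C\<close> are fixed by \<open>h t\<close>, so by
    injectivity no point of \<open>P\<close> can be carried out of \<open>P\<close>.\<close>
  have hP: "h t y \<in> P \<longleftrightarrow> y \<in> P" if t: "t \<in> ?I" for t y
  proof
    show "h t y \<in> P \<Longrightarrow> y \<in> P" using C(2) C(3)[of y] by (cases "y \<in> C") (auto simp: h_def)
    show "h t y \<in> P" if "y \<in> P"
    proof (rule ccontr)
      assume n: "h t y \<notin> P"
      then have "u (h t y) = 0" using C by blast
      then have "h t (h t y) = h t y" by (simp add: h_def)
      then have "h t y = y" using bij[OF t] by (meson bij_is_inj injD)
      then show False using n that by simp
    qed
  qed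
  define H where "H p = (if snd p \<in> \<kappa> ` P then \<kappa> (h (fst p) (\<kappa>i (snd p))) else snd p)" for p
  have Hk: "H (t, \<kappa> y) = \<kappa> (h t y)" if "y \<in> P" for t y using that k(3) by (simp add: H_def)
  have Hn: "H (t, x) = x" if "x \<notin> \<kappa> ` P" for t x using that by (simp add: H_def)
  have HX: "H (t, x) \<in> ?X" if "t \<in> ?I" "x \<in> ?X" for t x
  proof (cases "x \<in> \<kappa> ` P")
    case True
    then obtain y where y: "y \<in> P" "x = \<kappa> y" by blast
    then have "H (t, x) = \<kappa> (h t y)" "h t y \<in> P" using Hk hP[OF that(1)] by auto
    then show ?thesis using PX by (metis imageI subsetD)
  next
    case False then show ?thesis using Hn that(2) by metis
  qed
  let ?D = "?I \<times> ?X"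
  \<comment> \<open>The image of the chart and the complement of the image of the support are both
    open and cover the space. On the second \<open>H\<close> is the projection
    \<open>snd\<close>.\<close>
  let ?A = "?I \<times> \<kappa> ` P" let ?B = "?I \<times> (?X - \<kappa> ` C)"
  have AB: "?A \<union> ?B = ?D" using PX C(2) by blast
  have "continuous_on (?A \<union> ?B) H"
  proof (rule continuous_on_Un_local_open)
    show "openin (top_of_set (?A \<union> ?B)) ?A" unfolding AB by (intro openin_Times P(4)) auto
    have "compact (\<kappa> ` C)" using C k(1) by (meson compact_continuous_image continuous_on_subset)
    then have "closed (\<kappa> ` C)" by (rule compact_imp_closed)
    then have "openin (top_of_set ?X) (?X - \<kappa> ` C)" by (simp add: Diff_eq openin_open_Int open_Compl)
    then show "openin (top_of_set (?A \<union> ?B)) ?B" unfolding AB by (intro openin_Times) auto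
    have "continuous_on ?A (\<lambda>p. \<kappa> (h (fst p) (\<kappa>i (snd p))))"
    proof (rule continuous_on_compose2[OF k(1)])
      have c: "continuous_on ?A (\<lambda>p. \<kappa>i (snd p))"
        by (rule continuous_on_compose2[OF k(2) continuous_on_snd[OF continuous_on_id]]) auto
      show "continuous_on ?A (\<lambda>p. h (fst p) (\<kappa>i (snd p)))" unfolding h_def
        by (intro continuous_on_add c continuous_on_scaleR continuous_on_fst continuous_on_id
              continuous_on_compose2[OF uc c]) auto
      show "(\<lambda>p. h (fst p) (\<kappa>i (snd p))) ` ?A \<subseteq> P" using hP k(3) by auto
    qed
    then show "continuous_on ?A H" by (rule continuous_on_eq) (auto simp: H_def)
    have "H p = snd p" if "p \<in> ?B" for p
    proof (cases "snd p \<in> \<kappa> ` P")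
      case True
      then obtain y where y: "y \<in> P" "snd p = \<kappa> y" by blast
      then have "y \<notin> C" using that by auto
      then show ?thesis using y k(3) C(3) by (simp add: H_def h_def)
    qed (simp add: H_def)
    then show "continuous_on ?B H"
      using continuous_on_snd[OF continuous_on_id] by (metis (no_types, lifting) continuous_on_eq)
  qed
  then have Hc: "continuous_on ?D H" unfolding AB .
  have hom: "\<exists>G. homeomorphism ?X ?X (\<lambda>x. H (t, x)) G" if t: "t \<in> ?I" for t
  proof (rule homeomorphism_compact)
    show "compact ?X" using F by (intro compact_Times) auto
    show "continuous_on ?X (\<lambda>x. H (t, x))"
      by (rule continuous_on_compose2[OF Hc]) (use t in \<open>auto intro!: continuous_on_Pair continuous_on_const continuous_on_id\<close>)
    show "inj_on (\<lambda>x. H (t, x)) ?X"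
    proof (rule inj_onI)
      fix x y assume xy: "x \<in> ?X" "y \<in> ?X" "H (t, x) = H (t, y)"
      have im: "H (t, x) \<in> \<kappa> ` P \<longleftrightarrow> x \<in> \<kappa> ` P" for x
        using hP[OF t] Hk Hn by (cases "x \<in> \<kappa> ` P") auto
      show "x = y"
      proof (cases "x \<in> \<kappa> ` P")
        case True
        then have "y \<in> \<kappa> ` P" using im[of x] im[of y] xy(3) by simp
        then obtain a b where ab: "x = \<kappa> a" "y = \<kappa> b" "a \<in> P" "b \<in> P" using True by blast
        then have "\<kappa> (h t a) = \<kappa> (h t b)" using xy(3) Hk by simp
        then have "h t a = h t b" using k(3) ab hP[OF t] by metis
        then have "a = b" using bij[OF t] by (meson bij_is_inj injD)
        then show ?thesis using ab by simp
      next
        case False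
        then have "y \<notin> \<kappa> ` P" using im[of x] im[of y] xy(3) by simp
        then show ?thesis using False xy(3) Hn by simp
      qed
    qed
    show "(\<lambda>x. H (t, x)) ` ?X = ?X"
    proof (intro subset_antisym subsetI)
      fix x assume "x \<in> (\<lambda>x. H (t, x)) ` ?X" then show "x \<in> ?X" using HX[OF t] by blast
    next
      fix x assume x: "x \<in> ?X"
      show "x \<in> (\<lambda>x. H (t, x)) ` ?X"
      proof (cases "x \<in> \<kappa> ` P")
        case True
        then obtain a where a: "a \<in> P" "x = \<kappa> a" by blast
        obtain b where b: "h t b = a" using bij[OF t] by (metis bij_pointE)
        then have "b \<in> P" using hP[OF t] a by blast
        then have "x = H (t, \<kappa> b)" "\<kappa> b \<in> ?X" using Hk a b PX by auto
        then show ?thesis by (rule image_eqI)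
      next
        case False
        then have "x = H (t, x)" using Hn by simp
        then show ?thesis using x by (rule image_eqI)
      qed
    qed
  qed
  have bd: "H (t, x) = x" if "x \<in> surface_boundary F \<times> ?I \<union> F \<times> {0, 1}" for t x
    by (rule Hn) (use P(3) that in \<open>auto simp: surface_boundary_def\<close>)
  have 0: "H (0, x) = x" for x
    using k(3) by (cases "x \<in> \<kappa> ` P") (auto simp: H_def h_def)
  have "iso_end F (\<lambda>x. H (1, x))" unfolding iso_end_def
    by (intro exI[of _ H] conjI ballI) (use Hc hom bd 0 in auto)
  moreover have "H (1, \<kappa> y) = \<kappa> (y + u y)" if "y \<in> P" for y using Hk[OF that] by (simp add: h_def)
  ultimately show ?thesis using that by blast
qed

text \<open>A piecewise linear profile suffices since isotopies need only be continuous, and its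
  Lipschitz constant 1 / (r2 - r1) is explicit.\<close>

definition cutoff :: "real \<Rightarrow> real \<Rightarrow> 'a::real_normed_vector \<Rightarrow> real" where
  "cutoff r1 r2 y = max 0 (min 1 ((r2 - norm y) / (r2 - r1)))"

lemma cutoff_properties:
  assumes "r1 < r2"
  shows "0 \<le> cutoff r1 r2 y" "cutoff r1 r2 y \<le> 1" "norm y \<le> r1 \<Longrightarrow> cutoff r1 r2 y = 1"
    "norm y \<ge> r2 \<Longrightarrow> cutoff r1 r2 y = 0"
    "\<bar>cutoff r1 r2 x - cutoff r1 r2 y\<bar> \<le> norm (x - y) / (r2 - r1)"
proof -
  show "0 \<le> cutoff r1 r2 y" "cutoff r1 r2 y \<le> 1" by (auto simp: cutoff_def)
  show "cutoff r1 r2 y = 1" if "norm y \<le> r1"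
  proof -
    have "(r2 - norm y) / (r2 - r1) \<ge> 1" using that assms by (simp add: le_divide_eq)
    then show ?thesis by (simp add: cutoff_def)
  qed
  show "cutoff r1 r2 y = 0" if "norm y \<ge> r2"
  proof -
    have "(r2 - norm y) / (r2 - r1) \<le> 0" using that assms by (simp add: divide_le_0_iff)
    then show ?thesis by (simp add: cutoff_def)
  qed
  have "\<bar>cutoff r1 r2 x - cutoff r1 r2 y\<bar> \<le> \<bar>(r2 - norm x) / (r2 - r1) - (r2 - norm y) / (r2 - r1)\<bar>"
    unfolding cutoff_def by linarith
  also have "\<dots> = \<bar>norm y - norm x\<bar> / (r2 - r1)" using assms
    by (simp add: diff_divide_distrib[symmetric])
  also have "\<dots> \<le> norm (x - y) / (r2 - r1)"
    using assms norm_triangle_ineq3[of y x] by (intro divide_right_mono) (auto simp: norm_minus_commute)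
  finally show "\<bar>cutoff r1 r2 x - cutoff r1 r2 y\<bar> \<le> norm (x - y) / (r2 - r1)" .
qed

text \<open>A product rule for Lipschitz constants. The splitting needs only one of the two points
  inside the ball, because the cutoff removes the uncontrolled value of \<open>w\<close> at the
  other one.\<close>

lemma cutoff_lipschitz:
  fixes w :: "'a::real_normed_vector \<Rightarrow> 'a"
  assumes r: "r1 < r2" and AB: "A \<ge> 0" "B \<ge> 0"
    and w: "\<And>x y. x \<in> cball a r2 \<Longrightarrow> y \<in> cball a r2 \<Longrightarrow> norm (w x - w y) \<le> A * norm (x - y)"
      "\<And>x. x \<in> cball a r2 \<Longrightarrow> norm (w x) \<le> B"
  shows "norm (cutoff r1 r2 (x - a) *\<^sub>R w x - cutoff r1 r2 (y - a) *\<^sub>R w y) \<le> (A + B / (r2 - r1)) * norm (x - y)"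
proof -
  define c where "c x = cutoff r1 r2 (x - a)" for x
  have out: "c x = 0" if "x \<notin> cball a r2" for x
    unfolding c_def using that cutoff_properties(4)[OF r, of "x - a"] by (simp add: dist_norm norm_minus_commute)
  have cl: "\<bar>c x - c y\<bar> \<le> norm (x - y) / (r2 - r1)" for x y
    using cutoff_properties(5)[OF r, of "x - a" "y - a"] by (simp add: c_def)
  have *: "norm (c x *\<^sub>R w x - c y *\<^sub>R w y) \<le> (A + B / (r2 - r1)) * norm (x - y)" if y: "y \<in> cball a r2" for x y
  proof -
    have e: "c x *\<^sub>R w x - c y *\<^sub>R w y = c x *\<^sub>R (w x - w y) + (c x - c y) *\<^sub>R w y"
      by (simp add: algebra_simps)
    have 1: "norm (c x *\<^sub>R (w x - w y)) \<le> A * norm (x - y)"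
    proof (cases "x \<in> cball a r2")
      case True
      have "norm (c x *\<^sub>R (w x - w y)) \<le> 1 * norm (w x - w y)"
        unfolding norm_scaleR using cutoff_properties(1,2)[OF r, of "x - a"]
        by (intro mult_right_mono) (auto simp: c_def)
      then show ?thesis using w(1)[OF True y] by simp
    next
      case False then show ?thesis using out AB by simp
    qed
    have "norm ((c x - c y) *\<^sub>R w y) \<le> (norm (x - y) / (r2 - r1)) * B"
      unfolding norm_scaleR by (intro mult_mono cl w(2) y) (use r in auto)
    then show ?thesis using 1 norm_triangle_ineq[of "c x *\<^sub>R (w x - w y)" "(c x - c y) *\<^sub>R w y"]
      unfolding e by (simp add: algebra_simps)
  qed
  have "norm (c x *\<^sub>R w x - c y *\<^sub>R w y) \<le> (A + B / (r2 - r1)) * norm (x - y)"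
  proof (cases "y \<in> cball a r2")
    case True then show ?thesis using * by blast
  next
    case False
    show ?thesis
    proof (cases "x \<in> cball a r2")
      case True then show ?thesis using *[of x y] by (simp add: norm_minus_commute)
    next
      case F2: False
      have "0 \<le> (A + B / (r2 - r1)) * norm (x - y)" using AB r by simp
      then show ?thesis using out False F2 by simp
    qed
  qed
  then show ?thesis unfolding c_def .
qed

lemma iso_end_cutoff:
  assumes F: "compact F" and ch: "thick_chart F P \<kappa> \<kappa>i" and r: "r1 < r2" and AB: "A \<ge> 0" "B \<ge> 0"
    and P: "cball a r2 \<subseteq> P" and small: "A + B / (r2 - r1) \<le> 1 / 2"
    and w: "\<And>x y. x \<in> cball a r2 \<Longrightarrow> y \<in> cball a r2 \<Longrightarrow> norm (w x - w y) \<le> A * norm (x - y)"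
      "\<And>x. x \<in> cball a r2 \<Longrightarrow> norm (w x) \<le> B"
  obtains \<theta> where "iso_end F \<theta>" "\<And>y. y \<in> cball a r1 \<Longrightarrow> \<theta> (\<kappa> y) = \<kappa> (y + w y)"
proof -
  define u where "u y = cutoff r1 r2 (y - a) *\<^sub>R w y" for y
  have ul: "norm (u x - u y) \<le> 1 / 2 * norm (x - y)" for x y
  proof -
    have "norm (u x - u y) \<le> (A + B / (r2 - r1)) * norm (x - y)"
      unfolding u_def by (rule cutoff_lipschitz[OF r AB w])
    also have "\<dots> \<le> 1 / 2 * norm (x - y)" using small by (intro mult_right_mono) auto
    finally show ?thesis .
  qed
  have "u x = 0" if "x \<notin> cball a r2" for x
    using that cutoff_properties(4)[OF r, of "x - a"] by (simp add: u_def dist_norm norm_minus_commute)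
  then obtain \<theta> where t: "iso_end F \<theta>" "\<And>y. y \<in> P \<Longrightarrow> \<theta> (\<kappa> y) = \<kappa> (y + u y)"
    using iso_end_perturbation[OF F ch ul compact_cball P] by blast
  have "\<theta> (\<kappa> y) = \<kappa> (y + w y)" if y: "y \<in> cball a r1" for y
  proof -
    have "y \<in> cball a r2" using y r by simp
    then have "y \<in> P" using P by blast
    moreover have "u y = w y" using y cutoff_properties(3)[OF r, of "y - a"]
      by (simp add: u_def dist_norm norm_minus_commute)
    ultimately show ?thesis using t(2) by simp
  qed
  then show ?thesis using that t(1) by blast
qed

text \<open>The factor \<open>1 - \<alpha>\<close> does not depend on the chart, so that shrinking in one chart can be
  undone by the inverse isotopy in another one.\<close>

lemma iso_end_shrink:
  assumes F: "compact F" and r: "0 < r1" "r1 < R"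
  obtains \<alpha> where "0 < \<alpha>" "\<alpha> < 1" "\<And>\<kappa> \<kappa>i n. thick_chart F (ball 0 R) \<kappa> \<kappa>i \<Longrightarrow>
    \<exists>\<theta>. iso_end F \<theta> \<and> (\<forall>y\<in>cball 0 r1. \<theta> (\<kappa> y) = \<kappa> ((1 - \<alpha>) ^ n *\<^sub>R y))"
proof -
  define r2 where "r2 = (r1 + R) / 2"
  have r2: "r1 < r2" "r2 < R" "r2 > 0" using r by (auto simp: r2_def)
  \<comment> \<open>With A = \<alpha> and B = \<alpha> r2 the bound A + B / (r2 - r1) equals 1/2. A
    single step thus shrinks by the factor 1 - \<alpha> only, hence the powers.\<close>
  define \<alpha> where "\<alpha> = 1 / (2 * (1 + r2 / (r2 - r1)))"
  have q: "r2 / (r2 - r1) > 0" using r2 by simp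
  have a: "0 < \<alpha>" "\<alpha> < 1" using q by (auto simp: \<alpha>_def)
  have "\<alpha> * (1 + r2 / (r2 - r1)) = 1 / 2" using q by (simp add: \<alpha>_def)
  then have small: "\<alpha> + \<alpha> * r2 / (r2 - r1) \<le> 1 / 2" by (simp add: algebra_simps)
  have sub: "cball (0::complex \<times> real) r2 \<subseteq> ball 0 R" using r2 by auto
  have "\<exists>\<theta>. iso_end F \<theta> \<and> (\<forall>y\<in>cball 0 r1. \<theta> (\<kappa> y) = \<kappa> ((1 - \<alpha>) ^ n *\<^sub>R y))"
    if ch: "thick_chart F (ball 0 R) \<kappa> \<kappa>i" for \<kappa> \<kappa>i n
  proof -
  obtain \<theta> where t: "iso_end F \<theta>" "\<And>y. y \<in> cball 0 r1 \<Longrightarrow> \<theta> (\<kappa> y) = \<kappa> (y + (- \<alpha>) *\<^sub>R y)"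
  proof (rule iso_end_cutoff[OF F ch r2(1) _ _ sub small, of "\<lambda>y. (- \<alpha>) *\<^sub>R y"])
    show "norm (- \<alpha> *\<^sub>R x - - \<alpha> *\<^sub>R y) \<le> \<alpha> * norm (x - y)" for x y :: "complex \<times> real"
      using a by (simp add: scaleR_diff_right[symmetric] norm_minus_commute del: scaleR_minus_left)
    show "norm (- \<alpha> *\<^sub>R x) \<le> \<alpha> * r2" if "x \<in> cball 0 r2" for x :: "complex \<times> real"
      using that a by (simp add: mult_left_mono)
  qed (use a r2 in auto)
  have step: "\<theta> (\<kappa> y) = \<kappa> ((1 - \<alpha>) *\<^sub>R y)" if "y \<in> cball 0 r1" for y
    using t(2)[OF that] by (simp add: scaleR_left_diff_distrib)
  show ?thesis
  proof (induction n)
    case 0 then show ?case using iso_end_id by auto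
  next
    case (Suc n)
    then obtain \<theta>' where t': "iso_end F \<theta>'" "\<And>y. y\<in>cball 0 r1 \<Longrightarrow> \<theta>' (\<kappa> y) = \<kappa> ((1 - \<alpha>) ^ n *\<^sub>R y)" by blast
    have "\<theta> (\<theta>' (\<kappa> y)) = \<kappa> ((1 - \<alpha>) ^ Suc n *\<^sub>R y)" if y: "y \<in> cball 0 r1" for y
    proof -
      have "(1 - \<alpha>) ^ n * norm y \<le> 1 * norm y"
        using a by (intro mult_right_mono power_le_one) auto
      then have "(1 - \<alpha>) ^ n *\<^sub>R y \<in> cball 0 r1" using y a by auto
      then show ?thesis using t'(2)[OF y] step by simp
    qed
    then show ?case using iso_end_comp[OF t'(1) t(1)] by blast
  qed
  qed
  then show ?thesis using that a by blast
qed

section \<open>Moving balls\<close>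

text \<open>First-order regularity with injective derivative, stated at a single point. It passes
  through a composition whose outer map is regular only at the image point, as is the case for the
  isotopies. The domain may be any set, in particular a subset of the thickened surface.\<close>

definition immersive ::
  "'a::euclidean_space set \<Rightarrow> ('a \<Rightarrow> 'b::euclidean_space) \<Rightarrow> 'a \<Rightarrow> bool" where
  "immersive A m a \<longleftrightarrow> a \<in> A \<and> (\<exists>L. strict_derivative A m a L) \<and>
     (\<exists>c>0. \<exists>d>0. \<forall>u\<in>A. \<forall>v\<in>A. dist a u < d \<longrightarrow> dist a v < d \<longrightarrow> c * norm (u - v) \<le> norm (m u - m v))"

lemma immersiveI:
  assumes "a \<in> A" "strict_derivative A m a L" "c > 0" "d > 0"
    "\<And>u v. u \<in> A \<Longrightarrow> v \<in> A \<Longrightarrow> dist a u < d \<Longrightarrow> dist a v < d \<Longrightarrow> c * norm (u - v) \<le> norm (m u - m v)"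
  shows "immersive A m a"
  using assms unfolding immersive_def by blast

lemma immersiveE:
  assumes "immersive A m a"
  obtains L c d where "a \<in> A" "strict_derivative A m a L" "c > 0" "d > 0"
    "\<And>u v. u \<in> A \<Longrightarrow> v \<in> A \<Longrightarrow> dist a u < d \<Longrightarrow> dist a v < d \<Longrightarrow> c * norm (u - v) \<le> norm (m u - m v)"
  using assms unfolding immersive_def by metis

lemma strict_derivative_cong_subset:
  assumes "strict_derivative A f x L" "B \<subseteq> A" "\<And>y. y \<in> B \<Longrightarrow> f y = g y"
  shows "strict_derivative B g x L"
  unfolding strict_derivative_def
proof (intro conjI allI impI)
  show "bounded_linear L" using assms(1) strict_derivative_def by blast
  fix e :: real assume "e > 0"
  then obtain d where "d > 0" "\<And>u v. u \<in> A \<Longrightarrow> v \<in> A \<Longrightarrow> dist x u < d \<Longrightarrow> dist x v < d \<Longrightarrow>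
       norm (f u - f v - L (u - v)) \<le> e * norm (u - v)"
    using strict_derivativeD[OF assms(1)] by metis
  then show "\<exists>d>0. \<forall>u\<in>B \<inter> ball x d. \<forall>v\<in>B \<inter> ball x d. norm (g u - g v - L (u - v)) \<le> e * norm (u - v)"
  proof -
   assume d: "d > 0" "\<And>u v. u \<in> A \<Longrightarrow> v \<in> A \<Longrightarrow> dist x u < d \<Longrightarrow> dist x v < d \<Longrightarrow>
       norm (f u - f v - L (u - v)) \<le> e * norm (u - v)"
   show ?thesis
  proof (intro exI[of _ d] conjI ballI)
    fix u v assume uv: "u \<in> B \<inter> ball x d" "v \<in> B \<inter> ball x d"
    then have "f u = g u" "f v = g v" "u \<in> A" "v \<in> A" using assms(2,3) by blast+
    then show "norm (g u - g v - L (u - v)) \<le> e * norm (u - v)"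
      using d(2)[of u v] uv by simp
  qed (rule d(1))
  qed
qed

lemma immersive_cong_subset:
  assumes "immersive A f a" "B \<subseteq> A" "a \<in> B" "\<And>y. y \<in> B \<Longrightarrow> f y = g y"
  shows "immersive B g a"
proof -
  obtain L c d where *: "a \<in> A" "strict_derivative A f a L" "c > 0" "d > 0"
    "\<And>u v. u \<in> A \<Longrightarrow> v \<in> A \<Longrightarrow> dist a u < d \<Longrightarrow> dist a v < d \<Longrightarrow> c * norm (u - v) \<le> norm (f u - f v)"
    using immersiveE[OF assms(1)] by metis
  show ?thesis
  proof (rule immersiveI[OF assms(3) strict_derivative_cong_subset[OF *(2) assms(2,4)] *(3,4)])
    fix u v assume "u \<in> B" "v \<in> B" "dist a u < d" "dist a v < d"
    then show "c * norm (u - v) \<le> norm (g u - g v)" using *(5)[of u v] assms(2,4) by auto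
  qed
qed

lemma immersive_lipschitz:
  assumes "immersive A f a"
  obtains d K where "d > 0" "K > 0" "\<And>u. u \<in> A \<Longrightarrow> dist a u < d \<Longrightarrow> dist (f a) (f u) \<le> K * dist a u"
proof -
  obtain L where L: "a \<in> A" "strict_derivative A f a L" using assms unfolding immersive_def by blast
  obtain d K where "d > 0" "K > 0"
    "\<And>u v. u \<in> A \<Longrightarrow> v \<in> A \<Longrightarrow> dist a u < d \<Longrightarrow> dist a v < d \<Longrightarrow> norm (f u - f v) \<le> K * norm (u - v)"
    using strict_derivative_lipschitz[OF L(2)] by metis
  then show ?thesis using that[of d K] L(1) by (simp add: dist_norm)
qed

lemma immersive_near:
  assumes "immersive A f a" "e > 0"
  obtains d where "d > 0" "\<And>u. u \<in> A \<Longrightarrow> dist a u < d \<Longrightarrow> dist (f a) (f u) < e"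
proof -
  obtain d K where d: "d > 0" "K > 0" "\<And>u. u \<in> A \<Longrightarrow> dist a u < d \<Longrightarrow> dist (f a) (f u) \<le> K * dist a u"
    using immersive_lipschitz[OF assms(1)] by metis
  have "dist (f a) (f u) < e" if u: "u \<in> A" "dist a u < min d (e / K)" for u
  proof -
    have "dist (f a) (f u) \<le> K * dist a u" using d(3) u by simp
    also have "\<dots> < K * (e / K)" using u d(2) by (intro mult_strict_left_mono) auto
    finally show ?thesis using d(2) by simp
  qed
  then show ?thesis using that[of "min d (e / K)"] d assms(2) by simp
qed

lemma immersive_compose:
  assumes f: "immersive A f a" and g: "immersive B g (f a)" and AB: "f ` A \<subseteq> B"
  shows "immersive A (\<lambda>x. g (f x)) a"
proof -
  obtain L c d where 1: "a \<in> A" "strict_derivative A f a L" "c > 0" "d > 0"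
    "\<And>u v. u \<in> A \<Longrightarrow> v \<in> A \<Longrightarrow> dist a u < d \<Longrightarrow> dist a v < d \<Longrightarrow> c * norm (u - v) \<le> norm (f u - f v)"
    using immersiveE[OF f] by metis
  obtain M c' d' where 2: "f a \<in> B" "strict_derivative B g (f a) M" "c' > 0" "d' > 0"
    "\<And>u v. u \<in> B \<Longrightarrow> v \<in> B \<Longrightarrow> dist (f a) u < d' \<Longrightarrow> dist (f a) v < d' \<Longrightarrow> c' * norm (u - v) \<le> norm (g u - g v)"
    using immersiveE[OF g] by metis
  obtain d2 where d2: "d2 > 0" "\<And>u. u \<in> A \<Longrightarrow> dist a u < d2 \<Longrightarrow> dist (f a) (f u) < d'"
    using immersive_near[OF f 2(4)] by metis
  show ?thesis
  proof (rule immersiveI[OF 1(1) strict_derivative_compose[OF 1(2) 2(2) 1(1) AB], of "c' * c" "min d d2"])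
    fix u v assume uv: "u \<in> A" "v \<in> A" "dist a u < min d d2" "dist a v < min d d2"
    have "c' * (c * norm (u - v)) \<le> c' * norm (f u - f v)" using 1(5)[of u v] uv 2(3) by (intro mult_left_mono) auto
    also have "\<dots> \<le> norm (g (f u) - g (f v))" using 2(5)[of "f u" "f v"] uv d2(2) AB by auto
    finally show "c' * c * norm (u - v) \<le> norm (g (f u) - g (f v))" by simp
  qed (use 1 2 d2 in auto)
qed

lemma immersive_diffeo:
  assumes h: "homeomorphism A B f g" "smooth_on A f" "smooth_on B g" and a: "a \<in> A"
  shows "immersive A f a"
proof -
  obtain L where L: "strict_derivative A f a L" using smooth_on_strict_derivative[OF h(2) a] by metis
  obtain c d where cd: "c > 0" "d > 0" "\<And>u v. u \<in> A \<Longrightarrow> v \<in> A \<Longrightarrow> dist a u < d \<Longrightarrow> dist a v < d \<Longrightarrow>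
    c * norm (u - v) \<le> norm (f u - f v)"
    using smooth_inverse_lower_lipschitz[OF h(1,3) a] by metis
  show ?thesis by (rule immersiveI[OF a L cd])
qed

text \<open>Along a vector killed by \<open>L\<close> the map would move by at most c/2 times the
  distance, against the lower bound with constant \<open>c\<close>.\<close>

lemma immersive_derivative_inj:
  fixes f :: "'a::euclidean_space \<Rightarrow> 'b::euclidean_space"
  assumes "immersive (ball a r) f a" "r > 0" "strict_derivative (ball a r) f a L"
  shows "inj L"
proof -
  obtain M c d where 1: "c > 0" "d > 0"
    "\<And>u v. u \<in> ball a r \<Longrightarrow> v \<in> ball a r \<Longrightarrow> dist a u < d \<Longrightarrow> dist a v < d \<Longrightarrow> c * norm (u - v) \<le> norm (f u - f v)"
    using immersiveE[OF assms(1)] by metis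
  have lin: "linear L" using assms(3) bounded_linear.linear unfolding strict_derivative_def by blast
  obtain d2 where d2: "d2 > 0" "\<And>u v. u \<in> ball a r \<Longrightarrow> v \<in> ball a r \<Longrightarrow> dist a u < d2 \<Longrightarrow> dist a v < d2 \<Longrightarrow>
       norm (f u - f v - L (u - v)) \<le> (c / 2) * norm (u - v)"
    using strict_derivativeD[OF assms(3), of "c / 2"] 1(1) by auto
  have "h = 0" if "L h = 0" for h
  proof (rule ccontr)
    assume "h \<noteq> 0"
    define s where "s = (min (min r d) d2) / (2 * norm h)"
    have s: "s > 0" using assms(2) 1 d2 \<open>h \<noteq> 0\<close> by (simp add: s_def)
    have sh: "norm (s *\<^sub>R h) = min (min r d) d2 / 2"
      using assms(2) 1(2) d2(1) \<open>h \<noteq> 0\<close> by (simp add: s_def)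
    then have n: "norm (s *\<^sub>R h) < r" "norm (s *\<^sub>R h) < d" "norm (s *\<^sub>R h) < d2" "norm (s *\<^sub>R h) > 0"
      using assms(2) 1(2) d2(1) by auto
    define u where "u = a + s *\<^sub>R h"
    have u: "u \<in> ball a r" "dist a u < d" "dist a u < d2" "u - a = s *\<^sub>R h" using n by (auto simp: u_def dist_norm)
    have "L (u - a) = 0" using that lin by (simp add: u(4) linear_cmul)
    then have "norm (f u - f a) \<le> (c / 2) * norm (u - a)" using d2(2)[of u a] u assms(2) d2(1) by simp
    moreover have "c * norm (u - a) \<le> norm (f u - f a)" using 1(3)[of u a] u assms(2) 1(2) by simp
    ultimately have "c * norm (u - a) \<le> 0" by simp
    moreover have "c * norm (u - a) > 0" using 1(1) n(4) u(4) by simp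
    ultimately show False by simp
  qed
  then show ?thesis using linear_injective_0[OF lin] by blast
qed

text \<open>The isotopy may depend on the germ \<open>m\<close> at \<open>y\<close>. Quantifying
  over all germs makes the relation transitive: the second isotopy is chosen for the germ that the
  first one has produced. The radius \<open>d'\<close> leaves room to shrink the domain of the
  germ.\<close>

definition moves ::
  "(real^4) set \<Rightarrow> (real^4) \<times> real \<Rightarrow> (real^4) \<times> real \<Rightarrow> bool" where
  "moves F y y' \<longleftrightarrow> (\<forall>m d. d > 0 \<longrightarrow> immersive (ball (0::complex \<times> real) d) m 0 \<longrightarrow>
     m ` ball 0 d \<subseteq> F \<times> {0..1} \<longrightarrow> m 0 = y \<longrightarrow>
     (\<exists>\<theta> d'. iso_end F \<theta> \<and> \<theta> y = y' \<and> 0 < d' \<and> d' \<le> d \<and> immersive (ball 0 d') (\<lambda>x. \<theta> (m x)) 0))"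

lemma moves_trans:
  assumes "moves F x y" "moves F y z" shows "moves F x z"
  unfolding moves_def
proof (intro allI impI)
  fix m :: "complex \<times> real \<Rightarrow> (real^4) \<times> real" and d :: real
  assume m: "d > 0" "immersive (ball 0 d) m 0" "m ` ball 0 d \<subseteq> F \<times> {0..1}" "m 0 = x"
  obtain \<theta> d1 where 1: "iso_end F \<theta>" "\<theta> x = y" "0 < d1" "d1 \<le> d" "immersive (ball 0 d1) (\<lambda>x. \<theta> (m x)) 0"
    using assms(1) m unfolding moves_def by blast
  have "m ` ball 0 d1 \<subseteq> F \<times> {0..1}" using m(3) subset_ball[OF 1(4)] by (meson image_mono subset_trans)
  then have "(\<lambda>x. \<theta> (m x)) ` ball 0 d1 \<subseteq> F \<times> {0..1}" using iso_end_maps(1)[OF 1(1)] by (metis image_image image_mono)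
  moreover have "\<theta> (m 0) = y" using m(4) 1(2) by simp
  ultimately obtain \<theta>2 d2 where 2: "iso_end F \<theta>2" "\<theta>2 y = z" "0 < d2" "d2 \<le> d1" "immersive (ball 0 d2) (\<lambda>x. \<theta>2 (\<theta> (m x))) 0"
    using assms(2)[unfolded moves_def, rule_format, OF 1(3) 1(5)] by blast
  show "\<exists>\<theta> d'. iso_end F \<theta> \<and> \<theta> x = z \<and> 0 < d' \<and> d' \<le> d \<and> immersive (ball 0 d') (\<lambda>x. \<theta> (m x)) 0"
    by (rule exI[of _ "\<lambda>x. \<theta>2 (\<theta> x)"], rule exI[of _ d2])
       (use iso_end_comp[OF 1(1) 2(1)] 1 2 in auto)
qed

lemma Cinf_fst: "Cinf U fst" and Cinf_snd: "Cinf U snd"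
  by (rule Cinf_bounded_linear, simp add: bounded_linear_fst bounded_linear_snd)+

lemma smooth_on_fst: "smooth_on A fst" and smooth_on_snd: "smooth_on A snd"
  by (rule Cinf_imp_smooth_on[OF open_UNIV], simp_all add: Cinf_fst Cinf_snd)+

lemma disc_chart_thick:
  assumes F: "compact_surface F" and d: "disc_chart F c r f g"
  defines "P \<equiv> ball c r \<times> {0<..<1}" and "\<kappa> \<equiv> \<lambda>u. (f (fst u), snd u)" and "\<kappa>i \<equiv> \<lambda>y. (g (fst y), snd y)"
  shows "thick_chart F P \<kappa> \<kappa>i" "Cinf P \<kappa>" "smooth_on (\<kappa> ` P) \<kappa>i"
proof -
  have d': "r > 0" "Cinf (ball c r) f" "homeomorphism (ball c r) (f ` ball c r) f g"
     "openin (top_of_set F) (f ` ball c r)" "smooth_on (f ` ball c r) g"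
    using d unfolding disc_chart_def by auto
  have gf: "g (f w) = w" if "w \<in> ball c r" for w using homeomorphism_apply1[OF d'(3) that] .
  have fF: "f ` ball c r \<subseteq> F" using openin_imp_subset[OF d'(4)] .
  have P: "open P" unfolding P_def by (intro open_Times) auto
  have ki: "\<kappa>i (\<kappa> u) = u" if "u \<in> P" for u
    using gf[of "fst u"] that by (simp add: P_def \<kappa>_def \<kappa>i_def mem_Times_iff)
  show kC: "Cinf P \<kappa>" unfolding \<kappa>_def
    by (rule Cinf_Pair[OF Cinf_compose[OF d'(2) Cinf_fst] Cinf_snd]) (auto simp: P_def)
  have kF: "\<kappa> ` P \<subseteq> F \<times> {0<..<1}" using fF by (auto simp: \<kappa>_def P_def)
  have fst: "fst ` \<kappa> ` P \<subseteq> f ` ball c r" by (auto simp: \<kappa>_def P_def)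
  show ks: "smooth_on (\<kappa> ` P) \<kappa>i" unfolding \<kappa>i_def
    by (rule smooth_on_Pair[OF smooth_on_compose[OF smooth_on_fst d'(5) fst] smooth_on_snd])
  obtain \<kappa>j where j: "thick_chart F P \<kappa> \<kappa>j"
    using thick_chartI[OF F P Cinf_imp_continuous_on[OF kC] _ kF] ki by (metis inj_on_inverseI)
  have "homeomorphism P (\<kappa> ` P) \<kappa> \<kappa>i"
    by (rule homeomorphismI[OF Cinf_imp_continuous_on[OF kC] smooth_on_imp_continuous_on[OF ks]]) (use ki in auto)
  then show "thick_chart F P \<kappa> \<kappa>i" using j unfolding thick_chart_def by blast
qed

lemma thick_chart_openin:
  assumes "thick_chart F P \<kappa> \<kappa>i" "open A" "A \<subseteq> P"
  shows "openin (top_of_set (F \<times> {0..1})) (\<kappa> ` A)"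
proof -
  have *: "homeomorphism P (\<kappa> ` P) \<kappa> \<kappa>i" "openin (top_of_set (F \<times> {0..1})) (\<kappa> ` P)"
    using assms(1) unfolding thick_chart_def by auto
  have "openin (top_of_set P) A" using assms(2,3) by (simp add: open_subset)
  then have "openin (top_of_set (\<kappa> ` P)) (\<kappa> ` A)" by (rule homeomorphism_imp_open_map[OF *(1)])
  then show ?thesis using *(2) openin_trans by blast
qed

text \<open>Inside a chart the point \<open>a\<close> is carried to \<open>a'\<close> by a
  translation that is cut off further out. Near \<open>a\<close> the isotopy is exactly this
  translation, read in smooth coordinates, so immersive germs stay immersive.\<close>

lemma local_moves:
  assumes F: "compact_surface F" and ch: "surface_chart F W U f g" and w: "w \<in> W" "Im w > 0"
    and t: "0 < t" "t < 1"
  obtains e where "e > 0" "ball (w, t) e \<subseteq> W \<times> UNIV" "\<And>a a'. a \<in> ball (w, t) e \<Longrightarrow> a' \<in> ball (w, t) e \<Longrightarrow>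
    moves F (f (fst a), snd a) (f (fst a'), snd a')"
proof -
  obtain r f' where d: "disc_chart F w r f' g" "ball w r \<subseteq> W" "\<And>z. z \<in> ball w r \<Longrightarrow> f' z = f z"
    using disc_chart_in_surface_chart[OF ch w] by metis
  define P where "P = ball w r \<times> {0<..<1::real}"
  define \<kappa> where "\<kappa> u = (f' (fst u), snd u)" for u :: "complex \<times> real"
  define \<kappa>i where "\<kappa>i y = (g (fst y), snd y)" for y :: "(real^4) \<times> real"
  have k: "thick_chart F P \<kappa> \<kappa>i" "Cinf P \<kappa>" "smooth_on (\<kappa> ` P) \<kappa>i"
    using disc_chart_thick[OF F d(1)] unfolding P_def \<kappa>_def \<kappa>i_def by auto
  have r: "r > 0" using d(1) unfolding disc_chart_def by blast
  have cF: "compact F" using F unfolding compact_surface_def by blast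
  have P: "open P" "(w, t) \<in> P" "homeomorphism P (\<kappa> ` P) \<kappa> \<kappa>i" using k(1) r t unfolding thick_chart_def by (auto simp: P_def)
  obtain e0 where e0: "e0 > 0" "ball (w, t) e0 \<subseteq> P" using P(1,2) openE by blast
  \<comment> \<open>Both points lie within e of the centre, so the translation vector
    \<open>p\<close> has length at most 2e. The cutoff from radius e to radius 5e around
    \<open>a\<close> stays in the ball of radius 6e and gives the constant 2e / (5e - e) =
    1/2.\<close>
  define e where "e = e0 / 6"
  have e: "e > 0" "ball (w, t) (6 * e) \<subseteq> P" using e0 by (auto simp: e_def)
  have fk: "(f (fst a), snd a) = \<kappa> a" if "a \<in> P" for a
    using d(3)[of "fst a"] that by (auto simp: \<kappa>_def P_def mem_Times_iff)
  have eP: "ball (w, t) e \<subseteq> P" by (rule order_trans[OF subset_ball e(2)]) (use e(1) in simp)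
  have "moves F (\<kappa> a) (\<kappa> a')" if a: "a \<in> ball (w, t) e" "a' \<in> ball (w, t) e" for a a'
    unfolding moves_def
  proof (intro allI impI)
    fix m :: "complex \<times> real \<Rightarrow> (real^4) \<times> real" and d :: real
    assume m: "d > 0" "immersive (ball 0 d) m 0" "m ` ball 0 d \<subseteq> F \<times> {0..1}" "m 0 = \<kappa> a"
    define p where "p = a' - a"
    have "dist a a' \<le> dist (w, t) a + dist (w, t) a'" by (rule dist_triangle3)
    then have p: "norm p \<le> 2 * e" using a by (simp add: p_def dist_norm norm_minus_commute)
    have sub5: "cball a (5 * e) \<subseteq> P"
    proof
      fix y assume "y \<in> cball a (5 * e)"
      then have "dist (w, t) y < 6 * e" using a(1) dist_triangle[of "(w, t)" y a] by simp
      then show "y \<in> P" using e(2) by auto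
    qed
    obtain \<theta> where t: "iso_end F \<theta>" "\<And>y. y \<in> cball a e \<Longrightarrow> \<theta> (\<kappa> y) = \<kappa> (y + p)"
    proof (rule iso_end_cutoff[OF cF k(1) _ _ _ sub5, of e 0 "2 * e" "\<lambda>y. p"])
      show "0 + 2 * e / (5 * e - e) \<le> 1 / 2" using e(1) by simp
    qed (use e p in auto)
    have ba: "ball a e \<subseteq> P" using sub5 e(1) by (auto simp: subset_iff)
    have "openin (top_of_set (F \<times> {0..1})) (\<kappa> ` ball a e)" by (rule thick_chart_openin[OF k(1) open_ball ba])
    then obtain T where T: "open T" "\<kappa> ` ball a e = F \<times> {0..1} \<inter> T" by (auto simp: openin_open)
    have "\<kappa> a \<in> T" using T(2) e(1) by auto
    then obtain e1 where e1: "e1 > 0" "ball (\<kappa> a) e1 \<subseteq> T" using T(1) openE by blast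
    obtain d1 where d1: "d1 > 0" "\<And>u. u \<in> ball 0 d \<Longrightarrow> dist 0 u < d1 \<Longrightarrow> dist (m 0) (m u) < e1"
      using immersive_near[OF m(2) e1(1)] by metis
    define d' where "d' = min d d1"
    have d': "0 < d'" "d' \<le> d" using m(1) d1 by (auto simp: d'_def)
    have mk: "m u \<in> \<kappa> ` ball a e" if "u \<in> ball 0 d'" for u
    proof -
      have u: "u \<in> ball 0 d" "dist 0 u < d1" using that by (auto simp: d'_def)
      have "m u \<in> ball (\<kappa> a) e1" using d1(2)[OF u] m(4) by simp
      then have "m u \<in> T" using e1(2) by blast
      then show ?thesis using T(2) m(3) u(1) by blast
    qed
    have h1: "homeomorphism (\<kappa> ` ball a e) (ball a e) \<kappa>i \<kappa>"
      by (rule homeomorphism_symD, rule homeomorphism_of_subsets[OF P(3) ba])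
         (use ba homeomorphism_apply1[OF P(3)] in auto)
    have k1: "immersive (\<kappa> ` ball a e) \<kappa>i (\<kappa> a)"
      by (rule immersive_diffeo[OF h1 smooth_on_subset[OF k(3)] Cinf_imp_smooth_on[OF P(1) k(2) ba]])
         (use ba e(1) in auto)
    define Q where "Q = (\<lambda>y. y + p) ` ball a e"
    have QP: "Q \<subseteq> P"
    proof
      fix y assume "y \<in> Q"
      then obtain z where "z \<in> ball a e" "y = z + p" by (auto simp: Q_def)
      then have "dist a y \<le> e + 2 * e" using p norm_triangle_ineq[of "z - a" p]
        by (simp add: dist_norm norm_minus_commute add.commute add_diff_eq)
      then have "y \<in> cball a (5 * e)" using e(1) by simp
      then show "y \<in> P" using sub5 by blast
    qed
    have ki: "\<kappa>i (\<kappa> y) = y" if "y \<in> P" for y using homeomorphism_apply1[OF P(3) that] .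
    have k2C: "Cinf (ball a e) (\<lambda>y. \<kappa> (y + p))"
      by (rule Cinf_compose[OF k(2) Cinf_add[OF Cinf_ident Cinf_const]]) (use QP in \<open>simp add: Q_def\<close>)
    have k2i: "smooth_on (\<kappa> ` Q) (\<lambda>y. \<kappa>i y + - p)"
      by (rule smooth_on_compose[OF smooth_on_subset[OF k(3)]
            Cinf_imp_smooth_on[OF open_UNIV Cinf_add[OF Cinf_ident Cinf_const] subset_UNIV]])
         (use QP in auto)
    have h2: "homeomorphism (ball a e) (\<kappa> ` Q) (\<lambda>y. \<kappa> (y + p)) (\<lambda>y. \<kappa>i y + - p)"
    proof (rule homeomorphismI[OF Cinf_imp_continuous_on[OF k2C] smooth_on_imp_continuous_on[OF k2i]])
      have q: "\<kappa>i (\<kappa> (z + p)) = z + p" if "z \<in> ball a e" for z using ki QP that unfolding Q_def by blast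
      show "(\<lambda>y. \<kappa> (y + p)) ` ball a e \<subseteq> \<kappa> ` Q" by (auto simp: Q_def)
      show "(\<lambda>y. \<kappa>i y + - p) ` \<kappa> ` Q \<subseteq> ball a e"
        unfolding Q_def image_image by (rule image_subsetI) (use q in simp)
      show "\<kappa>i (\<kappa> (x + p)) + - p = x" if "x \<in> ball a e" for x using q[OF that] by simp
      show "\<kappa> (\<kappa>i y + - p + p) = y" if "y \<in> \<kappa> ` Q" for y
        using that q unfolding Q_def by auto
    qed
    have ae: "a \<in> ball a e" "a \<in> P" using e(1) ba by auto
    have k2: "immersive (ball a e) (\<lambda>y. \<kappa> (y + p)) a"
      by (rule immersive_diffeo[OF h2 Cinf_imp_smooth_on[OF open_ball k2C subset_refl] k2i ae(1)])
    have m': "immersive (ball 0 d') m 0"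
      by (rule immersive_cong_subset[OF m(2) subset_ball[OF d'(2)]]) (use d'(1) in auto)
    have i1: "immersive (ball 0 d') (\<lambda>x. \<kappa>i (m x)) 0"
      by (rule immersive_compose[OF m' _ image_subsetI[OF mk]]) (use k1 m(4) in auto)
    have i2: "immersive (ball 0 d') (\<lambda>x. \<kappa> (\<kappa>i (m x) + p)) 0"
    proof (rule immersive_compose[OF i1])
      show "immersive (ball a e) (\<lambda>y. \<kappa> (y + p)) (\<kappa>i (m 0))" using k2 m(4) ki[OF ae(2)] by simp
      show "(\<lambda>x. \<kappa>i (m x)) ` ball 0 d' \<subseteq> ball a e"
      proof (rule image_subsetI)
        fix u :: "complex \<times> real" assume "u \<in> ball 0 d'"
        then obtain z where "z \<in> ball a e" "m u = \<kappa> z" using mk by blast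
        then show "\<kappa>i (m u) \<in> ball a e" using ki[of z] ba by auto
      qed
    qed
    have "immersive (ball 0 d') (\<lambda>x. \<theta> (m x)) 0"
    proof (rule immersive_cong_subset[OF i2 subset_refl])
      fix u :: "complex \<times> real" assume "u \<in> ball 0 d'"
      then obtain z where z: "z \<in> ball a e" "m u = \<kappa> z" using mk by blast
      then have "z \<in> P" "z \<in> cball a e" using ba by auto
      then show "\<kappa> (\<kappa>i (m u) + p) = \<theta> (m u)" using t(2) ki z(2) by simp
    qed (use d'(1) in simp)
    moreover have "\<theta> (\<kappa> a) = \<kappa> a'" using t(2)[of a] e(1) by (simp add: p_def)
    ultimately show "\<exists>\<theta> d'. iso_end F \<theta> \<and> \<theta> (\<kappa> a) = \<kappa> a' \<and> 0 < d' \<and> d' \<le> d \<and> immersive (ball 0 d') (\<lambda>x. \<theta> (m x)) 0"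
      using t(1) d' by blast
  qed
  then have "moves F (f (fst a), snd a) (f (fst a'), snd a')" if "a \<in> ball (w, t) e" "a' \<in> ball (w, t) e" for a a'
    using fk eP that by (metis subsetD)
  moreover have "ball (w, t) e \<subseteq> W \<times> UNIV" using eP d(2) by (auto simp: P_def)
  ultimately show ?thesis using that e(1) by blast
qed

text \<open>Connectedness is given for the surface, not for its interior. The chain principle used
  here asks two things at every point, boundary points included: interior points arbitrarily close
  to it, and a neighbourhood whose interior points are all related. In a boundary chart both hold
  because the upper part of a small ball is nonempty and convex.\<close>

lemma interior_points_move:
  assumes F: "compact_surface F" "connected F"
    and a: "a \<in> surface_interior F \<times> {0<..<1}" and b: "b \<in> surface_interior F \<times> {0<..<1}"
  shows "moves F a b"
proof (rule connected_equivalence_relation_gen[of "F \<times> {0<..<1}" a b "\<lambda>y. fst y \<in> surface_interior F" "moves F"])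
  have iF: "surface_interior F \<subseteq> F" using open_chartD(3) unfolding surface_interior_def by blast
  show "connected (F \<times> {0<..<1::real})" using F(2) by (intro connected_Times) auto
  show "a \<in> F \<times> {0<..<1}" "b \<in> F \<times> {0<..<1}" using a b iF by (auto simp: mem_Times_iff)
  show "fst a \<in> surface_interior F" "fst b \<in> surface_interior F" using a b by (auto simp: mem_Times_iff)
  show "\<And>x y z. moves F x y \<Longrightarrow> moves F y z \<Longrightarrow> moves F x z" by (rule moves_trans)
  fix y :: "(real^4) \<times> real"
  {
    fix T assume T: "openin (top_of_set (F \<times> {0<..<1})) T" "y \<in> T"
    have y: "fst y \<in> F" "snd y \<in> {0<..<1}" using openin_imp_subset[OF T(1)] T(2) by (auto simp: mem_Times_iff)
    obtain W U f g where ch: "surface_chart F W U f g" "fst y \<in> U" using compact_surface_chart[OF F(1) y(1)] by metis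
    note c = surface_chartD[OF ch(1)]
    have gy: "g (fst y) \<in> W" "f (g (fst y)) = fst y" using c(7)[OF ch(2)] by auto
    have "continuous_on W (\<lambda>w. (f w, snd y))"
      by (intro continuous_on_Pair continuous_on_const smooth_on_imp_continuous_on[OF c(4)])
    moreover have "(\<lambda>w. (f w, snd y)) ` W \<subseteq> F \<times> {0<..<1}"
      by (rule image_subsetI) (use c(6,7) y(2) in simp)
    ultimately have "openin (top_of_set W) (W \<inter> (\<lambda>w. (f w, snd y)) -` T)"
      using continuous_openin_preimage[OF _ _ T(1)] by blast
    then have "openin (top_of_set {z. Im z \<ge> 0}) (W \<inter> (\<lambda>w. (f w, snd y)) -` T)" using c(2) openin_trans by blast
    then obtain N where N: "open N" "W \<inter> (\<lambda>w. (f w, snd y)) -` T = {z. Im z \<ge> 0} \<inter> N" by (auto simp: openin_open)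
    have "g (fst y) \<in> W \<inter> (\<lambda>w. (f w, snd y)) -` T" using gy T(2) by simp
    then have "g (fst y) \<in> N" "Im (g (fst y)) \<ge> 0" unfolding N(2) by auto
    then obtain e where e: "e > 0" "ball (g (fst y)) e \<subseteq> N" using N(1) openE by blast
    \<comment> \<open>A step straight up by half the radius leaves the boundary but not the
      neighbourhood \<open>N\<close>.\<close>
    define w where "w = g (fst y) + \<i> * of_real (e / 2)"
    have "w \<in> ball (g (fst y)) e" using e(1) by (simp add: w_def dist_norm norm_mult)
    moreover have Iw: "Im w > 0" using e(1) \<open>Im (g (fst y)) \<ge> 0\<close> by (simp add: w_def)
    ultimately have "w \<in> W \<inter> (\<lambda>w. (f w, snd y)) -` T" unfolding N(2) using e(2) by auto
    then have w: "w \<in> W" "(f w, snd y) \<in> T" by auto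
    obtain r f' where d: "disc_chart F w r f' g" "\<And>z. z \<in> ball w r \<Longrightarrow> f' z = f z"
      using disc_chart_in_surface_chart[OF ch(1) w(1) Iw] by metis
    have "w \<in> ball w r" using d(1) unfolding disc_chart_def by simp
    then have "f w \<in> surface_interior F" using disc_chart_interior[OF F(1) d(1)] d(2) by (metis image_eqI subsetD)
    then show "\<exists>z. z \<in> T \<and> fst z \<in> surface_interior F" using w(2) by force
  }
  assume y: "y \<in> F \<times> {0<..<1}"
  then have y1: "fst y \<in> F" by (simp add: mem_Times_iff)
  obtain W U f g where ch: "surface_chart F W U f g" "fst y \<in> U" using compact_surface_chart[OF F(1) y1] by metis
  note c = surface_chartD[OF ch(1)]
  have gy: "g (fst y) \<in> W" "f (g (fst y)) = fst y" using c(7)[OF ch(2)] by auto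
  obtain N where N: "open N" "W = {z. Im z \<ge> 0} \<inter> N" using c(2) by (auto simp: openin_open)
  have "g (fst y) \<in> N" using gy(1) N(2) by blast
  then obtain e where e: "e > 0" "ball (g (fst y)) e \<subseteq> N" using N(1) openE by blast
  define Q where "Q = ball (g (fst y)) e \<inter> {z. Im z > 0}"
  have QW: "Q \<subseteq> W" using e(2) N(2) by (auto simp: Q_def)
  have cQ: "connected (Q \<times> {0<..<1::real})" unfolding Q_def
    by (intro connected_Times convex_connected convex_Int convex_ball convex_halfspace_Im_gt) auto
  define V where "V = U \<inter> g -` ball (g (fst y)) e"
  have "continuous_on U g" by (rule smooth_on_imp_continuous_on[OF c(5)])
  then have "openin (top_of_set U) V" unfolding V_def by (rule continuous_openin_preimage_gen) simp
  then have VF: "openin (top_of_set F) V" using c(1) openin_trans by blast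
  have "openin (top_of_set (F \<times> {0<..<1})) (V \<times> {0<..<1::real})" by (intro openin_Times VF) auto
  moreover have "y \<in> V \<times> {0<..<1}" using y ch(2) e(1) by (simp add: V_def mem_Times_iff)
  moreover have "moves F p q" if p: "p \<in> V \<times> {0<..<1}" "fst p \<in> surface_interior F"
    and q: "q \<in> V \<times> {0<..<1}" "fst q \<in> surface_interior F" for p q
  proof -
    have *: "(g (fst p), snd p) \<in> Q \<times> {0<..<1} \<and> p = (f (g (fst p)), snd p)"
      if p: "p \<in> V \<times> {0<..<1}" "fst p \<in> surface_interior F" for p
    proof -
      have "fst p \<in> U" "g (fst p) \<in> ball (g (fst y)) e" "snd p \<in> {0<..<1}" using p(1) by (auto simp: V_def mem_Times_iff)
      then show ?thesis using interior_point_chart[OF F(1) p(2) ch(1)] c(7)[of "fst p"]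
        by (simp add: Q_def)
    qed
    let ?R = "\<lambda>u v. moves F (f (fst u), snd u) (f (fst v), snd v)"
    \<comment> \<open>A second connectedness argument, in the connected set of points over
      \<open>Q\<close>, chains the local moves.\<close>
    have "?R (g (fst p), snd p) (g (fst q), snd q)"
    proof (rule connected_equivalence_relation_gen[OF cQ, of _ _ "\<lambda>_. True" ?R])
      show "(g (fst p), snd p) \<in> Q \<times> {0<..<1}" "(g (fst q), snd q) \<in> Q \<times> {0<..<1}" using *[OF p] *[OF q] by blast+
      show "\<And>x y z. ?R x y \<Longrightarrow> ?R y z \<Longrightarrow> ?R x z" using moves_trans by blast
      fix u :: "complex \<times> real" assume u: "u \<in> Q \<times> {0<..<1}"
      then have u': "fst u \<in> W" "Im (fst u) > 0" "0 < snd u" "snd u < 1" using QW by (auto simp: mem_Times_iff Q_def)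
      obtain e' where e': "e' > 0" "\<And>a a'. a \<in> ball u e' \<Longrightarrow> a' \<in> ball u e' \<Longrightarrow> ?R a a'"
        using local_moves[OF F(1) ch(1) u'] by (metis prod.collapse)
      show "\<exists>T. openin (top_of_set (Q \<times> {0<..<1})) T \<and> u \<in> T \<and> (\<forall>x\<in>T. \<forall>y\<in>T. True \<and> True \<longrightarrow> ?R x y)"
        by (rule exI[of _ "(Q \<times> {0<..<1}) \<inter> ball u e'"]) (use u e' in \<open>auto simp del: mem_ball intro!: openin_open_Int\<close>)
    qed auto
    then show ?thesis using *[OF p] *[OF q] by (metis fst_conv snd_conv)
  qed
  ultimately show "\<exists>T. openin (top_of_set (F \<times> {0<..<1})) T \<and> y \<in> T \<and>
      (\<forall>x\<in>T. \<forall>y\<in>T. fst x \<in> surface_interior F \<and> fst y \<in> surface_interior F \<longrightarrow> moves F x y)"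
    by blast
qed

text \<open>Strictness at 0 means that \<open>m\<close> minus the identity has arbitrarily small
  Lipschitz constant near 0. On the ball of radius 2\<rho> the constant is 1/6, so displacements are
  at most \<rho>/3 and the cutoff between \<rho> and 2\<rho> leads to 1/6 + 1/3 = 1/2.\<close>

lemma iso_end_tangent_to_identity:
  assumes F: "compact F" and ch: "thick_chart F P \<kappa> \<kappa>i" "0 \<in> P"
    and m: "d > 0" "strict_derivative (ball 0 d) m 0 (\<lambda>h. h)" "m 0 = 0"
  obtains \<theta> \<rho> where "iso_end F \<theta>" "0 < \<rho>" "\<rho> < d" "ball 0 \<rho> \<subseteq> P" "\<And>y. y \<in> ball 0 \<rho> \<Longrightarrow> \<theta> (\<kappa> y) = \<kappa> (m y)"
proof -
  obtain d1 where d1: "d1 > 0" "\<And>u v. u \<in> ball 0 d \<Longrightarrow> v \<in> ball 0 d \<Longrightarrow> dist 0 u < d1 \<Longrightarrow> dist 0 v < d1 \<Longrightarrow>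
       norm (m u - m v - (u - v)) \<le> 1 / 6 * norm (u - v)"
    using strict_derivativeD[OF m(2), of "1 / 6"] by auto
  have "open P" using ch(1) unfolding thick_chart_def by blast
  then obtain d2 where d2: "d2 > 0" "ball 0 d2 \<subseteq> P" using ch(2) openE by blast
  define \<rho> where "\<rho> = min (min d d1) d2 / 3"
  have \<rho>: "0 < \<rho>" "2 * \<rho> < d" "2 * \<rho> < d1" "2 * \<rho> < d2" "\<rho> < d" using m(1) d1 d2 by (auto simp: \<rho>_def)
  have sub: "cball (0::complex \<times> real) (2 * \<rho>) \<subseteq> P"
  proof
    fix y :: "complex \<times> real" assume "y \<in> cball 0 (2 * \<rho>)"
    then have "y \<in> ball 0 d2" using \<rho>(4) by simp
    then show "y \<in> P" using d2(2) by blast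
  qed
  have w: "norm ((m x - x) - (m y - y)) \<le> 1 / 6 * norm (x - y)"
    if "x \<in> cball 0 (2 * \<rho>)" "y \<in> cball 0 (2 * \<rho>)" for x y
  proof -
    have "norm (m x - m y - (x - y)) \<le> 1 / 6 * norm (x - y)" using d1(2)[of x y] that \<rho> by simp
    then show ?thesis by (simp add: algebra_simps)
  qed
  have w2: "norm (m x - x) \<le> \<rho> / 3" if "x \<in> cball 0 (2 * \<rho>)" for x
    using w[OF that, of 0] that m(3) \<rho>(1) by simp
  obtain \<theta> where t: "iso_end F \<theta>" "\<And>y. y \<in> cball 0 \<rho> \<Longrightarrow> \<theta> (\<kappa> y) = \<kappa> (y + (m y - y))"
  proof (rule iso_end_cutoff[OF F ch(1) _ _ _ sub _ w w2])
    show "1 / 6 + \<rho> / 3 / (2 * \<rho> - \<rho>) \<le> 1 / 2" using \<rho>(1) by simp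
  qed (use \<rho> in auto)
  show ?thesis
  proof (rule that[OF t(1) \<rho>(1,5)])
    show "ball 0 \<rho> \<subseteq> P" using sub \<rho>(1) by (auto simp: subset_iff)
    show "\<theta> (\<kappa> y) = \<kappa> (m y)" if "y \<in> ball 0 \<rho>" for y using t(2)[of y] that by simp
  qed
qed

text \<open>The map to be reached on the ball is \<open>E\<close>, that is \<open>\<kappa>\<close>
  after an affine map \<open>A\<close> after \<open>\<iota>\<close> after \<open>h\<close>. An
  isotopy \<open>\<theta>1\<close> brings the chart \<open>\<kappa>\<close> to the centre of
  \<open>h\<close>; read through \<open>\<iota>\<close> it becomes a germ into
  \<open>real^3\<close>, and \<open>A\<close> inverts its derivative. The comparison map
  \<open>m\<close> is then tangent to the identity and is realised by \<open>\<theta>p\<close>, so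
  that the inverse of \<open>\<theta>1\<close> followed by \<open>\<theta>p\<close> turns
  \<open>h\<close> into \<open>E\<close> near 0. A contraction in the chart \<open>h\<close>
  beforehand, undone in the chart \<open>E\<close> afterwards, spreads the equality to the ball of
  radius \<open>r\<close>; the factors cancel because both charts use the same one.\<close>

lemma isotopy_transport:
  fixes h \<kappa> :: "complex \<times> real \<Rightarrow> (real^4) \<times> real" and \<iota> :: "(real^4) \<times> real \<Rightarrow> real^3"
  assumes F: "compact_surface F" "connected F"
    and h: "thick_chart F (ball 0 R) h hi" and r: "0 < r" "r < R"
    and i: "smooth_on (F \<times> UNIV) \<iota>" and c: "c > 0"
      "\<And>x y. x \<in> h ` ball 0 R \<Longrightarrow> y \<in> h ` ball 0 R \<Longrightarrow> c * norm (x - y) \<le> norm (\<iota> x - \<iota> y)"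
    and k: "thick_chart F UNIV \<kappa> \<kappa>i" "immersive UNIV \<kappa> 0"
  obtains B v0 \<theta> where "bounded_linear B" "inj B" "iso_end F \<theta>"
    "\<And>u. u \<in> cball 0 r \<Longrightarrow> \<theta> (h u) = \<kappa> (B (\<iota> (h u) - v0))"
proof -
  let ?X = "F \<times> {0..1::real}"
  have cF: "compact F" using F(1) unfolding compact_surface_def by blast
  have H: "homeomorphism (ball 0 R) (h ` ball 0 R) h hi"
    "h ` ball 0 R \<subseteq> surface_interior F \<times> {0<..<1}" "openin (top_of_set ?X) (h ` ball 0 R)"
    using h unfolding thick_chart_def by auto
  have hX: "h ` ball 0 R \<subseteq> ?X" using openin_imp_subset[OF H(3)] .
  have hFU: "h ` ball 0 R \<subseteq> F \<times> UNIV" by (rule order_trans[OF hX]) (rule Sigma_mono; simp)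
  have h0: "h 0 \<in> h ` ball 0 R" using r by simp
  have K: "range \<kappa> \<subseteq> surface_interior F \<times> {0<..<1}" "openin (top_of_set ?X) (range \<kappa>)"
    "homeomorphism UNIV (range \<kappa>) \<kappa> \<kappa>i"
    using k(1) unfolding thick_chart_def by auto
  have kX: "range \<kappa> \<subseteq> ?X" using openin_imp_subset[OF K(2)] .
  have kinj: "\<kappa> x = \<kappa> y \<longleftrightarrow> x = y" for x y using homeomorphism_apply1[OF K(3)] by (metis UNIV_I)
  have mv: "moves F (\<kappa> 0) (h 0)"
    by (rule interior_points_move[OF F]) (use K(1) H(2) h0 in blast)+
  have "immersive (ball 0 1) \<kappa> 0" by (rule immersive_cong_subset[OF k(2)]) auto
  moreover have "\<kappa> ` ball 0 1 \<subseteq> ?X" using kX by blast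
  ultimately obtain \<theta>1 d1 where t1: "iso_end F \<theta>1" "\<theta>1 (\<kappa> 0) = h 0" "0 < d1" "d1 \<le> 1"
      "immersive (ball 0 d1) (\<lambda>x. \<theta>1 (\<kappa> x)) 0"
    using mv unfolding moves_def by (metis zero_less_one)
  have t1X: "\<theta>1 (\<kappa> x) \<in> ?X" for x using iso_end_maps(1)[OF t1(1)] kX by blast
  obtain T where T: "open T" "h ` ball 0 R = ?X \<inter> T" using H(3) by (auto simp: openin_open)
  have "\<theta>1 (\<kappa> 0) \<in> T" using t1(2) h0 T(2) by (metis IntD2)
  then obtain e1 where e1: "e1 > 0" "ball (\<theta>1 (\<kappa> 0)) e1 \<subseteq> T" using T(1) openE by blast
  obtain d2 where d2: "d2 > 0" "\<And>u. u \<in> ball 0 d1 \<Longrightarrow> dist 0 u < d2 \<Longrightarrow> dist (\<theta>1 (\<kappa> 0)) (\<theta>1 (\<kappa> u)) < e1"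
    using immersive_near[OF t1(5) e1(1)] by metis
  define d where "d = min d1 d2"
  have d: "d > 0" "ball 0 d \<subseteq> ball (0::complex \<times> real) d1" using t1(3) d2(1) by (auto simp: d_def)
  have nh: "\<theta>1 (\<kappa> u) \<in> h ` ball 0 R" if "u \<in> ball 0 d" for u
  proof -
    have "u \<in> ball 0 d1" "dist 0 u < d2" using that by (auto simp: d_def)
    then have "\<theta>1 (\<kappa> u) \<in> ball (\<theta>1 (\<kappa> 0)) e1" using d2(2) by simp
    then show ?thesis using T(2) e1(2) t1X by blast
  qed
  have im1: "immersive (ball 0 d) (\<lambda>x. \<theta>1 (\<kappa> x)) 0"
    by (rule immersive_cong_subset[OF t1(5) d(2)]) (use d in auto)
  obtain L1 where L1: "strict_derivative (F \<times> UNIV) \<iota> (h 0) L1"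
    using smooth_on_strict_derivative[OF i, of "h 0"] hFU h0 by blast
  have "immersive (h ` ball 0 R) \<iota> (\<theta>1 (\<kappa> 0))" unfolding t1(2)
    by (rule immersiveI[OF h0 strict_derivative_subset[OF L1 hFU] c(1) zero_less_one]) (rule c(2))
  then have im2: "immersive (ball 0 d) (\<lambda>x. \<iota> (\<theta>1 (\<kappa> x))) 0"
    by (rule immersive_compose[OF im1]) (use nh in blast)
  obtain L where L: "strict_derivative (ball 0 d) (\<lambda>x. \<iota> (\<theta>1 (\<kappa> x))) 0 L"
    using im2 unfolding immersive_def by blast
  have Linj: "inj L" by (rule immersive_derivative_inj[OF im2 d(1) L])
  have Llin: "linear L" using L bounded_linear.linear unfolding strict_derivative_def by blast
  \<comment> \<open>\<open>m\<close> compares the chart \<open>\<kappa>\<close> with itself, by way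
    of \<open>\<iota>\<close>. Inverting the derivative therefore gives tangency to the identity
    however \<open>h\<close> and \<open>\<iota>\<close> behave with respect to orientation, and no
    sign has to be matched.\<close>
  obtain B where B: "linear B" "B \<circ> L = id" using linear_injective_left_inverse[OF Llin Linj] by blast
  have BL: "B (L x) = x" for x using B(2) by (metis comp_apply id_apply)
  have "dim (range L) = DIM(real^3)"
    using dim_image_eq[OF Llin inj_on_subset[OF Linj subset_UNIV], of UNIV] by simp
  moreover have "span (range L) = range L"
    using linear_subspace_image[OF Llin subspace_UNIV] by simp
  ultimately have "surj L" using dim_eq_full by metis
  then have Binj: "inj B" by (metis BL injI surj_def)
  have Bbl: "bounded_linear B" using B(1) by (simp add: linear_linear)
  define A where "A v = B (v - \<iota> (h 0))" for v
  define m where "m x = A (\<iota> (\<theta>1 (\<kappa> x)))" for x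
  have AC: "Cinf UNIV A" unfolding A_def
    by (rule Cinf_linear_compose[OF Bbl Cinf_diff[OF Cinf_ident Cinf_const]])
  have Astr: "strict_derivative UNIV A v B" for v
    unfolding strict_derivative_def
    using Bbl B(1) by (auto simp: A_def linear_diff algebra_simps intro!: exI[of _ 1])
  have mstr: "strict_derivative (ball 0 d) m 0 (\<lambda>h. h)"
  proof -
    have "strict_derivative (ball 0 d) m 0 (\<lambda>h. B (L h))" unfolding m_def
      by (rule strict_derivative_compose[OF L Astr]) (use d in auto)
    then show ?thesis by (simp add: BL)
  qed
  have m0: "m 0 = 0" using t1(2) linear_0[OF B(1)] by (simp add: m_def A_def)
  obtain \<theta>p \<rho> where tp: "iso_end F \<theta>p" "0 < \<rho>" "\<rho> < d" "\<And>y. y \<in> ball 0 \<rho> \<Longrightarrow> \<theta>p (\<kappa> y) = \<kappa> (m y)"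
    using iso_end_tangent_to_identity[OF cF k(1) UNIV_I d(1) mstr m0] by metis
  obtain b where b: "iso_end F b" "\<And>x. x \<in> ?X \<Longrightarrow> b (\<theta>1 x) = x" "\<And>x. x \<in> ?X \<Longrightarrow> \<theta>1 (b x) = x"
    using iso_end_inverse[OF cF t1(1)] by blast
  have bh0: "b (h 0) = \<kappa> 0" using b(2)[of "\<kappa> 0"] t1(2) kX by auto
  obtain s0 where s0: "s0 > 0" "s0 < R" "\<And>u. norm u < s0 \<Longrightarrow> b (h u) \<in> \<kappa> ` ball 0 \<rho>"
  proof -
    have "continuous_on (ball 0 R) (\<lambda>u. b (h u))"
      by (rule continuous_on_compose2[OF iso_end_maps(3)[OF b(1)] homeomorphism_cont1[OF H(1)] hX])
    moreover have "(\<lambda>u. b (h u)) ` ball 0 R \<subseteq> ?X" using iso_end_maps(1)[OF b(1)] hX by blast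
    ultimately have "openin (top_of_set (ball 0 R)) (ball 0 R \<inter> (\<lambda>u. b (h u)) -` (\<kappa> ` ball 0 \<rho>))"
      using continuous_openin_preimage[OF _ _ thick_chart_openin[OF k(1) open_ball subset_UNIV]] by blast
    then have "open (ball 0 R \<inter> (\<lambda>u. b (h u)) -` (\<kappa> ` ball 0 \<rho>))" using openin_open_trans by blast
    moreover have "0 \<in> ball 0 R \<inter> (\<lambda>u. b (h u)) -` (\<kappa> ` ball 0 \<rho>)" using bh0 r tp(2) by auto
    ultimately obtain e where "e > 0" "ball 0 e \<subseteq> ball 0 R \<inter> (\<lambda>u. b (h u)) -` (\<kappa> ` ball 0 \<rho>)"
      using openE by blast
    moreover have "u \<in> ball 0 e" if "norm u < min e (R / 2)" for u :: "complex \<times> real" using that by simp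
    ultimately have "norm u < min e (R / 2) \<Longrightarrow> b (h u) \<in> \<kappa> ` ball 0 \<rho>" for u by blast
    moreover have "min e (R / 2) > 0" "min e (R / 2) < R" using \<open>e > 0\<close> r by auto
    ultimately show ?thesis using that by blast
  qed
  \<comment> \<open>Continuity and injectivity already make \<open>E\<close> a chart, so the
    shrinking isotopy is available for it as well.\<close>
  define E where "E u = \<kappa> (A (\<iota> (h u)))" for u
  have ichc: "continuous_on (ball 0 R) (\<lambda>u. \<iota> (h u))"
    by (rule continuous_on_compose2[OF smooth_on_imp_continuous_on[OF i] homeomorphism_cont1[OF H(1)] hFU])
  have Ec: "continuous_on (ball 0 R) E" unfolding E_def
    by (rule continuous_on_compose2[OF homeomorphism_cont1[OF K(3)]
          continuous_on_compose2[OF Cinf_imp_continuous_on[OF AC] ichc]]) auto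
  have Ei: "inj_on E (ball 0 R)"
  proof (rule inj_onI)
    fix u v assume uv: "u \<in> ball 0 R" "v \<in> ball 0 R" "E u = E v"
    then have "A (\<iota> (h u)) = A (\<iota> (h v))" using kinj by (simp add: E_def)
    then have "\<iota> (h u) = \<iota> (h v)" using Binj by (auto simp: A_def inj_eq)
    then have "c * norm (h u - h v) \<le> 0" using c(2)[of "h u" "h v"] uv by simp
    then have "h u = h v" using c(1) by (simp add: mult_le_0_iff)
    then show "u = v" using uv homeomorphism_apply1[OF H(1)] by metis
  qed
  have EF: "E ` ball 0 R \<subseteq> F \<times> {0<..<1}"
  proof -
    have "surface_interior F \<subseteq> F" using open_chartD(3) unfolding surface_interior_def by blast
    then have "surface_interior F \<times> {0<..<1::real} \<subseteq> F \<times> {0<..<1}" by (rule Sigma_mono) simp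
    then show ?thesis using K(1) unfolding E_def by blast
  qed
  obtain Ei' where Ech: "thick_chart F (ball 0 R) E Ei'" using thick_chartI[OF F(1) open_ball Ec Ei EF] .
  obtain \<alpha> where al: "0 < \<alpha>" "\<alpha> < 1" "\<And>\<kappa> \<kappa>i n. thick_chart F (ball 0 R) \<kappa> \<kappa>i \<Longrightarrow>
    \<exists>\<theta>. iso_end F \<theta> \<and> (\<forall>y\<in>cball 0 r. \<theta> (\<kappa> y) = \<kappa> ((1 - \<alpha>) ^ n *\<^sub>R y))"
    using iso_end_shrink[OF cF r] by metis
  \<comment> \<open>Enough steps to bring the ball of radius \<open>r\<close> into the region that
    \<open>b\<close> maps into the domain of the correction \<open>\<theta>p\<close>.\<close>
  obtain n where n: "(1 - \<alpha>) ^ n < s0 / r" using real_arch_pow_inv[of "s0 / r" "1 - \<alpha>"] al s0 r by auto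
  define a where "a = (1 - \<alpha>) ^ n"
  have a: "0 < a" "a * r < s0" using al n r by (auto simp: a_def pos_less_divide_eq)
  obtain \<theta>s where ts: "iso_end F \<theta>s" "\<And>y. y\<in>cball 0 r \<Longrightarrow> \<theta>s (h y) = h (a *\<^sub>R y)"
    using al(3)[OF h, of n] unfolding a_def by blast
  obtain \<theta>e where te: "iso_end F \<theta>e" "\<And>y. y\<in>cball 0 r \<Longrightarrow> \<theta>e (E y) = E (a *\<^sub>R y)"
    using al(3)[OF Ech, of n] unfolding a_def by blast
  obtain g where g: "iso_end F g" "\<And>x. x \<in> ?X \<Longrightarrow> g (\<theta>e x) = x"
    using iso_end_inverse[OF cF te(1)] by metis
  have "g (\<theta>p (b (\<theta>s (h u)))) = \<kappa> (B (\<iota> (h u) - \<iota> (h 0)))" if u: "u \<in> cball 0 r" for u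
  proof -
    have "a * norm u \<le> a * r" using u a(1) by (intro mult_left_mono) auto
    then have "a * norm u < s0" using a(2) by linarith
    then have au: "norm (a *\<^sub>R u) < s0" using a(1) by simp
    then have auR: "a *\<^sub>R u \<in> ball 0 R" using s0(2) by simp
    obtain y where y: "y \<in> ball 0 \<rho>" "b (h (a *\<^sub>R u)) = \<kappa> y" using s0(3)[OF au] by blast
    have "h (a *\<^sub>R u) \<in> ?X" using hX auR by blast
    then have "\<theta>1 (\<kappa> y) = h (a *\<^sub>R u)" using b(3) y(2) by metis
    then have "\<theta>p (\<kappa> y) = E (a *\<^sub>R u)" using tp(4)[OF y(1)] by (simp add: m_def E_def)
    then have "\<theta>p (b (\<theta>s (h u))) = \<theta>e (E u)" using ts(2)[OF u] te(2)[OF u] y(2) by simp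
    moreover have "E u \<in> ?X" using kX unfolding E_def by blast
    ultimately show ?thesis using g(2) by (simp add: E_def A_def)
  qed
  then show ?thesis
    using that[OF Bbl Binj iso_end_comp[OF iso_end_comp[OF iso_end_comp[OF ts(1) b(1)] tp(1)] g(1)]] by blast
qed

section \<open>Thickening along a normal field\<close>

text \<open>The set need not be convex, so the mean value inequality gives local bounds only;
  compactness makes them global. The single time 0 is a dummy for a notion made for time-dependent
  maps.\<close>

lemma compact_smooth_lipschitz:
  fixes f :: "'a::euclidean_space \<Rightarrow> 'b::euclidean_space"
  assumes A: "compact A" and f: "smooth_on A f"
  obtains K where "K > 0" "\<And>x y. x \<in> A \<Longrightarrow> y \<in> A \<Longrightarrow> norm (f x - f y) \<le> K * norm (x - y)"
proof -
  have "local_lipschitz {0::real} A (\<lambda>t. f)"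
  proof (rule local_lipschitzI)
    fix x assume x: "x \<in> A"
    obtain d K where d: "d > 0" "K > 0"
      "\<And>u v. u \<in> A \<Longrightarrow> v \<in> A \<Longrightarrow> dist x u < d \<Longrightarrow> dist x v < d \<Longrightarrow> norm (f u - f v) \<le> K * norm (u - v)"
      using smooth_on_local_lipschitz[OF f x] by metis
    have "K-lipschitz_on (cball x (d / 2) \<inter> A) f"
      by (rule lipschitz_onI) (use d in \<open>auto simp: dist_norm\<close>)
    then show "\<exists>u>0. \<exists>L. \<forall>t\<in>cball t u \<inter> {0}. L-lipschitz_on (cball x u \<inter> A) f" for t :: real
      using d(1) by (intro exI[of _ "d / 2"]) auto
  qed
  then obtain L where L: "L-lipschitz_on A f"
    using local_lipschitz_compact_implies_lipschitz[where X = A and T = "{0::real}" and f = "\<lambda>t. f"] A by auto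
  show ?thesis
  proof (rule that[of "\<bar>L\<bar> + 1"])
    fix x y assume "x \<in> A" "y \<in> A"
    then have "norm (f x - f y) \<le> L * norm (x - y)" using lipschitz_onD[OF L] by (simp add: dist_norm)
    also have "\<dots> \<le> (\<bar>L\<bar> + 1) * norm (x - y)" by (intro mult_right_mono) auto
    finally show "norm (f x - f y) \<le> (\<bar>L\<bar> + 1) * norm (x - y)" .
  qed simp
qed

text \<open>Normality is first-order contact with the stereographic image of the surface, not
  orthogonality to the tangent plane of a chosen chart. The set is thus independent of charts and
  invariant under a change of sign.\<close>

definition unit_normals :: "(real^4 \<Rightarrow> real^3) \<Rightarrow> (real^4) set \<Rightarrow> real^4 \<Rightarrow> (real^3) set" where
  "unit_normals st F x = {v. norm v = 1 \<and> (\<forall>e>0. \<exists>d>0. \<forall>y\<in>F. dist x y < d \<longrightarrow>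
      \<bar>(st y - st x) \<bullet> v\<bar> \<le> e * norm (y - x))}"

text \<open>By the Lagrange identity the cross product of \<open>v\<close> and \<open>N\<close>
  vanishes, so the two vectors are collinear.\<close>

lemma perpendicular_unit_unique:
  fixes a b v N :: "real^3"
  assumes N: "N = cross3 a b" "N \<noteq> 0" and v: "v \<bullet> a = 0" "v \<bullet> b = 0" "norm v = 1"
  shows "v = (1 / norm N) *\<^sub>R N \<or> v = - ((1 / norm N) *\<^sub>R N)"
proof -
  have "cross3 v N = 0" unfolding N(1) Lagrange using v by simp
  then have "collinear {0, v, N}" using cross_eq_0 by blast
  then obtain c where c: "N = c *\<^sub>R v" using N(2) v(3) unfolding collinear_lemma by fastforce
  then have "norm N = \<bar>c\<bar>" "c \<noteq> 0" using v(3) N(2) by auto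
  then show ?thesis using c by (cases "c > 0") auto
qed

text \<open>\<open>n\<close> is the normalised cross product of the partial derivatives of a chart.
  The last clause says more than normality at each point: the contact is uniform over pairs of
  points near \<open>x0\<close>, which is what compactness can later globalise.\<close>

lemma local_unit_normal:
  assumes F: "compact_surface F" "F \<subseteq> S3 - {q}" and st: "stereo q st sti" and x0: "x0 \<in> surface_interior F"
  obtains U n where "openin (top_of_set F) U" "x0 \<in> U" "continuous_on U n"
    "\<And>x. x \<in> U \<Longrightarrow> n x \<in> unit_normals st F x" "\<And>x v. x \<in> U \<Longrightarrow> v \<in> unit_normals st F x \<Longrightarrow> v = n x \<or> v = - n x"
    "\<And>e. e > 0 \<Longrightarrow> \<exists>d>0. \<forall>x\<in>U. \<forall>y\<in>U. dist x0 x < d \<longrightarrow> dist x0 y < d \<longrightarrow>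
       \<bar>(st y - st x) \<bullet> n x\<bar> \<le> e * norm (y - x)"
proof -
  obtain c r f g where dc: "disc_chart F c r f g" "f c = x0" using surface_interior_disc_chart[OF F(1) x0] by metis
  have d: "r > 0" "Cinf (ball c r) f" "homeomorphism (ball c r) (f ` ball c r) f g"
     "openin (top_of_set F) (f ` ball c r)" "smooth_on (f ` ball c r) g"
    using dc(1) unfolding disc_chart_def by auto
  note s = stereoD[OF st]
  define U where "U = f ` ball c r"
  have UF: "U \<subseteq> F" using openin_imp_subset[OF d(4)] by (simp add: U_def)
  have fU: "f w \<in> U" "g (f w) = w" if "w \<in> ball c r" for w
    using that homeomorphism_apply1[OF d(3)] by (auto simp: U_def)
  have gU: "g x \<in> ball c r" "f (g x) = x" if "x \<in> U" for x
    using that fU unfolding U_def by auto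
  have fq: "f w \<in> S3 - {q}" if "w \<in> ball c r" for w using fU(1)[OF that] UF F(2) by blast
  define p where "p w = st (f w)" for w
  have pC: "Cinf (ball c r) p" unfolding p_def
    by (rule Cinf_compose[OF s(1) d(2)]) (use s(6)[OF fq] in auto)
  obtain p' where p': "\<And>w. w \<in> ball c r \<Longrightarrow> (p has_derivative p' w) (at w)" "\<And>v. Cinf (ball c r) (\<lambda>w. p' w v)"
    using Cinf_derivative[OF open_ball pC] by metis
  have p'c: "continuous_on (ball c r) (\<lambda>w. p' w v)" for v using Cinf_imp_continuous_on[OF p'(2)] .
  have lin: "linear (p' w)" if "w \<in> ball c r" for w
    using p'(1)[OF that] has_derivative_linear by blast
  have psplit: "p' w h = Re h *\<^sub>R p' w 1 + Im h *\<^sub>R p' w \<i>" if "w \<in> ball c r" for w h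
  proof -
    have "h = Re h *\<^sub>R 1 + Im h *\<^sub>R \<i>" by (simp add: complex_eq_iff)
    then have "p' w h = p' w (Re h *\<^sub>R 1 + Im h *\<^sub>R \<i>)" by simp
    also have "\<dots> = p' w (Re h *\<^sub>R 1) + p' w (Im h *\<^sub>R \<i>)" by (rule linear_add[OF lin[OF that]])
    finally show ?thesis by (simp only: linear_cmul[OF lin[OF that]])
  qed
  have strict: "\<exists>d>0. ball w d \<subseteq> ball c r \<and> (\<forall>z\<in>ball w d. \<forall>u\<in>ball w d. \<forall>v\<in>ball w d.
       norm (p u - p v - p' z (u - v)) \<le> e * norm (u - v))" if "w \<in> ball c r" "e > 0" for w e
    using Cinf_uniform_strict[OF open_ball that(1) p'(1) p'c that(2)] by metis
  \<comment> \<open>The projected chart has a smooth inverse, so it is immersive and its derivative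
    has no kernel.\<close>
  have inj: "inj (p' w)" if w: "w \<in> ball c r" for w
  proof -
    obtain d1 where d1: "d1 > 0" "ball w d1 \<subseteq> ball c r" using w openE[OF open_ball] by metis
    have "smooth_on (p ` ball c r) (\<lambda>y. g (sti y))"
      by (rule smooth_on_compose[OF stereo_inverse_smooth[OF st] d(5)])
         (use s(5)[OF fq] in \<open>auto simp: p_def\<close>)
    moreover have "sti (p w) = f w" if "w \<in> ball c r" for w
      using s(5)[OF fq[OF that]] unfolding p_def .
    then have "homeomorphism (ball c r) (p ` ball c r) p (\<lambda>y. g (sti y))"
      by (intro homeomorphismI Cinf_imp_continuous_on[OF pC] smooth_on_imp_continuous_on[OF calculation])
         (use fU in auto)
    ultimately have "immersive (ball c r) p w"
      by (intro immersive_diffeo Cinf_imp_smooth_on[OF open_ball pC]) (use w in auto)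
    then have im: "immersive (ball w d1) p w" by (rule immersive_cong_subset) (use d1 in auto)
    have "strict_derivative (ball w d1) p w (p' w)" unfolding strict_derivative_def
    proof (intro conjI allI impI)
      show "bounded_linear (p' w)" using p'(1)[OF w] has_derivative_bounded_linear by blast
      fix e :: real assume "e > 0"
      then show "\<exists>d>0. \<forall>u\<in>ball w d1 \<inter> ball w d. \<forall>v\<in>ball w d1 \<inter> ball w d. norm (p u - p v - p' w (u - v)) \<le> e * norm (u - v)"
        using strict[OF w] by (metis IntD2 centre_in_ball)
    qed
    then show ?thesis using immersive_derivative_inj[OF im d1(1)] by blast
  qed
  define N where "N w = cross3 (p' w 1) (p' w \<i>)" for w
  have N0: "N w \<noteq> 0" if w: "w \<in> ball c r" for w
  proof
    assume "N w = 0"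
    then have "collinear {0, p' w 1, p' w \<i>}" using cross_eq_0 unfolding N_def by blast
    then consider "p' w 1 = 0" | "p' w \<i> = 0" | k where "p' w \<i> = k *\<^sub>R p' w 1" unfolding collinear_lemma by blast
    then show False
    proof cases
      case 1 then show ?thesis using inj[OF w] linear_injective_0[OF lin[OF w]] by (metis zero_neq_one)
    next
      case 2 then show ?thesis using inj[OF w] linear_injective_0[OF lin[OF w]] by (metis complex_i_not_zero)
    next
      case 3
      then have "p' w (\<i> - of_real k) = 0"
        using linear_diff[OF lin[OF w]] linear_cmul[OF lin[OF w], of k 1] by (simp add: of_real_def)
      then have "\<i> = of_real k" using inj[OF w] linear_injective_0[OF lin[OF w]] by (metis eq_iff_diff_eq_0)
      then show ?thesis by (metis Im_complex_of_real imaginary_unit.simps(2) zero_neq_one)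
    qed
  qed
  have Nc: "continuous_on (ball c r) N" unfolding N_def
    by (rule bounded_bilinear.continuous_on[OF bilinear_conv_bounded_bilinear[THEN iffD1, OF bilinear_cross]]) (rule p'c)+
  define n where "n x = (1 / norm (N (g x))) *\<^sub>R N (g x)" for x
  have gc: "continuous_on U g" using smooth_on_imp_continuous_on[OF d(5)] by (simp add: U_def)
  have nc: "continuous_on U n" unfolding n_def
  proof (intro continuous_on_scaleR continuous_on_divide continuous_on_const continuous_on_norm ballI)
    show "continuous_on U (\<lambda>x. N (g x))" "continuous_on U (\<lambda>x. N (g x))"
      by (rule continuous_on_compose2[OF Nc gc], use gU in blast)+
  qed (use N0 gU in auto)
  have n1: "norm (n x) = 1" if "x \<in> U" for x using N0[OF gU(1)[OF that]] by (simp add: n_def)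
  have tang: "p' (g x) h \<bullet> n x = 0" if "x \<in> U" for x h
    using psplit[OF gU(1)[OF that], of h] dot_cross_self
    by (simp add: n_def N_def inner_add_left)
  have flat: "\<exists>d>0. \<forall>x\<in>U. \<forall>y\<in>U. dist x1 x < d \<longrightarrow> dist x1 y < d \<longrightarrow> \<bar>(st y - st x) \<bullet> n x\<bar> \<le> e * norm (y - x)"
    if x1: "x1 \<in> U" and e: "e > 0" for x1 e
  proof -
    obtain d1 K where K: "d1 > 0" "K > 0" "\<And>u v. u \<in> U \<Longrightarrow> v \<in> U \<Longrightarrow> dist x1 u < d1 \<Longrightarrow> dist x1 v < d1 \<Longrightarrow> norm (g u - g v) \<le> K * norm (u - v)"
      using smooth_on_local_lipschitz[OF d(5), of x1] x1 unfolding U_def by metis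
    obtain d2 where d2: "d2 > 0" "ball (g x1) d2 \<subseteq> ball c r" "\<And>z u v. z\<in>ball (g x1) d2 \<Longrightarrow> u\<in>ball (g x1) d2 \<Longrightarrow> v\<in>ball (g x1) d2 \<Longrightarrow>
       norm (p u - p v - p' z (u - v)) \<le> (e / K) * norm (u - v)"
      using strict[OF gU(1)[OF x1], of "e / K"] e K(2) by (metis divide_pos_pos)
    obtain d3 where d3: "d3 > 0" "\<And>u. u \<in> U \<Longrightarrow> dist u x1 < d3 \<Longrightarrow> dist (g u) (g x1) < d2"
      using gc x1 d2(1) unfolding continuous_on_iff by metis
    have "\<bar>(st y - st x) \<bullet> n x\<bar> \<le> e * norm (y - x)"
      if xy: "x \<in> U" "y \<in> U" "dist x1 x < min d1 d3" "dist x1 y < min d1 d3" for x y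
    proof -
      have gb: "g x \<in> ball (g x1) d2" "g y \<in> ball (g x1) d2"
        using d3(2)[of x] d3(2)[of y] xy by (simp_all add: dist_commute)
      have pe: "p (g x) = st x" "p (g y) = st y" using gU(2) xy by (auto simp: p_def)
      have "\<bar>(st y - st x) \<bullet> n x\<bar> = \<bar>(p (g y) - p (g x) - p' (g x) (g y - g x)) \<bullet> n x\<bar>"
        using tang[OF xy(1)] by (simp add: pe inner_diff_left)
      also have "\<dots> \<le> norm (p (g y) - p (g x) - p' (g x) (g y - g x)) * norm (n x)" by (rule Cauchy_Schwarz_ineq2)
      also have "\<dots> \<le> (e / K) * norm (g y - g x)" using d2(3)[OF gb(1) gb(2) gb(1)] n1[OF xy(1)] by simp
      also have "\<dots> \<le> (e / K) * (K * norm (y - x))"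
        using K(3)[of y x] xy e K(2) by (intro mult_left_mono) auto
      finally show ?thesis using K(2) by simp
    qed
    then show ?thesis using K(1) d3(1) by (intro exI[of _ "min d1 d3"]) auto
  qed
  have nn: "n x \<in> unit_normals st F x" if x: "x \<in> U" for x
    unfolding unit_normals_def
  proof (intro CollectI conjI allI impI)
    show "norm (n x) = 1" by (rule n1[OF x])
    fix e :: real assume "e > 0"
    then obtain d1 where d1: "d1 > 0" "\<forall>x'\<in>U. \<forall>y\<in>U. dist x x' < d1 \<longrightarrow> dist x y < d1 \<longrightarrow> \<bar>(st y - st x') \<bullet> n x'\<bar> \<le> e * norm (y - x')"
      using flat[OF x] by blast
    obtain T where T: "open T" "U = F \<inter> T" using d(4) unfolding U_def[symmetric] by (auto simp: openin_open)
    obtain d2 where d2: "d2 > 0" "ball x d2 \<subseteq> T" using T x openE by blast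
    have "\<bar>(st y - st x) \<bullet> n x\<bar> \<le> e * norm (y - x)" if "y \<in> F" "dist x y < min d1 d2" for y
    proof -
      have "y \<in> U" using T(2) d2(2) that by auto
      then show ?thesis using d1 x that by auto
    qed
    then show "\<exists>d>0. \<forall>y\<in>F. dist x y < d \<longrightarrow> \<bar>(st y - st x) \<bullet> n x\<bar> \<le> e * norm (y - x)"
      using d1(1) d2(1) by (intro exI[of _ "min d1 d2"]) auto
  qed
  have un: "v = n x \<or> v = - n x" if x: "x \<in> U" and v: "v \<in> unit_normals st F x" for x v
  proof -
    define w where "w = g x"
    have w: "w \<in> ball c r" "f w = x" using gU[OF x] by (auto simp: w_def)
    \<comment> \<open>A step of size s in direction \<open>h\<close> changes the height in direction
      \<open>v\<close> by at most e times s times a constant, for every e > 0. This leaves 0 as the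
      only possible first-order change.\<close>
    have perp: "v \<bullet> p' w h = 0" for h
    proof -
      obtain d1 K where K: "d1 > 0" "K > 0"
        "\<And>u u'. u \<in> ball c r \<Longrightarrow> u' \<in> ball c r \<Longrightarrow> dist w u < d1 \<Longrightarrow> dist w u' < d1 \<Longrightarrow> norm (f u - f u') \<le> K * norm (u - u')"
        using smooth_on_local_lipschitz[OF Cinf_imp_smooth_on[OF open_ball d(2) subset_refl] w(1)] by metis
      have small: "\<bar>v \<bullet> p' w h\<bar> \<le> e * ((K + 1) * norm h)" if e: "e > 0" for e
      proof (cases "h = 0")
        case True then show ?thesis using linear_0[OF lin[OF w(1)]] by simp
      next
        case h0: False
        obtain d2 where d2: "d2 > 0" "\<And>y. y \<in> F \<Longrightarrow> dist x y < d2 \<Longrightarrow> \<bar>(st y - st x) \<bullet> v\<bar> \<le> e * norm (y - x)"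
          using v e unfolding unit_normals_def by blast
        obtain d3 where d3: "d3 > 0" "ball w d3 \<subseteq> ball c r" "\<And>z u v. z\<in>ball w d3 \<Longrightarrow> u\<in>ball w d3 \<Longrightarrow> v\<in>ball w d3 \<Longrightarrow>
           norm (p u - p v - p' z (u - v)) \<le> e * norm (u - v)" using strict[OF w(1) e] by metis
        define s where "s = min (min d1 d3) (d2 / K) / (2 * norm h)"
        have s0: "s > 0" using K d2(1) d3(1) h0 by (simp add: s_def)
        have sh: "s * norm h = min (min d1 d3) (d2 / K) / 2" using h0 by (simp add: s_def)
        have mp: "min (min d1 d3) (d2 / K) > 0" using K d2(1) d3(1) by simp
        have "min (min d1 d3) (d2 / K) \<le> d1" "min (min d1 d3) (d2 / K) \<le> d3" "min (min d1 d3) (d2 / K) \<le> d2 / K" by auto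
        then have lt: "s * norm h < d1" "s * norm h < d3" "s * norm h < d2 / K" using mp sh by linarith+
        define u where "u = w + s *\<^sub>R h"
        have u: "dist w u = s * norm h" "u - w = s *\<^sub>R h" using s0 by (auto simp: u_def dist_norm)
        have ub: "u \<in> ball w d3" using u(1) lt by simp
        then have ur: "u \<in> ball c r" using d3(2) by blast
        have fl: "norm (f u - f w) \<le> K * (s * norm h)" using K(3)[OF ur w(1)] u lt K(1) s0 by simp
        also have "\<dots> < d2" using lt(3) K(2) by (simp add: pos_less_divide_eq mult.commute)
        finally have "dist x (f u) < d2" using w(2) by (simp add: dist_norm norm_minus_commute)
        then have 1: "\<bar>(p u - p w) \<bullet> v\<bar> \<le> e * (K * (s * norm h))"
          using d2(2)[of "f u"] fU(1)[OF ur] UF fl e w(2) unfolding p_def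
          by (smt (verit, best) mult_left_mono subsetD)
        have "\<bar>(p u - p w - p' w (u - w)) \<bullet> v\<bar> \<le> norm (p u - p w - p' w (u - w)) * norm v" by (rule Cauchy_Schwarz_ineq2)
        also have "\<dots> \<le> e * (s * norm h)" using d3(3)[OF _ ub, of w w] d3(1) v u s0 by (simp add: unit_normals_def)
        finally have 2: "\<bar>(p u - p w) \<bullet> v - p' w (u - w) \<bullet> v\<bar> \<le> e * (s * norm h)" by (simp add: inner_diff_left)
        have "p' w (u - w) \<bullet> v = s * (v \<bullet> p' w h)" using linear_cmul[OF lin[OF w(1)]] by (simp add: u(2) inner_commute)
        then have "\<bar>p' w (u - w) \<bullet> v\<bar> = s * \<bar>v \<bullet> p' w h\<bar>" using s0 by (simp add: abs_mult)
        then have "s * \<bar>v \<bullet> p' w h\<bar> \<le> e * (K * (s * norm h)) + e * (s * norm h)"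
          using 1 2 by linarith
        also have "\<dots> = s * (e * ((K + 1) * norm h))" by (simp add: algebra_simps)
        finally show ?thesis using s0 by simp
      qed
      show ?thesis
      proof (rule ccontr)
        assume ne: "v \<bullet> p' w h \<noteq> 0"
        define M where "M = (K + 1) * norm h"
        have "h \<noteq> 0" using ne linear_0[OF lin[OF w(1)]] by auto
        then have M: "M > 0" using K(2) by (simp add: M_def)
        have "\<bar>v \<bullet> p' w h\<bar> \<le> \<bar>v \<bullet> p' w h\<bar> / (2 * M) * M" using small[of "\<bar>v \<bullet> p' w h\<bar> / (2 * M)"] ne M by (simp add: M_def)
        then show False using M ne by simp
      qed
    qed
    have "norm v = 1" using v unfolding unit_normals_def by blast
    from perpendicular_unit_unique[OF N_def N0[OF w(1)] perp perp this]
    show ?thesis unfolding n_def w_def by simp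
  qed
  show ?thesis
    by (rule that[of U n]) (use d(4) dc(2) d(1) nc nn un flat in \<open>auto simp: U_def\<close>)
qed

lemma surface_interior_subset: "surface_interior F \<subseteq> F"
  using open_chartD(3) unfolding surface_interior_def by blast

lemma continuous_on_localI:
  fixes f :: "'a::metric_space \<Rightarrow> 'b::metric_space"
  assumes "\<And>x. x \<in> S \<Longrightarrow> \<exists>T. open T \<and> x \<in> T \<and> continuous_on (S \<inter> T) f"
  shows "continuous_on S f"
  unfolding continuous_on_eq_continuous_within
proof
  fix x assume x: "x \<in> S"
  then obtain T where T: "open T" "x \<in> T" "continuous_on (S \<inter> T) f" using assms by blast
  have "at x within S \<inter> T = at x within S" by (rule at_within_nhd[OF T(2,1)]) auto
  then show "continuous (at x within S) f"
    using T(2,3) x continuous_on_eq_continuous_within by (metis IntI)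
qed

text \<open>The sign of the normal is transported along the radii: a vector is projected in turn onto the
  normal lines at finitely many points, chosen so densely that consecutive normal lines are never
  perpendicular.\<close>

lemma normal_field_on_ball:
  fixes h :: "'a::euclidean_space \<Rightarrow> (real^4) \<times> real"
  assumes F: "compact_surface F" "F \<subseteq> S3 - {q}" and st: "stereo q st sti"
    and h: "continuous_on (cball 0 R) h" "fst ` h ` cball 0 R \<subseteq> surface_interior F" and R: "R > 0"
  obtains \<nu> where "continuous_on (cball 0 R) \<nu>"
    "\<And>u. u \<in> cball 0 R \<Longrightarrow> \<nu> u \<in> unit_normals st F (fst (h u))"
proof -
  define D where "D = cball (0::'a) R"
  \<comment> \<open>The sign is chosen arbitrarily at every point, so only expressions insensitive
    to it can be expected to be continuous.\<close>
  define N where "N u = (SOME v. v \<in> unit_normals st F (fst (h u)))" for u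
  have hc: "continuous_on D (\<lambda>u. fst (h u))" using h(1) unfolding D_def by (rule continuous_on_fst)
  have loc: "\<exists>T nl. open T \<and> u0 \<in> T \<and> continuous_on (D \<inter> T) nl \<and>
      (\<forall>u\<in>D \<inter> T. N u \<in> unit_normals st F (fst (h u)) \<and> (N u = nl u \<or> N u = - nl u))" if u0: "u0 \<in> D" for u0
  proof -
    have hu0: "fst (h u0) \<in> surface_interior F" using h(2) u0 unfolding D_def by blast
    show ?thesis
  proof (rule local_unit_normal[OF F st hu0])
    fix U n assume n: "openin (top_of_set F) U" "fst (h u0) \<in> U" "continuous_on U n"
      "\<And>x. x \<in> U \<Longrightarrow> n x \<in> unit_normals st F x" "\<And>x v. x \<in> U \<Longrightarrow> v \<in> unit_normals st F x \<Longrightarrow> v = n x \<or> v = - n x"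
    obtain V where V: "open V" "U = F \<inter> V" using n(1) by (auto simp: openin_open)
    have "openin (top_of_set D) (D \<inter> (\<lambda>u. fst (h u)) -` V)" by (rule continuous_openin_preimage_gen[OF hc V(1)])
    then obtain T where T: "open T" "D \<inter> (\<lambda>u. fst (h u)) -` V = D \<inter> T" by (auto simp: openin_open)
    have FD: "fst (h u) \<in> F" if "u \<in> D" for u
      using h(2) that surface_interior_subset[of F] unfolding D_def by blast
    have hU: "fst (h u) \<in> U" if "u \<in> D \<inter> T" for u using T(2) V(2) FD that by blast
    have "continuous_on (D \<inter> T) (\<lambda>u. n (fst (h u)))"
      by (rule continuous_on_compose2[OF n(3) continuous_on_subset[OF hc]]) (use hU in auto)
    moreover have "N u \<in> unit_normals st F (fst (h u))" if "u \<in> D \<inter> T" for u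
      unfolding N_def using n(4)[OF hU[OF that]] by (rule someI)
    moreover have "u0 \<in> T" using T(2) u0 n(2) V(2) by blast
    ultimately show ?thesis using T(1) n(5)[OF hU] by (intro exI[of _ T] exI[of _ "\<lambda>u. n (fst (h u))"]) blast
  qed
  qed
  have N: "N u \<in> unit_normals st F (fst (h u))" "norm (N u) = 1" if "u \<in> D" for u
    using loc[OF that] that unfolding unit_normals_def by blast+
  \<comment> \<open>The square removes the sign. On the diagonal it is 1, so uniform continuity
    keeps it nonzero for all sufficiently close pairs.\<close>
  define s where "s p = (N (fst p) \<bullet> N (snd p))\<^sup>2" for p
  have sc: "continuous_on (D \<times> D) s"
  proof (rule continuous_on_localI)
    fix p assume p: "p \<in> D \<times> D"
    then have p': "fst p \<in> D" "snd p \<in> D" by (auto simp: mem_Times_iff)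
    obtain T1 n1 where 1: "open T1" "fst p \<in> T1" "continuous_on (D \<inter> T1) n1" "\<And>u. u\<in>D \<inter> T1 \<Longrightarrow> N u = n1 u \<or> N u = - n1 u"
      using loc[OF p'(1)] by blast
    obtain T2 n2 where 2: "open T2" "snd p \<in> T2" "continuous_on (D \<inter> T2) n2" "\<And>u. u\<in>D \<inter> T2 \<Longrightarrow> N u = n2 u \<or> N u = - n2 u"
      using loc[OF p'(2)] by blast
    have "continuous_on ((D \<times> D) \<inter> (T1 \<times> T2)) (\<lambda>p. (n1 (fst p) \<bullet> n2 (snd p))\<^sup>2)"
      by (intro continuous_on_power continuous_on_inner
            continuous_on_compose2[OF 1(3) continuous_on_fst[OF continuous_on_id]]
            continuous_on_compose2[OF 2(3) continuous_on_snd[OF continuous_on_id]]) auto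
    moreover have "(n1 (fst p) \<bullet> n2 (snd p))\<^sup>2 = s p" if "p \<in> (D \<times> D) \<inter> (T1 \<times> T2)" for p
    proof -
      have "fst p \<in> D \<inter> T1" "snd p \<in> D \<inter> T2" using that by (auto simp: mem_Times_iff)
      then show ?thesis using 1(4)[of "fst p"] 2(4)[of "snd p"] by (auto simp: s_def)
    qed
    ultimately have "continuous_on ((D \<times> D) \<inter> (T1 \<times> T2)) s" by (rule continuous_on_eq)
    then show "\<exists>T. open T \<and> p \<in> T \<and> continuous_on ((D \<times> D) \<inter> T) s"
      using 1 2 by (intro exI[of _ "T1 \<times> T2"]) (auto simp: open_Times mem_Times_iff)
  qed
  have "compact (D \<times> D)" unfolding D_def by (intro compact_Times) auto
  then have "uniformly_continuous_on (D \<times> D) s" using compact_uniformly_continuous[OF sc] by blast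
  then obtain d where d: "d > 0" "\<And>p p'. p \<in> D \<times> D \<Longrightarrow> p' \<in> D \<times> D \<Longrightarrow> dist p' p < d \<Longrightarrow> dist (s p') (s p) < 1"
    unfolding uniformly_continuous_on_def by (metis zero_less_one)
  have np: "N u \<bullet> N v \<noteq> 0" if "u \<in> D" "v \<in> D" "dist u v < d" for u v
  proof
    assume "N u \<bullet> N v = 0"
    then have "s (u, v) = 0" by (simp add: s_def)
    moreover have "s (u, u) = 1" using N(2)[OF that(1)] by (simp add: s_def dot_square_norm)
    moreover have "dist (u, v) (u, u) = dist u v" by (simp add: dist_prod_def dist_commute)
    ultimately show False using d(2)[of "(u, u)" "(u, v)"] that by simp
  qed
  obtain k :: nat where k: "k > 0" "R / real k < d"
    using reals_Archimedean2[of "R / d"] d(1) R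
    by (metis divide_less_eq divide_pos_pos less_trans mult.commute of_nat_0_less_iff pos_divide_less_eq)
  \<comment> \<open>\<open>W i u\<close> lies on the normal line at the fraction i/k of the way from
    the centre to \<open>u\<close>. Each stage projects onto the next normal line, an operation that
    does not see the sign of \<open>N\<close>.\<close>
  define W where "W = rec_nat (\<lambda>u::'a. N 0) (\<lambda>i w u. (w u \<bullet> N ((real (Suc i) / real k) *\<^sub>R u)) *\<^sub>R N ((real (Suc i) / real k) *\<^sub>R u))"
  have W0: "W 0 u = N 0" for u by (simp add: W_def)
  have WS: "W (Suc i) u = (W i u \<bullet> N ((real (Suc i) / real k) *\<^sub>R u)) *\<^sub>R N ((real (Suc i) / real k) *\<^sub>R u)" for i u
    by (simp add: W_def)
  have sD: "(real i / real k) *\<^sub>R u \<in> D" if "u \<in> D" "i \<le> k" for i u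
  proof -
    have "(real i / real k) * norm u \<le> 1 * norm u" using that(2) k(1) by (intro mult_right_mono) auto
    then show ?thesis using that(1) by (simp add: D_def)
  qed
  have main: "continuous_on D (W i) \<and> (\<forall>u\<in>D. \<exists>t. t \<noteq> 0 \<and> W i u = t *\<^sub>R N ((real i / real k) *\<^sub>R u))" if "i \<le> k" for i
    using that
  proof (induction i)
    case 0
    have "W 0 u = 1 *\<^sub>R N ((real 0 / real k) *\<^sub>R u)" for u by (simp add: W0)
    then show ?case using W0 by (auto intro!: continuous_on_const exI[of _ 1] simp: W0[abs_def])
  next
    case (Suc i)
    then have IH: "continuous_on D (W i)" "\<And>u. u\<in>D \<Longrightarrow> \<exists>t. t \<noteq> 0 \<and> W i u = t *\<^sub>R N ((real i / real k) *\<^sub>R u)" by auto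
    let ?c = "real (Suc i) / real k"
    have "continuous_on D (W (Suc i))"
    proof (rule continuous_on_localI)
      fix u assume u: "u \<in> D"
      obtain T nl where T: "open T" "?c *\<^sub>R u \<in> T" "continuous_on (D \<inter> T) nl" "\<And>u. u\<in>D \<inter> T \<Longrightarrow> N u = nl u \<or> N u = - nl u"
        using loc[OF sD[OF u Suc.prems]] by blast
      define T' where "T' = (\<lambda>u. ?c *\<^sub>R u) -` T"
      have "open T'" unfolding T'_def by (intro open_vimage T(1) continuous_intros)
      moreover have "u \<in> T'" using T(2) by (simp add: T'_def)
      moreover have "continuous_on (D \<inter> T') (W (Suc i))"
      proof -
        have nlc: "continuous_on (D \<inter> T') (\<lambda>u. nl (?c *\<^sub>R u))"
          by (rule continuous_on_compose2[OF T(3)]) (use sD[OF _ Suc.prems] in \<open>auto simp: T'_def intro!: continuous_intros\<close>)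
        have "continuous_on (D \<inter> T') (\<lambda>u. (W i u \<bullet> nl (?c *\<^sub>R u)) *\<^sub>R nl (?c *\<^sub>R u))"
          by (intro continuous_on_scaleR continuous_on_inner nlc continuous_on_subset[OF IH(1)]) auto
        moreover have "(W i u \<bullet> nl (?c *\<^sub>R u)) *\<^sub>R nl (?c *\<^sub>R u) = W (Suc i) u" if "u \<in> D \<inter> T'" for u
          using T(4)[of "?c *\<^sub>R u"] sD[OF _ Suc.prems, of u] that unfolding WS T'_def by auto
        ultimately show ?thesis by (rule continuous_on_eq)
      qed
      ultimately show "\<exists>T. open T \<and> u \<in> T \<and> continuous_on (D \<inter> T) (W (Suc i))" by blast
    qed
    moreover have "\<exists>t. t \<noteq> 0 \<and> W (Suc i) u = t *\<^sub>R N (?c *\<^sub>R u)" if u: "u \<in> D" for u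
    proof -
      obtain t where t: "t \<noteq> 0" "W i u = t *\<^sub>R N ((real i / real k) *\<^sub>R u)" using IH(2)[OF u] by blast
      have "(real i / real k) *\<^sub>R u - ?c *\<^sub>R u = (- (1 / real k)) *\<^sub>R u"
        by (simp only: scaleR_left_diff_distrib[symmetric] of_nat_Suc) (simp add: diff_divide_distrib[symmetric])
      then have "dist ((real i / real k) *\<^sub>R u) (?c *\<^sub>R u) = norm u / real k" by (simp add: dist_norm)
      also have "\<dots> \<le> R / real k" using u k(1) by (intro divide_right_mono) (auto simp: D_def)
      finally have "dist ((real i / real k) *\<^sub>R u) (?c *\<^sub>R u) < d" using k(2) by simp
      then have "N ((real i / real k) *\<^sub>R u) \<bullet> N (?c *\<^sub>R u) \<noteq> 0"
        using np[OF sD[OF u, of i] sD[OF u Suc.prems]] Suc.prems by simp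
      then show ?thesis using t
        by (intro exI[of _ "t * (N ((real i / real k) *\<^sub>R u) \<bullet> N (?c *\<^sub>R u))"]) (simp add: WS del: of_nat_Suc)
    qed
    ultimately show ?case by blast
  qed
  define \<nu> where "\<nu> u = (1 / norm (W k u)) *\<^sub>R W k u" for u
  have Wk: "\<exists>t. t \<noteq> 0 \<and> W k u = t *\<^sub>R N u" if "u \<in> D" for u using main[of k] k(1) that by simp
  have Wn: "W k u \<noteq> 0" if "u \<in> D" for u using Wk[OF that] N(2)[OF that] by (metis norm_zero scaleR_eq_0_iff zero_neq_one)
  have "continuous_on D \<nu>" unfolding \<nu>_def
    using main[of k] Wn by (intro continuous_on_scaleR continuous_on_divide continuous_on_const continuous_on_norm) auto
  moreover have "\<nu> u \<in> unit_normals st F (fst (h u))" if u: "u \<in> D" for u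
  proof -
    obtain t where t: "t \<noteq> 0" "W k u = t *\<^sub>R N u" using Wk[OF u] by blast
    have "\<nu> u = N u \<or> \<nu> u = - N u" using t N(2)[OF u] by (cases "t > 0") (auto simp: \<nu>_def)
    moreover have "- v \<in> unit_normals st F x" if "v \<in> unit_normals st F x" for v x
      using that unfolding unit_normals_def by simp
    ultimately show ?thesis using N(1)[OF u] by metis
  qed
  ultimately show ?thesis using that unfolding D_def by blast
qed

text \<open>\<open>d\<close> is a Lebesgue number for the cover by open sets on which the estimate
  holds for all pairs. The estimate does not depend on the sign of the normal, so the local choices
  of a normal need not be compared.\<close>

lemma uniformly_flat:
  assumes F: "compact_surface F" "F \<subseteq> S3 - {q}" and st: "stereo q st sti"
    and A: "compact A" "A \<subseteq> surface_interior F" and e: "e > 0"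
  obtains d where "d > 0" "\<And>x y v. x \<in> A \<Longrightarrow> y \<in> A \<Longrightarrow> dist x y < d \<Longrightarrow> v \<in> unit_normals st F x \<Longrightarrow>
     \<bar>(st y - st x) \<bullet> v\<bar> \<le> e * norm (y - x)"
proof -
  define good where "good G \<longleftrightarrow> open G \<and> (\<forall>x\<in>A \<inter> G. \<forall>y\<in>A \<inter> G. \<forall>v\<in>unit_normals st F x. \<bar>(st y - st x) \<bullet> v\<bar> \<le> e * norm (y - x))" for G
  have "\<exists>G. good G \<and> x0 \<in> G" if x0: "x0 \<in> A" for x0
  proof -
    have x0F: "x0 \<in> surface_interior F" using A(2) x0 by blast
    show ?thesis
  proof (rule local_unit_normal[OF F st x0F])
    fix U n assume n: "openin (top_of_set F) U" "x0 \<in> U" "continuous_on U n"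
      "\<And>x. x \<in> U \<Longrightarrow> n x \<in> unit_normals st F x"
      "\<And>x v. x \<in> U \<Longrightarrow> v \<in> unit_normals st F x \<Longrightarrow> v = n x \<or> v = - n x"
      "\<And>e. e > 0 \<Longrightarrow> \<exists>d>0. \<forall>x\<in>U. \<forall>y\<in>U. dist x0 x < d \<longrightarrow> dist x0 y < d \<longrightarrow>
         \<bar>(st y - st x) \<bullet> n x\<bar> \<le> e * norm (y - x)"
    obtain d where d: "d > 0" "\<And>x y. x\<in>U \<Longrightarrow> y\<in>U \<Longrightarrow> dist x0 x < d \<Longrightarrow> dist x0 y < d \<Longrightarrow>
         \<bar>(st y - st x) \<bullet> n x\<bar> \<le> e * norm (y - x)" using n(6)[OF e] by blast
    obtain V where V: "open V" "U = F \<inter> V" using n(1) by (auto simp: openin_open)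
    note iF = surface_interior_subset[of F]
    have "\<bar>(st y - st x) \<bullet> v\<bar> \<le> e * norm (y - x)"
      if "x \<in> A \<inter> (ball x0 d \<inter> V)" "y \<in> A \<inter> (ball x0 d \<inter> V)" "v \<in> unit_normals st F x" for x y v
    proof -
      have xy: "x \<in> U" "y \<in> U" using that A(2) V(2) iF by auto
      have "\<bar>(st y - st x) \<bullet> n x\<bar> \<le> e * norm (y - x)" using d(2)[OF xy] that by simp
      then show ?thesis using n(5)[OF xy(1) that(3)] by auto
    qed
    then have "good (ball x0 d \<inter> V)" unfolding good_def using V(1) by blast
    then show ?thesis using d(1) n(2) V(2) by (intro exI[of _ "ball x0 d \<inter> V"]) auto
  qed
  qed
  then have "A \<subseteq> \<Union> {G. good G}" by blast
  then obtain d where d: "d > 0" "\<And>x. x \<in> A \<Longrightarrow> \<exists>G \<in> {G. good G}. ball x d \<subseteq> G"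
    using Heine_Borel_lemma[OF A(1), of "{G. good G}"] unfolding good_def by blast
  show ?thesis
  proof (rule that[OF d(1)])
    fix x y v assume xy: "x \<in> A" "y \<in> A" "dist x y < d" "v \<in> unit_normals st F x"
    obtain G where G: "good G" "ball x d \<subseteq> G" using d(2)[OF xy(1)] by blast
    have "x \<in> G" "y \<in> G" using G(2) xy(3) d(1) by auto
    then show "\<bar>(st y - st x) \<bullet> v\<bar> \<le> e * norm (y - x)" using G(1) xy unfolding good_def by blast
  qed
qed

text \<open>The hypotheses bound the cosine of the angle between \<open>d\<close> and
  \<open>v\<close> by 1/4 in absolute value. There is too little cancellation to push the length of
  the sum below half the sum of the lengths.\<close>

lemma transversal_lower_bound:
  fixes d v :: "'a::real_inner"
  assumes "norm v = 1" "b * D \<le> norm d" "\<bar>d \<bullet> v\<bar> \<le> b / 4 * D" 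
  shows "(b * D + \<bar>t\<bar>) / 2 \<le> norm (d + t *\<^sub>R v)"
proof -
  have vv: "v \<bullet> v = 1" using assms(1) by (simp add: dot_square_norm)
  have dv: "\<bar>d \<bullet> v\<bar> \<le> norm d / 4" using assms(2,3) by linarith
  have "(norm (d + t *\<^sub>R v))\<^sup>2 = (norm d)\<^sup>2 + 2 * (t * (d \<bullet> v)) + t\<^sup>2"
    unfolding power2_norm_eq_inner by (simp add: inner_add_left inner_add_right inner_commute vv power2_eq_square)
  moreover have "\<bar>t * (d \<bullet> v)\<bar> \<le> \<bar>t\<bar> * (norm d / 4)" unfolding abs_mult by (intro mult_left_mono dv) auto
  ultimately have 1: "(norm (d + t *\<^sub>R v))\<^sup>2 \<ge> (norm d)\<^sup>2 - \<bar>t\<bar> * norm d / 2 + t\<^sup>2" by linarith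
  have "((norm d + \<bar>t\<bar>) / 2)\<^sup>2 + 3 / 4 * (norm d - \<bar>t\<bar>)\<^sup>2 + 1 / 2 * (\<bar>t\<bar> * norm d) = (norm d)\<^sup>2 - \<bar>t\<bar> * norm d / 2 + t\<^sup>2"
    by (simp add: power2_eq_square field_simps)
  then have "((norm d + \<bar>t\<bar>) / 2)\<^sup>2 \<le> (norm d)\<^sup>2 - \<bar>t\<bar> * norm d / 2 + t\<^sup>2"
  proof -
    have "0 \<le> 3 / 4 * (norm d - \<bar>t\<bar>)\<^sup>2" "0 \<le> 1 / 2 * (\<bar>t\<bar> * norm d)" by auto
    then show ?thesis using \<open>((norm d + \<bar>t\<bar>) / 2)\<^sup>2 + 3 / 4 * (norm d - \<bar>t\<bar>)\<^sup>2 + 1 / 2 * (\<bar>t\<bar> * norm d) = (norm d)\<^sup>2 - \<bar>t\<bar> * norm d / 2 + t\<^sup>2\<close>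
      by linarith
  qed
  then have "((norm d + \<bar>t\<bar>) / 2)\<^sup>2 \<le> (norm (d + t *\<^sub>R v))\<^sup>2" using 1 by linarith
  then have "(norm d + \<bar>t\<bar>) / 2 \<le> norm (d + t *\<^sub>R v)" by (rule power2_le_imp_le) simp
  then show ?thesis using assms(2) by simp
qed

text \<open>The map is \<open>(x, t) \<mapsto> x + \<epsilon> exp (\<Lambda> t) P (x, t)\<close> with a polynomial approximation \<open>P\<close> of
  the normal field. A large \<open>\<Lambda>\<close> makes the growth in the normal direction dominate the dependence
  of \<open>P\<close> on \<open>t\<close>.\<close>

lemma exists_thickening_map:
  fixes h :: "complex \<times> real \<Rightarrow> (real^4) \<times> real"
  assumes F: "compact_surface F" "F \<subseteq> S3" "F \<noteq> S3"
    and h: "continuous_on (cball 0 R) h" "inj_on h (cball 0 R)" "h ` cball 0 R \<subseteq> surface_interior F \<times> {0<..<1}"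
    and R: "R > 0"
  obtains \<iota> :: "(real^4) \<times> real \<Rightarrow> real^3" and c where "smooth_on (F \<times> UNIV) \<iota>" "c > 0"
    "\<And>x y. x \<in> h ` cball 0 R \<Longrightarrow> y \<in> h ` cball 0 R \<Longrightarrow> c * norm (x - y) \<le> norm (\<iota> x - \<iota> y)"
proof -
  \<comment> \<open>The pole of the projection lies off the surface, so the whole surface is visible
    in \<open>real^3\<close>.\<close>
  obtain q where q: "q \<in> S3" "q \<notin> F" using F(2,3) by blast
  have Fq: "F \<subseteq> S3 - {q}" using F(2) q by blast
  obtain st sti where st: "stereo q st sti" using stereo_exists[OF q(1)] by metis
  note s = stereoD[OF st]
  have cF: "compact F" using F(1) unfolding compact_surface_def by blast
  define Y where "Y = h ` cball 0 R"
  have Yc: "compact Y" unfolding Y_def by (intro compact_continuous_image h(1) compact_cball)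
  define A where "A = fst ` Y"
  have Ac: "compact A" unfolding A_def by (intro compact_continuous_image Yc continuous_on_fst continuous_on_id)
  have AF: "A \<subseteq> surface_interior F" using h(3) by (auto simp: A_def Y_def)
  note iF = surface_interior_subset[of F]
  have stc: "continuous_on F st" by (rule smooth_on_imp_continuous_on[OF stereo_smooth[OF st Fq]])
  obtain K where K: "K > 0" "\<And>x y. x \<in> st ` F \<Longrightarrow> y \<in> st ` F \<Longrightarrow> norm (sti x - sti y) \<le> K * norm (x - y)"
    using compact_smooth_lipschitz[OF compact_continuous_image[OF stc cF] stereo_inverse_smooth[OF st]] by metis
  \<comment> \<open>A Lipschitz constant of the inverse projection, inverted, is a lower Lipschitz
    bound for \<open>st\<close> on the surface.\<close>
  define b where "b = 1 / K"
  have b: "b > 0" using K by (simp add: b_def)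
  have low: "b * norm (x - y) \<le> norm (st x - st y)" if "x \<in> F" "y \<in> F" for x y
  proof -
    have "x \<in> S3 - {q}" "y \<in> S3 - {q}" using that Fq by blast+
    then have "norm (x - y) \<le> K * norm (st x - st y)"
      using K(2)[of "st x" "st y"] that s(5)[of x] s(5)[of y] by (metis imageI)
    then show ?thesis using K(1) by (simp add: b_def divide_le_eq mult.commute)
  qed
  obtain \<eta> where eta: "\<eta> > 0" "\<And>x y v. x \<in> A \<Longrightarrow> y \<in> A \<Longrightarrow> dist x y < \<eta> \<Longrightarrow> v \<in> unit_normals st F x \<Longrightarrow>
     \<bar>(st y - st x) \<bullet> v\<bar> \<le> b / 4 * norm (y - x)"
    using uniformly_flat[OF F(1) Fq st Ac AF, of "b / 4"] b by auto
  obtain \<nu> where nu: "continuous_on (cball 0 R) \<nu>" "\<And>u. u \<in> cball 0 R \<Longrightarrow> \<nu> u \<in> unit_normals st F (fst (h u))"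
    using normal_field_on_ball[OF F(1) Fq st h(1) _ R] AF unfolding A_def Y_def by metis
  obtain hi where hi: "homeomorphism (cball 0 R) Y h hi"
    using homeomorphism_compact[OF compact_cball h(1) refl h(2)] unfolding Y_def by blast
  have hiY: "hi y \<in> cball 0 R" "h (hi y) = y" if "y \<in> Y" for y
    using homeomorphism_image2[OF hi] homeomorphism_apply2[OF hi] that by blast+
  have "continuous_on Y (\<lambda>y. \<nu> (hi y))"
    by (rule continuous_on_compose2[OF nu(1) homeomorphism_cont2[OF hi]]) (use hiY in blast)
  have nY: "\<nu> (hi y) \<in> unit_normals st F (fst y)" if "y \<in> Y" for y using nu(2)[OF hiY(1)[OF that]] hiY(2)[OF that] by simp
  \<comment> \<open>With this \<open>c\<close>, replacing the normal field by a map at distance less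
    than c/2 costs at most half of the transversal estimate.\<close>
  define c where "c = min b 1 / 2"
  have c: "c > 0" "c \<le> b / 2" "c \<le> 1 / 2" using b by (auto simp: c_def)
  \<comment> \<open>The normal field is merely continuous and is known only on the ball, while
    \<open>\<iota>\<close> has to be smooth on the product of the surface with the line. A
    polynomial is smooth everywhere.\<close>
  obtain P where P: "polynomial_function P" "\<And>y. y \<in> Y \<Longrightarrow> norm (\<nu> (hi y) - P y) < c / 2"
    using Stone_Weierstrass_polynomial_function[OF Yc \<open>continuous_on Y (\<lambda>y. \<nu> (hi y))\<close>, of "c / 2"] c(1) by auto
  have PC: "Cinf U P" for U by (rule Cinf_polynomial[OF P(1)])
  obtain L where L: "L > 0" "\<And>x y. x \<in> Y \<Longrightarrow> y \<in> Y \<Longrightarrow> norm (P x - P y) \<le> L * norm (x - y)"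
    using compact_smooth_lipschitz[OF Yc Cinf_imp_smooth_on[OF open_UNIV PC subset_UNIV]] by metis
  have Pn: "norm (P y) \<le> 2" if "y \<in> Y" for y
  proof -
    have "norm (\<nu> (hi y)) = 1" using nY[OF that] unfolding unit_normals_def by blast
    then show ?thesis using P(2)[OF that] c(3) norm_triangle_sub[of "P y" "\<nu> (hi y)"] by (simp add: norm_minus_commute)
  qed
  have trans: "(c / 2) * (norm (fst x - fst y) + \<bar>t\<bar>) \<le> norm (st (fst x) - st (fst y) + t *\<^sub>R P x)"
    if xy: "x \<in> Y" "y \<in> Y" "dist (fst x) (fst y) < \<eta>" for x y t
  proof -
    have A: "fst x \<in> A" "fst y \<in> A" using xy by (auto simp: A_def)
    then have xyF: "fst x \<in> F" "fst y \<in> F" using AF iF by auto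
    define v where "v = \<nu> (hi x)"
    have v: "v \<in> unit_normals st F (fst x)" "norm v = 1" using nY[OF xy(1)] unfolding v_def unit_normals_def by auto
    define d where "d = st (fst x) - st (fst y)"
    have "d \<bullet> v = - ((st (fst y) - st (fst x)) \<bullet> v)" by (simp add: d_def inner_diff_left)
    then have dv: "\<bar>d \<bullet> v\<bar> \<le> b / 4 * norm (fst x - fst y)"
      using eta(2)[OF A xy(3) v(1)] by (simp add: norm_minus_commute)
    have "(b * norm (fst x - fst y) + \<bar>t\<bar>) / 2 \<le> norm (d + t *\<^sub>R v)"
      by (rule transversal_lower_bound[OF v(2) _ dv]) (use low[OF xyF] in \<open>simp add: d_def\<close>)
    moreover have "c * norm (fst x - fst y) \<le> b / 2 * norm (fst x - fst y)" using c(2) by (intro mult_right_mono) auto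
    moreover have "c * \<bar>t\<bar> \<le> 1 / 2 * \<bar>t\<bar>" using c(3) by (intro mult_right_mono) auto
    ultimately have 1: "c * norm (fst x - fst y) + c * \<bar>t\<bar> \<le> norm (d + t *\<^sub>R v)" by (simp add: field_simps)
    have "norm (t *\<^sub>R (v - P x)) \<le> \<bar>t\<bar> * (c / 2)" unfolding norm_scaleR
      using P(2)[OF xy(1)] by (intro mult_left_mono) (auto simp: v_def)
    moreover have "d + t *\<^sub>R v = (d + t *\<^sub>R P x) + t *\<^sub>R (v - P x)" by (simp add: algebra_simps)
    ultimately have "norm (d + t *\<^sub>R v) \<le> norm (d + t *\<^sub>R P x) + \<bar>t\<bar> * (c / 2)"
      by (metis add_left_mono norm_triangle_le)
    moreover have "c * norm (fst x - fst y) \<ge> 0" using c by simp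
    ultimately show ?thesis using 1 unfolding d_def[symmetric] by (simp add: algebra_simps)
  qed
  \<comment> \<open>Makes the gain (c/2) t at least twice the loss that the Lipschitz constant
    \<open>L\<close> of \<open>P\<close> causes in the direction of the line.\<close>
  define \<Lambda> where "\<Lambda> = 4 * L / c"
  have La: "\<Lambda> > 0" "c * \<Lambda> = 4 * L" using L c by (auto simp: \<Lambda>_def)
  \<comment> \<open>The first bound limits the loss from horizontal distance to a quarter of
    \<open>c\<close>. The second keeps the total displacement of two points at most b \<eta> / 2,
    half the distance that the projections of far apart points are known to have.\<close>
  define \<epsilon> where "\<epsilon> = min (c / (4 * exp \<Lambda> * L)) (b * \<eta> / (8 * exp \<Lambda>))"
  have ep: "\<epsilon> > 0" using c L b eta(1) by (simp add: \<epsilon>_def)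
  have "\<epsilon> \<le> c / (4 * exp \<Lambda> * L)" "\<epsilon> \<le> b * \<eta> / (8 * exp \<Lambda>)" by (auto simp: \<epsilon>_def)
  then have ep1: "\<epsilon> * exp \<Lambda> * L \<le> c / 4" and ep2: "4 * (\<epsilon> * exp \<Lambda>) \<le> b * \<eta> / 2"
    using L(1) by (auto simp: field_simps)
  define \<theta> where "\<theta> t = exp (\<Lambda> * t)" for t :: real
  have th: "1 \<le> \<theta> t" "\<theta> t \<le> exp \<Lambda>" if "0 \<le> t" "t \<le> 1" for t
    using that La(1) by (auto simp: \<theta>_def mult_left_le)
  define \<iota> where "\<iota> y = st (fst y) + (\<epsilon> * \<theta> (snd y)) *\<^sub>R P y" for y
  define V where "V = {y::(real^4) \<times> real. fst y \<bullet> q \<noteq> 1}"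
  have V: "open V" unfolding V_def by (intro open_Collect_neq continuous_intros)
  have "Cinf V \<iota>" unfolding \<iota>_def \<theta>_def
    by (intro Cinf_add Cinf_scaleR Cinf_mult Cinf_const PC Cinf_compose[OF s(1) Cinf_fst]
          Cinf_compose[OF Cinf_exp_id[of UNIV] Cinf_mult[OF Cinf_const Cinf_snd]]) (auto simp: V_def)
  moreover have "F \<times> UNIV \<subseteq> V"
  proof
    fix y assume "y \<in> F \<times> (UNIV::real set)"
    then have "fst y \<in> S3 - {q}" using Fq by (auto simp: mem_Times_iff)
    then show "y \<in> V" using s(6) by (simp add: V_def)
  qed
  ultimately have smi: "smooth_on (F \<times> UNIV) \<iota>" by (rule Cinf_imp_smooth_on[OF V])
  obtain M where M: "M > 0" "\<And>y. y \<in> Y \<Longrightarrow> norm y \<le> M" using compact_imp_bounded[OF Yc] bounded_pos by metis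
  define c1 where "c1 = min (min (c / 4) (\<epsilon> * L)) (b * \<eta> / (4 * M))"
  have c1: "c1 > 0" "c1 \<le> c / 4" "c1 \<le> \<epsilon> * L" "c1 \<le> b * \<eta> / (4 * M)" using c ep L b eta(1) M by (auto simp: c1_def)
  \<comment> \<open>With the higher point first, t is nonnegative and dominates the height
    difference, because exp (\<Lambda> \<tau>) \<ge> 1 + \<Lambda> \<tau>.\<close>
  have near: "c1 * norm (x - y) \<le> norm (\<iota> x - \<iota> y)"
    if xy: "x \<in> Y" "y \<in> Y" "dist (fst x) (fst y) < \<eta>" "snd y \<le> snd x" for x y
  proof -
    define d where "d = st (fst x) - st (fst y)"
    define X where "X = norm (fst x - fst y)"
    define \<tau> where "\<tau> = snd x - snd y"
    have tau: "\<tau> \<ge> 0" using xy(4) by (simp add: \<tau>_def)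
    have "snd y \<in> {0<..<1}" using subsetD[OF h(3)] xy(2) unfolding Y_def by (metis mem_Times_iff)
    then have I: "0 \<le> snd y" "snd y \<le> 1" by auto
    have nxy: "norm (x - y) \<le> X + \<tau>"
      using sqrt_add_le_add_sqrt[of "(norm (fst x - fst y))\<^sup>2" "(norm (snd x - snd y))\<^sup>2"] tau
      by (simp add: norm_prod_def X_def \<tau>_def)
    have "\<theta> (snd x) = \<theta> (snd y) * exp (\<Lambda> * \<tau>)" by (simp add: \<theta>_def \<tau>_def exp_add[symmetric] algebra_simps)
    moreover have "exp (\<Lambda> * \<tau>) \<ge> 1 + \<Lambda> * \<tau>" by (rule exp_ge_add_one_self)
    ultimately have "\<theta> (snd x) \<ge> \<theta> (snd y) * (1 + \<Lambda> * \<tau>)" using th(1)[OF I] by (simp add: mult_left_mono)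
    then have g: "\<theta> (snd x) - \<theta> (snd y) \<ge> \<theta> (snd y) * (\<Lambda> * \<tau>)" by (simp add: algebra_simps)
    have g0: "\<theta> (snd y) * (\<Lambda> * \<tau>) \<ge> 0" using th(1)[OF I] La(1) tau by simp
    define t where "t = \<epsilon> * (\<theta> (snd x) - \<theta> (snd y))"
    have t: "t \<ge> \<epsilon> * (\<theta> (snd y) * (\<Lambda> * \<tau>))" unfolding t_def using g ep by (intro mult_left_mono) auto
    have t0: "t \<ge> 0" unfolding t_def using g g0 ep by (intro mult_nonneg_nonneg) auto
    have eq: "\<iota> x - \<iota> y = (d + t *\<^sub>R P x) + (\<epsilon> * \<theta> (snd y)) *\<^sub>R (P x - P y)"
      by (simp add: \<iota>_def d_def t_def algebra_simps)
    have "norm (P x - P y) \<le> L * (X + \<tau>)"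
      using L(2)[OF xy(1,2)] nxy L(1) by (meson less_imp_le mult_left_mono order_trans)
    then have "norm ((\<epsilon> * \<theta> (snd y)) *\<^sub>R (P x - P y)) \<le> (\<epsilon> * \<theta> (snd y)) * (L * (X + \<tau>))"
      unfolding norm_scaleR using ep th(1)[OF I] by (simp add: mult_left_mono)
    moreover have "(c / 2) * (X + t) \<le> norm (d + t *\<^sub>R P x)"
      using trans[OF xy(1-3), of t] t0 by (simp add: d_def X_def)
    moreover have "norm (d + t *\<^sub>R P x) \<le> norm (\<iota> x - \<iota> y) + norm ((\<epsilon> * \<theta> (snd y)) *\<^sub>R (P x - P y))"
      unfolding eq using norm_triangle_ineq4[of "(d + t *\<^sub>R P x) + (\<epsilon> * \<theta> (snd y)) *\<^sub>R (P x - P y)" "(\<epsilon> * \<theta> (snd y)) *\<^sub>R (P x - P y)"] by simp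
    ultimately have 1: "(c / 2) * (X + t) - (\<epsilon> * \<theta> (snd y)) * (L * (X + \<tau>)) \<le> norm (\<iota> x - \<iota> y)" by linarith
    have X0: "X \<ge> 0" by (simp add: X_def)
    have "\<epsilon> * \<theta> (snd y) * L \<le> \<epsilon> * exp \<Lambda> * L" using th(2)[OF I] ep L(1) by simp
    then have a1: "\<epsilon> * \<theta> (snd y) * L * X \<le> c / 4 * X" using ep1 X0 by (intro mult_right_mono) auto
    have "(c / 2) * t \<ge> (c / 2) * (\<epsilon> * (\<theta> (snd y) * (\<Lambda> * \<tau>)))" using t c(1) by (intro mult_left_mono) auto
    also have "(c / 2) * (\<epsilon> * (\<theta> (snd y) * (\<Lambda> * \<tau>))) = (c * \<Lambda>) / 2 * (\<epsilon> * \<theta> (snd y) * \<tau>)" by simp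
    also have "\<dots> = 2 * (\<epsilon> * \<theta> (snd y) * L * \<tau>)" unfolding La(2) by simp
    finally have a2: "(c / 2) * t \<ge> 2 * (\<epsilon> * \<theta> (snd y) * L * \<tau>)" .
    have "\<epsilon> * L * 1 \<le> \<epsilon> * L * \<theta> (snd y)" using th(1)[OF I] ep L(1) by (intro mult_left_mono) auto
    then have a3: "\<epsilon> * L * \<tau> \<le> \<epsilon> * \<theta> (snd y) * L * \<tau>" 
    proof -
      assume "\<epsilon> * L * 1 \<le> \<epsilon> * L * \<theta> (snd y)"
      then have "\<epsilon> * L * 1 * \<tau> \<le> \<epsilon> * L * \<theta> (snd y) * \<tau>" using tau by (rule mult_right_mono)
      then show ?thesis by (simp only: mult_1_right mult.assoc mult.commute mult.left_commute)
    qed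
    have "(c / 2) * (X + t) = c / 2 * X + c / 2 * t" "(\<epsilon> * \<theta> (snd y)) * (L * (X + \<tau>)) = \<epsilon> * \<theta> (snd y) * L * X + \<epsilon> * \<theta> (snd y) * L * \<tau>"
      by (simp_all add: algebra_simps)
    then have "c / 4 * X + \<epsilon> * L * \<tau> \<le> norm (\<iota> x - \<iota> y)" using 1 a1 a2 a3 by linarith
    moreover have "c1 * X \<le> c / 4 * X" using c1 X0 by (intro mult_right_mono) auto
    moreover have "c1 * \<tau> \<le> \<epsilon> * L * \<tau>" using c1 tau by (intro mult_right_mono) auto
    moreover have "c1 * norm (x - y) \<le> c1 * (X + \<tau>)" using nxy c1(1) by (intro mult_left_mono) auto
    ultimately show ?thesis by (simp add: distrib_left)
  qed
  have far: "c1 * norm (x - y) \<le> norm (\<iota> x - \<iota> y)"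
    if xy: "x \<in> Y" "y \<in> Y" "\<not> dist (fst x) (fst y) < \<eta>" for x y
  proof -
    have "fst x \<in> A" "fst y \<in> A" using xy by (auto simp: A_def)
    then have xyF: "fst x \<in> F" "fst y \<in> F" using AF iF by auto
    have bn: "norm ((\<epsilon> * \<theta> (snd z)) *\<^sub>R P z) \<le> 2 * (\<epsilon> * exp \<Lambda>)" if z: "z \<in> Y" for z
    proof -
      have "snd z \<in> {0<..<1}" using subsetD[OF h(3)] z unfolding Y_def by (metis mem_Times_iff)
    then have I: "0 \<le> snd z" "snd z \<le> 1" by auto
      have "\<epsilon> * \<theta> (snd z) * norm (P z) \<le> \<epsilon> * exp \<Lambda> * 2"
        using th[OF I] ep Pn[OF z] by (intro mult_mono mult_left_mono) auto
      moreover have "\<bar>\<epsilon> * \<theta> (snd z)\<bar> = \<epsilon> * \<theta> (snd z)" using th(1)[OF I] ep by simp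
      ultimately show ?thesis by simp
    qed
    have "b * \<eta> \<le> b * norm (fst x - fst y)" using xy(3) b by (intro mult_left_mono) (auto simp: dist_norm)
    also have "\<dots> \<le> norm (st (fst x) - st (fst y))" by (rule low[OF xyF])
    also have "st (fst x) - st (fst y) = (\<iota> x - \<iota> y) - ((\<epsilon> * \<theta> (snd x)) *\<^sub>R P x - (\<epsilon> * \<theta> (snd y)) *\<^sub>R P y)"
      by (simp add: \<iota>_def)
    also have "norm \<dots> \<le> norm (\<iota> x - \<iota> y) + (2 * (\<epsilon> * exp \<Lambda>) + 2 * (\<epsilon> * exp \<Lambda>))"
      by (intro order_trans[OF norm_triangle_ineq4] add_mono order_refl bn xy)
    finally have 1: "b * \<eta> / 2 \<le> norm (\<iota> x - \<iota> y)" using ep2 by linarith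
    have "norm (x - y) \<le> 2 * M" using norm_triangle_ineq4[of x y] M(2)[OF xy(1)] M(2)[OF xy(2)] by linarith
    then have "c1 * norm (x - y) \<le> (b * \<eta> / (4 * M)) * (2 * M)"
      using c1 b eta(1) M(1) by (intro mult_mono) auto
    also have "\<dots> = b * \<eta> / 2" using M(1) by simp
    finally show ?thesis using 1 by linarith
  qed
  have "c1 * norm (x - y) \<le> norm (\<iota> x - \<iota> y)" if xy: "x \<in> Y" "y \<in> Y" for x y
  proof (cases "dist (fst x) (fst y) < \<eta>")
    case True
    show ?thesis
    proof (cases "snd y \<le> snd x")
      case False
      then show ?thesis using near[OF xy(2,1)] True by (simp add: dist_commute norm_minus_commute)
    qed (use near[OF xy True] in blast)
  qed (use far[OF xy] in blast)
  then show ?thesis using that[OF smi c1(1)] unfolding Y_def by blast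
qed

section \<open>Pushing a ball off a tubular neighbourhood\<close>

lemma norm_pair_le: "norm (p :: 'a::real_normed_vector \<times> 'b::real_normed_vector) \<le> norm (fst p) + norm (snd p)"
  using sqrt_add_le_add_sqrt[of "(norm (fst p))\<^sup>2" "(norm (snd p))\<^sup>2"] by (simp add: norm_prod_def)

lemma norm_pair_mono:
  fixes p :: "'a::real_normed_vector \<times> 'b::real_normed_vector"
  assumes "norm (fst p) \<le> k * norm (fst r)" "norm (snd p) \<le> k * norm (snd r)" "k \<ge> 0"
  shows "norm p \<le> k * norm r"
proof -
  have "(norm (fst p))\<^sup>2 + (norm (snd p))\<^sup>2 \<le> (k * norm (fst r))\<^sup>2 + (k * norm (snd r))\<^sup>2"
    using assms by (intro add_mono power_mono) auto
  also have "\<dots> = k\<^sup>2 * ((norm (fst r))\<^sup>2 + (norm (snd r))\<^sup>2)" by (simp add: power_mult_distrib algebra_simps)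
  finally have "sqrt ((norm (fst p))\<^sup>2 + (norm (snd p))\<^sup>2) \<le> sqrt (k\<^sup>2 * ((norm (fst r))\<^sup>2 + (norm (snd r))\<^sup>2))"
    by (rule real_sqrt_le_mono)
  then show ?thesis using assms(3) by (simp add: norm_prod_def real_sqrt_mult)
qed

lemma norm_normalize_diff:
  fixes w w' :: complex
  assumes "1 \<le> norm w" "1 \<le> norm w'"
  shows "norm (sgn w - sgn w') \<le> 2 * norm (w - w')"
proof -
  have p: "norm w > 0" "norm w' > 0" using assms by linarith+
  have "norm w' *\<^sub>R sgn w' = w'" "inverse (norm w) *\<^sub>R w = sgn w" using p by (simp_all add: sgn_div_norm)
  moreover have "inverse (norm w) *\<^sub>R (norm w *\<^sub>R sgn w') = sgn w'" using p by simp
  ultimately have "sgn w - sgn w' = inverse (norm w) *\<^sub>R ((w - w') + (norm w' - norm w) *\<^sub>R sgn w')"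
    by (simp only: scaleR_left_diff_distrib scaleR_add_right scaleR_diff_right) simp
  also have "norm \<dots> \<le> inverse (norm w) * (norm (w - w') + \<bar>norm w' - norm w\<bar> * 1)"
  proof -
    have "norm ((w - w') + (norm w' - norm w) *\<^sub>R sgn w') \<le> norm (w - w') + norm ((norm w' - norm w) *\<^sub>R sgn w')"
      by (rule norm_triangle_ineq)
    also have "norm ((norm w' - norm w) *\<^sub>R sgn w') = \<bar>norm w' - norm w\<bar> * 1" using p by (simp add: norm_sgn)
    finally show ?thesis using p by (simp add: mult_left_mono)
  qed
  also have "\<dots> \<le> 1 * (norm (w - w') + norm (w - w'))"
    using assms p norm_triangle_ineq3[of w' w]
    by (intro mult_mono add_mono) (auto simp: norm_minus_commute field_simps)
  finally show ?thesis by simp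
qed

text \<open>Reflecting in the boundary circle: for \<open>R w = 2 w / |w| - w\<close> the combination
  \<open>2 \<sigma> (z, w / |w|) - \<sigma> (z, R w)\<close> has the same derivative along the boundary as \<open>\<sigma>\<close>, so that the
  extension is strictly differentiable there.\<close>

definition reflect_extend :: "(complex \<times> complex \<Rightarrow> 'b::real_vector) \<Rightarrow> complex \<times> complex \<Rightarrow> 'b" where
  "reflect_extend \<sigma> p = (if norm (snd p) \<le> 1 then \<sigma> p else
     2 *\<^sub>R \<sigma> (fst p, sgn (snd p)) - \<sigma> (fst p, 2 *\<^sub>R sgn (snd p) - snd p))"

lemma reflect_extend_outside:
  assumes "1 \<le> norm (snd p)"
  shows "reflect_extend \<sigma> p =
     2 *\<^sub>R \<sigma> (fst p, sgn (snd p)) - \<sigma> (fst p, 2 *\<^sub>R sgn (snd p) - snd p)"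
proof (cases "norm (snd p) = 1")
  case True
  then have "sgn (snd p) = snd p" by (simp add: sgn_div_norm)
  then have "sgn (snd p) = snd p" "2 *\<^sub>R sgn (snd p) - snd p = snd p"
    by (simp_all add: scaleR_2)
  then show ?thesis using True by (simp add: reflect_extend_def scaleR_2)
next
  case False then show ?thesis using assms by (simp add: reflect_extend_def)
qed

lemma norm_reflect:
  fixes w :: complex
  assumes "1 \<le> norm w" "norm w \<le> 2"
  shows "norm (2 *\<^sub>R sgn w - w) \<le> 1"
proof -
  have p: "norm w > 0" using assms by linarith
  have "2 *\<^sub>R sgn w - w = (2 - norm w) *\<^sub>R sgn w"
  proof -
    have "norm w *\<^sub>R sgn w = w" using p by (simp add: sgn_div_norm)
    then show ?thesis by (simp only: scaleR_left_diff_distrib)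
  qed
  then have "norm (2 *\<^sub>R sgn w - w) = \<bar>2 - norm w\<bar>" using p by (simp add: norm_sgn)
  then show ?thesis using assms by simp
qed

lemma reflect_extend_continuous:
  fixes \<sigma> :: "complex \<times> complex \<Rightarrow> 'b::real_normed_vector"
  assumes s: "continuous_on (circle \<times> cball 0 1) \<sigma>"
  shows "continuous_on (circle \<times> cball 0 (3 / 2)) (reflect_extend \<sigma>)"
proof -
  let ?A = "circle \<times> cball (0::complex) 1" and ?B = "circle \<times> (cball 0 (3 / 2) - ball (0::complex) 1)"
  have "continuous_on (?A \<union> ?B) (reflect_extend \<sigma>)"
  proof (rule continuous_on_closed_Un)
    show "closed ?A" "closed ?B" by (intro closed_Times closed_Diff; simp)+
    show "continuous_on ?A (reflect_extend \<sigma>)"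
      by (rule continuous_on_eq[OF s]) (auto simp: reflect_extend_def)
    have pc: "continuous_on ?B (\<lambda>p. sgn (snd p))"
      by (intro continuous_on_sgn continuous_on_snd continuous_on_id) auto
    have "continuous_on ?B (\<lambda>p. 2 *\<^sub>R \<sigma> (fst p, sgn (snd p)) - \<sigma> (fst p, 2 *\<^sub>R sgn (snd p) - snd p))"
    proof (intro continuous_on_diff continuous_on_scaleR continuous_on_const)
      show "continuous_on ?B (\<lambda>p. \<sigma> (fst p, sgn (snd p)))"
        by (rule continuous_on_compose2[OF s])
           (auto simp: norm_sgn intro!: continuous_on_Pair pc continuous_on_fst continuous_on_id)
      show "continuous_on ?B (\<lambda>p. \<sigma> (fst p, 2 *\<^sub>R sgn (snd p) - snd p))"
      proof (rule continuous_on_compose2[OF s])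
        show "(\<lambda>p. (fst p, 2 *\<^sub>R sgn (snd p) - snd p)) ` ?B \<subseteq> ?A"
        proof (rule image_subsetI)
          fix p assume "p \<in> ?B"
          then have "fst p \<in> circle" "1 \<le> norm (snd p)" "norm (snd p) \<le> 2" by (auto simp: mem_Times_iff)
          then show "(fst p, 2 *\<^sub>R sgn (snd p) - snd p) \<in> ?A" using norm_reflect[of "snd p"] by simp
        qed
      qed (intro continuous_on_Pair continuous_on_diff continuous_on_scaleR continuous_on_const pc
            continuous_on_fst continuous_on_snd continuous_on_id)
    qed
    then show "continuous_on ?B (reflect_extend \<sigma>)"
    proof (rule continuous_on_eq)
      fix p assume "p \<in> ?B"
      then have "1 \<le> norm (snd p)" by (auto simp: mem_Times_iff)
      from reflect_extend_outside[OF this, of \<sigma>]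
      show "2 *\<^sub>R \<sigma> (fst p, sgn (snd p)) - \<sigma> (fst p, 2 *\<^sub>R sgn (snd p) - snd p) = reflect_extend \<sigma> p" by simp
    qed
  qed
  moreover have "?A \<union> ?B = circle \<times> cball 0 (3 / 2)" by auto
  ultimately show ?thesis by simp
qed

text \<open>At a boundary point the extension differs from the linear map \<open>L\<close> of
  \<sigma> by an error of 9e on either side of the boundary circle, and of 18e across it. On the
  differences that occur, \<open>L\<close> is bounded below by c - e. Since e = c/40 is less than
  c/19, two points cannot have the same image.\<close>

lemma reflect_extend_locally_injective:
  fixes \<sigma> :: "complex \<times> complex \<Rightarrow> 'b::euclidean_space"
  assumes h: "homeomorphism (circle \<times> cball 0 1) V \<sigma> \<rho>"
    and s: "smooth_on (circle \<times> cball 0 1) \<sigma>" "smooth_on V \<rho>"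
    and z0: "z0 \<in> circle" "norm w0 = 1"
  obtains d where "d > 0" "inj_on (reflect_extend \<sigma>) (circle \<times> UNIV \<inter> ball (z0, w0) d)"
proof -
  define A where "A = circle \<times> cball (0::complex) 1"
  define T where "T = reflect_extend \<sigma>"
  define x0 where "x0 = (z0, w0)"
  have x0: "x0 \<in> A" using z0 by (simp add: A_def x0_def)
  have "immersive A \<sigma> x0" using immersive_diffeo[OF h s] x0 unfolding A_def by blast
  then obtain L c d0 where L: "strict_derivative A \<sigma> x0 L" "c > 0" "d0 > 0"
    "\<And>u v. u \<in> A \<Longrightarrow> v \<in> A \<Longrightarrow> dist x0 u < d0 \<Longrightarrow> dist x0 v < d0 \<Longrightarrow> c * norm (u - v) \<le> norm (\<sigma> u - \<sigma> v)"
    using immersiveE by metis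
  have Llin: "linear L" using L(1) bounded_linear.linear unfolding strict_derivative_def by blast
  define e where "e = c / 40"
  have e: "e > 0" using L(2) by (simp add: e_def)
  obtain d1 where d1: "d1 > 0" "\<And>u v. u \<in> A \<Longrightarrow> v \<in> A \<Longrightarrow> dist x0 u < d1 \<Longrightarrow> dist x0 v < d1 \<Longrightarrow>
       norm (\<sigma> u - \<sigma> v - L (u - v)) \<le> e * norm (u - v)"
    using strict_derivativeD[OF L(1) e] by metis
  define d where "d = min (min d0 d1) 1 / 10"
  have d: "d > 0" "10 * d \<le> d0" "10 * d \<le> d1" "d \<le> 1 / 10" using L(3) d1(1) by (auto simp: d_def)
  define N where "N = (circle \<inter> ball z0 d) \<times> ball w0 d"
  have NA: "u \<in> A" if "u \<in> N" "norm (snd u) \<le> 1" for u using that by (auto simp: N_def A_def mem_Times_iff)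
  have Nd: "dist x0 u < 2 * d" "norm (fst u) = 1" "norm (snd u - w0) < d" if "u \<in> N" for u
  proof -
    have *: "norm (z0 - fst u) < d" "norm (w0 - snd u) < d" "norm (fst u) = 1" using that by (auto simp: N_def dist_norm)
    then show "dist x0 u < 2 * d" using norm_pair_le[of "x0 - u"] by (simp add: dist_norm x0_def)
    show "norm (fst u) = 1" "norm (snd u - w0) < d" using * by (simp_all add: norm_minus_commute)
  qed
  have w2: "norm (snd u) \<le> 2" if "u \<in> N" for u
  proof -
    have "norm (snd u - w0) \<le> 1" using Nd(3)[OF that] d(4) by simp
    then show ?thesis using norm_triangle_sub[of "snd u" w0] z0(2) by linarith
  qed
  define pr where "pr u = (fst u, sgn (snd u))" for u :: "complex \<times> complex"
  define rf where "rf u = (fst u, 2 *\<^sub>R sgn (snd u) - snd u)" for u :: "complex \<times> complex"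
  have prx0: "pr x0 = x0" "rf x0 = x0" using z0 by (simp_all add: pr_def rf_def x0_def scaleR_2 sgn_div_norm)
  have prl: "norm (pr u - pr v) \<le> 2 * norm (u - v)" if "1 \<le> norm (snd u)" "1 \<le> norm (snd v)" for u v
    by (rule norm_pair_mono) (use norm_normalize_diff[OF that] in \<open>auto simp: pr_def\<close>)
  have rfl: "norm (rf u - rf v) \<le> 5 * norm (u - v)" if "1 \<le> norm (snd u)" "1 \<le> norm (snd v)" for u v
  proof (rule norm_pair_mono)
    have "snd (rf u - rf v) = 2 *\<^sub>R (sgn (snd u) - sgn (snd v)) - (snd u - snd v)"
      by (simp add: rf_def algebra_simps)
    then have "norm (snd (rf u - rf v)) \<le> 2 * norm (sgn (snd u) - sgn (snd v)) + norm (snd u - snd v)"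
      using norm_triangle_ineq4[of "2 *\<^sub>R (sgn (snd u) - sgn (snd v))" "snd u - snd v"] by simp
    then show "norm (snd (rf u - rf v)) \<le> 5 * norm (snd (u - v))" using norm_normalize_diff[OF that] by simp
  qed (auto simp: rf_def)
  have prA: "pr u \<in> A" "rf u \<in> A" if "u \<in> N" "1 \<le> norm (snd u)" for u
  proof -
    have "norm (snd u) > 0" using that by linarith
    then show "pr u \<in> A" using Nd(2)[OF that(1)] by (simp add: pr_def A_def norm_sgn)
    show "rf u \<in> A" using Nd(2)[OF that(1)] norm_reflect[OF that(2) w2[OF that(1)]] by (simp add: rf_def A_def)
  qed
  have prd: "dist x0 (pr u) < d1" "dist x0 (rf u) < d1" if "u \<in> N" "1 \<le> norm (snd u)" for u
  proof -
    have 1: "1 \<le> norm (snd x0)" using z0 by (simp add: x0_def)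
    have "norm (x0 - u) < 2 * d" using Nd(1)[OF that(1)] by (simp add: dist_norm)
    then show "dist x0 (pr u) < d1" "dist x0 (rf u) < d1"
      using prl[OF 1 that(2)] rfl[OF 1 that(2)] d prx0 by (auto simp: dist_norm)
  qed
  have inside: "norm (T u - T v - L (u - v)) \<le> 9 * e * norm (u - v)"
    if "u \<in> N" "v \<in> N" "norm (snd u) \<le> 1" "norm (snd v) \<le> 1" for u v
  proof -
    have "dist x0 u < d1" "dist x0 v < d1" using Nd(1)[OF that(1)] Nd(1)[OF that(2)] d by simp_all
    then have "norm (T u - T v - L (u - v)) \<le> e * norm (u - v)"
      using d1(2) NA that unfolding T_def reflect_extend_def by simp
    also have "\<dots> \<le> 9 * e * norm (u - v)" using e by (intro mult_right_mono) auto
    finally show ?thesis .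
  qed
  have outside: "norm (T u - T v - L (u - v)) \<le> 9 * e * norm (u - v)"
    if u: "u \<in> N" "1 \<le> norm (snd u)" and v: "v \<in> N" "1 \<le> norm (snd v)" for u v
  proof -
    have Tu: "T u = 2 *\<^sub>R \<sigma> (pr u) - \<sigma> (rf u)" "T v = 2 *\<^sub>R \<sigma> (pr v) - \<sigma> (rf v)"
      using reflect_extend_outside[OF u(2), of \<sigma>] reflect_extend_outside[OF v(2), of \<sigma>]
      by (simp_all add: T_def pr_def rf_def)
    \<comment> \<open>The identity is twice the radial retraction minus the reflection. Their
      Lipschitz constants 2 and 5 produce the factor 2 * 2 + 5 = 9.\<close>
    have "u - v = 2 *\<^sub>R (pr u - pr v) - (rf u - rf v)"
      by (simp add: pr_def rf_def prod_eq_iff algebra_simps scaleR_2)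
    then have "L (u - v) = 2 *\<^sub>R L (pr u - pr v) - L (rf u - rf v)"
      by (simp only: linear_cmul[OF Llin] linear_diff[OF Llin])
    then have eq: "T u - T v - L (u - v) =
       2 *\<^sub>R (\<sigma> (pr u) - \<sigma> (pr v) - L (pr u - pr v)) - (\<sigma> (rf u) - \<sigma> (rf v) - L (rf u - rf v))"
      unfolding Tu by (simp add: algebra_simps)
    have "norm (\<sigma> (pr u) - \<sigma> (pr v) - L (pr u - pr v)) \<le> e * norm (pr u - pr v)"
      by (rule d1(2)) (use prA prd u v in auto)
    also have "\<dots> \<le> e * (2 * norm (u - v))" using prl[OF u(2) v(2)] e by (intro mult_left_mono) auto
    finally have 1: "norm (\<sigma> (pr u) - \<sigma> (pr v) - L (pr u - pr v)) \<le> e * (2 * norm (u - v))" .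
    have "norm (\<sigma> (rf u) - \<sigma> (rf v) - L (rf u - rf v)) \<le> e * norm (rf u - rf v)"
      by (rule d1(2)) (use prA prd u v in auto)
    also have "\<dots> \<le> e * (5 * norm (u - v))" using rfl[OF u(2) v(2)] e by (intro mult_left_mono) auto
    finally have 2: "norm (\<sigma> (rf u) - \<sigma> (rf v) - L (rf u - rf v)) \<le> e * (5 * norm (u - v))" .
    have "norm (T u - T v - L (u - v)) \<le> norm (2 *\<^sub>R (\<sigma> (pr u) - \<sigma> (pr v) - L (pr u - pr v))) + norm (\<sigma> (rf u) - \<sigma> (rf v) - L (rf u - rf v))"
      unfolding eq by (rule norm_triangle_ineq4)
    then have "norm (T u - T v - L (u - v)) \<le> 2 * (e * (2 * norm (u - v))) + e * (5 * norm (u - v))" using 1 2 by simp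
    then show ?thesis by (simp add: algebra_simps)
  qed
  have mixed: "norm (T u - T v - L (u - v)) \<le> 18 * e * norm (u - v)"
    if u: "u \<in> N" "norm (snd u) \<le> 1" and v: "v \<in> N" "1 \<le> norm (snd v)" for u v
  proof -
    \<comment> \<open>The segment between the second coordinates meets the unit circle. The
      estimates for the two sides apply to the two halves of the way.\<close>
    have "\<exists>s\<ge>0. s \<le> 1 \<and> norm (snd u + s *\<^sub>R (snd v - snd u)) = 1"
      by (rule IVT') (use u(2) v(2) in \<open>auto intro!: continuous_intros\<close>)
    then obtain s where s: "0 \<le> s" "s \<le> 1" "norm (snd u + s *\<^sub>R (snd v - snd u)) = 1" by blast
    define m where "m = (fst u, snd u + s *\<^sub>R (snd v - snd u))"
    have mu: "norm (m - u) \<le> 1 * norm (v - u)"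
      by (rule norm_pair_mono) (use s mult_left_le_one_le[of "norm (snd v - snd u)" s] in \<open>auto simp: m_def\<close>)
    have vm: "norm (v - m) \<le> 1 * norm (v - u)"
    proof (rule norm_pair_mono)
      have "snd (v - m) = (1 - s) *\<^sub>R (snd v - snd u)" by (simp add: m_def algebra_simps)
      then show "norm (snd (v - m)) \<le> 1 * norm (snd (v - u))"
        using s mult_left_le_one_le[of "norm (snd v - snd u)" "1 - s"] by simp
    qed (auto simp: m_def)
    have "(1 - s) *\<^sub>R snd u + s *\<^sub>R snd v \<in> ball w0 d"
      using u(1) v(1) s by (intro convexD[OF convex_ball]) (auto simp: N_def)
    then have mN: "m \<in> N" using u(1) by (auto simp: N_def m_def algebra_simps)
    have m1: "norm (snd m) = 1" using s(3) by (simp add: m_def)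
    have "T u - T v - L (u - v) = (T u - T m - L (u - m)) + (T m - T v - L (m - v))"
      by (simp add: linear_diff[OF Llin])
    then have "norm (T u - T v - L (u - v)) \<le> norm (T u - T m - L (u - m)) + norm (T m - T v - L (m - v))"
      by (metis norm_triangle_ineq)
    also have "\<dots> \<le> 9 * e * norm (u - m) + 9 * e * norm (m - v)"
      using inside[OF u(1) mN u(2)] outside[OF mN _ v] m1 by (intro add_mono) auto
    also have "\<dots> \<le> 9 * e * norm (u - v) + 9 * e * norm (u - v)"
      using mu vm e by (intro add_mono mult_left_mono) (auto simp: norm_minus_commute)
    finally show ?thesis by simp
  qed
  have upper: "norm (T u - T v - L (u - v)) \<le> 18 * e * norm (u - v)" if uv: "u \<in> N" "v \<in> N" for u v
  proof -
    have "9 * e * norm (u - v) \<le> 18 * e * norm (u - v)" using e by (intro mult_right_mono) auto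
    moreover have "norm (T u - T v - L (u - v)) = norm (T v - T u - L (v - u))"
    proof -
      have "L (v - u) = - L (u - v)" using linear_diff[OF Llin] by simp
      then have "T v - T u - L (v - u) = - (T u - T v - L (u - v))" by simp
      then show ?thesis by (metis norm_minus_cancel)
    qed
    ultimately show ?thesis
      using inside[OF uv] outside[OF uv(1) _ uv(2)] mixed[OF uv(1) _ uv(2)] mixed[OF uv(2) _ uv(1)]
      by (cases "norm (snd u) \<le> 1"; cases "norm (snd v) \<le> 1") (auto simp: norm_minus_commute)
  qed
  \<comment> \<open>The lower bound is known only for points of \<open>A\<close>. A common inward
    translation by d w0 brings both points into \<open>A\<close> and leaves their difference
    unchanged.\<close>
  define sh where "sh u = u - (0, d *\<^sub>R w0)" for u :: "complex \<times> complex"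
  have shA: "sh u \<in> A" "dist x0 (sh u) < 3 * d" if "u \<in> N" for u
  proof -
    have "snd (sh u) = (snd u - w0) + (1 - d) *\<^sub>R w0" by (simp add: sh_def algebra_simps)
    then have "norm (snd (sh u)) \<le> norm (snd u - w0) + norm ((1 - d) *\<^sub>R w0)" by (metis norm_triangle_ineq)
    also have "norm ((1 - d) *\<^sub>R w0) = 1 - d" using z0(2) d by simp
    finally have "norm (snd (sh u)) \<le> 1" using Nd(3)[OF that] by simp
    then show "sh u \<in> A" using Nd(2)[OF that] by (simp add: A_def sh_def mem_Times_iff)
    have "norm (x0 - sh u) \<le> norm (x0 - u) + norm (0::complex, d *\<^sub>R w0)"
      using norm_triangle_ineq[of "x0 - u" "(0, d *\<^sub>R w0)"] by (simp add: sh_def algebra_simps)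
    then show "dist x0 (sh u) < 3 * d" using Nd(1)[OF that] z0(2) d(1) by (simp add: dist_norm norm_Pair1 norm_Pair2)
  qed
  have lower: "(c - e) * norm (u - v) \<le> norm (L (u - v))" if uv: "u \<in> N" "v \<in> N" for u v
  proof -
    have eq: "sh u - sh v = u - v" by (simp add: sh_def)
    have dd: "dist x0 (sh u) < d0" "dist x0 (sh v) < d0" "dist x0 (sh u) < d1" "dist x0 (sh v) < d1"
      using shA(2)[OF uv(1)] shA(2)[OF uv(2)] d by linarith+
    have "c * norm (u - v) \<le> norm (\<sigma> (sh u) - \<sigma> (sh v))"
      using L(4)[OF shA(1)[OF uv(1)] shA(1)[OF uv(2)] dd(1,2)] by (simp add: eq)
    moreover have "norm (\<sigma> (sh u) - \<sigma> (sh v) - L (u - v)) \<le> e * norm (u - v)"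
      using d1(2)[OF shA(1)[OF uv(1)] shA(1)[OF uv(2)] dd(3,4)] by (simp add: eq)
    moreover have "norm (\<sigma> (sh u) - \<sigma> (sh v)) \<le> norm (L (u - v)) + norm (\<sigma> (sh u) - \<sigma> (sh v) - L (u - v))"
      by (rule norm_triangle_sub)
    ultimately show ?thesis by (simp add: left_diff_distrib)
  qed
  have "inj_on T N"
  proof (rule inj_onI)
    fix u v assume uv: "u \<in> N" "v \<in> N" "T u = T v"
    have "norm (L (u - v)) \<le> 18 * e * norm (u - v)" using upper[OF uv(1,2)] uv(3) by simp
    then have "(c - e) * norm (u - v) \<le> 18 * e * norm (u - v)" using lower[OF uv(1,2)] by linarith
    then have "(c - 19 * e) * norm (u - v) \<le> 0" by (simp add: algebra_simps)
    moreover have "c - 19 * e > 0" using L(2) by (simp add: e_def)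
    ultimately have "norm (u - v) \<le> 0" by (simp add: mult_le_0_iff)
    then show "u = v" by simp
  qed
  moreover have "circle \<times> UNIV \<inter> ball x0 d \<subseteq> N"
  proof
    fix u assume u: "u \<in> circle \<times> UNIV \<inter> ball x0 d"
    have "dist z0 (fst u) \<le> dist x0 u" "dist w0 (snd u) \<le> dist x0 u"
      using dist_fst_le[of x0 u] dist_snd_le[of x0 u] by (auto simp: x0_def)
    then show "u \<in> N" using u by (auto simp: N_def mem_Times_iff)
  qed
  ultimately show ?thesis using that[of d] d(1) inj_on_subset unfolding T_def x0_def by blast
qed

text \<open>Otherwise distinct points with equal image exist in ever thinner neighbourhoods and
  accumulate at a pair in the closed solid torus. Injectivity there makes the two limits equal, and
  local injectivity at the common limit excludes the pairs.\<close>

lemma injective_near_compact: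
  fixes T :: "complex \<times> complex \<Rightarrow> 'b::metric_space"
  assumes c: "continuous_on (circle \<times> cball 0 (3 / 2)) T" and i: "inj_on T (circle \<times> cball 0 1)"
    and l: "\<And>z w. z \<in> circle \<Longrightarrow> norm w = 1 \<Longrightarrow> \<exists>d>0. inj_on T (circle \<times> UNIV \<inter> ball (z, w) d)"
  obtains e where "0 < e" "e \<le> 1 / 2" "inj_on T (circle \<times> cball 0 (1 + e))"
proof -
  let ?S = "circle \<times> cball (0::complex) (3 / 2)"
  \<comment> \<open>The double successor keeps all radii at most 3/2, inside the set on which
    \<open>T\<close> is continuous.\<close>
  have "\<exists>n. inj_on T (circle \<times> cball 0 (1 + inverse (real (Suc (Suc n)))))"
  proof (rule ccontr)
    assume "\<nexists>n. inj_on T (circle \<times> cball 0 (1 + inverse (real (Suc (Suc n)))))"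
    then have "\<exists>p. fst p \<in> circle \<times> cball 0 (1 + inverse (real (Suc (Suc n)))) \<and>
        snd p \<in> circle \<times> cball 0 (1 + inverse (real (Suc (Suc n)))) \<and> T (fst p) = T (snd p) \<and> fst p \<noteq> snd p" for n
      unfolding inj_on_def by (metis fst_conv snd_conv)
    then obtain P where P: "\<And>n. fst (P n) \<in> circle \<times> cball 0 (1 + inverse (real (Suc (Suc n))))"
       "\<And>n. snd (P n) \<in> circle \<times> cball 0 (1 + inverse (real (Suc (Suc n))))"
       "\<And>n. T (fst (P n)) = T (snd (P n))" "\<And>n. fst (P n) \<noteq> snd (P n)" by metis
    have le: "1 + inverse (real (Suc (Suc n))) \<le> 3 / 2" for n by (simp add: field_simps)
    have sub: "circle \<times> cball (0::complex) (1 + inverse (real (Suc (Suc n)))) \<subseteq> ?S" for n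
      by (rule Sigma_mono[OF subset_refl]) (use le[of n] in \<open>simp add: subset_cball\<close>)
    have PS: "P n \<in> ?S \<times> ?S" for n
      using subsetD[OF sub P(1)[of n]] subsetD[OF sub P(2)[of n]] by (simp add: mem_Times_iff)
    have "compact (?S \<times> ?S)" by (intro compact_Times) auto
    then obtain r p where rp: "strict_mono (r :: nat \<Rightarrow> nat)" "p \<in> ?S \<times> ?S" "(P \<circ> r) \<longlonglongrightarrow> p"
      using PS unfolding compact_def by blast
    have lim1: "(\<lambda>n. fst (P (r n))) \<longlonglongrightarrow> fst p" and lim2: "(\<lambda>n. snd (P (r n))) \<longlonglongrightarrow> snd p"
      using tendsto_fst[OF rp(3)] tendsto_snd[OF rp(3)] by (simp_all add: o_def)
    have pS: "fst p \<in> ?S" "snd p \<in> ?S" using rp(2) by (simp_all add: mem_Times_iff)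
    have inv0: "(\<lambda>n. 1 + inverse (real (Suc (Suc (r n))))) \<longlonglongrightarrow> 1 + 0"
      by (intro tendsto_add tendsto_const LIMSEQ_subseq_LIMSEQ[OF LIMSEQ_Suc[OF LIMSEQ_inverse_real_of_nat] rp(1), unfolded o_def])
    have b1: "norm (snd (fst p)) \<le> 1"
      using LIMSEQ_le[OF tendsto_norm[OF tendsto_snd[OF lim1]] inv0] P(1) by (force simp: mem_Times_iff)
    have b2: "norm (snd (snd p)) \<le> 1"
      using LIMSEQ_le[OF tendsto_norm[OF tendsto_snd[OF lim2]] inv0] P(2) by (force simp: mem_Times_iff)
    have A: "fst p \<in> circle \<times> cball 0 1" "snd p \<in> circle \<times> cball 0 1" using pS b1 b2 by (auto simp: mem_Times_iff)
    have tl: "(\<lambda>n. T (fst (P (r n)))) \<longlonglongrightarrow> T (fst p)" "(\<lambda>n. T (snd (P (r n)))) \<longlonglongrightarrow> T (snd p)"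
    proof -
      have m: "fst (P n) \<in> ?S" "snd (P n) \<in> ?S" for n using PS[of n] by (simp_all add: mem_Times_iff)
      show "(\<lambda>n. T (fst (P (r n)))) \<longlonglongrightarrow> T (fst p)"
        by (rule continuous_on_tendsto_compose[OF c lim1 pS(1)]) (rule always_eventually, rule allI, rule m)
      show "(\<lambda>n. T (snd (P (r n)))) \<longlonglongrightarrow> T (snd p)"
        by (rule continuous_on_tendsto_compose[OF c lim2 pS(2)]) (rule always_eventually, rule allI, rule m)
    qed
    have "T (fst p) = T (snd p)" using LIMSEQ_unique[OF tl(1)[unfolded P(3)] tl(2)] .
    then have eq: "fst p = snd p" by (rule inj_onD[OF i _ A])
    obtain d where d: "d > 0" "inj_on T (circle \<times> cball 0 (3 / 2) \<inter> ball (fst p) d)"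
    proof (cases "norm (snd (fst p)) = 1")
      case True
      then obtain d where d: "d > 0" "inj_on T (circle \<times> UNIV \<inter> ball (fst (fst p), snd (fst p)) d)"
      proof -
        have "fst (fst p) \<in> circle" using A(1) by (metis mem_Times_iff)
        from l[OF this True] show ?thesis using that by blast
      qed
      have "inj_on T (circle \<times> cball 0 (3 / 2) \<inter> ball (fst p) d)"
        by (rule inj_on_subset[OF d(2)[unfolded prod.collapse]]) (intro Int_mono Sigma_mono order_refl subset_UNIV)
      then show ?thesis using that[OF d(1)] by blast
    next
      case False
      then have lt: "norm (snd (fst p)) < 1" using b1 by simp
      define d where "d = 1 - norm (snd (fst p))"
      have "circle \<times> cball 0 (3 / 2) \<inter> ball (fst p) d \<subseteq> circle \<times> cball (0::complex) 1"
      proof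
        fix u assume u: "u \<in> circle \<times> cball (0::complex) (3 / 2) \<inter> ball (fst p) d"
        have "dist (snd (fst p)) (snd u) < d" using u dist_snd_le[of "fst p" u] by auto
        then have "norm (snd u) \<le> 1" using norm_triangle_sub[of "snd u" "snd (fst p)"]
          by (simp add: d_def dist_norm norm_minus_commute)
        then show "u \<in> circle \<times> cball 0 1" using u by (auto simp: mem_Times_iff)
      qed
      then have "inj_on T (circle \<times> cball 0 (3 / 2) \<inter> ball (fst p) d)" using i inj_on_subset by blast
      moreover have "d > 0" using lt by (simp add: d_def)
      ultimately show ?thesis using that by blast
    qed
    have "eventually (\<lambda>n. dist (fst (P (r n))) (fst p) < d) sequentially"
      "eventually (\<lambda>n. dist (snd (P (r n))) (fst p) < d) sequentially"
      using tendstoD[OF lim1 d(1)] tendstoD[OF lim2 d(1)] eq by simp_all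
    then obtain n where n: "dist (fst (P (r n))) (fst p) < d" "dist (snd (P (r n))) (fst p) < d"
      using eventually_happens[OF eventually_conj] by force
    then have "fst (P (r n)) = snd (P (r n))"
      using inj_onD[OF d(2) P(3)[of "r n"]] PS[of "r n"]
      by (simp add: mem_Times_iff dist_commute del: mem_cball mem_sphere)
    then show False using P(4) by blast
  qed
  then obtain n where "inj_on T (circle \<times> cball 0 (1 + inverse (real (Suc (Suc n)))))" by blast
  then show ?thesis using that[of "inverse (real (Suc (Suc n)))"] by (simp add: field_simps)
qed

section \<open>A collar of the tube and the push along its radii\<close>

lemma compact_gap:
  fixes f :: "'a::metric_space \<Rightarrow> real"
  assumes "compact S" "continuous_on S f" "\<And>p. p \<in> S \<Longrightarrow> f p > a" "b > 0"
  obtains e where "0 < e" "e \<le> b" "\<And>p. p \<in> S \<Longrightarrow> f p > a + e"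
proof (cases "S = {}")
  case True then show ?thesis using that[of b] assms(4) by auto
next
  case False
  then obtain p0 where p0: "p0 \<in> S" "\<And>p. p \<in> S \<Longrightarrow> f p0 \<le> f p"
    using continuous_attains_inf[OF assms(1) _ assms(2)] by blast
  define e where "e = min b ((f p0 - a) / 2)"
  have "f p0 > a" using assms(3) p0(1) by blast
  then have "0 < e" "e \<le> b" "a + e < f p0" using assms(4) by (auto simp: e_def min_def field_simps)
  then show ?thesis using that p0(2) by (metis less_le_trans)
qed

lemma compact_preimage:
  fixes f :: "'a::metric_space \<Rightarrow> 'b::metric_space"
  assumes "compact S" "continuous_on S f" "closed C"
  shows "compact (S \<inter> f -` C)"
proof -
  have "closedin (top_of_set S) (S \<inter> f -` C)" by (rule continuous_closedin_preimage[OF assms(2,3)])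
  then show ?thesis using closedin_compact[OF assms(1)] by blast
qed

lemma cis_inj_on_ball: "inj_on cis (ball s 1)"
proof (rule inj_onI)
  fix x y assume xy: "x \<in> ball s 1" "y \<in> ball s 1" "cis x = cis y"
  have "cis (x - y) = 1" using xy(3) by (simp add: cis_divide[symmetric])
  then have "sin (x - y) = 0" by (metis cis.simps(2) one_complex.simps(2))
  moreover have "\<bar>x - y\<bar> < 2" using xy(1,2) by (simp add: dist_real_def)
  then have "- pi < x - y" "x - y < pi" using pi_gt3 by linarith+
  ultimately show "x = y" using sin_eq_0_pi by fastforce
qed

lemma circle_cis: "z \<in> circle \<Longrightarrow> \<exists>a. z = cis a"
  using complex_norm_eq_1_exp cis_conv_exp by (metis mem_sphere_0)

text \<open>Locally the angle parametrises the circle, so invariance of domain applies on open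
  subsets of \<open>real \<times> complex\<close>, whose dimension is three.\<close>

lemma solid_torus_image_open:
  fixes T :: "complex \<times> complex \<Rightarrow> 'b::euclidean_space"
  assumes T: "continuous_on (circle \<times> ball 0 r) T" "inj_on T (circle \<times> ball 0 r)" and D: "DIM('b) = 3"
  shows "open (T ` (circle \<times> ball 0 r))"
proof (subst open_subopen, rule ballI)
  fix y assume "y \<in> T ` (circle \<times> ball 0 r)"
  then obtain z0 w0 where zw: "z0 \<in> circle" "w0 \<in> ball 0 r" "y = T (z0, w0)" by blast
  obtain s0 where s0: "z0 = cis s0" using circle_cis[OF zw(1)] by blast
  define P where "P = ball s0 1 \<times> ball (0::complex) r"
  have sub: "(\<lambda>u. (cis (fst u), snd u)) ` P \<subseteq> circle \<times> ball 0 r" by (auto simp: P_def)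
  have "continuous_on P (\<lambda>u. (cis (fst u), snd u))" by (intro continuous_intros)
  then have c: "continuous_on P (\<lambda>u. T (cis (fst u), snd u))"
    by (rule continuous_on_compose2[OF T(1)]) (rule sub)
  have i: "inj_on (\<lambda>u. T (cis (fst u), snd u)) P"
  proof (rule inj_onI)
    fix u v assume uv: "u \<in> P" "v \<in> P" "T (cis (fst u), snd u) = T (cis (fst v), snd v)"
    then have "(cis (fst u), snd u) = (cis (fst v), snd v)" using inj_onD[OF T(2)] sub by blast
    then show "u = v" using cis_inj_on_ball[of s0] uv(1,2) by (auto simp: P_def prod_eq_iff inj_on_def mem_Times_iff)
  qed
  have "open P" unfolding P_def by (intro open_Times) auto
  then have "open ((\<lambda>u. T (cis (fst u), snd u)) ` P)"
    by (rule invariance_of_domain_gen[OF _ c i]) (simp add: D)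
  moreover have "y \<in> (\<lambda>u. T (cis (fst u), snd u)) ` P"
    using zw s0 by (intro image_eqI[of _ _ "(s0, w0)"]) (auto simp: P_def)
  moreover have "(\<lambda>u. T (cis (fst u), snd u)) ` P \<subseteq> T ` (circle \<times> ball 0 r)" using sub by blast
  ultimately show "\<exists>O'. open O' \<and> y \<in> O' \<and> O' \<subseteq> T ` (circle \<times> ball 0 r)" by blast
qed

lemma stereo_open_image:
  assumes st: "stereo q st sti" and O: "open O'"
  shows "openin (top_of_set S3) (sti ` O')"
proof -
  note s = stereoD[OF st]
  have "continuous_on (S3 - {q}) st" by (rule smooth_on_imp_continuous_on[OF stereo_smooth[OF st subset_refl]])
  then have "openin (top_of_set (S3 - {q})) ((S3 - {q}) \<inter> st -` O')" by (rule continuous_openin_preimage_gen[OF _ O])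
  moreover have "(S3 - {q}) \<inter> st -` O' = sti ` O'"
  proof
    show "(S3 - {q}) \<inter> st -` O' \<subseteq> sti ` O'"
    proof
      fix x assume x: "x \<in> (S3 - {q}) \<inter> st -` O'"
      then have "x = sti (st x)" using s(5)[of x] by simp
      then show "x \<in> sti ` O'" using x by (metis IntE image_eqI vimageD)
    qed
    show "sti ` O' \<subseteq> (S3 - {q}) \<inter> st -` O'" using s(3,4) by auto
  qed
  moreover have "openin (top_of_set S3) (S3 - {q})" by (simp add: Diff_eq openin_open_Int open_Compl)
  ultimately show ?thesis using openin_trans by metis
qed

text \<open>A tube is parametrised by a closed solid torus, with no extension beyond its boundary
  given; reflection in the boundary circle supplies one. Reflection uses the linear structure of the
  target, hence the stereographic coordinates, with the pole in \<open>C\<close> and so off the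
  tube. The width \<open>e\<close> is shrunk until the collar misses \<open>C\<close>.\<close>

lemma extended_tube:
  assumes t: "tube J \<tau>" and C: "compact C" "C \<subseteq> S3" "C \<noteq> {}" "C \<inter> \<tau> ` (circle \<times> cball 0 1) = {}"
  obtains T e where "0 < e" "continuous_on (circle \<times> cball 0 (1 + e)) T" "inj_on T (circle \<times> cball 0 (1 + e))"
    "\<And>p. p \<in> circle \<times> cball 0 1 \<Longrightarrow> T p = \<tau> p" "T ` (circle \<times> cball 0 (1 + e)) \<subseteq> S3 - C"
    "openin (top_of_set S3) (T ` (circle \<times> ball 0 (1 + e)))"
proof -
  obtain q where q: "q \<in> C" using C(3) by blast
  obtain st sti where st: "stereo q st sti" using stereo_exists[of q] q C(2) by blast
  note s = stereoD[OF st]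
  let ?A = "circle \<times> cball (0::complex) 1"
  define V where "V = \<tau> ` ?A"
  obtain g where g: "homeomorphism ?A V \<tau> g" "smooth_on ?A \<tau>" "smooth_on V g"
    using t unfolding tube_def smooth_embedding_def diffeomorphism_def V_def by blast
  have VS: "V \<subseteq> S3 - {q}" using t q C(4) unfolding tube_def V_def by blast
  have tV: "\<tau> p \<in> V" if "p \<in> ?A" for p using that by (auto simp: V_def)
  have stt: "sti (st (\<tau> p)) = \<tau> p" if "p \<in> ?A" for p using s(5) tV[OF that] VS by blast
  define \<sigma> where "\<sigma> p = st (\<tau> p)" for p
  have ss: "smooth_on ?A \<sigma>" unfolding \<sigma>_def
    by (rule smooth_on_compose[OF g(2) stereo_smooth[OF st VS]]) (simp add: V_def)
  have sr: "smooth_on (\<sigma> ` ?A) (\<lambda>y. g (sti y))"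
    by (rule smooth_on_compose[OF stereo_inverse_smooth[OF st] g(3)]) (use stt tV in \<open>auto simp: \<sigma>_def\<close>)
  have gs: "g (sti (\<sigma> p)) = p" if "p \<in> ?A" for p
    using stt[OF that] homeomorphism_apply1[OF g(1) that] by (simp add: \<sigma>_def)
  have hs: "homeomorphism ?A (\<sigma> ` ?A) \<sigma> (\<lambda>y. g (sti y))"
    by (rule homeomorphismI[OF smooth_on_imp_continuous_on[OF ss] smooth_on_imp_continuous_on[OF sr]])
       (use gs in \<open>auto simp del: mem_sphere mem_cball\<close>)
  define T' where "T' = reflect_extend \<sigma>"
  have T'A: "T' p = \<sigma> p" if "p \<in> ?A" for p using that by (auto simp: T'_def reflect_extend_def)
  have T'c: "continuous_on (circle \<times> cball 0 (3 / 2)) T'"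
    unfolding T'_def by (rule reflect_extend_continuous[OF smooth_on_imp_continuous_on[OF ss]])
  have "inj_on \<sigma> ?A" using gs by (rule inj_on_inverseI)
  then have T'i: "inj_on T' ?A" using T'A by (simp cong: inj_on_cong)
  obtain e0 where e0: "0 < e0" "e0 \<le> 1 / 2" "inj_on T' (circle \<times> cball 0 (1 + e0))"
    using injective_near_compact[OF T'c T'i] reflect_extend_locally_injective[OF hs ss sr]
    unfolding T'_def by metis
  have sub: "circle \<times> cball (0::complex) (1 + e) \<subseteq> circle \<times> cball 0 (3 / 2)" if "e \<le> e0" for e
    using that e0(2) by (intro Sigma_mono subset_refl) (simp add: subset_cball)
  define T where "T p = sti (T' p)" for p
  have stic: "continuous_on UNIV sti" using Cinf_imp_continuous_on[OF s(2)] .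
  have Tc: "continuous_on (circle \<times> cball 0 (3 / 2)) T" unfolding T_def
    by (rule continuous_on_compose2[OF stic T'c]) simp
  have Tc0: "continuous_on (circle \<times> cball 0 (1 + e0)) T" by (rule continuous_on_subset[OF Tc sub]) simp
  have TA: "T p = \<tau> p" if "p \<in> ?A" for p using T'A[OF that] stt[OF that] by (simp add: T_def \<sigma>_def)
  \<comment> \<open>The parameters that hit \<open>C\<close> form a compact set outside the closed
    tube, hence one at positive distance from it.\<close>
  have cs: "compact (circle \<times> cball (0::complex) (1 + e0) \<inter> T -` C)"
    by (rule compact_preimage[OF _ Tc0 compact_imp_closed[OF C(1)]]) (intro compact_Times compact_sphere compact_cball)
  have cn: "continuous_on A (\<lambda>p::complex \<times> complex. norm (snd p))" for A
    by (intro continuous_on_norm continuous_on_snd continuous_on_id)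
  have gt: "norm (snd p) > 1" if p: "p \<in> circle \<times> cball (0::complex) (1 + e0) \<inter> T -` C" for p
  proof (rule ccontr)
    assume "\<not> norm (snd p) > 1"
    then have "p \<in> ?A" using p by (auto simp: mem_Times_iff)
    then show False using TA p C(4) by (metis IntD2 IntI emptyE imageI vimageD)
  qed
  obtain e where e: "0 < e" "e \<le> e0" "\<And>p. p \<in> circle \<times> cball (0::complex) (1 + e0) \<inter> T -` C \<Longrightarrow> norm (snd p) > 1 + e"
    using compact_gap[OF cs cn gt e0(1)] by blast
  have sub0: "circle \<times> cball (0::complex) (1 + e) \<subseteq> circle \<times> cball 0 (1 + e0)"
    using e(2) by (intro Sigma_mono subset_refl) (simp add: subset_cball)
  have subb: "circle \<times> ball (0::complex) (1 + e) \<subseteq> circle \<times> cball 0 (1 + e)" by (intro Sigma_mono subset_refl) auto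
  have T'ie: "inj_on T' (circle \<times> cball 0 (1 + e))" by (rule inj_on_subset[OF e0(3) sub0])
  have stii: "inj sti" using s(4) by (metis injI)
  show ?thesis
  proof (rule that[OF e(1)])
    show "continuous_on (circle \<times> cball 0 (1 + e)) T" by (rule continuous_on_subset[OF Tc0 sub0])
    show "inj_on T (circle \<times> cball 0 (1 + e))"
      using comp_inj_on[OF T'ie inj_on_subset[OF stii subset_UNIV]] by (simp add: T_def[abs_def] o_def)
    show "\<And>p. p \<in> ?A \<Longrightarrow> T p = \<tau> p" by (rule TA)
    show "T ` (circle \<times> cball 0 (1 + e)) \<subseteq> S3 - C"
    proof (rule image_subsetI)
      fix p assume p: "p \<in> circle \<times> cball (0::complex) (1 + e)"
      have "T p \<notin> C"
      proof
        assume "T p \<in> C"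
        then have "norm (snd p) > 1 + e" using e(3) p sub0 by blast
        then show False using p by (auto simp: mem_Times_iff)
      qed
      then show "T p \<in> S3 - C" using s(3) unfolding T_def by blast
    qed
    have "open (T' ` (circle \<times> ball 0 (1 + e)))"
      by (rule solid_torus_image_open[OF continuous_on_subset[OF T'c order_trans[OF subb sub[OF e(2)]]] inj_on_subset[OF T'ie subb]]) simp
    from stereo_open_image[OF st this] show "openin (top_of_set S3) (T ` (circle \<times> ball 0 (1 + e)))"
      by (simp add: T_def image_image)
  qed
qed

text \<open>The cell misses the core of the tube, so by compactness it misses a thin tube of radius
  \<open>d\<close>, and a slightly larger ball still does. A radial map of the extended tube carries
  the shell of radii from d to 1 + e onto the shell from 1 + e/2 to 1 + e. It fixes the outer rim,
  where the identity continues it.\<close>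

lemma push_ball_off_tube:
  fixes f :: "'a::euclidean_space \<Rightarrow> real^4"
  assumes t: "tube J \<tau>" and V: "V = \<tau> ` (circle \<times> cball 0 1)"
    and C: "compact C" "C \<subseteq> S3" "C \<noteq> {}" "C \<inter> V = {}"
    and f: "continuous_on (ball 0 2) f" "inj_on f (ball 0 2)" "f ` ball 0 2 \<subseteq> S3"
    and J: "J ` circle \<inter> f ` cball 0 1 = {}"
  obtains R h where "1 < R" "continuous_on (ball 0 R) h" "inj_on h (ball 0 R)" "h ` ball 0 R \<subseteq> S3 - V"
    "\<And>u. u \<in> ball 0 R \<Longrightarrow> f u \<in> C \<Longrightarrow> h u = f u"
proof -
  obtain T e where T: "0 < e" "continuous_on (circle \<times> cball 0 (1 + e)) T" "inj_on T (circle \<times> cball 0 (1 + e))"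
    "\<And>p. p \<in> circle \<times> cball 0 1 \<Longrightarrow> T p = \<tau> p" "T ` (circle \<times> cball 0 (1 + e)) \<subseteq> S3 - C"
    "openin (top_of_set S3) (T ` (circle \<times> ball 0 (1 + e)))"
    using extended_tube[OF t C(1-3)] C(4) unfolding V by metis
  have tz: "\<tau> (z, 0) = J z" if "z \<in> circle" for z using t that unfolding tube_def by blast
  have tc: "continuous_on (circle \<times> cball 0 1) \<tau>"
    using t unfolding tube_def smooth_embedding_def diffeomorphism_def homeomorphism_def by blast
  have fc1: "continuous_on (cball 0 1) f" "continuous_on (cball 0 (3 / 2)) f"
    by (rule continuous_on_subset[OF f(1)]; force)+
  have cs: "compact (circle \<times> cball (0::complex) 1 \<inter> \<tau> -` (f ` cball 0 1))"
    by (intro compact_preimage tc compact_imp_closed compact_continuous_image fc1 compact_cball compact_Times compact_sphere)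
  have cn: "continuous_on A (\<lambda>p::complex \<times> complex. norm (snd p))" for A
    by (intro continuous_on_norm continuous_on_snd continuous_on_id)
  have gt: "norm (snd p) > 0" if p: "p \<in> circle \<times> cball (0::complex) 1 \<inter> \<tau> -` (f ` cball 0 1)" for p
  proof (rule ccontr)
    assume "\<not> norm (snd p) > 0"
    then have "snd p = 0" by simp
    then have "p = (fst p, 0)" by (metis prod.collapse)
    moreover have "fst p \<in> circle" using p by (auto simp: mem_Times_iff)
    ultimately have "\<tau> p = J (fst p)" using tz by metis
    then show False using p J \<open>fst p \<in> circle\<close> by auto
  qed
  have half: "(1 / 2 :: real) > 0" by simp
  obtain d where d: "0 < d" "d \<le> 1 / 2"
      "\<And>p. p \<in> circle \<times> cball (0::complex) 1 \<inter> \<tau> -` (f ` cball 0 1) \<Longrightarrow> norm (snd p) > 0 + d"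
    using compact_gap[OF cs cn gt half] by blast
  define Wd where "Wd = \<tau> ` (circle \<times> cball 0 d)"
  have subd: "circle \<times> cball (0::complex) d \<subseteq> circle \<times> cball 0 1"
    using d(2) by (intro Sigma_mono subset_refl) (simp add: subset_cball)
  have Wc: "compact Wd" unfolding Wd_def
    by (intro compact_continuous_image continuous_on_subset[OF tc subd] compact_Times compact_sphere compact_cball)
  have cs2: "compact (cball 0 (3 / 2) \<inter> f -` Wd)"
    by (rule compact_preimage[OF compact_cball fc1(2) compact_imp_closed[OF Wc]])
  have gt2: "norm u > 1" if u: "u \<in> cball 0 (3 / 2) \<inter> f -` Wd" for u
  proof (rule ccontr)
    assume "\<not> norm u > 1"
    then have u1: "f u \<in> f ` cball 0 1" by simp
    obtain p where p: "p \<in> circle \<times> cball 0 d" "f u = \<tau> p" using u unfolding Wd_def by blast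
    then have "p \<in> circle \<times> cball (0::complex) 1 \<inter> \<tau> -` (f ` cball 0 1)" using subd u1 by auto
    then show False using d(3) p(1) by (fastforce simp: mem_Times_iff)
  qed
  \<comment> \<open>Here the tameness of the cell matters: the parametrisation continues past the
    unit ball, which leaves room for an open ball of radius R > 1.\<close>
  obtain r where r: "0 < r" "r \<le> 1 / 2" "\<And>u. u \<in> cball 0 (3 / 2) \<inter> f -` Wd \<Longrightarrow> norm u > 1 + r"
    using compact_gap[OF cs2 continuous_on_norm_id gt2 half] by blast
  define R where "R = 1 + r"
  have R: "1 < R" "R \<le> 3 / 2" using r by (auto simp: R_def)
  have fW: "f u \<notin> Wd" if "u \<in> ball 0 R" for u
  proof
    assume "f u \<in> Wd"
    then have "norm u > 1 + r" using r(3)[of u] that R(2) by simp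
    then show False using that by (simp add: R_def)
  qed
  define D where "D = 1 + e - d"
  \<comment> \<open>The affine function with m d = 1 + e/2 and m (1 + e) = 1 + e.\<close>
  define m where "m x = 1 + e / 2 + (x - d) * (e / 2) / D" for x :: real
  have den: "D > 0" using T(1) d by (simp add: D_def)
  have m1: "m (1 + e) = 1 + e"
  proof -
    have "m (1 + e) = 1 + e / 2 + D * (e / 2) / D" by (simp add: m_def D_def)
    then show ?thesis using den by simp
  qed
  have mge: "m x \<ge> 1 + e / 2" if "d \<le> x" for x
    unfolding m_def using that T(1) den by simp
  have mle: "m x \<le> 1 + e" if "x \<le> 1 + e" for x
  proof -
    have "(x - d) * (e / 2) / D \<le> D * (e / 2) / D"
      using that T(1) den by (intro divide_right_mono mult_right_mono) (auto simp: D_def)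
    also have "\<dots> = e / 2" using den by simp
    finally show ?thesis unfolding m_def by linarith
  qed
  have minj: "x = y" if "m x = m y" for x y using that T(1) den by (simp add: m_def)
  define P where "P = circle \<times> (cball (0::complex) (1 + e) - ball 0 d)"
  have Psub: "P \<subseteq> circle \<times> cball 0 (1 + e)" by (auto simp: P_def)
  have Pc: "compact P" unfolding P_def by (intro compact_Times compact_diff compact_sphere compact_cball open_ball)
  have Pn: "norm (snd p) > 0" "d \<le> norm (snd p)" "norm (snd p) \<le> 1 + e" "norm (fst p) = 1" if "p \<in> P" for p
    using that d(1) by (auto simp: P_def mem_Times_iff)
  define G where "G p = (fst p, (m (norm (snd p)) / norm (snd p)) *\<^sub>R snd p)" for p :: "complex \<times> complex"
  have Gn: "norm (snd (G p)) = m (norm (snd p))" if "p \<in> P" for p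
    using mge[OF Pn(2)[OF that]] Pn(1)[OF that] T(1) by (simp add: G_def)
  have GP: "G p \<in> circle \<times> cball 0 (1 + e)" "1 < norm (snd (G p))" if "p \<in> P" for p
    using Gn[OF that] mle[OF Pn(3)[OF that]] mge[OF Pn(2)[OF that]] Pn(4)[OF that] T(1)
    by (auto simp: mem_Times_iff G_def)
  have Gc: "continuous_on P G" unfolding G_def m_def
    by (intro continuous_intros) (use Pn(1) den in \<open>auto simp: P_def\<close>)
  have Gi: "inj_on G P"
  proof (rule inj_onI)
    fix p p' assume p: "p \<in> P" "p' \<in> P" "G p = G p'"
    then have "m (norm (snd p)) = m (norm (snd p'))" using Gn by metis
    then have n: "norm (snd p) = norm (snd p')" by (rule minj)
    have "m (norm (snd p)) / norm (snd p) \<noteq> 0" using mge[OF Pn(2)[OF p(1)]] Pn(1)[OF p(1)] T(1) by simp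
    then show "p = p'" using p(3) n by (simp add: G_def prod_eq_iff)
  qed
  have Tc': "continuous_on P T" by (rule continuous_on_subset[OF T(2) Psub])
  obtain Ti where Ti: "homeomorphism P (T ` P) T Ti"
    using homeomorphism_compact[OF Pc Tc' refl inj_on_subset[OF T(3) Psub]] by blast
  define Phi where "Phi x = (if x \<in> T ` P then T (G (Ti x)) else x)" for x
  have PhiT: "Phi (T p) = T (G p)" if "p \<in> P" for p
    using that homeomorphism_apply1[OF Ti] by (auto simp: Phi_def)
  define B1 where "B1 = T ` P"
  define B2 where "B2 = S3 - T ` (circle \<times> ball 0 (1 + e))"
  \<comment> \<open>The shell and the complement of the open extended tube can meet only in the rim,
    which \<open>G\<close> fixes. So the two definitions of \<open>Phi\<close> agree on the
    overlap.\<close>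
  have TP2: "Phi x = x" if x: "x \<in> B2" for x
  proof (cases "x \<in> T ` P")
    case True
    then obtain p where p: "p \<in> P" "x = T p" by blast
    have "norm (snd p) = 1 + e"
    proof (rule ccontr)
      assume "norm (snd p) \<noteq> 1 + e"
      then have "p \<in> circle \<times> ball 0 (1 + e)" using Pn[OF p(1)] by (auto simp: mem_Times_iff)
      then show False using x p(2) by (auto simp: B2_def)
    qed
    then have "G p = p" using m1 T(1) by (simp add: G_def prod_eq_iff)
    then show ?thesis using PhiT[OF p(1)] p(2) by simp
  qed (simp add: Phi_def)
  have B12: "S3 - T ` (circle \<times> ball 0 d) \<subseteq> B1 \<union> B2"
  proof
    fix x assume x: "x \<in> S3 - T ` (circle \<times> ball 0 d)"
    show "x \<in> B1 \<union> B2"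
    proof (cases "x \<in> T ` (circle \<times> ball 0 (1 + e))")
      case True
      then obtain p where p: "p \<in> circle \<times> ball 0 (1 + e)" "x = T p" by blast
      then have "p \<notin> circle \<times> ball 0 d" using x by blast
      then have "p \<in> P" using p(1) by (auto simp: P_def mem_Times_iff)
      then show ?thesis using p(2) by (simp add: B1_def)
    qed (use x in \<open>simp add: B2_def\<close>)
  qed
  have B1c: "closed B1" unfolding B1_def using compact_imp_closed[OF compact_continuous_image[OF Tc' Pc]] .
  have "closedin (top_of_set S3) B2" unfolding B2_def using T(6) by (simp add: closedin_diff)
  then have B2c: "closed B2" using closedin_closed_trans closed_sphere by blast
  have "continuous_on B1 Phi"
  proof -
    have "continuous_on B1 (\<lambda>x. T (G (Ti x)))" unfolding B1_def
      by (rule continuous_on_compose2[OF T(2) continuous_on_compose2[OF Gc homeomorphism_cont2[OF Ti]]])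
         (use GP(1) homeomorphism_image2[OF Ti] in blast)+
    then show ?thesis by (rule continuous_on_eq) (simp add: B1_def Phi_def)
  qed
  moreover have "continuous_on B2 Phi" by (rule continuous_on_eq[OF continuous_on_id]) (use TP2 in simp)
  ultimately have Phic: "continuous_on (B1 \<union> B2) Phi" by (intro continuous_on_closed_Un B1c B2c)
  have fB: "f u \<in> B1 \<union> B2" if u: "u \<in> ball 0 R" for u
  proof -
    have "T ` (circle \<times> ball 0 d) \<subseteq> Wd"
    proof (rule image_subsetI)
      fix p assume "p \<in> circle \<times> ball (0::complex) d"
      then have "p \<in> circle \<times> cball 0 d" by auto
      then show "T p \<in> Wd" using T(4)[of p] subd unfolding Wd_def by (metis imageI subsetD)
    qed
    then have "f u \<notin> T ` (circle \<times> ball 0 d)" using fW[OF u] by blast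
    moreover have "u \<in> ball 0 2" using u R(2) by simp
    then have "f u \<in> S3" using f(3) by blast
    ultimately show ?thesis using B12 by blast
  qed
  have VT: "V = T ` (circle \<times> cball 0 1)"
    unfolding V by (rule image_cong[OF refl]) (rule T(4)[symmetric])
  have PhiV: "Phi x \<in> S3 - V" if "x \<in> B1 \<union> B2" for x
  proof (cases "x \<in> B1")
    case True
    then obtain p where p: "p \<in> P" "x = T p" by (auto simp: B1_def)
    have "T (G p) \<notin> V"
    proof
      assume "T (G p) \<in> V"
      then obtain p' where p': "p' \<in> circle \<times> cball 0 1" "T (G p) = T p'" unfolding VT by (rule imageE)
      have "p' \<in> circle \<times> cball 0 (1 + e)" using p'(1) T(1) by (auto simp: mem_Times_iff)
      then have "G p = p'" using inj_onD[OF T(3) p'(2) GP(1)[OF p(1)]] by blast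
      then show False using GP(2)[OF p(1)] p'(1) by (auto simp: mem_Times_iff)
    qed
    moreover have "T (G p) \<in> S3" using subsetD[OF T(5) imageI[OF GP(1)[OF p(1)]]] by (rule DiffD1)
    ultimately show ?thesis using PhiT[OF p(1)] p(2) by simp
  next
    case False
    then have x: "x \<in> B2" using that by blast
    have "V \<subseteq> T ` (circle \<times> ball 0 (1 + e))"
    proof
      fix y assume "y \<in> V"
      then obtain p where "p \<in> circle \<times> cball 0 1" "y = T p" unfolding VT by (rule imageE)
      moreover then have "p \<in> circle \<times> ball 0 (1 + e)" using T(1) by (auto simp: mem_Times_iff)
      ultimately show "y \<in> T ` (circle \<times> ball 0 (1 + e))" by blast
    qed
    then show ?thesis using x TP2[OF x] by (auto simp: B2_def)
  qed
  have Phii: "inj_on Phi (B1 \<union> B2)"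
  proof (rule inj_onI)
    have imp: "x = y" if x: "x \<in> B1" and y: "y \<in> B1 \<union> B2" and eq: "Phi x = Phi y" for x y
    proof -
      obtain p where p: "p \<in> P" "x = T p" using x by (auto simp: B1_def)
      show ?thesis
      proof (cases "y \<in> B1")
        case True
        then obtain p' where p': "p' \<in> P" "y = T p'" by (auto simp: B1_def)
        have "T (G p) = T (G p')" using eq PhiT p p' by simp
        then have "G p = G p'" using inj_onD[OF T(3)] GP(1) p(1) p'(1) by blast
        then show ?thesis using inj_onD[OF Gi] p p' by blast
      next
        case False
        then have yB: "y \<in> B2" using y by blast
        have "T (G p) = y" using eq PhiT p TP2[OF yB] by simp
        moreover have "G p \<in> P"
          using GP[OF p(1)] d(2) by (auto simp: P_def mem_Times_iff)
        ultimately show ?thesis using False by (auto simp: B1_def)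
      qed
    qed
    fix x y assume xy: "x \<in> B1 \<union> B2" "y \<in> B1 \<union> B2" "Phi x = Phi y"
    show "x = y"
    proof (cases "x \<in> B1 \<or> y \<in> B1")
      case True then show ?thesis using imp xy by metis
    next
      case False then show ?thesis using xy TP2 by (metis UnE)
    qed
  qed
  have subR: "ball 0 R \<subseteq> ball (0::'a) 2" using R(2) by (intro subset_ball) simp
  show ?thesis
  proof (rule that[OF R(1), of "\<lambda>u. Phi (f u)"])
    show "continuous_on (ball 0 R) (\<lambda>u. Phi (f u))"
      by (rule continuous_on_compose2[OF Phic continuous_on_subset[OF f(1) subR]]) (use fB in blast)
    show "inj_on (\<lambda>u. Phi (f u)) (ball 0 R)"
      using inj_onD[OF Phii] inj_onD[OF f(2)] fB subR by (intro inj_onI) (metis subsetD)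
    show "(\<lambda>u. Phi (f u)) ` ball 0 R \<subseteq> S3 - V" using PhiV fB by blast
    show "Phi (f u) = f u" if "u \<in> ball 0 R" "f u \<in> C" for u
    proof -
      have "f u \<notin> T ` P" using T(5) Psub that(2) by blast
      then show ?thesis by (simp add: Phi_def)
    qed
  qed
qed

section \<open>Lifting the pushed ball to the cyclic cover, and the boundary of the fibre\<close>

lemma covering_space_homeomorphism:
  assumes c: "covering_space M p X" and h: "homeomorphism M N \<phi> \<psi>"
  shows "covering_space N (p \<circ> \<psi>) X"
proof
  have c': "continuous_on M p" "p ` M = X" using c unfolding covering_space_def by auto
  show "continuous_on N (p \<circ> \<psi>)"
    using homeomorphism_cont2[OF h] homeomorphism_image2[OF h] c'(1) by (intro continuous_on_compose) auto
  show "(p \<circ> \<psi>) ` N = X" using homeomorphism_image2[OF h] c'(2) by (metis image_comp)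
  fix x assume x: "x \<in> X"
  from c have "\<forall>x\<in>X. \<exists>T. x \<in> T \<and> openin (top_of_set X) T \<and> (\<exists>v. \<Union>v = M \<inter> p -` T \<and>
      (\<forall>u\<in>v. openin (top_of_set M) u) \<and> pairwise disjnt v \<and> (\<forall>u\<in>v. \<exists>q. homeomorphism u T p q))"
    unfolding covering_space_def by (elim conjE)
  from this[rule_format, OF x] obtain T v where T: "x \<in> T" "openin (top_of_set X) T" "\<Union>v = M \<inter> p -` T"
    "\<And>u. u \<in> v \<Longrightarrow> openin (top_of_set M) u" "pairwise disjnt v" "\<And>u. u \<in> v \<Longrightarrow> \<exists>q. homeomorphism u T p q"
    by (elim exE conjE) (rule that; (assumption | (drule bspec, assumption, erule exE, rule exI, assumption) | simp))
  have uM: "u \<subseteq> M" if "u \<in> v" for u using T(3) that by blast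
  have \<psi>\<phi>: "\<psi> (\<phi> y) = y" if "y \<in> M" for y using homeomorphism_apply1[OF h that] .
  have "\<Union> ((`) \<phi> ` v) = N \<inter> (p \<circ> \<psi>) -` T"
  proof -
    have "\<Union> ((`) \<phi> ` v) = \<phi> ` (M \<inter> p -` T)" unfolding T(3)[symmetric] by blast
    also have "\<dots> = N \<inter> (p \<circ> \<psi>) -` T"
    proof
      show "\<phi> ` (M \<inter> p -` T) \<subseteq> N \<inter> (p \<circ> \<psi>) -` T" using homeomorphism_image1[OF h] \<psi>\<phi> by auto
      show "N \<inter> (p \<circ> \<psi>) -` T \<subseteq> \<phi> ` (M \<inter> p -` T)"
      proof
        fix y assume y: "y \<in> N \<inter> (p \<circ> \<psi>) -` T"
        then have "y = \<phi> (\<psi> y)" "\<psi> y \<in> M" using homeomorphism_apply2[OF h] homeomorphism_image2[OF h] by auto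
        then show "y \<in> \<phi> ` (M \<inter> p -` T)" using y by (metis IntE IntI comp_apply imageI vimageE vimageI2)
      qed
    qed
    finally show ?thesis .
  qed
  moreover have "openin (top_of_set N) u" if "u \<in> (`) \<phi> ` v" for u
    using that homeomorphism_imp_open_map[OF h] T(4) by blast
  moreover have "pairwise disjnt ((`) \<phi> ` v)"
  proof (rule pairwise_imageI)
    fix a b assume ab: "a \<in> v" "b \<in> v" "a \<noteq> b"
    then have "a \<inter> b = {}" using T(5) by (auto simp: pairwise_def disjnt_def)
    moreover have "s = t" if "s \<in> a" "t \<in> b" "\<phi> s = \<phi> t" for s t
      using \<psi>\<phi>[of s] \<psi>\<phi>[of t] uM[OF ab(1)] uM[OF ab(2)] that by (metis subsetD)
    ultimately show "disjnt (\<phi> ` a) (\<phi> ` b)" unfolding disjnt_def by blast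
  qed
  moreover have "\<exists>q. homeomorphism u T (p \<circ> \<psi>) q" if "u \<in> (`) \<phi> ` v" for u
  proof -
    obtain w where w: "w \<in> v" "u = \<phi> ` w" using \<open>u \<in> (`) \<phi> ` v\<close> by blast
    have "homeomorphism w u \<phi> \<psi>"
      using homeomorphism_of_subsets[OF h uM[OF w(1)]] w(2) homeomorphism_image1[OF h] uM[OF w(1)] by blast
    moreover obtain q where "homeomorphism w T p q" using T(6)[OF w(1)] by blast
    ultimately show ?thesis using homeomorphism_compose[OF homeomorphism_symD] by blast
  qed
  ultimately show "\<exists>T. x \<in> T \<and> openin (top_of_set X) T \<and> (\<exists>v. \<Union>v = N \<inter> (p \<circ> \<psi>) -` T \<and>
      (\<forall>u\<in>v. openin (top_of_set N) u) \<and> pairwise disjnt v \<and> (\<forall>u\<in>v. \<exists>q. homeomorphism u T (p \<circ> \<psi>) q))"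
    using T(1,2) by (intro exI[of _ T] conjI exI[of _ "(`) \<phi> ` v"]) auto
qed

text \<open>A ball is simply connected, so \<open>h0\<close> lifts with a prescribed value at the
  base point \<open>u 1\<close>. Uniqueness of lifts along the connected circle then makes the
  lifted ball pass through the given knot. Injectivity is inherited, since the lift followed by
  \<open>p\<close> is \<open>h0\<close>.\<close>

lemma lift_ball:
  fixes h0 f :: "'a::euclidean_space \<Rightarrow> real^4" and p :: "'b::real_normed_vector \<Rightarrow> real^4"
  assumes c: "covering_space N p X"
    and h0: "continuous_on (ball 0 R) h0" "inj_on h0 (ball 0 R)" "h0 ` ball 0 R \<subseteq> X"
    and k: "continuous_on circle k" "k ` circle \<subseteq> N"
    and u: "continuous_on circle u" "u ` circle \<subseteq> ball 0 R" "\<And>z. z \<in> circle \<Longrightarrow> h0 (u z) = p (k z)"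
  obtains h where "continuous_on (ball 0 R) h" "inj_on h (ball 0 R)" "h ` ball 0 R \<subseteq> N"
    "\<And>z. z \<in> circle \<Longrightarrow> h (u z) = k z"
proof -
  have "(1::complex) \<in> circle" by simp
  then have 1: "k 1 \<in> N" "u 1 \<in> ball 0 R" using k(2) u(2) by blast+
  have "simply_connected (ball (0::'a) R)" by (intro convex_imp_simply_connected convex_ball)
  moreover have "locally path_connected (ball (0::'a) R)" by (intro convex_imp_locally_path_connected convex_ball)
  moreover have "h0 \<in> ball 0 R \<rightarrow> X" using h0(3) by blast
  moreover have "h0 (u 1) = p (k 1)" by (rule u(3)) simp
  ultimately obtain h where h: "continuous_on (ball 0 R) h" "h \<in> ball 0 R \<rightarrow> N" "h (u 1) = k 1"
     "\<And>y. y \<in> ball 0 R \<Longrightarrow> p (h y) = h0 y"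
    using covering_space_lift_strong[OF c 1 _ _ h0(1)] by metis
  have "h (u z) = k z" if z: "z \<in> circle" for z
  proof (rule covering_space_lift_unique[OF c, of "\<lambda>z. h (u z)" 1 k circle "\<lambda>z. p (k z)"])
    show "continuous_on circle (\<lambda>z. p (k z))"
      using c k unfolding covering_space_def by (blast intro: continuous_on_compose2)
    show "(\<lambda>z. p (k z)) \<in> circle \<rightarrow> X" using c k(2) unfolding covering_space_def by blast
    show "continuous_on circle (\<lambda>z. h (u z))" by (rule continuous_on_compose2[OF h(1) u(1,2)])
    show "(\<lambda>z. h (u z)) \<in> circle \<rightarrow> N" using h(2) u(2) by blast
    show "p (k z) = p (h (u z))" if "z \<in> circle" for z 
    proof -
      have "u z \<in> ball 0 R" using u(2) that by blast
      then show ?thesis using h(4) u(3)[OF that] by metis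
    qed
    show "connected circle" by (rule connected_sphere) simp
  qed (use k h(3) z in auto)
  moreover have "inj_on h (ball 0 R)"
    using inj_onD[OF h0(2)] h(4) by (intro inj_onI) metis
  ultimately show ?thesis using that h by (metis image_subset_iff_funcset)
qed

text \<open>Projection from the antipode of the point under consideration reduces this to invariance
  of domain in \<open>real^3\<close>.\<close>

lemma image_openin_S3:
  fixes e :: "complex \<times> real \<Rightarrow> real^4"
  assumes O: "open O'" "continuous_on O' e" "inj_on e O'" "e ` O' \<subseteq> S3"
  shows "openin (top_of_set S3) (e ` O')"
proof (subst openin_subopen, rule ballI)
  fix y assume "y \<in> e ` O'"
  then obtain u where u: "u \<in> O'" "y = e u" by blast
  have yS: "y \<in> S3" using O(4) u by blast
  have q: "- y \<in> S3" "y \<noteq> - y" using yS by (auto simp: eq_neg_iff_add_eq_0 scaleR_2[symmetric])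
  obtain st sti where st: "stereo (- y) st sti" using stereo_exists[OF q(1)] by metis
  note s = stereoD[OF st]
  define O2 where "O2 = O' \<inter> e -` (- {- y})"
  have "open O2" unfolding O2_def by (rule continuous_open_preimage[OF O(2,1)]) auto
  moreover have O2S: "e ` O2 \<subseteq> S3 - {- y}" using O(4) by (auto simp: O2_def)
  have stc: "continuous_on (S3 - {- y}) st" by (rule smooth_on_imp_continuous_on[OF stereo_smooth[OF st subset_refl]])
  have "continuous_on O2 (\<lambda>u. st (e u))"
    by (rule continuous_on_compose2[OF stc continuous_on_subset[OF O(2)] O2S]) (auto simp: O2_def)
  moreover have sts: "sti (st (e v)) = e v" if "v \<in> O2" for v using s(5) O2S that by blast
  have "inj_on (\<lambda>u. st (e u)) O2"
    using inj_onD[OF O(3)] sts by (intro inj_onI) (metis O2_def IntD1)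
  ultimately have "open ((\<lambda>u. st (e u)) ` O2)" by (intro invariance_of_domain_gen) auto
  from stereo_open_image[OF st this] have "openin (top_of_set S3) (sti ` (\<lambda>u. st (e u)) ` O2)" .
  moreover have "sti ` (\<lambda>u. st (e u)) ` O2 = e ` O2" using sts by force
  moreover have "u \<in> O2" using u q(2) by (simp add: O2_def)
  ultimately show "\<exists>T. openin (top_of_set S3) T \<and> y \<in> T \<and> T \<subseteq> e ` O'"
    using u(2) by (intro exI[of _ "e ` O2"]) (auto simp: O2_def)
qed

text \<open>Otherwise the exterior would be open in the sphere, hence all of it, although the tube has
  interior points.\<close>

lemma fiber_has_boundary_chart:
  assumes F: "compact_surface F" and t: "tube J \<tau>" and V: "V = \<tau> ` (circle \<times> cball 0 1)"
    and c: "covering_space (F \<times> {0<..<1::real}) p (exterior_of V)" and ne: "exterior_of V \<noteq> {}"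
  obtains W U f g w where "surface_chart F W U f g" "w \<in> W" "Im w = 0"
proof (rule ccontr)
  assume n: "\<not> thesis"
  let ?X = "exterior_of V" let ?N = "F \<times> {0<..<1::real}"
  have pc: "continuous_on ?N p" "p ` ?N = ?X" using c unfolding covering_space_def by auto
  have VS: "V \<subseteq> S3" using t unfolding tube_def V by blast
  have XS: "?X \<subseteq> S3" unfolding exterior_of_def by (intro closure_minimal) auto
  have "openin (top_of_set S3) ?X"
  proof (subst openin_subopen, rule ballI)
    fix x assume "x \<in> ?X"
    then obtain y where y: "y \<in> ?N" "x = p y" using pc(2) by blast
    have y': "fst y \<in> F" "snd y \<in> {0<..<1}" using y by (auto simp: mem_Times_iff)
    obtain W U f g where ch: "surface_chart F W U f g" "fst y \<in> U" using compact_surface_chart[OF F y'(1)] by metis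
    note cc = surface_chartD[OF ch(1)]
    have gy: "g (fst y) \<in> W" "f (g (fst y)) = fst y" "Im (g (fst y)) \<ge> 0" using cc(6,7) ch(2) by auto
    have "Im (g (fst y)) \<noteq> 0" using n that[OF ch(1) gy(1)] by blast
    then have Ig: "Im (g (fst y)) > 0" using gy(3) by simp
    obtain r f' where d: "disc_chart F (g (fst y)) r f' g" "\<And>z. z \<in> ball (g (fst y)) r \<Longrightarrow> f' z = f z"
      using disc_chart_in_surface_chart[OF ch(1) gy(1) Ig] by metis
    define P where "P = ball (g (fst y)) r \<times> {0<..<1::real}"
    define \<kappa> where "\<kappa> u = (f' (fst u), snd u)" for u :: "complex \<times> real"
    define \<kappa>i where "\<kappa>i y = (g (fst y), snd y)" for y :: "(real^4) \<times> real"
    have k: "thick_chart F P \<kappa> \<kappa>i"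
      using disc_chart_thick(1)[OF F d(1)] unfolding P_def \<kappa>_def \<kappa>i_def .
    have P: "open P" "homeomorphism P (\<kappa> ` P) \<kappa> \<kappa>i" "\<kappa> ` P \<subseteq> ?N"
      using k surface_interior_subset[of F] unfolding thick_chart_def by (auto simp: subset_iff)
    have r: "r > 0" using d(1) unfolding disc_chart_def by blast
    have u0: "(g (fst y), snd y) \<in> P" "\<kappa> (g (fst y), snd y) = y"
      using r y' d(2)[of "g (fst y)"] gy(2) by (auto simp: P_def \<kappa>_def)
    obtain T u q where T: "y \<in> T" "openin (top_of_set ?N) T" "homeomorphism T u p q"
      using covering_space_local_homeomorphism[OF c y(1)] by metis
    have kc: "continuous_on P \<kappa>" using homeomorphism_cont1[OF P(2)] .
    have "openin (top_of_set P) (P \<inter> \<kappa> -` T)"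
      by (rule continuous_openin_preimage[OF kc _ T(2)]) (use P(3) in blast)
    then have O2: "open (P \<inter> \<kappa> -` T)" using P(1) openin_open_trans by blast
    have "openin (top_of_set S3) ((\<lambda>v. p (\<kappa> v)) ` (P \<inter> \<kappa> -` T))"
    proof (rule image_openin_S3[OF O2])
      show "continuous_on (P \<inter> \<kappa> -` T) (\<lambda>v. p (\<kappa> v))"
        by (rule continuous_on_compose2[OF pc(1) continuous_on_subset[OF kc]]) (use P(3) in auto)
      show "inj_on (\<lambda>v. p (\<kappa> v)) (P \<inter> \<kappa> -` T)"
        using homeomorphism_apply1[OF T(3)] homeomorphism_apply1[OF P(2)] by (intro inj_onI) (metis IntD1 IntD2 vimageD)
      show "(\<lambda>v. p (\<kappa> v)) ` (P \<inter> \<kappa> -` T) \<subseteq> S3" using pc(2) P(3) XS by blast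
    qed
    moreover have "x \<in> (\<lambda>v. p (\<kappa> v)) ` (P \<inter> \<kappa> -` T)"
      using u0 T(1) y(2) by (intro image_eqI[of _ _ "(g (fst y), snd y)"]) auto
    moreover have "(\<lambda>v. p (\<kappa> v)) ` (P \<inter> \<kappa> -` T) \<subseteq> ?X" using pc(2) P(3) by blast
    ultimately show "\<exists>T. openin (top_of_set S3) T \<and> x \<in> T \<and> T \<subseteq> ?X" by blast
  qed
  moreover have "closedin (top_of_set S3) ?X" using XS unfolding exterior_of_def by (simp add: closed_subset)
  moreover have "connected S3" by (rule connected_sphere) simp
  ultimately have X: "?X = S3" using ne unfolding connected_clopen by blast
  obtain g where g: "homeomorphism (circle \<times> cball 0 1) V \<tau> g"
    using t unfolding tube_def smooth_embedding_def diffeomorphism_def V by blast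
  \<comment> \<open>A solid cylinder around a point of the core has an image that is open in the
    sphere and contained in \<open>V\<close>. The closure of the complement of \<open>V\<close>
    cannot contain that point, so the exterior is not the whole sphere.\<close>
  define P where "P = ball (0::complex) 1 \<times> ball (0::real) 1"
  define e where "e u = \<tau> (cis (snd u), fst u)" for u :: "complex \<times> real"
  have sub: "(cis (snd u), fst u) \<in> circle \<times> cball 0 1" if "u \<in> P" for u using that by (auto simp: P_def)
  have "openin (top_of_set S3) (e ` P)"
  proof (rule image_openin_S3)
    show "open P" unfolding P_def by (intro open_Times) auto
    have "continuous_on P (\<lambda>u. (cis (snd u), fst u))" by (intro continuous_intros)
    then show "continuous_on P e" unfolding e_def
      by (rule continuous_on_compose2[OF homeomorphism_cont1[OF g]]) (use sub in blast)
    show "inj_on e P"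
    proof (rule inj_onI)
      fix u v assume uv: "u \<in> P" "v \<in> P" "e u = e v"
      then have "(cis (snd u), fst u) = (cis (snd v), fst v)"
        using homeomorphism_apply1[OF g sub] unfolding e_def by metis
      then show "u = v" using cis_inj_on_ball[of 0] uv(1,2) by (auto simp: P_def prod_eq_iff inj_on_def mem_Times_iff)
    qed
    show "e ` P \<subseteq> S3" using sub VS V unfolding e_def by blast
  qed
  then obtain T where T: "open T" "e ` P = S3 \<inter> T" by (auto simp: openin_open)
  have "(0, 0) \<in> P" by (simp add: P_def)
  then have "e (0, 0) \<in> S3 \<inter> T" using T(2) by blast
  then have "e (0, 0) \<in> closure (S3 - V)" "e (0, 0) \<in> T" using X unfolding exterior_of_def by auto
  then have "T \<inter> (S3 - V) \<noteq> {}" using T(1) by (metis open_Int_closure_eq_empty disjoint_iff)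
  moreover have "S3 \<inter> T \<subseteq> V" using T(2) sub V unfolding e_def by blast
  ultimately show False by blast
qed

section \<open>Pulling orientations back\<close>

lemma orientation_preserving_at_cong:
  assumes g: "orientation_preserving_at g x" and d: "d > 0" "\<And>u. u \<in> ball x d \<Longrightarrow> f u = g u"
  shows "orientation_preserving_at f x"
proof -
  have "\<forall>\<^sub>F r in at_right (0::real). r < d \<and> r > 0"
    using d(1) by (simp add: eventually_at_right_field) (meson)
  then show ?thesis
    using g unfolding orientation_preserving_at_def
  proof eventually_elim
    case (elim r)
    have "f (x + v) - f x = g (x + v) - g x" if "v \<in> sphere 0 r" for v
      using that elim(1) d by (simp add: dist_norm)
    then show ?case using elim(2) by (intro homotopic_with_eq[OF elim(2)]) auto
  qed
qed

text \<open>Every point of the segment from the displacement to \<open>v\<close> has positive inner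
  product with \<open>v\<close>, so the straight-line homotopy avoids 0.\<close>

lemma orientation_preserving_at_monotone:
  fixes g :: "'a::euclidean_space \<Rightarrow> 'a"
  assumes d: "d > 0" "continuous_on (ball x d) g"
    and m: "\<And>u. u \<in> ball x d \<Longrightarrow> u \<noteq> x \<Longrightarrow> (g u - g x) \<bullet> (u - x) > 0"
  shows "orientation_preserving_at g x"
proof -
  have "\<forall>\<^sub>F r in at_right (0::real). r < d \<and> r > 0"
    using d(1) by (simp add: eventually_at_right_field) (meson)
  then show ?thesis
    unfolding orientation_preserving_at_def
  proof eventually_elim
    case (elim r)
    show ?case
    proof (rule homotopic_with_linear)
      show "continuous_on (sphere 0 r) (\<lambda>v. g (x + v) - g x)"
        by (intro continuous_intros continuous_on_compose2[OF d(2)]) (use elim in \<open>auto simp: dist_norm\<close>)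
      show "continuous_on (sphere 0 r) (\<lambda>v::'a. v)" by (rule continuous_on_id)
      fix v :: 'a assume v: "v \<in> sphere 0 r"
      have pos: "(g (x + v) - g x) \<bullet> v > 0" "v \<bullet> v > 0"
        using m[of "x + v"] v elim by (auto simp: dist_norm)
      show "closed_segment (g (x + v) - g x) v \<subseteq> - {0}"
      proof
        fix y assume "y \<in> closed_segment (g (x + v) - g x) v"
        then obtain t where t: "0 \<le> t" "t \<le> 1" "y = (1 - t) *\<^sub>R (g (x + v) - g x) + t *\<^sub>R v"
          unfolding closed_segment_def by blast
        have "y \<bullet> v = (1 - t) * ((g (x + v) - g x) \<bullet> v) + t * (v \<bullet> v)"
          unfolding t(3) by (simp only: inner_add_left inner_scaleR_left)
        also have "\<dots> > 0"
        proof (cases "t = 0")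
          case True
          then show ?thesis using pos by simp
        next
          case False
          then have "t * (v \<bullet> v) > 0" "(1 - t) * ((g (x + v) - g x) \<bullet> v) \<ge> 0" using pos t by auto
          then show ?thesis by linarith
        qed
        finally show "y \<in> - {0}" by auto
      qed
    qed
  qed
qed

text \<open>The homotopy belonging to \<open>g1\<close> may leave the ball in which
  \<open>g2\<close> is controlled. It is therefore retracted radially into the punctured ball
  \<open>Z\<close>, where \<open>G\<close> has no zero. Inside \<open>Z\<close> the small sphere is
  then blown up to the radius \<open>r'\<close>, for which a homotopy of \<open>G\<close> to the
  inclusion is at hand.\<close>

lemma orientation_preserving_at_compose:
  fixes g1 g2 :: "'a::euclidean_space \<Rightarrow> 'a"
  assumes g1: "orientation_preserving_at g1 x" and c1: "d1 > 0" "continuous_on (ball x d1) g1"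
    and g2: "orientation_preserving_at g2 (g1 x)"
    and c2: "d2 > 0" "continuous_on (ball (g1 x) d2) g2" "inj_on g2 (ball (g1 x) d2)"
  shows "orientation_preserving_at (\<lambda>u. g2 (g1 u)) x"
proof -
  define y where "y = g1 x"
  define A where "A v = g1 (x + v) - y" for v
  define G where "G w = g2 (y + w) - g2 y" for w
  have "\<forall>\<^sub>F r in at_right (0::real). r < d2 \<and> r > 0"
    using c2(1) by (simp add: eventually_at_right_field) (meson)
  then have "\<forall>\<^sub>F r in at_right (0::real). (r < d2 \<and> r > 0) \<and> homotopic_with_canon (\<lambda>_. True) (sphere 0 r) (- {0}) G (\<lambda>v. v)"
    using g2 unfolding orientation_preserving_at_def G_def y_def by (rule eventually_conj)
  then obtain r' where r': "r' < d2" "r' > 0" "homotopic_with_canon (\<lambda>_. True) (sphere 0 r') (- {0}) G (\<lambda>v. v)"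
    using eventually_happens[of _ "at_right (0::real)"] by force
  define Z where "Z = cball 0 r' - {0::'a}"
  have Gc: "continuous_on (cball 0 r') G" unfolding G_def
    by (intro continuous_intros continuous_on_compose2[OF c2(2)]) (use r'(1) in \<open>auto simp: y_def[symmetric] dist_norm\<close>)
  have Gc': "continuous_on Z G" by (rule continuous_on_subset[OF Gc]) (auto simp: Z_def)
  have G0: "G \<in> Z \<rightarrow> - {0}"
  proof
    fix w assume w: "w \<in> Z"
    have "g2 (y + w) \<noteq> g2 y"
      using inj_onD[OF c2(3), of "y + w" y] w r'(1,2) by (auto simp: Z_def y_def[symmetric] dist_norm)
    then show "G w \<in> - {0}" by (simp add: G_def)
  qed
  define c where "c w = min 1 (r' / norm w) *\<^sub>R w" for w :: 'a
  have cc: "continuous_on (- {0}) c" unfolding c_def by (intro continuous_intros) auto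
  have cZ: "c \<in> - {0} \<rightarrow> Z"
  proof
    fix w :: 'a assume w: "w \<in> - {0}"
    have p: "min 1 (r' / norm w) > 0" using w r'(2) by simp
    have "norm (c w) = min 1 (r' / norm w) * norm w" using p by (simp add: c_def)
    also have "\<dots> \<le> r' / norm w * norm w" by (intro mult_right_mono) auto
    also have "\<dots> = r'" using w by simp
    finally show "c w \<in> Z" using p w by (auto simp: Z_def c_def)
  qed
  have cid: "c w = w" if "norm w \<le> r'" for w
    using that by (cases "w = 0") (auto simp: c_def min_def field_simps)
  have "isCont g1 x" using c1 by (simp add: continuous_on_eq_continuous_at)
  then obtain e where e: "e > 0" "\<And>u. dist u x < e \<Longrightarrow> dist (g1 u) (g1 x) < r'"
    using r'(2) unfolding continuous_at_eps_delta by blast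
  define m where "m = min (min e r') d1"
  have "m > 0" using e(1) r'(2) c1(1) by (simp add: m_def)
  then have "\<forall>\<^sub>F r in at_right (0::real). r < m \<and> r > 0"
    by (simp add: eventually_at_right_field) (meson)
  then show ?thesis using g1
    unfolding orientation_preserving_at_def
  proof eventually_elim
    case (elim r)
    have r: "r < e" "r < r'" "r > 0" using elim(1) by (auto simp: m_def)
    have hA: "homotopic_with_canon (\<lambda>_. True) (sphere 0 r) (- {0}) A (\<lambda>v. v)"
      using elim(2) unfolding A_def y_def .
    have "homotopic_with_canon (\<lambda>_. True) (sphere 0 r) Z (c \<circ> A) (c \<circ> (\<lambda>v. v))"
      by (rule homotopic_with_compose_continuous_left[OF hA cc cZ])
    then have "homotopic_with_canon (\<lambda>_. True) (sphere 0 r) Z A (\<lambda>v. v)"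
    proof (rule homotopic_with_eq)
      fix v :: 'a assume "v \<in> topspace (top_of_set (sphere 0 r))"
      then have v: "norm v = r" by simp
      have "dist (g1 (x + v)) (g1 x) < r'" by (rule e(2)) (use v r in \<open>simp add: dist_norm\<close>)
      then show "A v = (c \<circ> A) v" by (simp add: cid A_def y_def dist_norm)
      show "v = (c \<circ> (\<lambda>v. v)) v" using v r by (simp add: cid)
    qed simp
    moreover have "homotopic_with_canon (\<lambda>_. True) (sphere 0 r) Z (\<lambda>v. v) (\<lambda>v. (r' / r) *\<^sub>R v)"
    proof (rule homotopic_with_linear)
      fix v :: 'a assume v: "v \<in> sphere 0 r"
      show "closed_segment v ((r' / r) *\<^sub>R v) \<subseteq> Z"
      proof
        fix w assume "w \<in> closed_segment v ((r' / r) *\<^sub>R v)"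
        then obtain t where t: "0 \<le> t" "t \<le> 1" "w = (1 - t) *\<^sub>R v + t *\<^sub>R ((r' / r) *\<^sub>R v)"
          unfolding closed_segment_def by blast
        have s: "w = ((1 - t) + t * (r' / r)) *\<^sub>R v" unfolding t(3) by (simp add: scaleR_add_left)
        have ge: "(1 - t) + t * (r' / r) \<ge> 1"
          using mult_left_mono[of 1 "r' / r" t] t(1) r by simp
        have "norm w = ((1 - t) + t * (r' / r)) * norm v" using ge unfolding s norm_scaleR by (simp only: abs_of_nonneg)
        also have "\<dots> = (1 - t) * r + t * r'" using v r by (simp add: field_simps)
        also have "\<dots> \<le> (1 - t) * r' + t * r'" using r t by (intro add_mono mult_left_mono) auto
        finally have "norm w \<le> r'" by (simp add: algebra_simps)
        moreover have "w \<noteq> 0" using s ge v r by auto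
        ultimately show "w \<in> Z" by (simp add: Z_def)
      qed
    qed (intro continuous_intros)+
    ultimately have "homotopic_with_canon (\<lambda>_. True) (sphere 0 r) Z A (\<lambda>v. (r' / r) *\<^sub>R v)"
      by (rule homotopic_with_trans)
    then have "homotopic_with_canon (\<lambda>_. True) (sphere 0 r) (- {0}) (G \<circ> A) (G \<circ> (\<lambda>v. (r' / r) *\<^sub>R v))"
      by (rule homotopic_with_compose_continuous_left[OF _ Gc' G0])
    moreover have "homotopic_with_canon (\<lambda>_. True) (sphere 0 r) (- {0}) (G \<circ> (\<lambda>v. (r' / r) *\<^sub>R v)) ((\<lambda>v. v) \<circ> (\<lambda>v. (r' / r) *\<^sub>R v))"
      by (rule homotopic_with_compose_continuous_right[OF r'(3)]) (use r in \<open>auto intro!: continuous_intros\<close>)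
    moreover have "homotopic_with_canon (\<lambda>_. True) (sphere 0 r) (- {0}) ((\<lambda>v. v) \<circ> (\<lambda>v. (r' / r) *\<^sub>R v)) (\<lambda>v::'a. v)"
    proof (rule homotopic_with_linear)
      fix v :: 'a assume v: "v \<in> sphere 0 r"
      show "closed_segment (((\<lambda>v. v) \<circ> (\<lambda>v. (r' / r) *\<^sub>R v)) v) v \<subseteq> - {0}"
      proof
        fix w assume "w \<in> closed_segment (((\<lambda>v. v) \<circ> (\<lambda>v. (r' / r) *\<^sub>R v)) v) v"
        then obtain t where t: "0 \<le> t" "t \<le> 1" "w = (1 - t) *\<^sub>R ((r' / r) *\<^sub>R v) + t *\<^sub>R v"
          unfolding closed_segment_def comp_def by blast
        have s: "w = ((1 - t) * (r' / r) + t) *\<^sub>R v" unfolding t(3) by (simp add: scaleR_add_left)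
        have "(1 - t) * (r' / r) + t \<ge> 1"
          using mult_left_mono[of 1 "r' / r" "1 - t"] t(2) r by simp
        then show "w \<in> - {0}" using s v r by auto
      qed
    qed (auto intro!: continuous_intros simp: comp_def)
    ultimately have "homotopic_with_canon (\<lambda>_. True) (sphere 0 r) (- {0}) (G \<circ> A) (\<lambda>v. v)"
      using homotopic_with_trans by blast
    then show ?case
      by (rule homotopic_with_eq) (auto simp: G_def A_def y_def)
  qed
qed

definition unsquash :: "complex \<Rightarrow> real \<Rightarrow> complex \<Rightarrow> complex" where
  "unsquash c r y = (1 / (r - norm (y - c))) *\<^sub>R (y - c)"

lemma unsquash_squash: assumes "r > 0" shows "unsquash c r (squash c r z) = z"
proof -
  have p: "1 + norm z > 0" by (simp add: add_pos_nonneg)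
  have n: "norm (squash c r z - c) = r * norm z / (1 + norm z)" using assms p by (simp add: squash_def)
  have "r - r * norm z / (1 + norm z) = r / (1 + norm z)" using p by (simp add: field_simps)
  then show ?thesis unfolding unsquash_def n using assms p by (simp add: squash_def)
qed

lemma squash_in_ball: "r > 0 \<Longrightarrow> squash c r z \<in> ball c r"
  using squash_range by blast

lemma squash_unsquash: assumes "r > 0" "y \<in> ball c r" shows "squash c r (unsquash c r y) = y"
proof -
  obtain z where "y = squash c r z" using squash_range[OF assms(1), of c] assms(2) by blast
  then show ?thesis using unsquash_squash[OF assms(1)] by simp
qed

lemma unsquash_continuous: "continuous_on (ball c r) (unsquash c r)"
  unfolding unsquash_def by (intro continuous_intros) (auto simp: dist_norm norm_minus_commute)

lemma squash_preserves_orientation: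
  assumes "r > 0" shows "orientation_preserving_at (squash c r) x"
  by (rule orientation_preserving_at_monotone[OF zero_less_one squash_continuous])
     (use squash_monotone[OF assms] in auto)

lemma unsquash_preserves_orientation:
  assumes "r > 0" "y \<in> ball c r" shows "orientation_preserving_at (unsquash c r) y"
proof -
  obtain d where d: "d > 0" "ball y d \<subseteq> ball c r" using assms(2) open_ball openE by blast
  show ?thesis
  proof (rule orientation_preserving_at_monotone[OF d(1) continuous_on_subset[OF unsquash_continuous d(2)]])
    fix u assume u: "u \<in> ball y d" "u \<noteq> y"
    have eq: "squash c r (unsquash c r u) = u" "squash c r (unsquash c r y) = y"
      using squash_unsquash[OF assms(1)] u(1) d(2) assms(2) by auto
    then have ne: "unsquash c r u \<noteq> unsquash c r y" using u(2) by metis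
    show "(unsquash c r u - unsquash c r y) \<bullet> (u - y) > 0"
      using squash_monotone[OF assms(1) ne, of c] unfolding eq by (simp add: inner_commute)
  qed
qed

lemma open_chart_ball:
  assumes e: "open_chart F a" and p: "continuous_on (ball x d) p" "d > 0" "p x \<in> range a" "p ` ball x d \<subseteq> F"
  obtains d' where "0 < d'" "d' \<le> d" "p ` ball x d' \<subseteq> range a"
proof -
  obtain T where T: "open T" "range a = F \<inter> T" using open_chartD(4)[OF e] by (auto simp: openin_open)
  have "open (ball x d \<inter> p -` T)" by (rule continuous_open_preimage[OF p(1) open_ball T(1)])
  moreover have "x \<in> ball x d \<inter> p -` T" using p T by auto
  ultimately obtain s where s: "s > 0" "ball x s \<subseteq> ball x d \<inter> p -` T" using openE by blast
  show ?thesis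
  proof (rule that[of "min s d"])
    show "p ` ball x (min s d) \<subseteq> range a"
    proof
      fix y assume "y \<in> p ` ball x (min s d)"
      then obtain u where u: "u \<in> ball x (min s d)" "y = p u" by blast
      then have "u \<in> ball x d" "u \<in> p -` T" using s(2) by auto
      then show "y \<in> range a" using T(2) p(4) u(2) by blast
    qed
  qed (use s p in auto)
qed

text \<open>Through \<open>q\<close> these charts appear as small discs of charts in
  \<open>ori\<close>. The reparametrisation by \<open>squash\<close> is there because a chart of
  \<open>C\<close> may see only part of a chart in \<open>ori\<close>, while every chart has the
  whole plane as domain.\<close>

definition pulled_back_charts ::
  "(real^4) set \<Rightarrow> (complex \<Rightarrow> real^4) set \<Rightarrow> (real^4 \<Rightarrow> real^4) \<Rightarrow> (complex \<Rightarrow> real^4) set" where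
  "pulled_back_charts C ori q =
     {e. open_chart C e \<and> (\<exists>a\<in>ori. \<exists>c r. r > 0 \<and> (\<forall>z. q (e z) = a (squash c r z)))}"

text \<open>The second and third conclusions provide the base value and the local continuity needed
  to compose local degrees once more.\<close>

lemma pulled_back_charts_transition:
  assumes F: "compact_surface F" and o: "surface_orientation F ori"
    and e: "open_chart C e" "a \<in> ori" "r > 0" "\<And>z. q (e z) = a (squash c r z)"
    and b: "b \<in> ori" and xy: "q (e x) = b y"
  shows "orientation_preserving_at (\<lambda>u. inv_into UNIV b (q (e u))) x"
    and "inv_into UNIV b (q (e x)) = y"
    and "\<exists>d>0. continuous_on (ball x d) (\<lambda>u. inv_into UNIV b (q (e u))) \<and>
         (\<forall>u\<in>ball x d. q (e u) \<in> range b)"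
proof -
  have ch: "open_chart F a" "open_chart F b" using o e(2) b unfolding surface_orientation_def by auto
  note ca = open_chartD[OF ch(1)] and cb = open_chartD[OF ch(2)]
  have tr: "orientation_preserving_at (\<lambda>u. inv_into UNIV b (a u)) (squash c r x)"
    using o e(2) b xy e(4) unfolding surface_orientation_def orientation_preserving_def by metis
  obtain d1 where d1: "0 < d1" "a ` ball (squash c r x) d1 \<subseteq> range b"
    using open_chart_ball[OF ch(2) continuous_on_subset[OF ca(1) subset_UNIV] zero_less_one, of "squash c r x"]
      xy e(4) ca(3) by (metis image_subset_iff rangeI subset_iff)
  have ci: "continuous_on (ball (squash c r x) d1) (\<lambda>u. inv_into UNIV b (a u))"
    by (rule continuous_on_compose2[OF cb(5) continuous_on_subset[OF ca(1) subset_UNIV] d1(2)])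
  have ii: "inj_on (\<lambda>u. inv_into UNIV b (a u)) (ball (squash c r x) d1)"
  proof (rule inj_onI)
    fix u v assume uv: "u \<in> ball (squash c r x) d1" "v \<in> ball (squash c r x) d1"
      "inv_into UNIV b (a u) = inv_into UNIV b (a v)"
    have "a u \<in> range b" "a v \<in> range b" using uv d1(2) by auto
    then have "a u = a v" using uv(3) f_inv_into_f by metis
    then show "u = v" using ca(2) by (simp add: inj_eq)
  qed
  have "orientation_preserving_at (\<lambda>u. inv_into UNIV b (a (squash c r u))) x"
    by (rule orientation_preserving_at_compose[OF squash_preserves_orientation[OF e(3)] zero_less_one squash_continuous tr d1(1) ci ii])
  then show "orientation_preserving_at (\<lambda>u. inv_into UNIV b (q (e u))) x" using e(4) by simp
  show "inv_into UNIV b (q (e x)) = y" using xy cb(2) by simp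
  have "isCont (squash c r) x" using squash_continuous[of UNIV] by (simp add: continuous_on_eq_continuous_at)
  then obtain d where d: "d > 0" "\<And>u. dist u x < d \<Longrightarrow> dist (squash c r u) (squash c r x) < d1"
    using d1(1) unfolding continuous_at_eps_delta by blast
  have sb: "squash c r u \<in> ball (squash c r x) d1" if "u \<in> ball x d" for u
    using d(2)[of u] that by (simp add: dist_commute)
  have "continuous_on (ball x d) (\<lambda>u. inv_into UNIV b (a (squash c r u)))"
    by (rule continuous_on_compose2[OF ci squash_continuous]) (use sb in blast)
  moreover have "q (e u) \<in> range b" if "u \<in> ball x d" for u using sb[OF that] d1(2) e(4) by auto
  ultimately show "\<exists>d>0. continuous_on (ball x d) (\<lambda>u. inv_into UNIV b (q (e u))) \<and>
         (\<forall>u\<in>ball x d. q (e u) \<in> range b)"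
    using d(1) e(4) by (intro exI[of _ d]) simp
qed

text \<open>Injectivity of \<open>q\<close> is asked for on chart ranges only, because a regluing
  map identifies two boundary arcs. A chart of \<open>C\<close> followed by \<open>q\<close> is then
  a chart of \<open>F\<close> and can be compared with the charts in \<open>ori\<close>.\<close>

lemma pulled_back_orientation:
  assumes F: "compact_surface F" and o: "surface_orientation F ori" and C: "compact_surface C"
    and q: "continuous_on C q" "q ` C \<subseteq> F" "\<And>e :: complex \<Rightarrow> real^4. open_chart C e \<Longrightarrow> inj_on q (range e)"
  shows "surface_orientation C (pulled_back_charts C ori q)"
    and "orientation_preserving (pulled_back_charts C ori q) ori q"
proof -
  let ?P = "pulled_back_charts C ori q"
  show op: "orientation_preserving ?P ori q"
    unfolding orientation_preserving_def
  proof (intro ballI allI impI)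
    fix e b x y assume e: "e \<in> ?P" and b: "b \<in> ori" and xy: "q (e x) = b y"
    obtain a c r where a: "open_chart C e" "a \<in> ori" "r > 0" "\<And>z. q (e z) = a (squash c r z)"
      using e unfolding pulled_back_charts_def by blast
    show "orientation_preserving_at (\<lambda>u. inv_into UNIV b (q (e u))) x"
      by (rule pulled_back_charts_transition(1)[OF F o a b xy])
  qed
  have cov: "\<Union> (range ` ?P) = surface_interior C"
  proof
    show "\<Union> (range ` ?P) \<subseteq> surface_interior C"
      unfolding pulled_back_charts_def surface_interior_def by blast
    show "surface_interior C \<subseteq> \<Union> (range ` ?P)"
    proof
      fix x assume "x \<in> surface_interior C"
      then obtain e0 :: "complex \<Rightarrow> real^4" and u0 where e0: "open_chart C e0" "x = e0 u0"
        unfolding surface_interior_def by blast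
      note c0 = open_chartD[OF e0(1)]
      let ?g = "\<lambda>u. q (e0 u)"
      have gc: "continuous_on UNIV ?g" by (rule continuous_on_compose2[OF q(1) c0(1)]) (use c0(3) in auto)
      have gi: "inj ?g" 
      proof (rule injI)
        fix u v assume "?g u = ?g v"
        then have "e0 u = e0 v" by (rule inj_onD[OF q(3)[OF e0(1)]]) auto
        then show "u = v" by (rule injD[OF c0(2)])
      qed
      have gF: "range ?g \<subseteq> F" using q(2) c0(3) by blast
      have gch: "open_chart F ?g" by (rule open_chartI[OF F gc gi gF])
      have "?g u0 \<in> surface_interior F" using gch unfolding surface_interior_def by blast
      then obtain a w0 where a: "a \<in> ori" "?g u0 = a w0" using o unfolding surface_orientation_def by blast
      have ach: "open_chart F a" using o a(1) unfolding surface_orientation_def by blast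
      note ca = open_chartD[OF ach]
      obtain r where r: "0 < r" "a ` ball w0 r \<subseteq> range ?g"
        using open_chart_ball[OF gch continuous_on_subset[OF ca(1) subset_UNIV] zero_less_one, of w0]
          a(2) ca(3) by (metis (no_types, lifting) image_subset_iff rangeI subset_iff)
      \<comment> \<open>A small disc of the oriented chart \<open>a\<close>, pulled back along the
        local inverse of \<open>q\<close> that \<open>e0\<close> provides.\<close>
      define e where "e z = e0 (inv_into UNIV ?g (a (squash w0 r z)))" for z
      have asq: "a (squash w0 r z) \<in> range ?g" for z using r squash_in_ball[OF r(1)] by blast
      have qe: "q (e z) = a (squash w0 r z)" for z
        unfolding e_def using f_inv_into_f[OF asq[of z]] by simp
      have "continuous_on UNIV (\<lambda>z. inv_into UNIV ?g (a (squash w0 r z)))"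
        by (rule continuous_on_compose2[OF open_chartD(5)[OF gch]])
           (use asq in \<open>auto intro!: continuous_on_compose2[OF ca(1)] squash_continuous\<close>)
      then have "continuous_on UNIV e" unfolding e_def by (rule continuous_on_compose2[OF c0(1)]) auto
      moreover have "inj e"
      proof (rule injI)
        fix z z' assume "e z = e z'"
        then have "a (squash w0 r z) = a (squash w0 r z')" using qe by metis
        then show "z = z'" using ca(2) squash_inj[OF r(1)] by (simp add: inj_eq)
      qed
      moreover have "range e \<subseteq> C" using c0(3) unfolding e_def by blast
      ultimately have "open_chart C e" by (rule open_chartI[OF C])
      then have "e \<in> ?P" unfolding pulled_back_charts_def using a(1) r(1) qe by blast
      moreover have "x \<in> range e"
      proof -
        have "e (0) = e0 (inv_into UNIV ?g (?g u0))" using a(2) by (simp add: e_def squash_def)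
        also have "\<dots> = x" using e0(2) inv_into_f_f[OF gi UNIV_I, of u0] by (simp only:)
        finally show ?thesis by (metis rangeI)
      qed
      ultimately show "x \<in> \<Union> (range ` ?P)" by blast
    qed
  qed
  have "orientation_preserving ?P ?P (\<lambda>x. x)"
    unfolding orientation_preserving_def
  proof (intro ballI allI impI)
    fix e1 e2 x y assume e1: "e1 \<in> ?P" and e2: "e2 \<in> ?P" and xy: "e1 x = e2 y"
    obtain a1 c1 r1 where a1: "open_chart C e1" "a1 \<in> ori" "r1 > 0" "\<And>z. q (e1 z) = a1 (squash c1 r1 z)"
      using e1 unfolding pulled_back_charts_def by blast
    obtain a2 c2 r2 where a2: "open_chart C e2" "a2 \<in> ori" "r2 > 0" "\<And>z. q (e2 z) = a2 (squash c2 r2 z)"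
      using e2 unfolding pulled_back_charts_def by blast
    have xy': "q (e1 x) = a2 (squash c2 r2 y)" using xy a2(4) by simp
    note t = pulled_back_charts_transition[OF F o a1 a2(2) xy']
    let ?m = "\<lambda>u. inv_into UNIV a2 (q (e1 u))"
    have "open_chart F a2" using o a2(2) unfolding surface_orientation_def by blast
    note ca = open_chartD[OF this]
    have yb: "squash c2 r2 y \<in> ball c2 r2" by (rule squash_in_ball[OF a2(3)])
    have mx: "?m x = squash c2 r2 y" by (rule t(2))
    obtain d where d: "d > 0" "continuous_on (ball x d) ?m" "\<And>u. u \<in> ball x d \<Longrightarrow> q (e1 u) \<in> range a2"
      using t(3) by blast
    obtain d' where d': "d' > 0" "ball (?m x) d' \<subseteq> ball c2 r2" using yb open_ball openE unfolding mx by blast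
    have ui: "inj_on (unsquash c2 r2) (ball (?m x) d')"
      by (rule inj_on_inverseI[of _ "squash c2 r2"]) (use squash_unsquash[OF a2(3)] d'(2) in blast)
    \<comment> \<open>The transition from \<open>e1\<close> to \<open>e2\<close> is the one from
      \<open>e1\<close> to \<open>a2\<close> followed by the inverse of the squash in
      \<open>e2\<close>.\<close>
    have "orientation_preserving_at (\<lambda>u. unsquash c2 r2 (?m u)) x"
      by (rule orientation_preserving_at_compose[OF t(1) d(1,2) _ d'(1) continuous_on_subset[OF unsquash_continuous d'(2)] ui])
         (unfold mx, rule unsquash_preserves_orientation[OF a2(3) yb])
    note op1 = this
    obtain d2 where d2: "0 < d2" "e1 ` ball x d2 \<subseteq> range e2"
      using open_chart_ball[OF a2(1) continuous_on_subset[OF open_chartD(1)[OF a1(1)] subset_UNIV] zero_less_one, of x]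
        xy open_chartD(3)[OF a1(1)] by (metis (no_types, lifting) image_subset_iff rangeI subset_iff)
    show "orientation_preserving_at (\<lambda>u. inv_into UNIV e2 (e1 u)) x"
    proof (rule orientation_preserving_at_cong[OF op1 d2(1)])
      fix u assume "u \<in> ball x d2"
      then obtain v where v: "e1 u = e2 v" using d2(2) by blast
      have "inv_into UNIV e2 (e1 u) = v" using v open_chartD(2)[OF a2(1)] by simp
      moreover have "?m u = squash c2 r2 v" using v a2(4) ca(2) by simp
      ultimately show "inv_into UNIV e2 (e1 u) = unsquash c2 r2 (?m u)"
        using unsquash_squash[OF a2(3)] by simp
    qed
  qed
  then show "surface_orientation C ?P"
    unfolding surface_orientation_def using cov by (auto simp: pulled_back_charts_def)
qed

text \<open>Chart ranges are connected, so each of them lies inside the clopen set \<open>D\<close>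
  or misses it.\<close>

lemma orientation_of_component:
  assumes o: "surface_orientation C ori" and D: "openin (top_of_set C) D" "closedin (top_of_set C) D"
  shows "surface_orientation D {e \<in> ori. range e \<subseteq> D}"
proof -
  have DC: "D \<subseteq> C" using openin_imp_subset[OF D(1)] .
  have chD: "open_chart D e" if "open_chart C e" "range e \<subseteq> D" for e :: "complex \<Rightarrow> real^4"
    using that openin_subset_trans[OF _ that(2) DC] unfolding open_chart_def by blast
  have chC: "open_chart C e" if "open_chart D e" for e :: "complex \<Rightarrow> real^4"
    using that openin_trans[OF _ D(1)] unfolding open_chart_def by blast
  have dich: "range e \<subseteq> D" if e: "open_chart C e" "range e \<inter> D \<noteq> {}" for e :: "complex \<Rightarrow> real^4"
  proof -
    note c = open_chartD[OF e(1)]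
    have con: "connected (range e)" by (rule connected_continuous_image[OF c(1) connected_UNIV])
    obtain T T' where T: "open T" "D = C \<inter> T" "closed T'" "D = C \<inter> T'"
      using D by (auto simp: openin_open closedin_closed)
    then have "range e \<inter> D = range e \<inter> T" "range e \<inter> D = range e \<inter> T'" using c(3) by blast+
    then have "openin (top_of_set (range e)) (range e \<inter> D)" "closedin (top_of_set (range e)) (range e \<inter> D)"
      using T openin_open closedin_closed by metis+
    then have "range e \<inter> D = {} \<or> range e \<inter> D = range e" using con by (simp add: connected_clopen)
    then show ?thesis using e(2) by blast
  qed
  have chO: "open_chart C e" if "e \<in> ori" for e using o that unfolding surface_orientation_def by blast
  have "\<Union> (range ` {e \<in> ori. range e \<subseteq> D}) = surface_interior D"
  proof
    show "\<Union> (range ` {e \<in> ori. range e \<subseteq> D}) \<subseteq> surface_interior D"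
      using chD chO unfolding surface_interior_def by blast
    show "surface_interior D \<subseteq> \<Union> (range ` {e \<in> ori. range e \<subseteq> D})"
    proof
      fix x assume "x \<in> surface_interior D"
      then obtain e :: "complex \<Rightarrow> real^4" where e: "open_chart D e" "x \<in> range e"
        unfolding surface_interior_def by blast
      have "x \<in> D" using e(2) open_chartD(3)[OF e(1)] by blast
      have "x \<in> surface_interior C" using chC[OF e(1)] e(2) unfolding surface_interior_def by blast
      then obtain b where b: "b \<in> ori" "x \<in> range b" using o unfolding surface_orientation_def by blast
      have "range b \<subseteq> D" by (rule dich[OF chO[OF b(1)]]) (use b(2) \<open>x \<in> D\<close> in blast)
      then show "x \<in> \<Union> (range ` {e \<in> ori. range e \<subseteq> D})" using b by blast
    qed
  qed
  moreover have "orientation_preserving {e \<in> ori. range e \<subseteq> D} {e \<in> ori. range e \<subseteq> D} (\<lambda>x. x)"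
    using o unfolding surface_orientation_def orientation_preserving_def by blast
  ultimately show ?thesis unfolding surface_orientation_def using chD chO by blast
qed

section \<open>A lens in the half-plane\<close>

lemma Cinf_Complex:
  assumes "Cinf U a" "Cinf U b" shows "Cinf U (\<lambda>x. Complex (a x) (b x))"
proof -
  have "Cinf U (\<lambda>x. a x *\<^sub>R (1::complex) + b x *\<^sub>R \<i>)"
    by (intro Cinf_add Cinf_scaleR Cinf_const assms)
  moreover have "(\<lambda>x. a x *\<^sub>R (1::complex) + b x *\<^sub>R \<i>) = (\<lambda>x. Complex (a x) (b x))"
    by (rule ext) (simp add: complex_eq_iff)
  ultimately show ?thesis by simp
qed

lemma Cinf_Re: "Cinf U Re" and Cinf_Im: "Cinf U Im"
  by (rule Cinf_bounded_linear, rule bounded_linear_Re, rule Cinf_bounded_linear, rule bounded_linear_Im)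

lemma smooth_embedding_compose:
  assumes k: "smooth_embedding A k" "k ` A \<subseteq> B"
    and G: "smooth_on B G" "smooth_on (G ` B) Gi" "\<And>u. u \<in> B \<Longrightarrow> Gi (G u) = u"
  shows "smooth_embedding A (G \<circ> k)"
proof -
  obtain g where h: "homeomorphism A (k ` A) k g" and sk: "smooth_on A k" and sg: "smooth_on (k ` A) g"
    using k(1) unfolding smooth_embedding_def diffeomorphism_def by blast
  have kB: "k z \<in> B" if "z \<in> A" for z using k(2) that by blast
  have inv: "g (Gi (G (k z))) = z" if "z \<in> A" for z
    using G(3)[OF kB[OF that]] homeomorphism_apply1[OF h that] by simp
  have s1: "smooth_on A (\<lambda>z. G (k z))" by (rule smooth_on_compose[OF sk G(1) k(2)])
  have s2: "smooth_on ((G \<circ> k) ` A) (\<lambda>y. g (Gi y))"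
  proof (rule smooth_on_compose[OF smooth_on_subset[OF G(2)] sg])
    show "(G \<circ> k) ` A \<subseteq> G ` B" using kB by auto
    show "Gi ` (G \<circ> k) ` A \<subseteq> k ` A" using G(3) kB by auto
  qed
  have "homeomorphism A ((G \<circ> k) ` A) (G \<circ> k) (\<lambda>y. g (Gi y))"
  proof (rule homeomorphismI)
    show "continuous_on A (G \<circ> k)" using smooth_on_imp_continuous_on[OF s1] by (simp add: comp_def)
    show "continuous_on ((G \<circ> k) ` A) (\<lambda>y. g (Gi y))" by (rule smooth_on_imp_continuous_on[OF s2])
  qed (use inv in auto)
  then show ?thesis unfolding smooth_embedding_def diffeomorphism_def using s1 s2 by (auto simp: comp_def)
qed

text \<open>A diffeomorphism of the whole space onto the open unit ball, with inverse
  \<open>of_ball\<close>. The radial map \<open>squash\<close> would not do, since the norm is not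
  smooth at 0.\<close>

definition to_ball :: "'a::euclidean_space \<Rightarrow> 'a" where
  "to_ball u = (1 / sqrt (1 + u \<bullet> u)) *\<^sub>R u"

definition of_ball :: "'a::euclidean_space \<Rightarrow> 'a" where
  "of_ball w = (1 / sqrt (1 - w \<bullet> w)) *\<^sub>R w"

lemma to_ball_in: "to_ball u \<in> ball 0 1"
proof -
  have "norm u < sqrt (1 + u \<bullet> u)" by (rule real_less_rsqrt) (simp add: power2_norm_eq_inner)
  moreover have "sqrt (1 + u \<bullet> u) > 0" by (simp add: add_pos_nonneg)
  ultimately show ?thesis by (simp add: to_ball_def)
qed

lemma of_ball_to_ball: "of_ball (to_ball u) = u"
proof -
  have p: "1 + u \<bullet> u > 0" by (simp add: add_pos_nonneg)
  have "to_ball u \<bullet> to_ball u = (1 / sqrt (1 + u \<bullet> u)) * (1 / sqrt (1 + u \<bullet> u)) * (u \<bullet> u)"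
    by (simp add: to_ball_def)
  also have "\<dots> = (u \<bullet> u) / (1 + u \<bullet> u)" using p by simp
  finally have "1 - to_ball u \<bullet> to_ball u = 1 / (1 + u \<bullet> u)" using p by (simp add: field_simps)
  then have "1 / sqrt (1 - to_ball u \<bullet> to_ball u) = sqrt (1 + u \<bullet> u)" by (simp add: real_sqrt_divide)
  then show ?thesis using p unfolding of_ball_def by (simp add: to_ball_def)
qed

lemma Cinf_to_ball: "Cinf U to_ball"
proof -
  have "Cinf U (\<lambda>u. (1 / sqrt (1 + u \<bullet> u)) *\<^sub>R u)"
    by (intro Cinf_scaleR Cinf_divide Cinf_sqrt Cinf_add Cinf_inner Cinf_const Cinf_ident)
       (simp_all add: add_pos_nonneg add_nonneg_eq_0_iff)
  then show ?thesis by (simp add: to_ball_def[abs_def])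
qed

lemma Cinf_of_ball: "Cinf (ball 0 1) of_ball"
proof -
  have p: "1 - u \<bullet> u > 0" if "u \<in> ball 0 1" for u :: 'a
    using that by (simp add: power2_norm_eq_inner[symmetric] power_less_one_iff abs_square_less_1)
  have "Cinf (ball 0 1) (\<lambda>u::'a. (1 / sqrt (1 - u \<bullet> u)) *\<^sub>R u)"
    by (intro Cinf_scaleR Cinf_divide Cinf_sqrt Cinf_diff Cinf_inner Cinf_const Cinf_ident)
       (use p in \<open>auto dest: less_imp_neq\<close>)
  then show ?thesis by (simp add: of_ball_def[abs_def])
qed

text \<open>All derivatives vanish at -1 and 1. The graph therefore leaves the real axis without a
  corner, and the region above it has a smooth boundary.\<close>

definition bump :: "real \<Rightarrow> real" where
  "bump x = flat_exp 0 (1 - x\<^sup>2)"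

lemma bump_eq: "bump x = (if \<bar>x\<bar> < 1 then exp (- 1 / (1 - x\<^sup>2)) else 0)"
  by (simp add: bump_def flat_exp_def abs_square_less_1)

lemma bump_pos_iff: "bump x > 0 \<longleftrightarrow> \<bar>x\<bar> < 1"
  by (simp add: bump_eq)

lemma bump_nonneg: "bump x \<ge> 0"
  by (simp add: bump_eq)

lemma bump_less_1: "bump x < 1"
proof (cases "\<bar>x\<bar> < 1")
  case True
  then have "1 - x\<^sup>2 > 0" by (simp add: abs_square_less_1)
  then have "- 1 / (1 - x\<^sup>2) < 0" by simp
  then show ?thesis using True by (simp add: bump_eq)
qed (simp add: bump_eq)

lemma Cinf_bump: "Cinf U a \<Longrightarrow> Cinf U (\<lambda>x. bump (a x))"
  unfolding bump_def power2_eq_square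
  by (intro Cinf_compose[OF Cinf_flat_exp[of UNIV]] Cinf_diff Cinf_mult Cinf_const) auto

definition lens :: "complex set" where
  "lens = {z. \<bar>Re z\<bar> \<le> 1 \<and> 0 \<le> Im z \<and> Im z \<le> bump (Re z)}"

text \<open>The strict inequality already forces the real part to be less than 1 in absolute value,
  as \<open>bump\<close> is 0 elsewhere.\<close>

definition lens_below :: "complex set" where
  "lens_below = {z. 0 \<le> Im z \<and> Im z < bump (Re z)}"

definition lens_arc :: "complex set" where
  "lens_arc = {z. \<bar>Re z\<bar> \<le> 1 \<and> Im z = bump (Re z)}"

definition half_disc :: "complex set" where
  "half_disc = {z. Im z \<ge> 0} \<inter> ball 0 2"

lemma lens_eq: "lens = lens_below \<union> lens_arc" "lens_below \<inter> lens_arc = {}"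
proof -
  show "lens = lens_below \<union> lens_arc"
  proof (rule Set.set_eqI)
    fix z show "z \<in> lens \<longleftrightarrow> z \<in> lens_below \<union> lens_arc"
      using bump_nonneg[of "Re z"] bump_pos_iff[of "Re z"]
      by (auto simp: lens_def lens_below_def lens_arc_def)
  qed
  show "lens_below \<inter> lens_arc = {}" by (auto simp: lens_below_def lens_arc_def)
qed

lemma lens_half_disc: "lens \<subseteq> half_disc"
proof
  fix z assume z: "z \<in> lens"
  then have "\<bar>Re z\<bar> \<le> 1" "\<bar>Im z\<bar> < 1" "Im z \<ge> 0" using bump_less_1[of "Re z"] by (auto simp: lens_def)
  then show "z \<in> half_disc" using cmod_le[of z] by (simp add: half_disc_def)
qed

text \<open>With \<open>s = 1 - x\<^sup>2\<close> the height of the image of \<open>x + i y\<close> is \<open>bump x (1 + y / \<surd>s) / 2\<close>; the quotient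
  \<open>bump x / \<surd>s\<close> is written so that it extends continuously by 0 to \<open>s = 0\<close>.\<close>

definition lens_map :: "complex \<Rightarrow> complex" where
  "lens_map w = Complex (Re w)
     ((bump (Re w) + sqrt (1 - (Re w)\<^sup>2) * flat_exp 1 (1 - (Re w)\<^sup>2) * Im w) / 2)"

definition lens_inv :: "complex \<Rightarrow> complex" where
  "lens_inv z = Complex (Re z) (sqrt (1 - (Re z)\<^sup>2) * (2 * Im z / bump (Re z) - 1))"

lemma lens_map_inside:
  assumes "\<bar>Re w\<bar> < 1"
  shows "lens_map w = Complex (Re w) (bump (Re w) * (1 + Im w / sqrt (1 - (Re w)\<^sup>2)) / 2)"
proof -
  define s where "s = 1 - (Re w)\<^sup>2"
  have s: "s > 0" using assms by (simp add: s_def abs_square_less_1)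
  have "sqrt s * flat_exp 1 s = flat_exp 0 s * (sqrt s / s)" using s by (simp add: flat_exp_def)
  also have "sqrt s / s = 1 / sqrt s" using sqrt_divide_self_eq[of s] s by (simp add: divide_inverse)
  finally show ?thesis by (simp add: lens_map_def bump_def s_def[symmetric] algebra_simps)
qed

lemma lens_map_edge: "\<bar>Re w\<bar> \<ge> 1 \<Longrightarrow> lens_map w = Complex (Re w) 0"
  using abs_square_less_1[of "Re w"] by (simp add: lens_map_def bump_def flat_exp_def)

lemma sqrt_slice_pos: "\<bar>x\<bar> < 1 \<Longrightarrow> sqrt (1 - x\<^sup>2) > 0"
  by (simp add: abs_square_less_1)

lemma lens_inv_map: assumes "\<bar>Re w\<bar> < 1" shows "lens_inv (lens_map w) = w"
proof -
  have "bump (Re w) > 0" "sqrt (1 - (Re w)\<^sup>2) > 0" using assms bump_pos_iff sqrt_slice_pos by auto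
  then show ?thesis
    unfolding lens_map_inside[OF assms] lens_inv_def by (simp add: complex_eq_iff field_simps)
qed

lemma lens_map_inv: assumes "\<bar>Re z\<bar> < 1" shows "lens_map (lens_inv z) = z"
proof -
  have "bump (Re z) > 0" "sqrt (1 - (Re z)\<^sup>2) > 0" using assms bump_pos_iff sqrt_slice_pos by auto
  moreover have "\<bar>Re (lens_inv z)\<bar> < 1" using assms by (simp add: lens_inv_def)
  ultimately show ?thesis
    by (simp add: lens_map_inside lens_inv_def complex_eq_iff field_simps)
qed

lemma disc_slice: "w \<in> cball 0 1 \<longleftrightarrow> \<bar>Im w\<bar> \<le> sqrt (1 - (Re w)\<^sup>2)"
proof -
  have "w \<in> cball 0 1 \<longleftrightarrow> (Im w)\<^sup>2 \<le> 1 - (Re w)\<^sup>2" by (auto simp: cmod_def)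
  also have "\<dots> \<longleftrightarrow> \<bar>Im w\<bar> \<le> sqrt (1 - (Re w)\<^sup>2)"
    using real_sqrt_le_iff[of "(Im w)\<^sup>2" "1 - (Re w)\<^sup>2"] unfolding real_sqrt_abs by (rule sym)
  finally show ?thesis .
qed

lemma Re_cball: "w \<in> cball 0 1 \<Longrightarrow> \<bar>Re w\<bar> \<le> 1"
  using abs_Re_le_cmod[of w] by simp

lemma lens_map_image: "lens_map ` cball 0 1 = lens"
proof
  show "lens_map ` cball 0 1 \<subseteq> lens"
  proof
    fix z assume "z \<in> lens_map ` cball 0 1"
    then obtain w where w: "w \<in> cball 0 1" "z = lens_map w" by blast
    show "z \<in> lens"
    proof (cases "\<bar>Re w\<bar> < 1")
      case True
      note p = sqrt_slice_pos[OF True]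
      define t where "t = Im w / sqrt (1 - (Re w)\<^sup>2)"
      have t: "-1 \<le> t" "t \<le> 1" using w(1) p unfolding disc_slice t_def by (auto simp: field_simps abs_le_iff)
      have "Im z = bump (Re w) * ((1 + t) / 2)" "Re z = Re w"
        using w(2) unfolding lens_map_inside[OF True] t_def by auto
      moreover have "bump (Re w) * ((1 + t) / 2) \<le> bump (Re w) * 1"
        by (rule mult_left_mono) (use t bump_nonneg in auto)
      moreover have "bump (Re w) * ((1 + t) / 2) \<ge> 0" using t bump_nonneg by simp
      ultimately show ?thesis using True by (simp add: lens_def)
    next
      case False
      then have "z = Complex (Re w) 0" using w(2) lens_map_edge[of w] by simp
      then show ?thesis using Re_cball[OF w(1)] bump_nonneg by (simp add: lens_def)
    qed
  qed
  show "lens \<subseteq> lens_map ` cball 0 1"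
  proof
    fix z assume z: "z \<in> lens"
    show "z \<in> lens_map ` cball 0 1"
    proof (cases "\<bar>Re z\<bar> < 1")
      case True
      have b: "bump (Re z) > 0" using True bump_pos_iff by simp
      have "2 * Im z / bump (Re z) \<le> 2" "2 * Im z / bump (Re z) \<ge> 0" using z b by (auto simp: lens_def field_simps)
      then have "\<bar>2 * Im z / bump (Re z) - 1\<bar> \<le> 1" by (simp add: abs_le_iff)
      then have "sqrt (1 - (Re z)\<^sup>2) * \<bar>2 * Im z / bump (Re z) - 1\<bar> \<le> sqrt (1 - (Re z)\<^sup>2) * 1"
        using sqrt_slice_pos[OF True] by (intro mult_left_mono) auto
      then have "lens_inv z \<in> cball 0 1"
        using sqrt_slice_pos[OF True] unfolding disc_slice lens_inv_def by (simp add: abs_mult)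
      then show ?thesis using lens_map_inv[OF True] by (metis image_eqI)
    next
      case False
      then have "bump (Re z) = 0" by (simp add: bump_eq)
      then have "Im z = 0" "\<bar>Re z\<bar> \<le> 1" using z by (auto simp: lens_def)
      moreover then have "z \<in> cball 0 1" using cmod_le[of z] by simp
      moreover have "lens_map z = z" using lens_map_edge[of z] False \<open>Im z = 0\<close> by (simp add: complex_eq_iff)
      ultimately show ?thesis by (metis image_eqI)
    qed
  qed
qed

lemma lens_map_inj: "inj_on lens_map (cball 0 1)"
proof (rule inj_onI)
  fix v w assume vw: "v \<in> cball 0 1" "w \<in> cball 0 1" "lens_map v = lens_map w"
  have Re: "Re v = Re w" using vw(3) unfolding lens_map_def by simp
  show "v = w"
  proof (cases "\<bar>Re w\<bar> < 1")
    case True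
    have "lens_inv (lens_map v) = v" by (rule lens_inv_map) (use True Re in simp)
    then show ?thesis using lens_inv_map[OF True] vw(3) by metis
  next
    case False
    then have "(Re w)\<^sup>2 = 1" using Re_cball[OF vw(2)] by (simp add: abs_square_eq_1)
    then show ?thesis using vw(1,2) Re unfolding disc_slice by (simp add: complex_eq_iff)
  qed
qed

lemma lens_map_continuous: "continuous_on A lens_map"
proof -
  have "continuous_on A (\<lambda>w. of_real (Re w) + \<i> * of_real ((bump (Re w) + sqrt (1 - (Re w)\<^sup>2) * flat_exp 1 (1 - (Re w)\<^sup>2) * Im w) / 2))"
    unfolding bump_def
    by (intro continuous_intros continuous_on_compose2[OF Cinf_imp_continuous_on[OF Cinf_flat_exp[of UNIV]]]) auto
  then show ?thesis unfolding lens_map_def Complex_eq .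
qed

lemma lens_map_arc: assumes w: "w \<in> cball 0 1" "lens_map w \<in> lens_arc" shows "norm w = 1"
proof (cases "\<bar>Re w\<bar> < 1")
  case True
  have b: "bump (Re w) > 0" using True bump_pos_iff by simp
  have "bump (Re w) * (1 + Im w / sqrt (1 - (Re w)\<^sup>2)) / 2 = bump (Re w)"
    using w(2) unfolding lens_map_inside[OF True] lens_arc_def by simp
  then have "Im w = sqrt (1 - (Re w)\<^sup>2)" using b sqrt_slice_pos[OF True] by (simp add: field_simps)
  then have "(Im w)\<^sup>2 = 1 - (Re w)\<^sup>2" using True abs_square_less_1[of "Re w"] by simp
  then show ?thesis by (simp add: cmod_def)
next
  case False
  then show ?thesis using w(1) abs_Re_le_cmod[of w] by simp
qed

lemma lens_map_below: assumes "w \<in> ball 0 1" shows "lens_map w \<in> lens_below"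
proof -
  have "lens_map w \<in> lens" using lens_map_image assms by fastforce
  moreover have "lens_map w \<notin> lens_arc" using lens_map_arc[of w] assms by auto
  ultimately show ?thesis using lens_eq by blast
qed

lemma Re_ball: "w \<in> ball 0 1 \<Longrightarrow> \<bar>Re w\<bar> < 1"
  using abs_Re_le_cmod[of w] by simp

lemma open_strip: "open {z. \<bar>Re z\<bar> < 1}"
  by (intro open_Collect_less continuous_intros)

lemma Cinf_lens_map: "Cinf {z. \<bar>Re z\<bar> < 1} lens_map"
proof -
  have p: "1 - Re x * Re x > 0" if "x \<in> {z. \<bar>Re z\<bar> < 1}" for x
    using that abs_square_less_1[of "Re x"] by (simp add: power2_eq_square)
  show ?thesis
    unfolding lens_map_def[abs_def] power2_eq_square
    by (intro Cinf_Complex Cinf_Re Cinf_Im Cinf_divide Cinf_add Cinf_mult Cinf_sqrt Cinf_diff Cinf_const Cinf_bump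
         Cinf_compose[OF Cinf_flat_exp[of UNIV]] p subset_UNIV) auto
qed

lemma Cinf_lens_inv: "Cinf {z. \<bar>Re z\<bar> < 1} lens_inv"
proof -
  have p: "1 - Re x * Re x > 0" if "x \<in> {z. \<bar>Re z\<bar> < 1}" for x
    using that abs_square_less_1[of "Re x"] by (simp add: power2_eq_square)
  have b: "bump (Re x) \<noteq> 0" if "x \<in> {z. \<bar>Re z\<bar> < 1}" for x
    using that bump_pos_iff[of "Re x"] by auto
  show ?thesis
    unfolding lens_inv_def[abs_def] power2_eq_square
    by (intro Cinf_Complex Cinf_Re Cinf_Im Cinf_divide Cinf_add Cinf_mult Cinf_sqrt Cinf_diff Cinf_const Cinf_bump p b)
qed

lemma compact_lens: "compact lens"
  using compact_continuous_image[OF lens_map_continuous compact_cball] lens_map_image by metis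

lemma lens_below_openin: "openin (top_of_set {z. Im z \<ge> 0}) lens_below"
proof -
  have "continuous_on UNIV (\<lambda>z. bump (Re z))"
    by (rule Cinf_imp_continuous_on[OF Cinf_bump[OF Cinf_Re]])
  then have "open {z. Im z < bump (Re z)}" by (intro open_Collect_less continuous_on_Im continuous_on_id)
  moreover have "lens_below = {z. Im z \<ge> 0} \<inter> {z. Im z < bump (Re z)}" by (auto simp: lens_below_def)
  ultimately show ?thesis by (metis openin_open_Int)
qed

text \<open>Takes the closed half-plane to the region on or above the graph of \<open>bump\<close>.
  Being smooth with a smooth inverse, it provides boundary charts for what remains after the lens is
  cut off.\<close>

definition shear :: "complex \<Rightarrow> complex" where
  "shear v = v + \<i> * of_real (bump (Re v))"

definition unshear :: "complex \<Rightarrow> complex" where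
  "unshear v = v - \<i> * of_real (bump (Re v))"

lemma shear_unshear: "shear (unshear v) = v" "unshear (shear v) = v"
  by (simp_all add: shear_def unshear_def)

lemma Cinf_shear: "Cinf U shear" "Cinf U unshear"
proof -
  have "Cinf U (\<lambda>v. v + \<i> * (bump (Re v) *\<^sub>R 1))" "Cinf U (\<lambda>v. v - \<i> * (bump (Re v) *\<^sub>R 1))"
    by (intro Cinf_add Cinf_diff Cinf_mult Cinf_const Cinf_ident Cinf_scaleR Cinf_bump Cinf_Re)+
  then show "Cinf U shear" "Cinf U unshear"
    by (simp_all add: shear_def[abs_def] unshear_def[abs_def] of_real_def)
qed

section \<open>Surface charts\<close>

lemma surface_chart_restrict:
  assumes ch: "surface_chart F W U f g" and U': "openin (top_of_set F') U'" "U' \<subseteq> U" "openin (top_of_set F) U'"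
  shows "surface_chart F' (g ` U') U' f g"
proof -
  note c = surface_chartD[OF ch]
  have UU: "openin (top_of_set U) U'" using openin_subset_trans[OF U'(3,2)] openin_imp_subset[OF c(1)] by blast
  have "openin (top_of_set W) (g ` U')"
    by (rule homeomorphism_imp_open_map[OF homeomorphism_symD[OF c(3)] UU])
  then have o: "openin (top_of_set {z. Im z \<ge> 0}) (g ` U')" using c(2) openin_trans by blast
  have "homeomorphism (g ` U') U' f g"
    by (rule homeomorphism_of_subsets[OF c(3)]) (use c(7) U'(2) in \<open>force+\<close>)
  moreover have "smooth_on (g ` U') f" by (rule smooth_on_subset[OF c(4)]) (use c(7) U'(2) in blast)
  moreover have "smooth_on U' g" by (rule smooth_on_subset[OF c(5) U'(2)])
  ultimately show ?thesis unfolding surface_chart_def diffeomorphism_def using U'(1) o by blast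
qed

lemma surface_chart_Un:
  assumes ch: "surface_chart A W U f g" and A: "openin (top_of_set (A \<union> B)) A"
  shows "surface_chart (A \<union> B) W U f g"
  using ch openin_trans[OF _ A] unfolding surface_chart_def by blast

lemma compact_surface_Un:
  assumes A: "compact_surface A" and B: "compact_surface B"
    and o: "openin (top_of_set (A \<union> B)) A" "openin (top_of_set (A \<union> B)) B"
  shows "compact_surface (A \<union> B)"
proof -
  have cc: "compact (A \<union> B)" using A B compact_Un unfolding compact_surface_def by blast
  have "\<exists>U W f g. x \<in> U \<and> surface_chart (A \<union> B) W U f g" if "x \<in> A \<union> B" for x
  proof (cases "x \<in> A")
    case True
    then show ?thesis using compact_surface_chart[OF A True] surface_chart_Un[OF _ o(1)] by metis
  next
    case False
    then have "x \<in> B" using that by blast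
    then show ?thesis using compact_surface_chart[OF B] surface_chart_Un[of B _ _ _ _ A] o(2)
      by (metis Un_commute)
  qed
  then show ?thesis using cc unfolding compact_surface_def surface_chart_def by blast
qed

lemma surface_chart_interior_point:
  assumes F: "compact_surface F" and ch: "surface_chart F W U f g" and w: "w \<in> W" "Im w > 0"
  shows "f w \<in> surface_interior F"
proof -
  obtain r f' where d: "disc_chart F w r f' g" "\<And>z. z \<in> ball w r \<Longrightarrow> f' z = f z"
    using disc_chart_in_surface_chart[OF ch w] by metis
  then have "f' w = f w" "w \<in> ball w r" by (auto simp: disc_chart_def)
  then show ?thesis using disc_chart_interior[OF F d(1)] by (metis image_subset_iff)
qed

text \<open>An affine rescaling by half the available radius makes the half-disc of radius 2 fit,
  and this half-disc contains the lens.\<close>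

lemma surface_chart_normalise:
  assumes ch: "surface_chart F W U f g" and w: "w \<in> W" "Im w = 0"
  obtains U' f' g' where "surface_chart F half_disc U' f' g'"
proof -
  note c = surface_chartD[OF ch]
  obtain T where T: "open T" "W = {z. Im z \<ge> 0} \<inter> T" using c(2) by (auto simp: openin_open)
  then obtain e where e: "e > 0" "ball w e \<subseteq> T" using w(1) openE by blast
  define \<rho> where "\<rho> = e / 2"
  have \<rho>: "\<rho> > 0" using e by (simp add: \<rho>_def)
  define l where "l z = w + \<rho> *\<^sub>R z" for z
  define li where "li z = (1 / \<rho>) *\<^sub>R (z - w)" for z
  have lli: "l (li z) = z" "li (l z) = z" for z using \<rho> by (simp_all add: l_def li_def)
  define Wd where "Wd = {z. Im z \<ge> 0} \<inter> ball w e"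
  have WdW: "Wd \<subseteq> W" using e(2) T(2) by (auto simp: Wd_def)
  have lW: "l z \<in> Wd \<longleftrightarrow> z \<in> half_disc" for z
    using \<rho> w(2) by (auto simp: l_def Wd_def half_disc_def dist_norm \<rho>_def zero_le_mult_iff)
  have im: "l ` half_disc = Wd"
  proof
    show "l ` half_disc \<subseteq> Wd" using lW by blast
    show "Wd \<subseteq> l ` half_disc" using lW lli by (metis image_eqI subsetI)
  qed
  define U' where "U' = f ` Wd"
  have "openin (top_of_set {z. Im z \<ge> 0}) Wd" unfolding Wd_def by (simp add: openin_open_Int)
  then have "openin (top_of_set W) Wd" by (rule openin_subset_trans[OF _ WdW openin_imp_subset[OF c(2)]])
  then have oU: "openin (top_of_set U) U'" unfolding U'_def by (rule homeomorphism_imp_open_map[OF c(3)])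
  have oF: "openin (top_of_set F) U'" using openin_trans[OF oU c(1)] .
  have U'U: "U' \<subseteq> U" by (rule openin_imp_subset[OF oU])
  have gU: "g y \<in> Wd" "f (g y) = y" if "y \<in> U'" for y
    using that c(6) WdW unfolding U'_def by auto
  have lC: "Cinf UNIV l" "Cinf UNIV li" unfolding l_def[abs_def] li_def[abs_def]
    by (intro Cinf_add Cinf_scaleR Cinf_diff Cinf_const Cinf_ident)+
  have s1: "smooth_on half_disc (\<lambda>z. f (l z))"
    by (rule smooth_on_compose[OF Cinf_imp_smooth_on[OF open_UNIV lC(1) subset_UNIV] c(4)]) (use im WdW in blast)
  have s2: "smooth_on U' (\<lambda>y. li (g y))"
    by (rule smooth_on_compose[OF smooth_on_subset[OF c(5) U'U] Cinf_imp_smooth_on[OF open_UNIV lC(2) subset_UNIV] subset_UNIV])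
  have "homeomorphism half_disc U' (\<lambda>z. f (l z)) (\<lambda>y. li (g y))"
  proof (rule homeomorphismI)
    show "(\<lambda>z. f (l z)) ` half_disc \<subseteq> U'" using lW unfolding U'_def by blast
    show "(\<lambda>y. li (g y)) ` U' \<subseteq> half_disc" using gU(1) lW lli by (metis image_subset_iff)
    show "li (g (f (l z))) = z" if "z \<in> half_disc" for z
      using lW[of z] that c(6) WdW lli by (metis subsetD)
    show "f (l (li (g y))) = y" if "y \<in> U'" for y using gU[OF that] lli by simp
  qed (use s1 s2 smooth_on_imp_continuous_on in auto)
  moreover have "openin (top_of_set {z. Im z \<ge> 0}) half_disc" unfolding half_disc_def by (simp add: openin_open_Int)
  ultimately have "surface_chart F half_disc U' (\<lambda>z. f (l z)) (\<lambda>y. li (g y))"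
    unfolding surface_chart_def diffeomorphism_def using oF s1 s2 by blast
  then show ?thesis by (rule that)
qed

text \<open>The third coordinate 5 puts the disc outside the unit sphere, in which the surface to be
  cut is contained.\<close>

definition flat_disc_map :: "complex \<Rightarrow> real^4" where
  "flat_disc_map w = Re w *\<^sub>R axis 1 1 + Im w *\<^sub>R axis 2 1 + 5 *\<^sub>R axis 3 1"

definition plane_proj :: "real^4 \<Rightarrow> complex" where
  "plane_proj x = Complex (x $ 1) (x $ 2)"

definition flat_disc :: "(real^4) set" where
  "flat_disc = flat_disc_map ` cball 0 1"

lemma flat_disc_map_nth: "flat_disc_map w $ 3 = 5" "plane_proj (flat_disc_map w) = w"
  by (simp_all add: flat_disc_map_def plane_proj_def axis_def complex_eq_iff)

lemma Cinf_flat_disc_map: "Cinf U flat_disc_map"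
  unfolding flat_disc_map_def[abs_def] by (intro Cinf_add Cinf_scaleR Cinf_const Cinf_Re Cinf_Im)

lemma Cinf_plane_proj: "Cinf U plane_proj"
  unfolding plane_proj_def[abs_def] by (intro Cinf_Complex Cinf_bounded_linear bounded_linear_vec_nth)

lemma compact_flat_disc: "compact flat_disc"
  unfolding flat_disc_def by (rule compact_continuous_image[OF Cinf_imp_continuous_on[OF Cinf_flat_disc_map] compact_cball])

lemma flat_disc_homeomorphism: "homeomorphism (cball 0 1) flat_disc flat_disc_map plane_proj"
  unfolding flat_disc_def
  by (rule homeomorphismI) (auto simp: flat_disc_map_nth intro!: Cinf_imp_continuous_on Cinf_flat_disc_map Cinf_plane_proj)

lemma cayley_bounds:
  assumes "Im z \<ge> 0" shows "z + \<i> \<noteq> 0" "norm ((z - \<i>) / (z + \<i>)) \<le> 1" "(z - \<i>) / (z + \<i>) \<noteq> 1"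
proof -
  show n: "z + \<i> \<noteq> 0" using assms by (auto simp: complex_eq_iff)
  have "(norm (z - \<i>))\<^sup>2 \<le> (norm (z + \<i>))\<^sup>2" unfolding cmod_power2 using assms by (simp add: power2_eq_square algebra_simps)
  then have "norm (z - \<i>) \<le> norm (z + \<i>)" by (rule power2_le_imp_le) simp
  then show "norm ((z - \<i>) / (z + \<i>)) \<le> 1" using n by (simp add: norm_divide divide_le_eq)
  show "(z - \<i>) / (z + \<i>) \<noteq> 1" using n by (subst divide_eq_1_iff) (simp add: complex_eq_iff)
qed

lemma cayley_inverse_Im:
  assumes "w \<noteq> 1" shows "Im (\<i> * (1 + w) / (1 - w)) = (1 - (norm w)\<^sup>2) / (norm (1 - w))\<^sup>2"
  unfolding Im_divide cmod_power2 by (simp add: power2_eq_square algebra_simps)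

text \<open>Cayley transform; the sign \<open>\<epsilon>\<close> chooses which boundary point is left out.\<close>

lemma flat_disc_chart:
  assumes \<epsilon>: "\<epsilon> \<in> {1, -1::complex}"
  shows "surface_chart flat_disc {z. Im z \<ge> 0} (flat_disc - {flat_disc_map \<epsilon>})
     (\<lambda>z. flat_disc_map (\<epsilon> * ((z - \<i>) / (z + \<i>))))
     (\<lambda>x. \<i> * (1 + \<epsilon> * plane_proj x) / (1 - \<epsilon> * plane_proj x))"
proof -
  let ?f = "\<lambda>z. flat_disc_map (\<epsilon> * ((z - \<i>) / (z + \<i>)))"
  let ?g = "\<lambda>x. \<i> * (1 + \<epsilon> * plane_proj x) / (1 - \<epsilon> * plane_proj x)"
  have ee: "\<epsilon> * \<epsilon> = 1" "norm \<epsilon> = 1" using \<epsilon> by auto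
  have ew: "\<epsilon> * w \<noteq> 1 \<longleftrightarrow> w \<noteq> \<epsilon>" for w using \<epsilon> by (auto simp: minus_equation_iff)
  have Uw: "x \<in> flat_disc - {flat_disc_map \<epsilon>} \<longleftrightarrow> (\<exists>w. x = flat_disc_map w \<and> norm w \<le> 1 \<and> \<epsilon> * w \<noteq> 1)" for x
    unfolding flat_disc_def ew by (auto; metis flat_disc_map_nth(2))
  have op: "openin (top_of_set flat_disc) (flat_disc - {flat_disc_map \<epsilon>})"
    by (rule openin_delete) simp
  have o1: "open {z. z + \<i> \<noteq> 0}" by (intro open_Collect_neq continuous_intros)
  have "Cinf {z. z + \<i> \<noteq> 0} ?f"
    by (intro Cinf_compose[OF Cinf_flat_disc_map[of UNIV]] Cinf_mult Cinf_divide Cinf_add Cinf_diff Cinf_const Cinf_ident) auto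
  then have s1: "smooth_on {z. Im z \<ge> 0} ?f" by (rule Cinf_imp_smooth_on[OF o1]) (use cayley_bounds(1) in auto)
  have o2: "open {x. 1 - \<epsilon> * plane_proj x \<noteq> 0}"
    by (intro open_Collect_neq continuous_intros Cinf_imp_continuous_on[OF Cinf_plane_proj])
  have "Cinf {x. 1 - \<epsilon> * plane_proj x \<noteq> 0} ?g"
    by (intro Cinf_mult Cinf_divide Cinf_add Cinf_diff Cinf_const Cinf_plane_proj) auto
  then have s2: "smooth_on (flat_disc - {flat_disc_map \<epsilon>}) ?g"
    by (rule Cinf_imp_smooth_on[OF o2]) (rule subsetI, metis (mono_tags, lifting) Uw flat_disc_map_nth(2) mem_Collect_eq right_minus_eq)
  have "homeomorphism {z. Im z \<ge> 0} (flat_disc - {flat_disc_map \<epsilon>}) ?f ?g"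
  proof (rule homeomorphismI)
    show "continuous_on {z. 0 \<le> Im z} ?f" "continuous_on (flat_disc - {flat_disc_map \<epsilon>}) ?g"
      using s1 s2 smooth_on_imp_continuous_on by auto
    show "?f ` {z. 0 \<le> Im z} \<subseteq> flat_disc - {flat_disc_map \<epsilon>}"
    proof clarify
      fix z :: complex assume z: "0 \<le> Im z"
      have "norm (\<epsilon> * ((z - \<i>) / (z + \<i>))) \<le> 1" using cayley_bounds(2)[OF z] unfolding norm_mult ee(2) mult_1 .
      moreover have "\<epsilon> * (\<epsilon> * ((z - \<i>) / (z + \<i>))) \<noteq> 1"
        using cayley_bounds(3)[OF z] ee(1) by (metis mult.assoc mult_1)
      ultimately show "?f z \<in> flat_disc - {flat_disc_map \<epsilon>}" unfolding Uw by blast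
    qed
    show "?g ` (flat_disc - {flat_disc_map \<epsilon>}) \<subseteq> {z. 0 \<le> Im z}"
    proof
      fix y assume "y \<in> ?g ` (flat_disc - {flat_disc_map \<epsilon>})"
      then obtain x where x: "x \<in> flat_disc - {flat_disc_map \<epsilon>}" "y = ?g x" by blast
      obtain w where w: "x = flat_disc_map w" "norm w \<le> 1" "\<epsilon> * w \<noteq> 1" using x(1) Uw by blast
      have "Im y = (1 - (norm (\<epsilon> * w))\<^sup>2) / (norm (1 - \<epsilon> * w))\<^sup>2"
        using cayley_inverse_Im[OF w(3)] x(2) w(1) flat_disc_map_nth(2) by simp
      moreover have "(norm (\<epsilon> * w))\<^sup>2 \<le> 1" using w(2) ee(2) by (simp add: norm_mult power_le_one)
      ultimately show "y \<in> {z. 0 \<le> Im z}" by simp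
    qed
    show "?g (?f z) = z" if "z \<in> {z. 0 \<le> Im z}" for z
    proof -
      have n: "z + \<i> \<noteq> 0" using cayley_bounds(1) that by simp
      define c where "c = (z - \<i>) / (z + \<i>)"
      have a: "\<epsilon> * (\<epsilon> * c) = c" using ee(1) by (metis mult.assoc mult_1)
      have d: "1 - c = 2 * \<i> / (z + \<i>)" "1 + c = 2 * z / (z + \<i>)" using n by (simp_all add: c_def field_simps)
      have "?g (?f z) = \<i> * (1 + c) / (1 - c)"
        unfolding flat_disc_map_nth(2) c_def[symmetric] a ..
      also have "\<dots> = z" unfolding d using n by simp
      finally show ?thesis .
    qed
    show "?f (?g x) = x" if "x \<in> flat_disc - {flat_disc_map \<epsilon>}" for x
    proof -
      from iffD1[OF Uw that] obtain w where w: "x = flat_disc_map w" "\<epsilon> * w \<noteq> 1" by (elim exE conjE)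
      define c where "c = \<epsilon> * w"
      define y where "y = \<i> * (1 + c) / (1 - c)"
      have c: "1 - c \<noteq> 0" using w(2) by (simp add: c_def)
      have yc: "y * (1 - c) = \<i> * (1 + c)" using c by (simp add: y_def)
      have "y - \<i> = (2 * \<i> * c) / (1 - c)"
        by (rule eq_divide_imp[OF c], simp only: left_diff_distrib yc) (simp add: algebra_simps)
      moreover have "y + \<i> = (2 * \<i>) / (1 - c)"
        by (rule eq_divide_imp[OF c], simp only: distrib_right yc) (simp add: algebra_simps)
      ultimately have "(y - \<i>) / (y + \<i>) = c" using c by simp
      then have "\<epsilon> * ((y - \<i>) / (y + \<i>)) = w" using ee(1) by (metis c_def mult.assoc mult_1)
      then show ?thesis unfolding w(1) flat_disc_map_nth(2) c_def[symmetric] y_def[symmetric] by simp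
    qed
  qed
  then show ?thesis unfolding surface_chart_def diffeomorphism_def using op s1 s2 by (simp add: openin_subtopology_self)
qed

lemma compact_surface_flat_disc: "compact_surface flat_disc"
proof -
  have "\<exists>U W f g. x \<in> U \<and> surface_chart flat_disc W U f g" if x: "x \<in> flat_disc" for x
  proof (cases "x = flat_disc_map 1")
    case True
    then have "x \<noteq> flat_disc_map (-1)" by (metis flat_disc_map_nth(2) one_neq_neg_one)
    then show ?thesis using flat_disc_chart[of "-1"] x by blast
  next
    case False
    then show ?thesis using flat_disc_chart[of 1] x by blast
  qed
  then show ?thesis using compact_flat_disc unfolding compact_surface_def surface_chart_def by blast
qed

text \<open>Two Cayley charts omit opposite points, so at least one of them contains the given
  boundary point, and it maps the unit circle to height 0.\<close>

lemma flat_disc_boundary_chart: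
  assumes w: "norm w = 1"
  obtains W U f g where "surface_chart flat_disc W U f g" "flat_disc_map w \<in> U" "Im (g (flat_disc_map w)) = 0"
proof -
  obtain \<epsilon> :: complex where \<epsilon>: "\<epsilon> \<in> {1, -1}" "w \<noteq> \<epsilon>" by (metis insertCI one_neq_neg_one)
  have ew: "\<epsilon> * w \<noteq> 1" using \<epsilon> by (auto simp: minus_equation_iff)
  have ne: "flat_disc_map w \<in> flat_disc - {flat_disc_map \<epsilon>}"
    using w \<epsilon>(2) flat_disc_map_nth(2) unfolding flat_disc_def by (auto, metis)
  have "norm (\<epsilon> * w) = 1" using \<epsilon>(1) w by (auto simp: norm_mult)
  then have "Im (\<i> * (1 + \<epsilon> * plane_proj (flat_disc_map w)) / (1 - \<epsilon> * plane_proj (flat_disc_map w))) = 0"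
    unfolding flat_disc_map_nth(2) cayley_inverse_Im[OF ew] by simp
  then show ?thesis using that[OF flat_disc_chart[OF \<epsilon>(1)] ne] by blast
qed

section \<open>Cutting a lens off a surface\<close>

locale lens_cut =
  fixes F U :: "(real^4) set" and f :: "complex \<Rightarrow> real^4" and g :: "real^4 \<Rightarrow> complex"
  assumes F: "compact_surface F" "F \<subseteq> S3" and chart: "surface_chart F half_disc U f g"
begin

lemmas c = surface_chartD[OF chart]

definition rest :: "(real^4) set" where
  "rest = F - f ` lens_below"

definition pieces :: "(real^4) set" where
  "pieces = rest \<union> flat_disc"

text \<open>The surface lies in the unit sphere, so the third coordinate tells its points from those of
  the flat disc.\<close>

definition glue :: "real^4 \<Rightarrow> real^4" where
  "glue x = (if x $ 3 = 5 then f (lens_map (plane_proj x)) else x)"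

lemma lens_sub: "lens_below \<subseteq> half_disc" "lens_arc \<subseteq> half_disc" "lens \<subseteq> half_disc"
  using lens_half_disc lens_eq by auto

lemma f_inj: "v \<in> half_disc \<Longrightarrow> w \<in> half_disc \<Longrightarrow> f v = f w \<longleftrightarrow> v = w"
  using c(6) by metis

lemma fF: "w \<in> half_disc \<Longrightarrow> f w \<in> F"
  using c(6,7) by blast

lemma f_mem_image: "A \<subseteq> half_disc \<Longrightarrow> w \<in> half_disc \<Longrightarrow> f w \<in> f ` A \<longleftrightarrow> w \<in> A"
  using f_inj by (metis image_iff subsetD)

lemma fc: "continuous_on half_disc f"
  using homeomorphism_cont1[OF c(3)] .

lemma below_openin: "openin (top_of_set F) (f ` lens_below)"
proof -
  have "openin (top_of_set half_disc) lens_below"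
    by (rule openin_subset_trans[OF lens_below_openin lens_sub(1)]) (auto simp: half_disc_def)
  then show ?thesis using homeomorphism_imp_open_map[OF c(3)] c(1) openin_trans by blast
qed

lemma rest_sub: "rest \<subseteq> F" "rest \<subseteq> S3"
  using F(2) by (auto simp: rest_def)

lemma compact_F: "compact F"
  using F(1) by (simp add: compact_surface_def)

lemma compact_rest: "compact rest"
proof -
  have "closedin (top_of_set F) rest" unfolding rest_def using below_openin by (simp add: closedin_diff)
  then show ?thesis using closedin_compact[OF compact_F] by blast
qed

lemma f_in_rest: "w \<in> half_disc \<Longrightarrow> f w \<in> rest \<longleftrightarrow> w \<notin> lens_below"
  using f_mem_image[OF lens_sub(1)] fF by (auto simp: rest_def)

lemma below_iff: "w \<in> half_disc \<Longrightarrow> w \<notin> lens_below \<longleftrightarrow> Im (unshear w) \<ge> 0"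
  by (auto simp: half_disc_def lens_below_def unshear_def)

text \<open>In the given chart \<open>rest\<close> is the region on or above the graph of
  \<open>bump\<close>, and \<open>shear\<close> straightens it. Along the real axis outside the lens
  the shear is the identity, so both kinds of boundary point, and the two end points of the arc, are
  covered by one chart.\<close>

lemma rest_chart:
  "surface_chart rest ({v. Im v \<ge> 0} \<inter> shear -` ball 0 2) (U \<inter> rest) (f \<circ> shear) (unshear \<circ> g)"
proof -
  let ?W = "{v. Im v \<ge> 0} \<inter> shear -` ball 0 2"
  have sW: "shear v \<in> half_disc" "shear v \<notin> lens_below" if "v \<in> ?W" for v
    using that bump_nonneg[of "Re v"] by (auto simp: half_disc_def lens_below_def shear_def)
  have uW: "unshear w \<in> ?W" if "w \<in> half_disc" "w \<notin> lens_below" for w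
    using that below_iff[OF that(1)] by (auto simp: shear_unshear half_disc_def)
  have gU: "g x \<in> half_disc" "g x \<notin> lens_below" "f (g x) = x" if "x \<in> U \<inter> rest" for x
    using c(7)[of x] f_in_rest[of "g x"] that by auto
  have s1: "smooth_on ?W (\<lambda>v. f (shear v))"
    by (rule smooth_on_compose[OF Cinf_imp_smooth_on[OF open_UNIV Cinf_shear(1) subset_UNIV] c(4)]) (use sW in blast)
  have s2: "smooth_on (U \<inter> rest) (\<lambda>x. unshear (g x))"
    by (rule smooth_on_compose[OF smooth_on_subset[OF c(5)] Cinf_imp_smooth_on[OF open_UNIV Cinf_shear(2) subset_UNIV]]) auto
  have hom: "homeomorphism ?W (U \<inter> rest) (f \<circ> shear) (unshear \<circ> g)"
  proof (rule homeomorphismI)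
    show "continuous_on ?W (f \<circ> shear)" "continuous_on (U \<inter> rest) (unshear \<circ> g)"
      using s1 s2 smooth_on_imp_continuous_on by (auto simp: comp_def)
    show "(f \<circ> shear) ` ?W \<subseteq> U \<inter> rest"
    proof
      fix y assume "y \<in> (f \<circ> shear) ` ?W"
      then obtain v where v: "v \<in> ?W" "y = f (shear v)" by auto
      then show "y \<in> U \<inter> rest" using c(6)[OF sW(1)[OF v(1)]] f_in_rest[OF sW(1)[OF v(1)]] sW(2)[OF v(1)] by simp
    qed
    show "(unshear \<circ> g) ` (U \<inter> rest) \<subseteq> ?W" using uW gU by auto
    show "(unshear \<circ> g) ((f \<circ> shear) v) = v" if "v \<in> ?W" for v
      using c(6)[OF sW(1)[OF that]] shear_unshear by simp
    show "(f \<circ> shear) ((unshear \<circ> g) x) = x" if "x \<in> U \<inter> rest" for x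
      using gU[OF that] shear_unshear by simp
  qed
  have "openin (top_of_set rest) (U \<inter> rest)"
  proof -
    obtain T where "open T" "U = F \<inter> T" using c(1) by (auto simp: openin_open)
    then have "open T" "U \<inter> rest = rest \<inter> T" using rest_sub by auto
    then show ?thesis by (metis openin_open_Int)
  qed
  moreover have "openin (top_of_set {v. Im v \<ge> 0}) ?W"
    by (rule openin_open_Int) (rule open_vimage[OF open_ball Cinf_imp_continuous_on[OF Cinf_shear(1)]])
  ultimately show ?thesis
    unfolding surface_chart_def diffeomorphism_def using hom s1 s2 by (auto simp: comp_def)
qed

text \<open>At a point off \<open>U\<close> a chart of \<open>F\<close> is kept but restricted to
  the complement of the compact image of the whole lens. Removing the arc as well is what makes the
  restricted domain open in \<open>F\<close> and contained in \<open>rest\<close>.\<close>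

lemma compact_surface_rest: "compact_surface rest"
proof -
  have "\<exists>V W f g. x \<in> V \<and> surface_chart rest W V f g" if x: "x \<in> rest" for x
  proof (cases "x \<in> U")
    case True
    then show ?thesis using rest_chart x by blast
  next
    case False
    obtain W1 U1 f1 g1 where ch: "surface_chart F W1 U1 f1 g1" "x \<in> U1"
      using compact_surface_chart[OF F(1), of x] x rest_sub by blast
    define U2 where "U2 = U1 \<inter> (F - f ` lens)"
    have "compact (f ` lens)" by (rule compact_continuous_image[OF continuous_on_subset[OF fc lens_sub(3)] compact_lens])
    then have "open (- (f ` lens))" using compact_imp_closed by blast
    then have "openin (top_of_set F) (F - f ` lens)" by (metis Diff_eq openin_open_Int)
    then have o: "openin (top_of_set F) U2" unfolding U2_def by (rule openin_Int[OF surface_chartD(1)[OF ch(1)]])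
    have sub: "U2 \<subseteq> rest" using lens_eq(1) by (auto simp: U2_def rest_def)
    have "openin (top_of_set rest) U2" by (rule openin_subset_trans[OF o sub rest_sub(1)])
    then have "surface_chart rest (g1 ` U2) U2 f1 g1"
      by (rule surface_chart_restrict[OF ch(1) _ _ o]) (auto simp: U2_def)
    moreover have "x \<in> U2"
    proof -
      have "x \<notin> f ` lens" using False c(6) lens_sub(3) by blast
      then show ?thesis using ch(2) x rest_sub by (auto simp: U2_def)
    qed
    ultimately show ?thesis by blast
  qed
  then show ?thesis using compact_rest unfolding compact_surface_def surface_chart_def by blast
qed

lemma disc_nth: "x \<in> flat_disc \<Longrightarrow> x $ 3 = 5"
  unfolding flat_disc_def using flat_disc_map_nth by auto

lemma F_nth: "x \<in> F \<Longrightarrow> x $ 3 \<noteq> 5"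
proof
  assume "x \<in> F" "x $ 3 = 5"
  then have "norm x = 1" "x $ 3 = 5" using F(2) by auto
  then show False using component_le_norm_cart[of x 3] by simp
qed

lemma disjoint: "rest \<inter> flat_disc = {}"
  using disc_nth F_nth rest_sub by blast

lemma pieces_parts:
  "openin (top_of_set pieces) rest" "openin (top_of_set pieces) flat_disc"
  "closedin (top_of_set pieces) rest" "closedin (top_of_set pieces) flat_disc"
proof -
  have cl: "closed rest" "closed flat_disc" using compact_rest compact_flat_disc compact_imp_closed by auto
  then show c1: "closedin (top_of_set pieces) rest" "closedin (top_of_set pieces) flat_disc"
    unfolding pieces_def by (auto simp: closedin_closed)
  have "pieces - flat_disc = rest" "pieces - rest = flat_disc" using disjoint unfolding pieces_def by auto
  then show "openin (top_of_set pieces) rest" "openin (top_of_set pieces) flat_disc"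
    using openin_diff[OF openin_subtopology_self c1(2)] openin_diff[OF openin_subtopology_self c1(1)] by simp_all
qed

lemma compact_surface_cut: "compact_surface pieces"
  unfolding pieces_def
  by (rule compact_surface_Un[OF compact_surface_rest compact_surface_flat_disc pieces_parts(1,2)[unfolded pieces_def]])

lemma glue_rest: "x \<in> F \<Longrightarrow> glue x = x"
  using F_nth by (simp add: glue_def)

lemma glue_disc: "glue (flat_disc_map w) = f (lens_map w)"
  by (simp add: glue_def flat_disc_map_nth)

lemma lens_map_in: "w \<in> cball 0 1 \<Longrightarrow> lens_map w \<in> lens \<and> lens_map w \<in> half_disc"
  using lens_map_image lens_sub(3) by blast

lemma glue_continuous: "continuous_on pieces glue"
  unfolding pieces_def
proof (rule continuous_on_closed_Un)
  show "closed rest" "closed flat_disc" using compact_rest compact_flat_disc compact_imp_closed by auto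
  show "continuous_on rest glue"
    by (rule continuous_on_eq[OF continuous_on_id]) (use glue_rest rest_sub in auto)
  have "continuous_on flat_disc (\<lambda>x. f (lens_map (plane_proj x)))"
    by (intro continuous_on_compose2[OF fc] continuous_on_compose2[OF lens_map_continuous[of UNIV]]
          Cinf_imp_continuous_on[OF Cinf_plane_proj])
       (use lens_map_in flat_disc_map_nth(2) in \<open>auto simp: flat_disc_def\<close>)
  then show "continuous_on flat_disc glue"
    by (rule continuous_on_eq) (use disc_nth in \<open>auto simp: glue_def\<close>)
qed

lemma glue_image_disc: "glue ` flat_disc = f ` lens"
proof -
  have "glue ` flat_disc = (\<lambda>w. f (lens_map w)) ` cball 0 1"
    unfolding flat_disc_def image_image glue_disc ..
  also have "\<dots> = f ` lens" using lens_map_image by (metis image_image)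
  finally show ?thesis .
qed

lemma glue_image: "glue ` pieces = F"
proof -
  have "glue ` rest = rest" using glue_rest rest_sub by force
  then have "glue ` pieces = rest \<union> f ` lens" unfolding pieces_def image_Un glue_image_disc by simp
  also have "\<dots> = F"
  proof
    show "rest \<union> f ` lens \<subseteq> F" using rest_sub(1) fF lens_sub(3) by blast
    show "F \<subseteq> rest \<union> f ` lens" using lens_eq(1) unfolding rest_def by blast
  qed
  finally show ?thesis .
qed

lemma glue_inj_parts: "inj_on glue rest" "inj_on glue flat_disc"
proof -
  show "inj_on glue rest" by (rule inj_onI) (metis glue_rest rest_sub(1) subsetD)
  show "inj_on glue flat_disc"
  proof (rule inj_onI)
    fix x y assume xy: "x \<in> flat_disc" "y \<in> flat_disc" "glue x = glue y"
    then obtain v w where vw: "v \<in> cball 0 1" "x = flat_disc_map v" "w \<in> cball 0 1" "y = flat_disc_map w"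
      unfolding flat_disc_def by blast
    have "f (lens_map v) = f (lens_map w)" using xy(3) vw glue_disc by simp
    then have "lens_map v = lens_map w" using f_inj lens_map_in vw by blast
    then have "v = w" using inj_onD[OF lens_map_inj] vw by blast
    then show "x = y" using vw by simp
  qed
qed

section \<open>The cutting arc and its two copies\<close>

definition edge :: "(real^4) set" where
  "edge = f ` lens_arc"

definition edge' :: "(real^4) set" where
  "edge' = flat_disc \<inter> glue -` edge"

lemma edge_rest: "edge \<subseteq> rest"
  unfolding edge_def using f_in_rest lens_sub(2) lens_eq(2) by blast

lemma edge_vimage: "edge \<union> edge' = pieces \<inter> glue -` edge"
proof -
  have "glue x \<in> edge \<longleftrightarrow> x \<in> edge" if "x \<in> rest" for x
    using glue_rest[of x] rest_sub(1) that by auto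
  then have "rest \<inter> glue -` edge = edge" using edge_rest by blast
  then show ?thesis unfolding edge'_def pieces_def by blast
qed

lemma edge_disjoint: "edge \<inter> edge' = {}"
  using edge_rest disjoint by (auto simp: edge'_def)

text \<open>On the side of \<open>rest\<close> the sheared chart puts the arc at height 0. On the
  side of the disc only points of the unit circle are sent to the arc by \<open>lens_map\<close>,
  and these have height 0 in a Cayley chart.\<close>

lemma edge_boundary: "edge \<union> edge' \<subseteq> surface_boundary pieces"
proof
  fix x assume x: "x \<in> edge \<union> edge'"
  then have xc: "x \<in> pieces" using edge_vimage by blast
  have "x \<notin> surface_interior pieces"
  proof
    assume xi: "x \<in> surface_interior pieces"
    from x show False
    proof
      assume xa: "x \<in> edge"
      have ch: "surface_chart pieces ({v. Im v \<ge> 0} \<inter> shear -` ball 0 2) (U \<inter> rest) (f \<circ> shear) (unshear \<circ> g)"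
        using surface_chart_Un[OF rest_chart] pieces_parts(1) unfolding pieces_def by blast
      obtain w where w: "w \<in> lens_arc" "x = f w" using xa unfolding edge_def by blast
      have fw: "f w \<in> U" "g (f w) = w" using c(6) lens_sub(2) w(1) by blast+
      have "Im ((unshear \<circ> g) x) > 0"
        by (rule interior_point_chart[OF compact_surface_cut xi ch]) (use fw w(2) xa edge_rest in blast)
      then show False using w fw(2) by (simp add: unshear_def lens_arc_def)
    next
      assume xa: "x \<in> edge'"
      then obtain w where w: "w \<in> cball 0 1" "x = flat_disc_map w" unfolding edge'_def flat_disc_def by blast
      have "f (lens_map w) \<in> f ` lens_arc" using xa w(2) glue_disc unfolding edge'_def edge_def by simp
      then have "lens_map w \<in> lens_arc" using f_mem_image[OF lens_sub(2)] lens_map_in[OF w(1)] by blast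
      then have "norm w = 1" by (rule lens_map_arc[OF w(1)])
      then obtain W' U' f' g' where ch: "surface_chart flat_disc W' U' f' g'" "x \<in> U'" "Im (g' x) = 0"
        using flat_disc_boundary_chart w(2) by metis
      have "surface_chart pieces W' U' f' g'"
        using surface_chart_Un[OF ch(1), of rest] pieces_parts(2) unfolding pieces_def by (simp add: Un_commute)
      then have "Im (g' x) > 0" by (rule interior_point_chart[OF compact_surface_cut xi _ ch(2)])
      then show False using ch(3) by simp
    qed
  qed
  then show "x \<in> surface_boundary pieces" using xc unfolding surface_boundary_def by blast
qed

lemma compact_arc: "compact edge"
proof -
  have "lens_arc = lens \<inter> {z. Im z = bump (Re z)}"
    using bump_nonneg unfolding lens_arc_def lens_def by auto
  moreover have "closed {z. Im z = bump (Re z)}"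
    by (intro closed_Collect_eq continuous_intros Cinf_imp_continuous_on[OF Cinf_bump[OF Cinf_Re]])
  ultimately have "compact lens_arc" using compact_lens compact_Int_closed by metis
  then show ?thesis unfolding edge_def by (rule compact_continuous_image[OF continuous_on_subset[OF fc lens_sub(2)]])
qed

lemma edge_homeomorphisms: "\<exists>r. homeomorphism edge edge glue r" "\<exists>r. homeomorphism edge' edge glue r"
proof -
  show "\<exists>r. homeomorphism edge edge glue r"
    by (intro exI homeomorphism_cong[OF homeomorphism_ident]) (use glue_rest edge_rest rest_sub in auto)
  have cd: "continuous_on flat_disc glue" by (rule continuous_on_subset[OF glue_continuous]) (simp add: pieces_def)
  have "compact edge'"
  proof -
    have "closedin (top_of_set flat_disc) edge'"
      unfolding edge'_def by (rule continuous_closedin_preimage[OF cd compact_imp_closed[OF compact_arc]])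
    then show ?thesis using closedin_compact[OF compact_flat_disc] by blast
  qed
  moreover have "continuous_on edge' glue" by (rule continuous_on_subset[OF cd]) (auto simp: edge'_def)
  moreover have "glue ` edge' = edge"
  proof
    show "glue ` edge' \<subseteq> edge" by (auto simp: edge'_def)
    have "edge \<subseteq> glue ` flat_disc" unfolding glue_image_disc edge_def using lens_eq(1) by blast
    then show "edge \<subseteq> glue ` edge'" unfolding edge'_def by blast
  qed
  moreover have "inj_on glue edge'" by (rule inj_on_subset[OF glue_inj_parts(2)]) (auto simp: edge'_def)
  ultimately show "\<exists>r. homeomorphism edge' edge glue r" using homeomorphism_compact by metis
qed

lemma glue_cross: assumes "x \<in> rest" "y \<in> flat_disc" "glue x = glue y" shows "glue x \<in> edge"
proof -
  have gx: "glue x = x" using glue_rest rest_sub assms(1) by blast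
  have "x \<in> f ` lens" using gx glue_image_disc assms(2,3) by (metis imageI)
  then obtain z where z: "z \<in> lens" "x = f z" by blast
  then have "z \<notin> lens_below" using f_in_rest[of z] lens_sub(3) assms(1) by blast
  then show ?thesis using z gx lens_eq(1) unfolding edge_def by auto
qed

text \<open>Points that \<open>glue\<close> identifies lie over the arc. The restricted map is
  closed because \<open>pieces\<close> is compact and the removed set is a full preimage.\<close>

lemma complement_homeomorphism: "\<exists>r. homeomorphism (pieces - (edge \<union> edge')) (F - edge) glue r"
proof -
  let ?C = "pieces - (edge \<union> edge')"
  have C: "?C = pieces \<inter> glue -` (- edge)" unfolding edge_vimage by blast
  have im: "glue ` ?C = F - edge"
  proof -
    have "glue ` (A \<inter> glue -` B) = glue ` A \<inter> B" for A B by blast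
    then show ?thesis unfolding C using glue_image by (simp add: Diff_eq)
  qed
  have cc: "continuous_on ?C glue" by (rule continuous_on_subset[OF glue_continuous]) blast
  have inj: "inj_on glue ?C"
  proof (rule inj_onI)
    fix x y assume xy: "x \<in> ?C" "y \<in> ?C" "glue x = glue y"
    have na: "glue x \<notin> edge" "glue y \<notin> edge" using xy C by blast+
    have "x \<in> rest \<or> x \<in> flat_disc" "y \<in> rest \<or> y \<in> flat_disc" using xy unfolding pieces_def by auto
    then consider "x \<in> rest" "y \<in> rest" | "x \<in> flat_disc" "y \<in> flat_disc" | "x \<in> rest" "y \<in> flat_disc" | "y \<in> rest" "x \<in> flat_disc"
      by blast
    then show "x = y"
    proof cases
      case 1 then show ?thesis using inj_onD[OF glue_inj_parts(1)] xy(3) by blast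
    next
      case 2 then show ?thesis using inj_onD[OF glue_inj_parts(2)] xy(3) by blast
    next
      case 3 then show ?thesis using glue_cross xy(3) na by blast
    next
      case 4 then show ?thesis using glue_cross[OF _ _ xy(3)[symmetric]] na by blast
    qed
  qed
  have "closedin (top_of_set (F - edge)) (glue ` V)" if V: "closedin (top_of_set ?C) V" for V
  proof -
    obtain Z where Z: "closed Z" "V = ?C \<inter> Z" using V by (auto simp: closedin_closed)
    have "compact pieces" using compact_surface_cut by (simp add: compact_surface_def)
    then have "compact (pieces \<inter> Z)" using Z(1) compact_Int_closed by blast
    then have "compact (glue ` (pieces \<inter> Z))"
      by (rule compact_continuous_image[OF continuous_on_subset[OF glue_continuous], rotated]) blast
    then have "closed (glue ` (pieces \<inter> Z))" by (rule compact_imp_closed)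
    moreover have "glue ` V = (F - edge) \<inter> glue ` (pieces \<inter> Z)"
      proof
      show "glue ` V \<subseteq> (F - edge) \<inter> glue ` (pieces \<inter> Z)" using im unfolding Z(2) by blast
      show "(F - edge) \<inter> glue ` (pieces \<inter> Z) \<subseteq> glue ` V"
      proof
        fix y assume y: "y \<in> (F - edge) \<inter> glue ` (pieces \<inter> Z)"
        then obtain x where x: "x \<in> pieces \<inter> Z" "y = glue x" by (metis IntD2 imageE)
        then have "x \<in> V" using y unfolding Z(2) C by auto
        then show "y \<in> glue ` V" using x(2) by (rule image_eqI[rotated])
      qed
    qed
    ultimately show ?thesis by (auto simp: closedin_closed)
  qed
  then show ?thesis using homeomorphism_injective_closed_map[OF cc im inj] by metis
qed

text \<open>A chart range is connected, hence contained in one of the two closed pieces, and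
  \<open>glue\<close> is injective on each of them.\<close>

lemma glue_inj_chart:
  fixes e :: "complex \<Rightarrow> real^4"
  assumes e: "open_chart pieces e" shows "inj_on glue (range e)"
proof -
  note ce = open_chartD[OF e]
  have con: "connected (range e)" by (rule connected_continuous_image[OF ce(1) connected_UNIV])
  have "range e \<subseteq> rest \<or> range e \<subseteq> flat_disc"
  proof (rule ccontr)
    assume n: "\<not> ?thesis"
    have cl: "closed rest" "closed flat_disc" using compact_rest compact_flat_disc compact_imp_closed by auto
    have "rest \<inter> range e = {} \<or> flat_disc \<inter> range e = {}"
      by (rule connected_closedD[OF con _ _ cl]) (use disjoint ce(3) in \<open>auto simp: pieces_def\<close>)
    then show False using n ce(3) unfolding pieces_def by blast
  qed
  then show ?thesis using glue_inj_parts inj_on_subset by blast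
qed

lemma edge_proper: "proper_arc F edge"
proof -
  \<comment> \<open>The graph of \<open>bump\<close> over [-1, 1], reparametrised to the unit
    interval. Reading off the real part in the chart inverts it smoothly.\<close>
  define \<gamma> where "\<gamma> s = f (Complex (2 * s - 1) (bump (2 * s - 1)))" for s
  have arcp: "Complex (2 * s - 1) (bump (2 * s - 1)) \<in> lens_arc" if "s \<in> {0..1}" for s
    using that by (auto simp: lens_arc_def)
  have im: "\<gamma> ` {0..1} = edge"
  proof
    show "\<gamma> ` {0..1} \<subseteq> edge" using arcp unfolding \<gamma>_def edge_def by blast
    show "edge \<subseteq> \<gamma> ` {0..1}"
    proof
      fix y assume "y \<in> edge"
      then obtain z where z: "z \<in> lens_arc" "y = f z" unfolding edge_def by blast
      have r: "2 * ((Re z + 1) / 2) - 1 = Re z" by (simp add: field_simps)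
      have "Complex (Re z) (bump (Re z)) = z" using z(1) by (simp add: lens_arc_def complex_eq_iff)
      then have "y = \<gamma> ((Re z + 1) / 2)" unfolding \<gamma>_def r z(2) by simp
      moreover have "(Re z + 1) / 2 \<in> {0..1}" using z(1) by (auto simp: lens_arc_def abs_le_iff)
      ultimately show "y \<in> \<gamma> ` {0..1}" by blast
    qed
  qed
  have lin: "Cinf UNIV (\<lambda>s::real. 2 * s - 1)" by (intro Cinf_diff Cinf_mult Cinf_const Cinf_ident)
  have s1: "smooth_on {0..1} \<gamma>"
    unfolding \<gamma>_def[abs_def]
    by (rule smooth_on_compose[OF Cinf_imp_smooth_on[OF open_UNIV Cinf_Complex[OF lin Cinf_bump[OF lin]] subset_UNIV] c(4)])
       (use arcp lens_sub(2) in blast)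
  have arcU: "edge \<subseteq> U" unfolding edge_def using c(6) lens_sub(2) by blast
  have s2: "smooth_on edge (\<lambda>y. (Re (g y) + 1) / 2)"
  proof (rule smooth_on_compose[OF smooth_on_subset[OF c(5) arcU]])
    have "Cinf UNIV (\<lambda>z. (Re z + 1) / 2)" by (intro Cinf_divide Cinf_add Cinf_Re Cinf_const) auto
    then show "smooth_on UNIV (\<lambda>z. (Re z + 1) / 2)" by (rule Cinf_imp_smooth_on[OF open_UNIV]) simp
  qed simp
  have inv: "(Re (g (\<gamma> s)) + 1) / 2 = s" if "s \<in> {0..1}" for s
    using c(6)[OF subsetD[OF lens_sub(2) arcp[OF that]]] unfolding \<gamma>_def by simp
  have "homeomorphism {0..1} (\<gamma> ` {0..1}) \<gamma> (\<lambda>y. (Re (g y) + 1) / 2)"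
  proof (rule homeomorphismI)
    show "continuous_on {0..1} \<gamma>" by (rule smooth_on_imp_continuous_on[OF s1])
    show "continuous_on (\<gamma> ` {0..1}) (\<lambda>y. (Re (g y) + 1) / 2)" unfolding im by (rule smooth_on_imp_continuous_on[OF s2])
    show "(\<lambda>y. (Re (g y) + 1) / 2) ` \<gamma> ` {0..1} \<subseteq> {0..1}" unfolding image_subset_iff using inv by (metis imageE)
    show "\<gamma> ((Re (g y) + 1) / 2) = y" if "y \<in> \<gamma> ` {0..1}" for y using that inv by (metis imageE)
  qed (use inv in blast)+
  then have emb: "smooth_embedding {0..1} \<gamma>"
    unfolding smooth_embedding_def diffeomorphism_def using s1 s2 unfolding im by blast
  have bdy: "f z \<in> surface_boundary F \<longleftrightarrow> Im z = 0" if z: "z \<in> half_disc" for z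
  proof
    assume b: "f z \<in> surface_boundary F"
    show "Im z = 0"
    proof (rule ccontr)
      assume "Im z \<noteq> 0"
      then have "Im z > 0" using z by (simp add: half_disc_def)
      then show False using surface_chart_interior_point[OF F(1) chart z] b by (simp add: surface_boundary_def)
    qed
  next
    assume 0: "Im z = 0"
    have "f z \<notin> surface_interior F"
      using interior_point_chart[OF F(1) _ chart, of "f z"] c(6)[OF z] 0 by auto
    then show "f z \<in> surface_boundary F" using fF[OF z] by (simp add: surface_boundary_def)
  qed
  have g01: "\<gamma> 0 = f (-1)" "\<gamma> 1 = f 1" unfolding \<gamma>_def
    by (simp_all add: bump_eq complex_eq_iff Complex_eq)
  have "edge \<inter> surface_boundary F = {\<gamma> 0, \<gamma> 1}"
  proof
    show "edge \<inter> surface_boundary F \<subseteq> {\<gamma> 0, \<gamma> 1}"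
    proof
      fix y assume y: "y \<in> edge \<inter> surface_boundary F"
      then obtain z where z: "z \<in> lens_arc" "y = f z" unfolding edge_def by blast
      then have "Im z = 0" using bdy[of z] lens_sub(2) y by blast
      then have "bump (Re z) = 0" "\<bar>Re z\<bar> \<le> 1" using z(1) by (auto simp: lens_arc_def)
      then have "\<bar>Re z\<bar> = 1" using bump_pos_iff[of "Re z"] by auto
      then have "z = 1 \<or> z = -1" using \<open>Im z = 0\<close> by (auto simp: complex_eq_iff abs_if split: if_splits)
      then show "y \<in> {\<gamma> 0, \<gamma> 1}" using z(2) g01 by auto
    qed
    have "1 \<in> lens_arc" "-1 \<in> lens_arc" by (auto simp: lens_arc_def bump_eq)
    then have "f 1 \<in> edge \<inter> surface_boundary F" "f (-1) \<in> edge \<inter> surface_boundary F"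
      using bdy[of 1] bdy[of "-1"] lens_sub(2) unfolding edge_def by (auto dest: subsetD)
    then show "{\<gamma> 0, \<gamma> 1} \<subseteq> edge \<inter> surface_boundary F" unfolding g01 by blast
  qed
  then show ?thesis
    unfolding proper_arc_def using emb im[symmetric] edge_rest rest_sub(1) by (intro conjI exI[of _ \<gamma>]) auto
qed

lemma disc_component: "flat_disc \<in> components pieces"
proof -
  have con: "connected flat_disc"
    unfolding flat_disc_def
    by (rule connected_continuous_image[OF Cinf_imp_continuous_on[OF Cinf_flat_disc_map]]) (simp add: convex_connected)
  have ne: "flat_disc \<noteq> {}" "flat_disc \<subseteq> pieces" by (auto simp: flat_disc_def pieces_def)
  show ?thesis unfolding in_components_maximal
  proof (intro conjI allI impI ne con)
    fix d assume d: "d \<noteq> {} \<and> flat_disc \<subseteq> d \<and> d \<subseteq> pieces \<and> connected d"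
    have cl: "closed rest" "closed flat_disc" using compact_rest compact_flat_disc compact_imp_closed by auto
    have "rest \<inter> d = {} \<or> flat_disc \<inter> d = {}"
      by (rule connected_closedD[OF _ _ _ cl]) (use d disjoint in \<open>auto simp: pieces_def\<close>)
    then have "rest \<inter> d = {}" using d ne by blast
    then show "d = flat_disc" using d unfolding pieces_def by blast
  qed
qed

text \<open>Coordinates by the whole model space on a region over the lens. They are smooth because
  \<open>to_ball\<close> avoids the two points of the closed disc where \<open>lens_map\<close> is
  only continuous.\<close>

definition into_lens :: "complex \<times> real \<Rightarrow> (real^4) \<times> real" where
  "into_lens u = (f (lens_map (to_ball (fst u))), (to_ball (snd u) + 1) / 2)"

text \<open>The same point before regluing: \<open>glue\<close> takes the surface coordinate to that
  of \<open>into_lens\<close> and the heights agree.\<close>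

definition into_disc :: "complex \<times> real \<Rightarrow> (real^4) \<times> real" where
  "into_disc u = (flat_disc_map (to_ball (fst u)), (to_ball (snd u) + 1) / 2)"

lemma into_lens_in: "lens_map (to_ball u) \<in> lens_below" "lens_map (to_ball u) \<in> half_disc"
  using lens_map_below[OF to_ball_in] lens_sub(1) by blast+

lemma Cinf_height: "Cinf V (\<lambda>u::complex \<times> real. (to_ball (snd u) + 1) / 2)"
  by (intro Cinf_divide Cinf_add Cinf_const Cinf_compose[OF Cinf_to_ball[of UNIV]] Cinf_snd) auto

lemma Cinf_planar: "Cinf V (\<lambda>u::complex \<times> real. to_ball (fst u))"
  by (intro Cinf_compose[OF Cinf_to_ball[of UNIV]] Cinf_fst) auto

lemma height_in: "(to_ball (t::real) + 1) / 2 \<in> {0<..<1}"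
  using to_ball_in[of t] by (auto simp: abs_less_iff)

lemma smooth_lens_to_ball: "smooth_on V (\<lambda>u::complex \<times> real. lens_map (to_ball (fst u)))"
proof -
  have "Cinf UNIV (\<lambda>u::complex \<times> real. lens_map (to_ball (fst u)))"
    by (rule Cinf_compose[OF Cinf_lens_map Cinf_planar]) (use Re_ball[OF to_ball_in] in blast)
  then show ?thesis by (rule Cinf_imp_smooth_on[OF open_UNIV _ subset_UNIV])
qed

lemma smooth_height_inverse:
  fixes G :: "complex \<times> real \<Rightarrow> (real^4) \<times> real"
  assumes "\<And>u. snd (G u) = (to_ball (snd u) + 1) / 2"
  shows "smooth_on (range G) (\<lambda>x. of_ball (2 * snd x - 1))" "of_ball (2 * snd (G u) - 1) = snd u"
proof -
  have s1: "smooth_on (range G) (\<lambda>x. 2 * snd x - 1)"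
    by (rule Cinf_imp_smooth_on[OF open_UNIV _ subset_UNIV]) (intro Cinf_diff Cinf_mult Cinf_const Cinf_snd)
  have s2: "smooth_on (ball 0 1) (of_ball :: real \<Rightarrow> real)"
    by (rule Cinf_imp_smooth_on[OF open_ball Cinf_of_ball subset_refl])
  have s3: "(\<lambda>x. 2 * snd x - 1) ` range G \<subseteq> ball 0 1"
  proof
    fix y assume "y \<in> (\<lambda>x. 2 * snd x - 1) ` range G"
    then obtain u where "y = 2 * snd (G u) - 1" by blast
    then have "y = to_ball (snd u)" unfolding assms by (simp add: field_simps)
    then show "y \<in> ball 0 1" using to_ball_in by metis
  qed
  show "smooth_on (range G) (\<lambda>x. of_ball (2 * snd x - 1))" by (rule smooth_on_compose[OF s1 s2 s3])
  have "2 * ((to_ball (snd u) + 1) / 2) - 1 = to_ball (snd u)" by (simp add: field_simps)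
  then show "of_ball (2 * snd (G u) - 1) = snd u" unfolding assms by (simp add: of_ball_to_ball)
qed

lemma into_lens_smooth: "smooth_on UNIV into_lens"
  unfolding into_lens_def[abs_def]
  by (intro smooth_on_Pair smooth_on_compose[OF smooth_lens_to_ball c(4)] Cinf_imp_smooth_on[OF open_UNIV Cinf_height subset_UNIV])
     (use into_lens_in in blast)

lemma into_disc_smooth: "smooth_on UNIV into_disc"
  unfolding into_disc_def[abs_def]
  by (intro smooth_on_Pair Cinf_imp_smooth_on[OF open_UNIV _ subset_UNIV] Cinf_height
        Cinf_compose[OF Cinf_flat_disc_map[of UNIV] Cinf_planar]) auto

definition into_lens_inv :: "(real^4) \<times> real \<Rightarrow> complex \<times> real" where
  "into_lens_inv x = (of_ball (lens_inv (g (fst x))), of_ball (2 * snd x - 1))"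

definition into_disc_inv :: "(real^4) \<times> real \<Rightarrow> complex \<times> real" where
  "into_disc_inv x = (of_ball (plane_proj (fst x)), of_ball (2 * snd x - 1))"

lemma snd_into: "snd (into_lens u) = (to_ball (snd u) + 1) / 2" "snd (into_disc u) = (to_ball (snd u) + 1) / 2"
  by (simp_all add: into_lens_def into_disc_def)

lemma into_lens_back: "lens_inv (g (fst (into_lens u))) = to_ball (fst u)" "fst (into_lens u) \<in> U" "\<bar>Re (g (fst (into_lens u)))\<bar> < 1"
proof -
  have 1: "fst (into_lens u) \<in> U" "g (fst (into_lens u)) = lens_map (to_ball (fst u))"
    using c(6)[OF into_lens_in(2)] by (simp_all add: into_lens_def)
  then show "fst (into_lens u) \<in> U" by simp
  show "lens_inv (g (fst (into_lens u))) = to_ball (fst u)" unfolding 1 by (rule lens_inv_map[OF Re_ball[OF to_ball_in]])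
  show "\<bar>Re (g (fst (into_lens u)))\<bar> < 1" unfolding 1 using Re_ball[OF to_ball_in[of "fst u"]] by (simp add: lens_map_def)
qed

lemma into_lens_inverse: "into_lens_inv (into_lens u) = u" "into_disc_inv (into_disc u) = u"
proof -
  show "into_lens_inv (into_lens u) = u"
    unfolding into_lens_inv_def into_lens_back(1) smooth_height_inverse(2)[of into_lens, OF snd_into(1)] of_ball_to_ball by simp
  have "plane_proj (fst (into_disc u)) = to_ball (fst u)" by (simp add: into_disc_def flat_disc_map_nth)
  then show "into_disc_inv (into_disc u) = u"
    unfolding into_disc_inv_def smooth_height_inverse(2)[of into_disc, OF snd_into(2)] by (simp add: of_ball_to_ball)
qed

lemma into_lens_inv_smooth: "smooth_on (range into_lens) into_lens_inv"
  unfolding into_lens_inv_def[abs_def]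
proof (rule smooth_on_Pair[OF _ smooth_height_inverse(1)[OF snd_into(1)]])
  have s1: "smooth_on (range into_lens) (\<lambda>x. g (fst x))"
    by (rule smooth_on_compose[OF smooth_on_fst c(5)]) (use into_lens_back(2) in blast)
  have s2: "smooth_on (range into_lens) (\<lambda>x. lens_inv (g (fst x)))"
    by (rule smooth_on_compose[OF s1 Cinf_imp_smooth_on[OF open_strip Cinf_lens_inv subset_refl]]) (use into_lens_back(3) in blast)
  show "smooth_on (range into_lens) (\<lambda>x. of_ball (lens_inv (g (fst x))))"
    by (rule smooth_on_compose[OF s2 Cinf_imp_smooth_on[OF open_ball Cinf_of_ball subset_refl]])
       (unfold image_image, unfold into_lens_back(1), use to_ball_in in blast)
qed

lemma into_disc_inv_smooth: "smooth_on (range into_disc) into_disc_inv"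
  unfolding into_disc_inv_def[abs_def]
proof (rule smooth_on_Pair[OF _ smooth_height_inverse(1)[OF snd_into(2)]])
  have s1: "smooth_on (range into_disc) (\<lambda>x. plane_proj (fst x))"
    by (rule Cinf_imp_smooth_on[OF open_UNIV Cinf_compose[OF Cinf_plane_proj[of UNIV] Cinf_fst] subset_UNIV]) simp
  show "smooth_on (range into_disc) (\<lambda>x. of_ball (plane_proj (fst x)))"
    by (rule smooth_on_compose[OF s1 Cinf_imp_smooth_on[OF open_ball Cinf_of_ball subset_refl]])
       (use to_ball_in in \<open>auto simp: into_disc_def flat_disc_map_nth simp del: mem_ball mem_ball_0\<close>)
qed

lemma into_lens_thick: "\<exists>\<kappa>i. thick_chart F UNIV into_lens \<kappa>i"
proof -
  have "inj into_lens" by (metis injI into_lens_inverse(1))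
  moreover have "range into_lens \<subseteq> F \<times> {0<..<1}"
  proof
    fix y assume "y \<in> range into_lens"
    then obtain u where "y = into_lens u" by blast
    then show "y \<in> F \<times> {0<..<1}" using fF[OF into_lens_in(2)] height_in unfolding into_lens_def by (metis mem_Sigma_iff)
  qed
  ultimately show ?thesis
    using thick_chartI[OF F(1) open_UNIV smooth_on_imp_continuous_on[OF into_lens_smooth]] by metis
qed

lemma into_lens_immersive: "immersive UNIV into_lens 0"
proof (rule immersive_diffeo)
  show "homeomorphism UNIV (range into_lens) into_lens into_lens_inv"
    by (rule homeomorphismI)
       (use into_lens_smooth into_lens_inv_smooth smooth_on_imp_continuous_on into_lens_inverse in auto)
  show "smooth_on UNIV into_lens" "smooth_on (range into_lens) into_lens_inv" by (rule into_lens_smooth into_lens_inv_smooth)+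
qed simp

text \<open>The first knot misses the wall over the arc, because \<open>into_lens\<close> stays
  strictly below it. After the cut the knot lies over the flat disc, which is a component, so the
  rest of the surface is discarded.\<close>

lemma lens_stabilization:
  assumes o: "surface_orientation F ori" and k: "smooth_embedding circle k"
  defines "oriC \<equiv> pulled_back_charts pieces ori glue"
  defines "oriD \<equiv> {e \<in> oriC. range e \<subseteq> flat_disc}"
  shows "is_thick_knot (F, ori, into_lens \<circ> k)" "is_thick_knot (flat_disc, oriD, into_disc \<circ> k)"
    "stabilization (F, ori, into_lens \<circ> k) (flat_disc, oriD, into_disc \<circ> k)"
proof -
  have po1: "surface_orientation pieces oriC" unfolding oriC_def
    by (rule pulled_back_orientation(1)[OF F(1) o compact_surface_cut glue_continuous eq_refl[OF glue_image]])
       (rule glue_inj_chart)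
  have po2: "orientation_preserving oriC ori glue" unfolding oriC_def
    by (rule pulled_back_orientation(2)[OF F(1) o compact_surface_cut glue_continuous eq_refl[OF glue_image]])
       (rule glue_inj_chart)
  have e1: "smooth_embedding circle (into_lens \<circ> k)"
    by (rule smooth_embedding_compose[OF k subset_UNIV into_lens_smooth into_lens_inv_smooth into_lens_inverse(1)])
  have e2: "smooth_embedding circle (into_disc \<circ> k)"
    by (rule smooth_embedding_compose[OF k subset_UNIV into_disc_smooth into_disc_inv_smooth into_lens_inverse(2)])
  have h01: "(to_ball (t::real) + 1) / 2 \<in> {0..1}" for t using height_in[of t] by auto
  have inF: "into_lens u \<in> F \<times> {0..1}" for u
    unfolding into_lens_def using fF[OF into_lens_in(2)] h01 by (intro SigmaI)
  have inD: "into_disc u \<in> flat_disc \<times> {0..1}" for u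
  proof -
    have "to_ball (fst u) \<in> cball 0 1" using to_ball_in[of "fst u"] ball_subset_cball by blast
    then have "flat_disc_map (to_ball (fst u)) \<in> flat_disc" unfolding flat_disc_def by (rule imageI)
    then show ?thesis unfolding into_disc_def using h01 by (intro SigmaI)
  qed
  have DC: "flat_disc \<times> {0..1} \<subseteq> pieces \<times> {0..(1::real)}" by (rule Sigma_mono) (auto simp: pieces_def)
  have im1: "(into_lens \<circ> k) ` circle \<subseteq> F \<times> {0..1}" unfolding image_subset_iff comp_def using inF by (intro ballI)
  have im2: "(into_disc \<circ> k) ` circle \<subseteq> flat_disc \<times> {0..1}" unfolding image_subset_iff comp_def using inD by (intro ballI)
  show t1: "is_thick_knot (F, ori, into_lens \<circ> k)" using F(1) o e1 im1 by simp
  have oD: "surface_orientation flat_disc oriD"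
    unfolding oriD_def by (rule orientation_of_component[OF po1 pieces_parts(2,4)])
  then show "is_thick_knot (flat_disc, oriD, into_disc \<circ> k)"
    using compact_surface_flat_disc e2 im2 by simp
  have tC: "is_thick_knot (pieces, oriC, into_disc \<circ> k)"
    using compact_surface_cut po1 e2 subset_trans[OF im2 DC] by simp
  have io: "into_lens u = (glue (fst (into_disc u)), snd (into_disc u))" for u
    by (simp add: into_lens_def into_disc_def glue_disc)
  have miss: "(into_lens \<circ> k) ` circle \<inter> edge \<times> {0..1} = {}"
  proof -
    have "fst (into_lens u) \<notin> edge" for u
    proof -
      have "lens_map (to_ball (fst u)) \<notin> lens_arc" using into_lens_in(1) lens_eq(2) by blast
      then show ?thesis unfolding edge_def into_lens_def using f_mem_image[OF lens_sub(2) into_lens_in(2)] by simp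
    qed
    then have n: "into_lens (k z) \<notin> edge \<times> {0..1}" for z by (metis mem_Times_iff)
    show ?thesis
    proof (rule equals0I)
      fix y assume y: "y \<in> (into_lens \<circ> k) ` circle \<inter> edge \<times> {0..1}"
      then obtain z where "y = into_lens (k z)" unfolding image_comp[symmetric] by blast
      then show False using n[of z] y by (metis IntD2)
    qed
  qed
  have cutal: "cut_along (F, ori, into_lens \<circ> k) edge (pieces, oriC, into_disc \<circ> k) edge edge'"
    unfolding cut_along.simps
    by (rule conjI[OF miss], rule exI[of _ glue], intro conjI glue_continuous glue_image edge_vimage edge_disjoint edge_boundary
          edge_homeomorphisms complement_homeomorphism po2) (simp add: io)
  have disc: "discard_components (pieces, oriC, into_disc \<circ> k) (flat_disc, oriD, into_disc \<circ> k)"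
    unfolding discard_components.simps using disc_component im2 by (simp add: oriD_def)
  show "stabilization (F, ori, into_lens \<circ> k) (flat_disc, oriD, into_disc \<circ> k)"
    unfolding stabilization_def
    by (intro exI[of _ edge] exI[of _ edge'] exI[of _ "(pieces, oriC, into_disc \<circ> k)"] conjI tC cutal disjI1 disc)
       (simp add: edge_proper)
qed

end

section \<open>Knots in a ball are classical\<close>

text \<open>The isotopy ends at \<open>L.into_lens \<circ> k\<close>, and \<open>k\<close> is
  computed from \<open>K\<close> by the smooth map \<open>\<iota>\<close> and an affine map, without
  \<open>h\<close>. So \<open>k\<close> is smooth, and the lower Lipschitz bounds of the linear map,
  of \<open>\<iota>\<close> and of \<open>K\<close> multiply to one for \<open>k\<close>, which
  makes it an embedding. Only this regularity turns the end of a topological isotopy into a knot to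
  which a stabilization applies.\<close>

lemma knot_in_ball_classical:
  fixes h :: "complex \<times> real \<Rightarrow> (real^4) \<times> real"
  assumes F: "compact_surface F" "connected F" "F \<subseteq> S3" "F \<noteq> S3"
    and bd: "surface_chart F W U f g" "w \<in> W" "Im w = 0"
    and K: "is_thick_knot (F, ori, K)"
    and h: "continuous_on (ball 0 R) h" "inj_on h (ball 0 R)" "h ` ball 0 R \<subseteq> F \<times> {0<..<1}" "1 < R"
    and Kh: "K ` circle \<subseteq> h ` cball 0 1"
  shows "classical (virtual_knot_of (F, ori, K))"
proof -
  have Kem: "smooth_embedding circle K" and o: "surface_orientation F ori" and KF: "K ` circle \<subseteq> F \<times> {0..1}"
    using K by auto
  obtain Ki where Ki: "homeomorphism circle (K ` circle) K Ki" "smooth_on circle K" "smooth_on (K ` circle) Ki"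
    using Kem unfolding smooth_embedding_def diffeomorphism_def by blast
  \<comment> \<open>An intermediate radius: the thickening map needs a closed ball inside the domain
    of \<open>h\<close>, and the isotopy needs an open one larger than the unit ball.\<close>
  define R' where "R' = (1 + R) / 2"
  have R': "1 < R'" "R' < R" using h(4) by (auto simp: R'_def)
  have bb: "ball 0 R' \<subseteq> ball (0 :: complex \<times> real) R" "cball 0 R' \<subseteq> ball (0 :: complex \<times> real) R"
    "ball 0 R' \<subseteq> cball (0 :: complex \<times> real) R'"
    using R' by auto
  have hN: "h ` ball 0 R' \<subseteq> F \<times> {0<..<1}" using h(3) image_mono[OF bb(1), of h] by (rule subset_trans[rotated])
  obtain hi where hi: "thick_chart F (ball 0 R') h hi"
    using thick_chartI[OF F(1) open_ball continuous_on_subset[OF h(1) bb(1)] inj_on_subset[OF h(2) bb(1)] hN] by metis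
  have hU: "h ` ball 0 R \<subseteq> F \<times> UNIV" by (rule subset_trans[OF h(3)]) (rule Sigma_mono; simp)
  have hint: "h ` cball 0 R' \<subseteq> surface_interior F \<times> {0<..<1}"
  proof
    fix y assume "y \<in> h ` cball 0 R'"
    then have y: "y \<in> h ` ball 0 R" using bb(2) by blast
    have "y \<in> surface_interior F \<times> UNIV"
      by (rule subsetD[OF thickened_image_interior[OF F(1) open_ball h(1,2) hU] y])
    moreover have "y \<in> F \<times> {0<..<1}" by (rule subsetD[OF h(3) y])
    ultimately show "y \<in> surface_interior F \<times> {0<..<1}" unfolding mem_Times_iff by (elim conjE) (intro conjI)
  qed
  have R0: "R' > 0" using R' by simp
  obtain \<iota> :: "(real^4) \<times> real \<Rightarrow> real^3" and c where i: "smooth_on (F \<times> UNIV) \<iota>" "c > 0"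
    "\<And>x y. x \<in> h ` cball 0 R' \<Longrightarrow> y \<in> h ` cball 0 R' \<Longrightarrow> c * norm (x - y) \<le> norm (\<iota> x - \<iota> y)"
  proof (rule exists_thickening_map[OF F(1,3,4) continuous_on_subset[OF h(1) bb(2)] inj_on_subset[OF h(2) bb(2)] hint R0])
    fix \<iota> :: "(real^4) \<times> real \<Rightarrow> real^3" and c
    assume a: "smooth_on (F \<times> UNIV) \<iota>" "0 < c"
      "\<And>x y. x \<in> h ` cball 0 R' \<Longrightarrow> y \<in> h ` cball 0 R' \<Longrightarrow> c * norm (x - y) \<le> norm (\<iota> x - \<iota> y)"
    show thesis by (rule that[OF a])
  qed
  have i': "c * norm (x - y) \<le> norm (\<iota> x - \<iota> y)" if "x \<in> h ` ball 0 R'" "y \<in> h ` ball 0 R'" for x y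
    by (rule i(3)) (use that bb(3) in blast)+
  obtain U' f' g' where ch: "surface_chart F half_disc U' f' g'" using surface_chart_normalise[OF bd] by metis
  interpret L: lens_cut F U' f' g' by (rule lens_cut.intro[OF F(1,3) ch])
  obtain \<kappa>i where \<kappa>i: "thick_chart F UNIV L.into_lens \<kappa>i" using L.into_lens_thick by blast
  obtain B v0 \<theta> where B: "bounded_linear B" "inj B" and \<theta>: "iso_end F \<theta>"
    "\<And>u. u \<in> cball 0 1 \<Longrightarrow> \<theta> (h u) = L.into_lens (B (\<iota> (h u) - v0))"
  proof (rule isotopy_transport[OF F(1,2) hi zero_less_one R'(1) i(1,2) _ \<kappa>i L.into_lens_immersive])
    fix B v0 \<theta>
    assume a: "bounded_linear B" "inj B" "iso_end F \<theta>"
      "\<And>u. u \<in> cball 0 1 \<Longrightarrow> \<theta> (h u) = L.into_lens (B (\<iota> (h u) - v0))"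
    show thesis by (rule that[OF a])
  qed (rule i')
  define k where "k z = B (\<iota> (K z) - v0)" for z
  have Kz: "\<theta> (K z) = L.into_lens (k z)" if "z \<in> circle" for z
  proof -
    obtain u where u: "u \<in> cball 0 1" "K z = h u" using Kh \<open>z \<in> circle\<close> by blast
    show ?thesis unfolding k_def u(2) by (rule \<theta>(2)[OF u(1)])
  qed
  obtain b where b: "b > 0" "\<And>x. b * norm x \<le> norm (B x)"
    using linear_inj_bounded_below_pos[OF bounded_linear.linear[OF B(1)] B(2)] by metis
  have Kh': "K z \<in> h ` cball 0 R'" if "z \<in> circle" for z
  proof -
    have "h ` cball 0 1 \<subseteq> h ` cball 0 R'" by (rule image_mono) (use R' in auto)
    then show ?thesis using Kh that by blast
  qed
  have low: "b * c * norm (K z - K z') \<le> norm (k z - k z')" if "z \<in> circle" "z' \<in> circle" for z z'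
  proof -
    have "b * (c * norm (K z - K z')) \<le> b * norm (\<iota> (K z) - \<iota> (K z'))"
      by (rule mult_left_mono[OF i(3)[OF Kh'[OF that(1)] Kh'[OF that(2)]]]) (use b in simp)
    also have "\<dots> \<le> norm (B (\<iota> (K z) - \<iota> (K z')))" by (rule b(2))
    also have "\<iota> (K z) - \<iota> (K z') = (\<iota> (K z) - v0) - (\<iota> (K z') - v0)" by simp
    also have "B \<dots> = k z - k z'" unfolding k_def by (rule linear_diff[OF bounded_linear.linear[OF B(1)]])
    finally show ?thesis by (simp add: mult.assoc)
  qed
  have bc: "b * c > 0" using b i by simp
  have kem: "smooth_embedding circle k"
  proof (rule smooth_embedding_circleI)
    have KU: "K ` circle \<subseteq> F \<times> UNIV" by (rule subset_trans[OF KF]) (rule Sigma_mono; simp)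
    have "Cinf UNIV (\<lambda>y. B (y - v0))" by (intro Cinf_linear_compose[OF B(1)] Cinf_diff Cinf_ident Cinf_const)
    then have "smooth_on UNIV (\<lambda>y. B (y - v0))" by (rule Cinf_imp_smooth_on[OF open_UNIV _ subset_UNIV])
    then show "smooth_on circle k" unfolding k_def[abs_def]
      by (rule smooth_on_compose[OF smooth_on_compose[OF Ki(2) i(1) KU] _ subset_UNIV])
    show "inj_on k circle"
    proof (rule inj_onI)
      fix z z' assume z: "z \<in> circle" "z' \<in> circle" "k z = k z'"
      have "b * c * norm (K z - K z') \<le> 0" using low[OF z(1,2)] z(3) by simp
      then have "\<not> norm (K z - K z') > 0" using mult_pos_pos[OF bc, of "norm (K z - K z')"] by linarith
      then have "K z = K z'" by simp
      then show "z = z'" using homeomorphism_apply1[OF Ki(1)] z by metis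
    qed
    fix z0 :: complex assume z0: "z0 \<in> circle"
    obtain c1 d where cd: "c1 > 0" "d > 0" "\<And>u v. u \<in> circle \<Longrightarrow> v \<in> circle \<Longrightarrow> dist z0 u < d \<Longrightarrow> dist z0 v < d \<Longrightarrow>
        c1 * norm (u - v) \<le> norm (K u - K v)"
      using smooth_inverse_lower_lipschitz[OF Ki(1,3) z0] by metis
    have "b * c * c1 * norm (z - z') \<le> norm (k z - k z')"
      if "z \<in> circle" "z' \<in> circle" "dist z0 z < d" "dist z0 z' < d" for z z'
    proof -
      have "b * c * (c1 * norm (z - z')) \<le> b * c * norm (K z - K z')"
        by (rule mult_left_mono[OF cd(3)[OF that]]) (use bc in simp)
      also have "\<dots> \<le> norm (k z - k z')" by (rule low[OF that(1,2)])
      finally show ?thesis by (simp add: mult.assoc)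
    qed
    then show "\<exists>c>0. \<exists>d>0. \<forall>z\<in>circle. \<forall>z'\<in>circle. dist z0 z < d \<longrightarrow> dist z0 z' < d \<longrightarrow> c * norm (z - z') \<le> norm (k z - k z')"
      using bc cd(1,2) by (intro exI[of _ "b * c * c1"] exI[of _ d] conjI) simp_all
  qed
  note st = L.lens_stabilization[OF o kem]
  have "ambient_isotopic (F, ori, K) (F, ori, L.into_lens \<circ> k)"
    by (rule iso_end_ambient_isotopic[OF \<theta>(1) KF]) (simp add: Kz)
  then have "stable_move (F, ori, K) (F, ori, L.into_lens \<circ> k)"
    unfolding stable_move_def using K st(1) by blast
  then have "equivclp stable_move (F, ori, K) (F, ori, L.into_lens \<circ> k)" by (rule r_into_equivclp)
  moreover have "equivclp stable_move (F, ori, L.into_lens \<circ> k)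
      (flat_disc, {e \<in> pulled_back_charts L.pieces ori L.glue. range e \<subseteq> flat_disc}, L.into_disc \<circ> k)"
    by (rule r_into_equivclp) (unfold stable_move_def, use st in blast)
  ultimately have "equivclp stable_move (F, ori, K)
      (flat_disc, {e \<in> pulled_back_charts L.pieces ori L.glue. range e \<subseteq> flat_disc}, L.into_disc \<circ> k)"
    by (rule equivclp_trans)
  moreover have "flat_disc homeomorphic cball (0::complex) 1"
    using flat_disc_homeomorphism homeomorphic_def homeomorphic_sym by blast
  ultimately show ?thesis unfolding classical_def virtual_knot_of_def using st(2) by blast
qed

theorem theorem2:
  fixes J K :: "complex \<Rightarrow> real^4"
    and V F :: "(real^4) set"
    and p :: "real^4 \<Rightarrow> complex"
    and ori :: "(complex \<Rightarrow> real^4) set"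
    and M :: "'m::topological_space set"
    and \<pi> :: "'m \<Rightarrow> real^4"
    and vk :: "thick_knot set"
  assumes "knot_in_S3 K"
    and "fibered_triple J V p F"
    and "V \<inter> K ` circle = {}"
    and "surface_orientation F ori"
    and "linking_number J K = 0"
    and "unlinked J K"
    and "virtual_cover K V F ori M \<pi> vk"
  shows "classical vk"
proof -
  let ?X = "exterior_of V" and ?N = "F \<times> {0<..<1::real}"
  obtain \<tau> where \<tau>: "tube J \<tau>" "V = \<tau> ` (circle \<times> cball 0 1)"
    using assms(2) unfolding fibered_triple_def regular_nbhd_def by blast
  obtain z0 where z0: "F = ?X \<inter> p -` {z0}" and pX: "p ` ?X = circle" and F: "compact_surface F"
    using assms(2) unfolding fibered_triple_def circle_fibration_def by blast
  have Xsub: "?X \<subseteq> S3" unfolding exterior_of_def by (rule closure_minimal) auto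
  have FS: "F \<subseteq> S3" using z0 Xsub by blast
  \<comment> \<open>The fibration is onto the circle, so a single fibre cannot contain the whole
    exterior.\<close>
  have FnS: "F \<noteq> S3"
  proof
    assume "F = S3"
    then have "p ` ?X \<subseteq> {z0}" using z0 Xsub by blast
    then have "circle \<subseteq> {z0}" using pX by simp
    moreover have "(1::complex) \<in> circle" "(-1::complex) \<in> circle" by auto
    ultimately show False by (metis one_neq_neg_one singletonD subsetD)
  qed
  obtain \<phi> \<psi> K' where cov: "covering_space M \<pi> ?X" "connected M"
    and \<phi>: "homeomorphism M ?N \<phi> \<psi>"
    and K': "continuous_on circle K'" "K' ` circle \<subseteq> M" "\<And>z. z \<in> circle \<Longrightarrow> \<pi> (K' z) = K z"
    and T: "is_thick_knot (F, ori, \<phi> \<circ> K')" and vk: "vk = virtual_knot_of (F, ori, \<phi> \<circ> K')"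
    using assms(7) unfolding virtual_cover_def infinite_cyclic_cover_def by blast
  have cN: "covering_space ?N (\<pi> \<circ> \<psi>) ?X" by (rule covering_space_homeomorphism[OF cov(1) \<phi>])
  have "connected ?N"
    using connected_continuous_image[OF homeomorphism_cont1[OF \<phi>] cov(2)] homeomorphism_image1[OF \<phi>] by simp
  then have "connected (fst ` ?N)" by (intro connected_continuous_image continuous_on_fst continuous_on_id)
  moreover have "fst ` ?N = F" by (simp add: fst_image_times)
  ultimately have conF: "connected F" by simp
  have KS: "K ` circle \<subseteq> S3" and Kc: "continuous_on circle K"
    using assms(1) unfolding knot_in_S3_def smooth_embedding_def diffeomorphism_def homeomorphism_def by blast+
  have SX: "S3 - V \<subseteq> ?X" unfolding exterior_of_def by (rule closure_subset)
  have K1: "K 1 \<in> S3 - V" using KS assms(3) by force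
  then have Xne: "?X \<noteq> {}" using SX by blast
  obtain f g where f: "homeomorphism (ball (0::complex \<times> real) 2) (f ` ball 0 2) f g" "f ` ball 0 2 \<subseteq> S3"
    and KB: "K ` circle \<subseteq> f ` cball 0 1" and JB: "J ` circle \<inter> f ` cball 0 1 = {}"
    using assms(6) unfolding unlinked_def three_cell_def by blast
  have gf: "g (f u) = u" if "u \<in> ball 0 2" for u by (rule homeomorphism_apply1[OF f(1) that])
  have cb: "cball 0 1 \<subseteq> ball (0::complex \<times> real) 2" by auto
  have finj: "inj_on f (ball 0 2)" by (rule inj_on_inverseI[of _ g]) (rule gf)
  have Kcomp: "compact (K ` circle)" by (rule compact_continuous_image[OF Kc compact_sphere])
  have Kne: "K ` circle \<noteq> {}" by (auto intro: exI[of _ "1::complex"])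
  have KV: "K ` circle \<inter> V = {}" using assms(3) by blast
  \<comment> \<open>The compact set to be left fixed is the knot itself, so the pushed ball contains
    it at unchanged parameters.\<close>
  obtain R h0 where R: "1 < R" and h0: "continuous_on (ball 0 R) h0" "inj_on h0 (ball 0 R)" "h0 ` ball 0 R \<subseteq> S3 - V"
    "\<And>u. u \<in> ball 0 R \<Longrightarrow> f u \<in> K ` circle \<Longrightarrow> h0 u = f u"
    using push_ball_off_tube[OF \<tau> Kcomp KS Kne KV homeomorphism_cont1[OF f(1)] finj f(2) JB] by metis
  define u where "u z = g (K z)" for z
  have fu: "u z \<in> cball 0 1" "f (u z) = K z" if z: "z \<in> circle" for z
  proof -
    obtain v where v: "v \<in> cball 0 1" "K z = f v" using KB z by blast
    then have "u z = v" using gf[of v] cb unfolding u_def by auto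
    then show "u z \<in> cball 0 1" "f (u z) = K z" using v by auto
  qed
  have cR: "cball 0 1 \<subseteq> ball (0::complex \<times> real) R" using R by auto
  have uR: "u ` circle \<subseteq> ball 0 R" using fu(1) cR by blast
  have uc: "continuous_on circle u" unfolding u_def[abs_def]
    by (rule continuous_on_compose2[OF homeomorphism_cont2[OF f(1)] Kc])
       (rule subset_trans[OF KB image_mono[OF cb]])
  have kc: "continuous_on circle (\<phi> \<circ> K')"
    by (rule continuous_on_compose[OF K'(1) continuous_on_subset[OF homeomorphism_cont1[OF \<phi>] K'(2)]])
  have kN: "(\<phi> \<circ> K') ` circle \<subseteq> ?N"
    using image_mono[OF K'(2), of \<phi>] homeomorphism_image1[OF \<phi>] by (simp add: image_comp)
  have hk: "h0 (u z) = (\<pi> \<circ> \<psi>) ((\<phi> \<circ> K') z)" if z: "z \<in> circle" for z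
  proof -
    have "h0 (u z) = K z" using h0(4)[OF subsetD[OF uR imageI[OF z]]] z unfolding fu(2)[OF z] by blast
    moreover have "\<psi> (\<phi> (K' z)) = K' z" by (rule homeomorphism_apply1[OF \<phi>]) (use K'(2) z in blast)
    ultimately show ?thesis using K'(3)[OF z] by simp
  qed
  \<comment> \<open>The covering is used in its form over the thickened surface, transported along
    \<open>\<phi>\<close>, so that the lifted ball lands where the isotopies act.\<close>
  obtain h where h: "continuous_on (ball 0 R) h" "inj_on h (ball 0 R)" "h ` ball 0 R \<subseteq> ?N"
    "\<And>z. z \<in> circle \<Longrightarrow> h (u z) = (\<phi> \<circ> K') z"
    using lift_ball[OF cN h0(1,2) subset_trans[OF h0(3) SX] kc kN uc uR hk] by metis
  obtain W U b c w where bd: "surface_chart F W U b c" "w \<in> W" "Im w = 0"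
    using fiber_has_boundary_chart[OF F \<tau> cN Xne] by metis
  have Kh: "(\<phi> \<circ> K') ` circle \<subseteq> h ` cball 0 1"
  proof
    fix y assume "y \<in> (\<phi> \<circ> K') ` circle"
    then obtain z where z: "z \<in> circle" "y = (\<phi> \<circ> K') z" by (rule imageE)
    show "y \<in> h ` cball 0 1" unfolding z(2) h(4)[OF z(1), symmetric] by (rule imageI[OF fu(1)[OF z(1)]])
  qed
  show ?thesis unfolding vk
    by (rule knot_in_ball_classical[OF F conF FS FnS bd T h(1-3) R Kh])
qed

end
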